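(* Let $(M,N,F,\gamma,\Sigma,g)$ be a double coating construction, $\tilde g=F_*g$, and let $k\ge 0$. Let $u=(u_1,u_2):M\setminus\gamma\to\mathbb R$ and $\tilde u:N\setminus\Sigma\to\mathbb R$ be measurable functions such that $u=\tilde u\circ F$. Let $f=(f_1,f_2):M\setminus\gamma\to\mathbb R$ and $\tilde f:N\setminus\Sigma\to\mathbb R$ be $L^2$ functions supported away from $\Sigma$ and $\gamma$ such that $f=\tilde f\circ F$, and let $\tilde h:\partial N\to\mathbb R$, $h:\partial M_1\to\mathbb R$ be such that $h=\tilde h\circ F_1$. Then the following are equivalent: (1) The function $\tilde u$, considered as a measurable function on $N\setminus\Sigma$, is a finite energy solution of the boundary value problem with degenerate Neumann boundary conditions at $\Sigma$, $$(\Delta_{\tilde g}+k^2)\tilde u=\tilde f\ \text{ in }N\setminus\Sigma,\qquad \tilde u|_{\partial N}=\tilde h,\qquad |\tilde g|^{1/2}\partial_\nu\tilde u|_{\Sigma_+}=0,\quad |\tilde g|^{1/2}\partial_\nu\tilde u|_{\Sigma_-}=0.$$ (2) The function $u$ satisfies $$(\Delta_g+k^2)u_1=f_1\ \text{ on } M_1,\qquad u_1|_{\partial M_1}=h,$$ and $$(\Delta_g+k^2)u_2=f_2\ \text{ on } M_2$$ (with $u_1,u_2$ extended across $\gamma_1,\gamma_2$).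
   Context: Double coating construction $(M,N,F,\gamma,\Sigma,g)$: $B(0,r)\subset\mathbb R^3$ is the open Euclidean ball. $N=B(0,2)$, $N_1=B(0,2)\setminus\overline{B}(0,1)$, $N_2=B(0,1)$, $\Sigma=\partial B(0,1)$, so $N=N_1\cup\Sigma\cup N_2$ and $\partial N=\partial B(0,2)$. $\Sigma_+=\partial N_1\setminus\partial N$ and $\Sigma_-=\partial N_2$ denote $\Sigma$ viewed from $N_1$, respectively $N_2$. $M$ is the disjoint union of $M_1=B(0,2)$ and $M_2=\mathbb S^3_{1/\pi}$, the 3-sphere of radius $1/\pi$ (compact without boundary). $\gamma_1=\{0\}\subset M_1$, $\gamma_2=\{NP\}\subset M_2$ with $NP$ a chosen point, $\gamma=\gamma_1\cup\gamma_2$; $SP$ is the point antipodal to $NP$. $F:M\setminus\gamma\to N\setminus\Sigma$ consists of $F_1:M_1\setminus\gamma_1\to N_1$, $F_1(x)=(\frac{|x|}{2}+1)\frac{x}{|x|}$ (also used at $|x|=2$), and $F_2=(\exp_{SP})^{-1}:M_2\setminus\{NP\}\to B(0,1)\subset T_{SP}\mathbb S^3\simeq\mathbb R^3$, the inverse of the exponential map of the standard round metric. $g=(g_1,g_2)$ is a nonsingular smooth Riemannian metric on $M$ (smooth and positive definite up to $\partial M_1$; the basic example is $g_1$ Euclidean, $g_2$ the round metric). $\tilde g=F_*g=(F^{-1})^*g$ is the resulting metric on $N\setminus\Sigma$, singular as one approaches $\Sigma$ from either side. Notation: $|\tilde g|=\det(\tilde g_{ij})$, $(\tilde g^{ij})=(\tilde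 g_{ij})^{-1}$ in Euclidean coordinates, $dx$ is Lebesgue measure, summation convention is used, $\Delta_g$ is the Laplace–Beltrami operator. Finite energy solution with degenerate Neumann conditions: a measurable function $\tilde u$ on $N\setminus\Sigma$ is a finite energy solution of the boundary value problem in (1) if (i) $\tilde u\in L^2(N\setminus\Sigma,|\tilde g|^{1/2}dx)$; (ii) $\tilde u\in H^1_{loc}(N\setminus\Sigma,dx)$; (iii) $\int_{N\setminus\Sigma}|\tilde g|^{1/2}\tilde g^{ij}\partial_i\tilde u\,\partial_j\tilde u\,dx<\infty$; (iv) $(\Delta_{\tilde g}+k^2)\tilde u=\tilde f$ in some neighborhood of $\partial N$ and $\tilde u|_{\partial N}=\tilde h$; and (v) $$\int_{N\setminus\Sigma}\big(-\tilde g^{ij}\partial_i\tilde u\,\partial_j\tilde\psi+(k^2\tilde u-\tilde f)\tilde\psi\big)|\tilde g|^{1/2}dx=0$$ for all $\tilde\psi$ equal to $\tilde\psi_1$ on $N_1$ and $\tilde\psi_2$ on $N_2$, where $\tilde\psi_1\in C^\infty(\overline{N_1})$ vanishes near the exterior boundary $\partial N=\partial N_1\setminus\Sigma$ and $\tilde\psi_2\in C^\infty(\overline{N_2})$. On $M$, where $g$ is nonsingular, the equations are understood in the usual sense ($u_j\in H^1(M_j)$, the equation and Dirichlet condition holding in the standard weak sense; classical where the data are regular). *)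

theory Defs
  imports "HOL-Analysis.Analysis"
begin

section \<open>Smooth functions\<close>

primrec Ck_on :: "nat \<Rightarrow> 'a::euclidean_space set \<Rightarrow> ('a \<Rightarrow> real) \<Rightarrow> bool" where
  "Ck_on 0 U f \<longleftrightarrow> continuous_on U f"
| "Ck_on (Suc n) U f \<longleftrightarrow>
     (\<forall>x\<in>U. f differentiable (at x)) \<and> (\<forall>b\<in>Basis. Ck_on n U (\<lambda>x. frechet_derivative f (at x) b))"

text \<open>For closed \<open>S\<close> (a closed ball or annulus, a sphere) this is the usual notion of a smooth
  function on \<open>S\<close>: the restriction of a smooth function on an open neighbourhood.  On open \<open>S\<close> it
  is ordinary smoothness.\<close>

definition smooth_on :: "'a::euclidean_space set \<Rightarrow> ('a \<Rightarrow> real) \<Rightarrow> bool" where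
  "smooth_on S f \<longleftrightarrow>
     (\<exists>U f'. open U \<and> S \<subseteq> U \<and> (\<forall>n. Ck_on n U f') \<and> (\<forall>x\<in>S. f x = f' x))"

definition test_function :: "'a::euclidean_space set \<Rightarrow> ('a \<Rightarrow> real) \<Rightarrow> bool" where
  "test_function \<Omega> \<phi> \<longleftrightarrow>
     smooth_on UNIV \<phi> \<and> (\<exists>K. compact K \<and> K \<subseteq> \<Omega> \<and> (\<forall>x. x \<notin> K \<longrightarrow> \<phi> x = 0))"

definition grad :: "(real^'n \<Rightarrow> real) \<Rightarrow> real^'n \<Rightarrow> real^'n" where
  "grad f x = (\<chi> i. frechet_derivative f (at x) (axis i 1))"


section \<open>Lebesgue and Sobolev spaces\<close>

definition square_integrable :: "'a measure \<Rightarrow> ('a \<Rightarrow> real) \<Rightarrow> bool" where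
  "square_integrable \<mu> f \<longleftrightarrow> f \<in> borel_measurable \<mu> \<and> integrable \<mu> (\<lambda>x. (f x)\<^sup>2)"

definition L2_loc :: "'a::euclidean_space set \<Rightarrow> ('a \<Rightarrow> real) \<Rightarrow> bool" where
  "L2_loc \<Omega> f \<longleftrightarrow> f \<in> borel_measurable (lebesgue_on \<Omega>) \<and>
     (\<forall>K. compact K \<and> K \<subseteq> \<Omega> \<longrightarrow> square_integrable (lebesgue_on K) f)"

text \<open>\<open>u\<close> belongs to \<open>H\<^sup>1\<^sub>l\<^sub>o\<^sub>c(\<Omega>)\<close> and \<open>Du\<close> is (a representative of) its weak gradient.\<close>

definition H1_loc_grad :: "(real^'n) set \<Rightarrow> (real^'n \<Rightarrow> real) \<Rightarrow> (real^'n \<Rightarrow> real^'n) \<Rightarrow> bool" where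
  "H1_loc_grad \<Omega> u Du \<longleftrightarrow> L2_loc \<Omega> u \<and> (\<forall>i. L2_loc \<Omega> (\<lambda>x. Du x $ i)) \<and>
     (\<forall>\<phi>. test_function \<Omega> \<phi> \<longrightarrow>
        (\<forall>i. (\<integral>x. u x * grad \<phi> x $ i \<partial>lebesgue_on \<Omega>) = - (\<integral>x. Du x $ i * \<phi> x \<partial>lebesgue_on \<Omega>)))"

text \<open>Surface measure on the sphere of radius \<open>R > 0\<close> in dimension \<open>n\<close>: the measure of \<open>A\<close> is
  \<open>n / R\<close> times the volume of the solid cone over \<open>A\<close> with apex \<open>0\<close>.\<close>

definition sphere_measure :: "real \<Rightarrow> 'a::euclidean_space measure" where
  "sphere_measure R = scale_measure (ennreal (real DIM('a) / R))
     (distr (restrict_space lborel (ball 0 R - {0})) (restrict_space borel (sphere 0 R))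
        (\<lambda>x. (R / norm x) *\<^sub>R x))"

lemma emeasure_sphere_measure:
  assumes "R > 0" and "A \<in> sets borel" and "A \<subseteq> sphere (0::'a::euclidean_space) R"
  shows "emeasure (sphere_measure R) A =
    ennreal (real DIM('a) / R) * emeasure lborel {x \<in> ball 0 R - {0}. (R / norm x) *\<^sub>R x \<in> A}"
proof -
  let ?B = "ball (0::'a) R - {0}"
  have "(\<lambda>x. (R / norm x) *\<^sub>R x) \<in> restrict_space lborel ?B \<rightarrow>\<^sub>M restrict_space borel (sphere 0 R)"
    using assms(1) by (intro measurable_restrict_space2 measurable_restrict_space1) (auto simp: space_restrict_space)
  moreover have "A \<in> sets (restrict_space borel (sphere 0 R))"
    using assms by (auto simp: sets_restrict_space_iff)
  moreover have "(\<lambda>x. (R / norm x) *\<^sub>R x) -` A \<inter> space (restrict_space lborel ?B)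
      = {x \<in> ?B. (R / norm x) *\<^sub>R x \<in> A}"
    by (auto simp: space_restrict_space)
  ultimately show ?thesis
    unfolding sphere_measure_def
    by (simp only: emeasure_scale_measure emeasure_distr) (subst emeasure_restrict_space, auto)
qed

text \<open>\<open>h\<close> is the Sobolev trace on the sphere of radius \<open>R\<close> of a function \<open>u \<in> H\<^sup>1(\<Omega>)\<close> with weak gradient
  \<open>Du\<close>, where \<open>\<Omega>\<close> is the part of the ball of radius \<open>R\<close> inside some neighbourhood of the sphere: \<open>h\<close> is
  obtained from \<open>u\<close> by continuous extension of the restriction map on functions smooth up to the
  boundary.\<close>

definition has_trace ::
  "real \<Rightarrow> (real^'n) set \<Rightarrow> (real^'n \<Rightarrow> real) \<Rightarrow> (real^'n \<Rightarrow> real^'n) \<Rightarrow> (real^'n \<Rightarrow> real) \<Rightarrow> bool" where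
  "has_trace R \<Omega> u Du h \<longleftrightarrow> h \<in> borel_measurable (completion (sphere_measure R)) \<and>
     (\<exists>\<phi>. (\<forall>n::nat. smooth_on (closure \<Omega>) (\<phi> n)) \<and>
        (\<lambda>n. \<integral>\<^sup>+x. ennreal ((\<phi> n x - u x)\<^sup>2) \<partial>lebesgue_on \<Omega>) \<longlonglongrightarrow> 0 \<and>
        (\<lambda>n. \<integral>\<^sup>+x. ennreal ((norm (grad (\<phi> n) x - Du x))\<^sup>2) \<partial>lebesgue_on \<Omega>) \<longlonglongrightarrow> 0 \<and>
        (\<lambda>n. \<integral>\<^sup>+x. ennreal ((\<phi> n x - h x)\<^sup>2) \<partial>completion (sphere_measure R)) \<longlonglongrightarrow> 0)"


section \<open>Metrics and the Helmholtz equation\<close>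

text \<open>A metric on \<open>S\<close> with tangent spaces \<open>T p\<close> is a smooth field of symmetric matrices whose
  quadratic forms are positive definite on the tangent spaces.  For the sphere only the
  restriction of the form to the tangent space matters, and every smooth metric on the sphere is
  of this kind (compose it with the orthogonal projections onto the tangent spaces).\<close>

definition riemannian_metric ::
  "(real^'n) set \<Rightarrow> (real^'n \<Rightarrow> (real^'n) set) \<Rightarrow> (real^'n \<Rightarrow> real^'n^'n) \<Rightarrow> bool" where
  "riemannian_metric S T g \<longleftrightarrow> (\<forall>i j. smooth_on S (\<lambda>p. g p $ i $ j)) \<and>
     (\<forall>p\<in>S. transpose (g p) = g p \<and> (\<forall>v\<in>T p. v \<noteq> 0 \<longrightarrow> 0 < v \<bullet> (g p *v v)))"

definition pullback_metric ::
  "(real^'n \<Rightarrow> real^'m) \<Rightarrow> (real^'m \<Rightarrow> real^'m^'m) \<Rightarrow> real^'n \<Rightarrow> real^'n^'n" where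
  "pullback_metric \<Phi> g y = (\<chi> i j.
     frechet_derivative \<Phi> (at y) (axis i 1) \<bullet> (g (\<Phi> y) *v frechet_derivative \<Phi> (at y) (axis j 1)))"

text \<open>The integrand
  \<open>(- G\<^sup>i\<^sup>j \<partial>\<^sub>i u \<partial>\<^sub>j \<psi> + (k\<^sup>2 u - f) \<psi>) \<bar>G\<bar>\<^sup>1\<^sup>/\<^sup>2\<close> of the weak formulation.\<close>

definition weak_integrand ::
  "(real^'n \<Rightarrow> real^'n^'n) \<Rightarrow> real \<Rightarrow> (real^'n \<Rightarrow> real) \<Rightarrow> (real^'n \<Rightarrow> real^'n) \<Rightarrow> (real^'n \<Rightarrow> real) \<Rightarrow>
     (real^'n \<Rightarrow> real) \<Rightarrow> real^'n \<Rightarrow> real" where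
  "weak_integrand G k u Du f \<psi> x =
     (- (Du x \<bullet> (matrix_inv (G x) *v grad \<psi> x)) + (k\<^sup>2 * u x - f x) * \<psi> x) * sqrt (det (G x))"

definition weak_helmholtz ::
  "(real^'n) set \<Rightarrow> (real^'n \<Rightarrow> real^'n^'n) \<Rightarrow> real \<Rightarrow> (real^'n \<Rightarrow> real) \<Rightarrow> (real^'n \<Rightarrow> real^'n) \<Rightarrow>
     (real^'n \<Rightarrow> real) \<Rightarrow> bool" where
  "weak_helmholtz \<Omega> G k u Du f \<longleftrightarrow> H1_loc_grad \<Omega> u Du \<and>
     (\<forall>\<phi>. test_function \<Omega> \<phi> \<longrightarrow>
        has_bochner_integral (lebesgue_on \<Omega>) (weak_integrand G k u Du f \<phi>) 0)"


section \<open>The double coating construction\<close>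

definition dom_N :: "(real^3) set" where "dom_N = ball 0 2"
definition dom_N1 :: "(real^3) set" where "dom_N1 = ball 0 2 - cball 0 1"
definition dom_N2 :: "(real^3) set" where "dom_N2 = ball 0 1"
definition Sig :: "(real^3) set" where "Sig = sphere 0 1"

definition dom_M1 :: "(real^3) set" where "dom_M1 = ball 0 2"
definition dom_M2 :: "(real^4) set" where "dom_M2 = sphere 0 (1 / pi)"
definition dom_M :: "(real^3 + real^4) set" where "dom_M = dom_M1 <+> dom_M2"
definition gam :: "real^4 \<Rightarrow> (real^3 + real^4) set" where "gam NP = {0} <+> {NP}"

definition tangent_sphere :: "real^'n \<Rightarrow> (real^'n) set" where
  "tangent_sphere p = {v. p \<bullet> v = 0}"

text \<open>The exponential map at \<open>p\<close> of the round sphere with centre \<open>0\<close> through \<open>p\<close> (radius \<open>norm p\<close>), for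
  tangent vectors \<open>v\<close>: geodesics are great circles traversed at constant speed.\<close>

definition sphere_exp :: "real^'n \<Rightarrow> real^'n \<Rightarrow> real^'n" where
  "sphere_exp p v = cos (norm v / norm p) *\<^sub>R p + (norm p * sin (norm v / norm p) / norm v) *\<^sub>R v"

text \<open>Indeed, \<open>t \<mapsto> sphere_exp p (t *\<^sub>R v)\<close> stays on the sphere, starts at \<open>p\<close> with velocity \<open>v\<close> and has
  acceleration normal to the sphere.\<close>

lemma sphere_exp_geodesic:
  fixes p v :: "real^'n"
  assumes "p \<noteq> 0" "v \<in> tangent_sphere p"
  defines "c \<equiv> \<lambda>t. sphere_exp p (t *\<^sub>R v)"
  shows "norm (c t) = norm p" "c 0 = p"
    and "\<exists>c'. c' 0 = v \<and> (\<forall>t. (c has_vector_derivative c' t) (at t) \<and>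
           (c' has_vector_derivative (- ((norm v / norm p)\<^sup>2)) *\<^sub>R c t) (at t))"
proof -
  have ceq: "c t = cos (t * norm v / norm p) *\<^sub>R p + (norm p * sin (t * norm v / norm p) / norm v) *\<^sub>R v"
    for t
    by (cases "t \<ge> 0"; cases "v = 0"; cases "t = 0") (auto simp: c_def sphere_exp_def)
  show "c 0 = p" by (simp add: c_def sphere_exp_def)
  have pv: "p \<bullet> v = 0" using assms by (simp add: tangent_sphere_def)
  have "(norm (c t))\<^sup>2 = (norm p)\<^sup>2"
  proof (cases "v = 0")
    case False
    define s where "s = t * norm v / norm p"
    have "(norm (c t))\<^sup>2 = (cos s)\<^sup>2 * (norm p)\<^sup>2 + (norm p * sin s / norm v)\<^sup>2 * (norm v)\<^sup>2"
      using pv unfolding ceq s_def[symmetric] power2_norm_eq_inner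
      by (simp add: inner_add_left inner_add_right inner_commute[of v p] power2_eq_square)
    also have "\<dots> = ((cos s)\<^sup>2 + (sin s)\<^sup>2) * (norm p)\<^sup>2"
      using False by (simp add: power_divide power_mult_distrib sin_squared_eq field_simps)
    finally show ?thesis by simp
  qed (simp add: ceq)
  then show "norm (c t) = norm p" by simp
  show "\<exists>c'. c' 0 = v \<and> (\<forall>t. (c has_vector_derivative c' t) (at t) \<and>
           (c' has_vector_derivative (- ((norm v / norm p)\<^sup>2)) *\<^sub>R c t) (at t))"
  proof (intro exI conjI allI)
    let ?c' = "\<lambda>t. (- sin (t * norm v / norm p) * (norm v / norm p)) *\<^sub>R p
                 + cos (t * norm v / norm p) *\<^sub>R v"
    show "?c' 0 = v" by simp
    fix t
    have "((\<lambda>t. cos (t * norm v / norm p) *\<^sub>R p + (norm p * sin (t * norm v / norm p) / norm v) *\<^sub>R v)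
            has_vector_derivative ?c' t) (at t)"
      using assms(1)
      by (cases "v = 0") (auto intro!: derivative_eq_intros simp: field_simps)
    then show "(c has_vector_derivative ?c' t) (at t)" by (simp add: ceq[abs_def])
    show "(?c' has_vector_derivative (- ((norm v / norm p)\<^sup>2)) *\<^sub>R c t) (at t)"
      using assms(1)
      by (cases "v = 0") (auto intro!: derivative_eq_intros simp: ceq field_simps power2_eq_square)
  qed
qed

definition F1 :: "real^3 \<Rightarrow> real^3" where
  "F1 x = (norm x / 2 + 1) *\<^sub>R ((1 / norm x) *\<^sub>R x)"

text \<open>\<open>\<iota>\<close> is the identification of \<open>\<real>\<^sup>3\<close> with the tangent space of the sphere at \<open>SP = - NP\<close>.\<close>

definition F2 :: "real^4 \<Rightarrow> (real^3 \<Rightarrow> real^4) \<Rightarrow> real^4 \<Rightarrow> real^3" where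
  "F2 NP \<iota> = inv_into dom_N2 (\<lambda>v. sphere_exp (- NP) (\<iota> v))"

definition F :: "real^4 \<Rightarrow> (real^3 \<Rightarrow> real^4) \<Rightarrow> real^3 + real^4 \<Rightarrow> real^3" where
  "F NP \<iota> = case_sum F1 (F2 NP \<iota>)"

definition double_coating ::
  "real^4 \<Rightarrow> (real^3 \<Rightarrow> real^4) \<Rightarrow> (real^3 \<Rightarrow> real^3^3) \<Rightarrow> (real^4 \<Rightarrow> real^4^4) \<Rightarrow> bool" where
  "double_coating NP \<iota> g1 g2 \<longleftrightarrow>
     NP \<in> dom_M2 \<and>
     linear \<iota> \<and> (\<forall>v. norm (\<iota> v) = norm v) \<and> range \<iota> = tangent_sphere (- NP) \<and>
     riemannian_metric (closure dom_M1) (\<lambda>_. UNIV) g1 \<and>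
     riemannian_metric dom_M2 tangent_sphere g2"

text \<open>\<open>(F\<^sup>-\<^sup>1)\<^sup>* g\<close>; only its values on \<open>dom_N - Sig\<close> are meaningful.\<close>

definition push_metric ::
  "real^4 \<Rightarrow> (real^3 \<Rightarrow> real^4) \<Rightarrow> (real^3 \<Rightarrow> real^3^3) \<Rightarrow> (real^4 \<Rightarrow> real^4^4) \<Rightarrow> real^3 \<Rightarrow> real^3^3" where
  "push_metric NP \<iota> g1 g2 y =
     (if y \<in> dom_N2 then pullback_metric (inv_into (dom_M2 - {NP}) (F2 NP \<iota>)) g2 y
      else pullback_metric (inv_into (dom_M1 - {0}) F1) g1 y)"


section \<open>Solutions on the two sides\<close>

text \<open>\<open>G\<close> is the singular metric on \<open>dom_N - Sig\<close>.\<close>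

definition finite_energy_solution ::
  "(real^3 \<Rightarrow> real^3^3) \<Rightarrow> real \<Rightarrow> (real^3 \<Rightarrow> real) \<Rightarrow> (real^3 \<Rightarrow> real) \<Rightarrow> (real^3 \<Rightarrow> real) \<Rightarrow> bool" where
  "finite_energy_solution G k u f h \<longleftrightarrow>
     u \<in> borel_measurable (lebesgue_on (dom_N - Sig)) \<and>
     integrable (lebesgue_on (dom_N - Sig)) (\<lambda>x. (u x)\<^sup>2 * sqrt (det (G x))) \<and>
     (\<exists>Du. H1_loc_grad (dom_N - Sig) u Du \<and>
        integrable (lebesgue_on (dom_N - Sig))
          (\<lambda>x. sqrt (det (G x)) * (Du x \<bullet> (matrix_inv (G x) *v Du x))) \<and>
        (\<exists>V. open V \<and> frontier dom_N \<subseteq> V \<and>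
           weak_helmholtz (V \<inter> dom_N1) G k u Du f \<and> has_trace 2 (V \<inter> dom_N1) u Du h) \<and>
        (\<forall>\<psi>1 \<psi>2. smooth_on (closure dom_N1) \<psi>1 \<and>
           (\<exists>V. open V \<and> frontier dom_N \<subseteq> V \<and> (\<forall>x \<in> V \<inter> closure dom_N1. \<psi>1 x = 0)) \<and>
           smooth_on (closure dom_N2) \<psi>2 \<longrightarrow>
           has_bochner_integral (lebesgue_on (dom_N - Sig))
             (weak_integrand G k u Du f (\<lambda>x. if x \<in> dom_N2 then \<psi>2 x else \<psi>1 x)) 0))"

text \<open>\<open>u \<in> H\<^sup>1(M\<^sub>1)\<close>, the equation and the Dirichlet condition in the weak sense.  The Euclidean
  \<open>H\<^sup>1\<close> is the one of \<open>g1\<close>, which is smooth and positive definite up to the boundary.  Test functions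
  need not vanish at the origin.\<close>

definition solution_M1 ::
  "(real^3 \<Rightarrow> real^3^3) \<Rightarrow> real \<Rightarrow> (real^3 \<Rightarrow> real) \<Rightarrow> (real^3 \<Rightarrow> real) \<Rightarrow> (real^3 \<Rightarrow> real) \<Rightarrow> bool" where
  "solution_M1 g1 k u f h \<longleftrightarrow>
     (\<exists>Du. square_integrable (lebesgue_on dom_M1) u \<and>
        (\<forall>i. square_integrable (lebesgue_on dom_M1) (\<lambda>x. Du x $ i)) \<and>
        weak_helmholtz dom_M1 g1 k u Du f \<and> has_trace 2 dom_M1 u Du h)"

definition chart_M2 :: "(real^3) set \<Rightarrow> (real^3 \<Rightarrow> real^4) \<Rightarrow> bool" where
  "chart_M2 U \<kappa> \<longleftrightarrow> open U \<and> inj_on \<kappa> U \<and> \<kappa> ` U \<subseteq> dom_M2 \<and>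
     (\<forall>i. smooth_on U (\<lambda>x. \<kappa> x $ i)) \<and> (\<forall>x\<in>U. inj (frechet_derivative \<kappa> (at x)))"

text \<open>\<open>u \<in> H\<^sup>1(M\<^sub>2)\<close> and the weak equation on the whole sphere, in local coordinates (\<open>\<kappa>\<close> is the inverse
  of a coordinate map).  As the sphere is compact, \<open>H\<^sup>1\<^sub>l\<^sub>o\<^sub>c\<close> in all coordinates is \<open>H\<^sup>1\<close>, and testing with functions
  supported in coordinate patches amounts to testing with all smooth functions.\<close>

definition solution_M2 ::
  "(real^4 \<Rightarrow> real^4^4) \<Rightarrow> real \<Rightarrow> (real^4 \<Rightarrow> real) \<Rightarrow> (real^4 \<Rightarrow> real) \<Rightarrow> bool" where
  "solution_M2 g2 k u f \<longleftrightarrow>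
     (\<forall>U \<kappa>. chart_M2 U \<kappa> \<longrightarrow>
        (\<exists>Du. weak_helmholtz U (pullback_metric \<kappa> g2) k (u \<circ> \<kappa>) Du (f \<circ> \<kappa>)))"

end

theory Submission
  imports Defs
begin

text \<open>
  In polar coordinates \<open>N\<^sub>1\<close> is \<open>M\<^sub>1\<close> without \<open>0\<close>, and geodesic polar coordinates at \<open>SP\<close> turn \<open>N\<^sub>2\<close> into
  \<open>M\<^sub>2\<close> without \<open>NP\<close>.  The weak equation says that the flux \<open>- \<bar>G\<bar>\<^sup>1\<^sup>/\<^sup>2 G\<inverse> Du\<close> has a prescribed
  distributional divergence, which is invariant under \<open>C\<^sup>1\<close> diffeomorphisms, so the theorem compares the
  equations on \<open>M\<close> with and without the two points.  In dimension three \<open>1 / \<bar>x - p\<bar>\<close> is locally square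
  integrable.  Hence if the flux is square integrable and its divergence is prescribed off \<open>p\<close>, then a
  test function \<open>\<phi>\<close> that is \<open>C\<^sup>1\<close> off \<open>p\<close>, bounded, with \<open>\<bar>\<nabla>\<phi>\<bar> \<le> C / \<bar>x - p\<bar>\<close>, is admissible: cut it off near
  \<open>p\<close> at scale \<open>1 / n\<close> and let \<open>n\<close> grow.  For \<open>\<phi>\<close> smooth across \<open>p\<close> this removes the point and gives
  \<open>(1) \<Longrightarrow> (2)\<close>; for \<open>\<phi> = \<psi> \<circ> F\<close> with \<open>\<psi>\<close> smooth up to \<open>\<Sigma>\<close>, which is in general discontinuous at \<open>p\<close>, it is
  the degenerate Neumann condition and gives \<open>(2) \<Longrightarrow> (1)\<close>.
\<close>


section \<open>Calculus of smooth functions\<close>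

text \<open>Three obstacles shape the argument. The definitions test with smooth functions, whereas
  the changes of variables are handled as C^1 maps and leave only C^1 test functions; mollification
  enlarges the test class to compactly supported C^1 functions once and for all. Next, the metric on
  N is degenerate near \<Sigma>. From outside it is controlled because \<open>g1\<close> is
  uniformly positive on the closed ball; from inside because NP has geodesic coordinates of its own.
  The radial reflection r to 1 - r exchanges these with the coordinates at SP, so an estimate near
  \<Sigma> from inside becomes one near the origin of a regular chart. Finally, the weak equation on
  the sphere is demanded in every chart. A chart meets the two poles in at most two points, off
  which it factors through the geodesic coordinates by an explicit formula; finiteness of mass and
  energy puts the function and its gradient in L^2 up to these points, which are then filled in. The
  Dirichlet data are carried over unchanged, since \<open>F1\<close> is the identity on the sphere
  of radius 2; what moves are the smooth approximants that define the trace.\<close>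

lemma has_derivative_cong_open:
  assumes "open U" "x \<in> U" "\<And>y. y \<in> U \<Longrightarrow> f y = g y"
  shows "(f has_derivative D) (at x) \<longleftrightarrow> (g has_derivative D) (at x)"
  using assms by (metis has_derivative_transform_within_open)

lemma frechet_derivative_cong_open:
  assumes "open U" "x \<in> U" "\<And>y. y \<in> U \<Longrightarrow> f y = g y"
  shows "frechet_derivative f (at x) = frechet_derivative g (at x)"
  unfolding frechet_derivative_def using has_derivative_cong_open[OF assms] by simp

lemma differentiable_cong_open:
  assumes "open U" "x \<in> U" "\<And>y. y \<in> U \<Longrightarrow> f y = g y"
  shows "f differentiable (at x) \<longleftrightarrow> g differentiable (at x)"
  unfolding differentiable_def using has_derivative_cong_open[OF assms] by simp

lemma Ck_on_subset: "Ck_on n U f \<Longrightarrow> V \<subseteq> U \<Longrightarrow> Ck_on n V f"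
  by (induction n arbitrary: f) (auto intro: continuous_on_subset)

lemma Ck_on_cong_open:
  assumes "open U" "\<And>x. x \<in> U \<Longrightarrow> f x = g x" "Ck_on n U f"
  shows "Ck_on n U g"
  using assms(2,3)
proof (induction n arbitrary: f g)
  case 0
  then show ?case by (auto cong: continuous_on_cong)
next
  case (Suc n)
  have "Ck_on n U (\<lambda>x. frechet_derivative g (at x) b)" if "b \<in> Basis" for b
    by (rule Suc.IH[of "\<lambda>x. frechet_derivative f (at x) b"])
      (use Suc.prems that frechet_derivative_cong_open[OF assms(1), of _ f g] in auto)
  then show ?case
    using Suc.prems differentiable_cong_open[OF assms(1), of _ f g] by auto
qed

text \<open>Derivatives at a point are unique, so any explicit formula \<open>f'\<close> may stand
  for \<open>frechet_derivative\<close> in \<open>Ck_on\<close>; as \<open>U\<close> is open,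
  agreement on \<open>U\<close> is inherited by the higher derivatives.\<close>

lemma Ck_on_SucI:
  assumes "open U" "\<And>x. x \<in> U \<Longrightarrow> (f has_derivative f' x) (at x)"
    and "\<And>b. b \<in> Basis \<Longrightarrow> Ck_on n U (\<lambda>x. f' x b)"
  shows "Ck_on (Suc n) U f"
proof -
  have "frechet_derivative f (at x) = f' x" if "x \<in> U" for x
    using frechet_derivative_at[OF assms(2)[OF that]] by simp
  then show ?thesis
    using assms by (auto intro: differentiableI Ck_on_cong_open[OF assms(1), of "\<lambda>x. f' x _"])
qed

lemma Ck_on_Suc_has_derivative:
  "Ck_on (Suc n) U f \<Longrightarrow> x \<in> U \<Longrightarrow> (f has_derivative frechet_derivative f (at x)) (at x)"
  by (simp add: frechet_derivative_works)

lemma Ck_on_SucD: "Ck_on (Suc n) U f \<Longrightarrow> Ck_on n U f"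
  by (induction n arbitrary: f)
    (auto intro: continuous_at_imp_continuous_on differentiable_imp_continuous_within)

lemma Ck_on_continuous: "Ck_on n U f \<Longrightarrow> continuous_on U f"
  by (induction n) (use Ck_on_SucD in auto)

lemma Ck_on_const: "open U \<Longrightarrow> Ck_on n U (\<lambda>x. c)"
  by (induction n arbitrary: c) (auto intro!: Ck_on_SucI[where f' = "\<lambda>_ _. 0"])

lemma Ck_on_bounded_linear:
  assumes "open U" "bounded_linear f"
  shows "Ck_on n U f"
proof (cases n)
  case 0
  then show ?thesis using assms linear_continuous_on by auto
next
  case (Suc m)
  then show ?thesis
    using assms
    by (auto intro!: Ck_on_SucI[where f' = "\<lambda>_. f"] Ck_on_const bounded_linear_imp_has_derivative
        simp del: Ck_on.simps)
qed

lemma Ck_on_inner: "open U \<Longrightarrow> Ck_on n U (\<lambda>x. x \<bullet> b)"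
  by (rule Ck_on_bounded_linear) (auto intro: bounded_linear_inner_left)

lemma Ck_on_nth: "open U \<Longrightarrow> Ck_on n U (\<lambda>x::real^'n. x $ i)"
  by (rule Ck_on_bounded_linear) (auto intro: bounded_linear_vec_nth)

lemma Ck_on_add:
  assumes "open U" "Ck_on n U f" "Ck_on n U g"
  shows "Ck_on n U (\<lambda>x. f x + g x)"
  using assms(2,3)
proof (induction n arbitrary: f g)
  case 0
  then show ?case by (auto intro: continuous_intros)
next
  case (Suc n)
  show ?case
  proof (rule Ck_on_SucI[OF assms(1)])
    show "((\<lambda>x. f x + g x) has_derivative
       (\<lambda>h. frechet_derivative f (at x) h + frechet_derivative g (at x) h)) (at x)" if "x \<in> U" for x
      by (rule has_derivative_add) (use Suc.prems that Ck_on_Suc_has_derivative in blast)+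
  qed (use Suc in auto)
qed

lemma Ck_on_mult:
  assumes "open U" "Ck_on n U f" "Ck_on n U g"
  shows "Ck_on n U (\<lambda>x. f x * g x)"
  using assms(2,3)
proof (induction n arbitrary: f g)
  case 0
  then show ?case by (auto intro: continuous_intros)
next
  case (Suc n)
  have f: "Ck_on n U f" and g: "Ck_on n U g"
    using Suc.prems Ck_on_SucD by blast+
  show ?case
  proof (rule Ck_on_SucI[OF assms(1)])
    show "((\<lambda>x. f x * g x) has_derivative
       (\<lambda>h. f x * frechet_derivative g (at x) h + frechet_derivative f (at x) h * g x)) (at x)"
      if "x \<in> U" for x
      by (rule has_derivative_mult) (use Suc.prems that Ck_on_Suc_has_derivative in auto)
    show "Ck_on n U (\<lambda>x. f x * frechet_derivative g (at x) b + frechet_derivative f (at x) b * g x)"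
      if "b \<in> Basis" for b
      using Suc f g that by (auto intro!: Ck_on_add[OF assms(1)])
  qed
qed

lemma Ck_on_cmult: "open U \<Longrightarrow> Ck_on n U f \<Longrightarrow> Ck_on n U (\<lambda>x. c * f x)"
  by (rule Ck_on_mult[OF _ Ck_on_const])

lemma Ck_on_uminus: "open U \<Longrightarrow> Ck_on n U f \<Longrightarrow> Ck_on n U (\<lambda>x. - f x)"
  using Ck_on_cmult[of U n f "-1"] by simp

lemma Ck_on_diff: "open U \<Longrightarrow> Ck_on n U f \<Longrightarrow> Ck_on n U g \<Longrightarrow> Ck_on n U (\<lambda>x. f x - g x)"
  using Ck_on_add[of U n f "\<lambda>x. - g x"] Ck_on_uminus[of U n g] by simp

lemma Ck_on_sum:
  "open U \<Longrightarrow> (\<And>i. i \<in> I \<Longrightarrow> Ck_on n U (f i)) \<Longrightarrow> Ck_on n U (\<lambda>x. \<Sum>i\<in>I. f i x)"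
  by (induction I rule: infinite_finite_induct) (auto intro: Ck_on_const Ck_on_add)

text \<open>The sequence \<open>fs\<close> lists the successive derivatives of the outer function.
  Differentiating \<open>fs m\<close> along \<open>q\<close> leads to \<open>fs (Suc m)\<close>,
  hence the induction on the order with \<open>m\<close> arbitrary. Powers and power series both
  have this form.\<close>

lemma Ck_on_compose_real:
  fixes q :: "'a::euclidean_space \<Rightarrow> real"
  assumes U: "open U"
    and fs: "\<And>n t. t \<in> q ` U \<Longrightarrow> (fs n has_real_derivative fs (Suc n) t) (at t)"
    and q: "Ck_on n U q"
  shows "Ck_on n U (\<lambda>x. fs m (q x))"
  using q
proof (induction n arbitrary: m)
  case 0
  have "continuous_on (q ` U) (fs m)"
    by (rule continuous_at_imp_continuous_on) (use fs DERIV_isCont in blast)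
  then show ?case
    using 0 by (auto intro: continuous_on_compose2)
next
  case (Suc n)
  have q: "Ck_on n U q" using Suc.prems Ck_on_SucD by blast
  show ?case
  proof (rule Ck_on_SucI[OF U])
    show "((\<lambda>x. fs m (q x)) has_derivative (\<lambda>h. fs (Suc m) (q x) * frechet_derivative q (at x) h)) (at x)"
      if "x \<in> U" for x
      using has_derivative_compose[OF Ck_on_Suc_has_derivative[OF Suc.prems that]
          fs[OF imageI[OF that], unfolded has_field_derivative_def]] .
    show "Ck_on n U (\<lambda>x. fs (Suc m) (q x) * frechet_derivative q (at x) b)" if "b \<in> Basis" for b
      using Suc that q by (auto intro!: Ck_on_mult[OF U])
  qed
qed

text \<open>The chain rule produces partial derivatives of \<open>f\<close>, again evaluated along
  \<open>g\<close>. The induction therefore keeps \<open>g\<close> fixed and lets \<open>f\<close>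
  vary.\<close>

lemma Ck_on_compose:
  fixes g :: "'a::euclidean_space \<Rightarrow> 'b::euclidean_space"
  assumes U: "open U" and gUV: "g ` U \<subseteq> V"
    and g: "\<And>b. b \<in> Basis \<Longrightarrow> Ck_on n U (\<lambda>x. g x \<bullet> b)"
    and f: "Ck_on n V f"
  shows "Ck_on n U (\<lambda>x. f (g x))"
  using g f
proof (induction n arbitrary: f)
  case 0
  have "continuous_on U (\<lambda>x. \<Sum>b\<in>Basis. (g x \<bullet> b) *\<^sub>R b)"
    using 0 by (intro continuous_on_sum continuous_on_scaleR continuous_on_const) auto
  then have "continuous_on U g"
    by (subst (asm) euclidean_representation)
  then show ?case
    using 0 gUV by (auto intro: continuous_on_compose2)
next
  case (Suc n)
  have gn: "Ck_on n U (\<lambda>x. g x \<bullet> b)" if "b \<in> Basis" for b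
    using Suc.prems(1) Ck_on_SucD that by blast
  define g' where "g' x h = (\<Sum>b\<in>Basis. frechet_derivative (\<lambda>x. g x \<bullet> b) (at x) h *\<^sub>R b)" for x h
  have dg: "(g has_derivative g' x) (at x)" if "x \<in> U" for x
  proof -
    have "((\<lambda>x. \<Sum>b\<in>Basis. (g x \<bullet> b) *\<^sub>R b) has_derivative g' x) (at x)"
      unfolding g'_def
      by (intro has_derivative_sum has_derivative_scaleR_left)
        (use Ck_on_Suc_has_derivative Suc.prems(1) that in blast)
    then show ?thesis by (simp add: euclidean_representation)
  qed
  show ?case
  proof (rule Ck_on_SucI[OF U])
    fix x assume x: "x \<in> U"
    have Df: "(f has_derivative frechet_derivative f (at (g x))) (at (g x))"
      using Ck_on_Suc_has_derivative Suc.prems(2) gUV x by blast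
    have lin: "linear (frechet_derivative f (at (g x)))"
      using Df has_derivative_linear by blast
    have "((\<lambda>x. f (g x)) has_derivative (\<lambda>h. frechet_derivative f (at (g x)) (g' x h))) (at x)"
      by (rule has_derivative_compose[OF dg[OF x] Df])
    then show "((\<lambda>x. f (g x)) has_derivative (\<lambda>h. \<Sum>b\<in>Basis. frechet_derivative (\<lambda>x. g x \<bullet> b) (at x) h
        * frechet_derivative f (at (g x)) b)) (at x)"
      unfolding g'_def by (simp add: linear_sum[OF lin] linear_scale[OF lin])
  next
    fix c :: 'a assume c: "c \<in> Basis"
    show "Ck_on n U (\<lambda>x. \<Sum>b\<in>Basis. frechet_derivative (\<lambda>x. g x \<bullet> b) (at x) c
        * frechet_derivative f (at (g x)) b)"
    proof (intro Ck_on_sum Ck_on_mult U)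
      fix b :: 'b assume b: "b \<in> Basis"
      show "Ck_on n U (\<lambda>x. frechet_derivative (\<lambda>x. g x \<bullet> b) (at x) c)"
        using Suc.prems(1) b c by auto
      show "Ck_on n U (\<lambda>x. frechet_derivative f (at (g x)) b)"
        by (rule Suc.IH) (use Suc.prems(2) gn b in auto)
    qed
  qed
qed

lemma Ck_on_compose_vec:
  fixes g :: "'a::euclidean_space \<Rightarrow> real^'m"
  assumes "open U" "g ` U \<subseteq> V" "\<And>i. Ck_on n U (\<lambda>x. g x $ i)" "Ck_on n V f"
  shows "Ck_on n U (\<lambda>x. f (g x))"
  by (rule Ck_on_compose[OF assms(1,2) _ assms(4)])
    (use assms(3) in \<open>auto simp: Basis_vec_def inner_axis\<close>)

lemma Ck_on_inner_self: "open U \<Longrightarrow> Ck_on n U (\<lambda>x. x \<bullet> x)"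
  by (subst euclidean_inner) (intro Ck_on_sum Ck_on_mult Ck_on_inner)

lemma Ck_on_inverse_norm:
  fixes U :: "'a::euclidean_space set"
  assumes U: "open U" and "0 \<notin> U"
  shows "Ck_on n U (\<lambda>x. 1 / norm x)"
proof -
  \<comment> \<open>Successive derivatives of t powr (-1/2): the product is the falling factorial of
    -1/2. The function sought is \<open>fs 0\<close> at t = x \<bullet> x, which is positive on
    \<open>U\<close>.\<close>
  define fs :: "nat \<Rightarrow> real \<Rightarrow> real" where "fs m = (\<lambda>t. (\<Prod>i<m. - 1/2 - real i) * t powr (- 1/2 - real m))" for m
  have "(fs m has_real_derivative fs (Suc m) t) (at t)" if "t > 0" for m t
    unfolding fs_def using that
    by (auto intro!: derivative_eq_intros simp: algebra_simps)
  moreover have "t > 0" if "t \<in> (\<lambda>x. x \<bullet> x) ` U" for t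
    using that assms(2) by force
  ultimately have "Ck_on n U (\<lambda>x. fs 0 (x \<bullet> x))"
    using U by (intro Ck_on_compose_real[where fs = fs] Ck_on_inner_self) auto
  moreover have "fs 0 (x \<bullet> x) = 1 / norm x" if "x \<in> U" for x
  proof -
    have "fs 0 (x \<bullet> x) = (x \<bullet> x) powr (- (1 / 2))"
      by (simp add: fs_def)
    also have "\<dots> = inverse (sqrt (x \<bullet> x))"
      by (simp only: powr_minus powr_half_sqrt inner_ge_zero)
    finally show ?thesis
      by (simp only: norm_eq_sqrt_inner inverse_eq_divide)
  qed
  ultimately show ?thesis
    by (rule Ck_on_cong_open[OF U, rotated])
qed

text \<open>Termwise differentiation acts on the coefficients by \<open>diffs\<close>, and a series
  that converges everywhere still does so afterwards. This is what makes \<open>sinc\<close> and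
  \<open>cosc\<close>, series in the squared norm, smooth at the origin.\<close>

lemma Ck_on_powser:
  fixes c :: "nat \<Rightarrow> real" and q :: "'a::euclidean_space \<Rightarrow> real"
  assumes U: "open U" and c: "\<And>t. summable (\<lambda>k. c k * t ^ k)" and q: "Ck_on n U q"
  shows "Ck_on n U (\<lambda>x. \<Sum>k. c k * q x ^ k)"
proof -
  define fs :: "nat \<Rightarrow> real \<Rightarrow> real" where "fs m = (\<lambda>t. \<Sum>k. (diffs ^^ m) c k * t ^ k)" for m
  have *: "summable (\<lambda>k. (diffs ^^ m) c k * t ^ k)" for m t
  proof (induction m arbitrary: t)
    case (Suc m)
    then show ?case using termdiff_converges_all by (simp, blast)
  qed (use c in simp)
  have "(fs m has_real_derivative fs (Suc m) t) (at t)" for m t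
    unfolding fs_def using termdiffs_strong_converges_everywhere[OF *] by simp
  then have "Ck_on n U (\<lambda>x. fs 0 (q x))"
    using U q by (intro Ck_on_compose_real[where fs = fs]) auto
  then show ?thesis by (simp add: fs_def)
qed

text \<open>\<open>flat_exp 0\<close> is the classical flat function exp (- 1/t), continued by 0.
  The powers of 1/t are carried along because the derivatives are linear combinations of members of
  the family.\<close>

definition flat_exp :: "nat \<Rightarrow> real \<Rightarrow> real" where
  "flat_exp m t = (if t > 0 then (1 / t) ^ m * exp (- (1 / t)) else 0)"

lemma flat_exp_tendsto_0: "((\<lambda>t. flat_exp m t) \<longlongrightarrow> 0) (at 0)"
proof -
  have "((\<lambda>t. (inverse t) ^ m / exp (inverse t)) \<longlongrightarrow> (0::real)) (at_right 0)"
    using filterlim_compose[OF tendsto_power_div_exp_0 filterlim_inverse_at_top_right] .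
  then have "((\<lambda>t. flat_exp m t) \<longlongrightarrow> 0) (at_right 0)"
    by (rule Lim_transform_eventually)
      (auto simp: flat_exp_def exp_minus field_simps eventually_at_filter)
  moreover have "((\<lambda>t. flat_exp m t) \<longlongrightarrow> 0) (at_left 0)"
    by (rule tendsto_eventually) (auto simp: flat_exp_def eventually_at_filter)
  ultimately show ?thesis
    using filterlim_split_at by blast
qed

text \<open>Away from 0 this is the product rule. At 0 the difference quotient of
  \<open>flat_exp m\<close> is \<open>flat_exp (Suc m)\<close>, which tends to 0.\<close>

lemma flat_exp_deriv:
  "(flat_exp m has_real_derivative (- real m * flat_exp (Suc m) t + flat_exp (m + 2) t)) (at t)"
proof -
  consider "t > 0" | "t < 0" | "t = 0" by linarith
  then show ?thesis
  proof cases
    case 1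
    have "((\<lambda>t. (1 / t) ^ m * exp (- (1 / t))) has_real_derivative
        (- real m * flat_exp (Suc m) t + flat_exp (m + 2) t)) (at t)"
      using 1 by (cases m) (auto intro!: derivative_eq_intros simp: flat_exp_def divide_simps power2_eq_square,
        simp_all add: algebra_simps power_eq_if)
    then show ?thesis
      by (rule has_field_derivative_transform_within_open[where S = "{0<..}"])
        (use 1 in \<open>auto simp: flat_exp_def\<close>)
  next
    case 2
    have "((\<lambda>t. 0) has_real_derivative 0) (at t)" by simp
    then have "(flat_exp m has_real_derivative 0) (at t)"
      by (rule has_field_derivative_transform_within_open[where S = "{..<0}"])
        (use 2 in \<open>auto simp: flat_exp_def\<close>)
    then show ?thesis using 2 by (simp add: flat_exp_def)
  next
    case 3
    have "((\<lambda>h. flat_exp (Suc m) h) \<longlongrightarrow> 0) (at 0)" by (rule flat_exp_tendsto_0)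
    moreover have "flat_exp (Suc m) h = flat_exp m h / h" for h
      by (simp add: flat_exp_def)
    ultimately show ?thesis
      using 3 by (simp add: DERIV_def flat_exp_def[of _ 0])
  qed
qed

lemma Ck_on_flat_exp:
  fixes q :: "'a::euclidean_space \<Rightarrow> real"
  assumes U: "open U" and q: "Ck_on n U q"
  shows "Ck_on n U (\<lambda>x. flat_exp m (q x))"
  using q
proof (induction n arbitrary: m)
  case 0
  have "continuous_on UNIV (flat_exp m)"
    by (rule continuous_at_imp_continuous_on) (use flat_exp_deriv DERIV_isCont in blast)
  then show ?case
    using 0 by (auto intro: continuous_on_compose2)
next
  case (Suc n)
  have q: "Ck_on n U q" using Suc.prems Ck_on_SucD by blast
  show ?case
  proof (rule Ck_on_SucI[OF U])
    show "((\<lambda>x. flat_exp m (q x)) has_derivative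
      (\<lambda>h. (- real m * flat_exp (Suc m) (q x) + flat_exp (m + 2) (q x)) * frechet_derivative q (at x) h)) (at x)"
      if "x \<in> U" for x
      using has_derivative_compose[OF Ck_on_Suc_has_derivative[OF Suc.prems that]
          flat_exp_deriv[unfolded has_field_derivative_def]] .
    show "Ck_on n U (\<lambda>x. (- real m * flat_exp (Suc m) (q x) + flat_exp (m + 2) (q x))
      * frechet_derivative q (at x) b)" if "b \<in> Basis" for b
      by (intro Ck_on_mult Ck_on_add Ck_on_const U Suc.IH q) (use Suc.prems that in auto)
  qed
qed

lemma smooth_on_openD: "open S \<Longrightarrow> smooth_on S f \<Longrightarrow> Ck_on n S f"
  unfolding smooth_on_def using Ck_on_subset Ck_on_cong_open by (metis (no_types, lifting))

lemma smooth_on_openI: "open S \<Longrightarrow> (\<And>n. Ck_on n S f) \<Longrightarrow> smooth_on S f"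
  unfolding smooth_on_def by blast

lemma smooth_on_subset: "smooth_on S f \<Longrightarrow> T \<subseteq> S \<Longrightarrow> smooth_on T f"
  unfolding smooth_on_def by blast

lemma smooth_on_binop:
  fixes S :: "'a::euclidean_space set"
  assumes op: "\<And>(U::'a set) n f g. open U \<Longrightarrow> Ck_on n U f \<Longrightarrow> Ck_on n U g \<Longrightarrow> Ck_on n U (\<lambda>x. p (f x) (g x))"
    and "smooth_on S f" "smooth_on S g"
  shows "smooth_on S (\<lambda>x. p (f x) (g x))"
proof -
  obtain U f' V g' where U: "open U" "S \<subseteq> U" "\<And>n. Ck_on n U f'" and f: "\<And>x. x \<in> S \<Longrightarrow> f x = f' x"
    and V: "open V" "S \<subseteq> V" "\<And>n. Ck_on n V g'" and g: "\<And>x. x \<in> S \<Longrightarrow> g x = g' x"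
    using assms(2,3) unfolding smooth_on_def by metis
  have "Ck_on n (U \<inter> V) (\<lambda>x. p (f' x) (g' x))" for n
    by (intro op open_Int U V Ck_on_subset[OF U(3)] Ck_on_subset[OF V(3)]) auto
  moreover have "\<forall>x\<in>S. p (f x) (g x) = p (f' x) (g' x)"
    using f g by metis
  ultimately show ?thesis
    unfolding smooth_on_def using U(1,2) V(1,2)
    by (intro exI[of _ "U \<inter> V"] exI[of _ "\<lambda>x. p (f' x) (g' x)"] conjI allI open_Int Int_greatest)
qed

lemma smooth_on_const: "smooth_on S (\<lambda>x. c)"
  unfolding smooth_on_def by (intro exI[of _ UNIV]) (auto intro: Ck_on_const)

section \<open>Mollification\<close>

lemma continuous_compact_support_integrable:
  fixes f :: "'a::euclidean_space \<Rightarrow> 'b::euclidean_space"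
  assumes "continuous_on UNIV f" "compact K" "\<And>x. x \<notin> K \<Longrightarrow> f x = 0"
  shows "integrable lebesgue f"
proof -
  have "integrable lborel (\<lambda>x. indicator K x *\<^sub>R f x)"
    using assms(1,2) by (intro borel_integrable_compact) (auto intro: continuous_on_subset)
  moreover have "(\<lambda>x. indicator K x *\<^sub>R f x) = f"
    using assms(3) by (auto simp: indicator_def)
  ultimately show ?thesis
    by (simp add: integrable_completion)
qed

lemma continuous_compact_support_bounded:
  fixes f :: "'a::euclidean_space \<Rightarrow> 'b::real_normed_vector"
  assumes "continuous_on UNIV f" "compact K" "\<And>x. x \<notin> K \<Longrightarrow> f x = 0"
  obtains B where "B > 0" "\<And>x. norm (f x) \<le> B"
proof -
  have "bounded (f ` K)"
    using assms by (meson compact_continuous_image compact_imp_bounded continuous_on_subset subset_UNIV)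
  then obtain B where B: "B > 0" "\<And>x. x \<in> K \<Longrightarrow> norm (f x) \<le> B"
    unfolding bounded_pos by auto
  then show ?thesis
    using that[of B] assms(3) by (metis less_eq_real_def norm_zero)
qed

lemma continuous_compact_support_uniform:
  fixes f :: "'a::euclidean_space \<Rightarrow> 'b::real_normed_vector"
  assumes "continuous_on UNIV f" "compact K" "\<And>x. x \<notin> K \<Longrightarrow> f x = 0" "e > 0"
  obtains d where "d > 0" "\<And>x y. dist x y < d \<Longrightarrow> dist (f x) (f y) < e"
proof -
  obtain R where R: "K \<subseteq> cball 0 R"
    using bounded_subset_ballD[OF compact_imp_bounded[OF assms(2)], of 0] ball_subset_cball by (metis order_trans)
  have "uniformly_continuous_on (cball 0 (R + 1)) f"
    using assms(1) by (intro compact_uniformly_continuous) (auto intro: continuous_on_subset)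
  then obtain d where d: "d > 0"
    "\<And>x y. x \<in> cball 0 (R + 1) \<Longrightarrow> y \<in> cball 0 (R + 1) \<Longrightarrow> dist y x < d \<Longrightarrow> dist (f y) (f x) < e"
    using \<open>e > 0\<close> unfolding uniformly_continuous_on_def by meson
  have "dist (f x) (f y) < e" if xy: "dist x y < min d 1" for x y
  proof (cases "x \<in> cball 0 R \<or> y \<in> cball 0 R")
    case True
    then have "norm x \<le> R + 1" "norm y \<le> R + 1"
      using xy norm_triangle_sub[of x y] norm_triangle_sub[of y x]
      by (auto simp: dist_norm norm_minus_commute)
    then show ?thesis
      using d(2)[of y x] xy by auto
  next
    case False
    then show ?thesis using R assms(3,4) by (metis dist_self subsetD)
  qed
  then show ?thesis using that[of "min d 1"] d(1) by auto
qed

section \<open>Gradients and compactly supported C^1 functions\<close>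

lemma GDERIV_imp_grad: "GDERIV f x :> D \<Longrightarrow> grad f x = D"
  unfolding gderiv_def grad_def by (subst frechet_derivative_at[symmetric], assumption) (simp add: inner_axis')

lemma GDERIV_grad:
  fixes f :: "real^'n \<Rightarrow> real"
  assumes "f differentiable (at x)"
  shows "GDERIV f x :> grad f x"
proof -
  have D: "(f has_derivative frechet_derivative f (at x)) (at x)"
    using assms frechet_derivative_works by blast
  have "frechet_derivative f (at x) h = h \<bullet> grad f x" for h
  proof -
    have lin: "linear (frechet_derivative f (at x))"
      using D has_derivative_linear by blast
    have "frechet_derivative f (at x) h = frechet_derivative f (at x) (\<Sum>i\<in>UNIV. h $ i *\<^sub>R axis i 1)"
      using basis_expansion[of h] by (simp add: scalar_mult_eq_scaleR)
    also have "\<dots> = h \<bullet> grad f x"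
      by (simp add: linear_sum[OF lin] linear_scale[OF lin] inner_vec_def grad_def)
    finally show ?thesis .
  qed
  then show ?thesis
    unfolding gderiv_def by (intro has_derivative_eq_rhs[OF D]) auto
qed

lemma grad_nth: "grad f x $ i = frechet_derivative f (at x) (axis i 1)"
  by (simp add: grad_def)

lemma GDERIV_cong_open:
  assumes "open U" "x \<in> U" "\<And>y. y \<in> U \<Longrightarrow> f y = g y"
  shows "GDERIV f x :> D \<longleftrightarrow> GDERIV g x :> D"
  unfolding gderiv_def using has_derivative_cong_open[OF assms] .

lemma grad_cong_open:
  assumes "open U" "x \<in> U" "\<And>y. y \<in> U \<Longrightarrow> f y = g y"
  shows "grad f x = grad g x"
  unfolding grad_def using frechet_derivative_cong_open[OF assms] by simp

lemma GDERIV_continuous: "GDERIV f x :> D \<Longrightarrow> isCont f x"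
  unfolding gderiv_def by (rule has_derivative_continuous)

text \<open>Composing a smooth test function with a C^1 diffeomorphism leaves a function of this
  class, which is stable under such changes of variables. The function is C^1 on the whole space,
  being 0 off a compact part of \<open>U\<close>, so that integrals can be taken over
  \<open>lebesgue\<close>.\<close>

definition C1_compact :: "(real^'n) set \<Rightarrow> (real^'n \<Rightarrow> real) \<Rightarrow> bool" where
  "C1_compact U \<phi> \<longleftrightarrow> (\<forall>x. GDERIV \<phi> x :> grad \<phi> x) \<and> continuous_on UNIV (grad \<phi>) \<and>
     (\<exists>K. compact K \<and> K \<subseteq> U \<and> (\<forall>x. x \<notin> K \<longrightarrow> \<phi> x = 0))"

lemma C1_compactE:
  assumes "C1_compact U \<phi>"
  obtains K where "compact K" "K \<subseteq> U" "\<And>x. x \<notin> K \<Longrightarrow> \<phi> x = 0" "\<And>x. x \<notin> K \<Longrightarrow> grad \<phi> x = 0"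
proof -
  obtain K where K: "compact K" "K \<subseteq> U" "\<And>x. x \<notin> K \<Longrightarrow> \<phi> x = 0"
    using assms unfolding C1_compact_def by blast
  have "grad \<phi> x = 0" if "x \<notin> K" for x
  proof -
    have "GDERIV \<phi> x :> 0 \<longleftrightarrow> GDERIV (\<lambda>_. 0) x :> 0"
      by (rule GDERIV_cong_open[of "- K"]) (use K that compact_imp_closed in auto)
    then show ?thesis
      using GDERIV_const GDERIV_imp_grad by blast
  qed
  then show ?thesis using K that by blast
qed

lemma C1_compact_GDERIV: "C1_compact U \<phi> \<Longrightarrow> GDERIV \<phi> x :> grad \<phi> x"
  by (simp add: C1_compact_def)

lemma C1_compact_continuous: "C1_compact U \<phi> \<Longrightarrow> continuous_on UNIV \<phi>"
  by (rule continuous_at_imp_continuous_on) (use C1_compact_GDERIV GDERIV_continuous in blast)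

lemma C1_compact_continuous_grad: "C1_compact U \<phi> \<Longrightarrow> continuous_on UNIV (grad \<phi>)"
  by (simp add: C1_compact_def)

lemma C1_compact_continuous_grad_nth: "C1_compact U \<phi> \<Longrightarrow> continuous_on UNIV (\<lambda>x. grad \<phi> x $ i)"
  by (intro continuous_intros C1_compact_continuous_grad)

lemma C1_compact_mono: "C1_compact U \<phi> \<Longrightarrow> U \<subseteq> U' \<Longrightarrow> C1_compact U' \<phi>"
  unfolding C1_compact_def by blast

text \<open>The open sets \<open>U\<close> and \<open>- K\<close> cover the space, and on the second
  the function is 0. A gradient known only on \<open>U\<close> thus makes the zero extension C^1
  everywhere.\<close>

lemma C1_compactI:
  assumes "open U" "compact K" "K \<subseteq> U" "\<And>x. x \<notin> K \<Longrightarrow> \<phi> x = 0"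
    and D: "\<And>x. x \<in> U \<Longrightarrow> GDERIV \<phi> x :> D x" and "continuous_on U D"
  shows "C1_compact U \<phi>"
proof -
  have o: "open (- K)" using assms(2) compact_imp_closed by auto
  have out: "GDERIV \<phi> x :> 0" if "x \<notin> K" for x
  proof -
    have "GDERIV \<phi> x :> 0 \<longleftrightarrow> GDERIV (\<lambda>_. 0) x :> 0"
      by (rule GDERIV_cong_open[OF o]) (use assms that in auto)
    then show ?thesis using GDERIV_const by blast
  qed
  have G: "GDERIV \<phi> x :> grad \<phi> x" for x
    using out[of x] D[of x] assms(3) GDERIV_imp_grad by (metis subsetD)
  have "continuous_on (U \<union> - K) (grad \<phi>)"
  proof (rule continuous_on_open_Un)
    show "continuous_on U (grad \<phi>)"
      using assms(6) D GDERIV_imp_grad by (metis (no_types, lifting) continuous_on_cong)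
    show "continuous_on (- K) (grad \<phi>)"
      using out GDERIV_imp_grad by (metis (no_types, lifting) ComplD continuous_on_cong continuous_on_const)
  qed (use assms o in auto)
  moreover have "U \<union> - K = UNIV" using assms(3) by auto
  ultimately show ?thesis
    unfolding C1_compact_def using G assms by auto
qed

lemma test_function_C1_compact: "test_function U \<phi> \<Longrightarrow> C1_compact U \<phi>"
proof -
  assume t: "test_function U \<phi>"
  have C: "Ck_on n UNIV \<phi>" for n
    using t smooth_on_openD[of UNIV] unfolding test_function_def by auto
  have d: "\<phi> differentiable (at x)" for x
    using C[of 1] by auto
  have "continuous_on UNIV (grad \<phi>)"
    unfolding grad_def using C[of 1] by (intro continuous_on_vec_lambda) (auto simp: axis_in_Basis_iff)
  then show ?thesis
    using t GDERIV_grad[OF d] unfolding C1_compact_def test_function_def by auto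
qed

lemma C1_compact_mult:
  fixes \<phi> :: "real^'n \<Rightarrow> real"
  assumes "open U" "C1_compact U \<zeta>"
    and D: "\<And>x. x \<in> U \<Longrightarrow> GDERIV \<phi> x :> D x" and "continuous_on U D"
  shows "C1_compact U (\<lambda>x. \<zeta> x * \<phi> x)"
    and "\<And>x. x \<in> U \<Longrightarrow> grad (\<lambda>x. \<zeta> x * \<phi> x) x = \<zeta> x *\<^sub>R D x + \<phi> x *\<^sub>R grad \<zeta> x"
proof -
  show A: "grad (\<lambda>x. \<zeta> x * \<phi> x) x = \<zeta> x *\<^sub>R D x + \<phi> x *\<^sub>R grad \<zeta> x" if "x \<in> U" for x
    using GDERIV_imp_grad[OF GDERIV_mult[OF C1_compact_GDERIV[OF assms(2)] D[OF that]]] .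
  have G: "GDERIV (\<lambda>x. \<zeta> x * \<phi> x) x :> \<zeta> x *\<^sub>R D x + \<phi> x *\<^sub>R grad \<zeta> x" if "x \<in> U" for x
    using GDERIV_mult[OF C1_compact_GDERIV[OF assms(2)] D[OF that]] .
  obtain K where K: "compact K" "K \<subseteq> U" "\<And>x. x \<notin> K \<Longrightarrow> \<zeta> x = 0"
    using C1_compactE[OF assms(2)] by metis
  have "continuous_on U \<phi>"
    by (rule continuous_at_imp_continuous_on) (use D GDERIV_continuous in blast)
  then have "continuous_on U (\<lambda>x. \<zeta> x *\<^sub>R D x + \<phi> x *\<^sub>R grad \<zeta> x)"
    using assms(4) C1_compact_continuous[OF assms(2)] C1_compact_continuous_grad[OF assms(2)]
    by (intro continuous_intros) (auto intro: continuous_on_subset)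
  then show "C1_compact U (\<lambda>x. \<zeta> x * \<phi> x)"
    by (intro C1_compactI[OF assms(1) K(1,2) _ G]) (use K in auto)
qed

text \<open>A continuous gradient of compact support is uniformly continuous, and the mean value
  inequality on a ball turns this into a first order expansion whose remainder is uniform in x. It
  is what allows differentiation under an integral.\<close>

lemma C1_compact_uniform_deriv:
  fixes \<phi> :: "real^'n \<Rightarrow> real"
  assumes "C1_compact U \<phi>" "e > 0"
  obtains d where "d > 0" "\<And>x h. norm h < d \<Longrightarrow> \<bar>\<phi> (x + h) - \<phi> x - h \<bullet> grad \<phi> x\<bar> \<le> e * norm h"
proof -
  obtain K where K: "compact K" "\<And>x. x \<notin> K \<Longrightarrow> grad \<phi> x = 0"
    using C1_compactE[OF assms(1)] by metis
  obtain d where d: "d > 0" "\<And>x y. dist x y < d \<Longrightarrow> dist (grad \<phi> x) (grad \<phi> y) < e"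
    using continuous_compact_support_uniform[OF C1_compact_continuous_grad[OF assms(1)] K assms(2)] by blast
  have "\<bar>\<phi> (x + h) - \<phi> x - h \<bullet> grad \<phi> x\<bar> \<le> e * norm h" if h: "norm h < d" for x h
  proof -
    define D where "D = (\<lambda>y h. h \<bullet> grad \<phi> y)"
    have "norm (\<phi> (x + h) - \<phi> x - D x (x + h - x)) \<le> norm (x + h - x) * e"
    proof (rule differentiable_bound_linearization[where S = "ball x d"])
      show "x + t *\<^sub>R (x + h - x) \<in> ball x d" if "t \<in> {0..1}" for t
      proof -
        have "\<bar>t\<bar> * norm h \<le> 1 * norm h"
          using that by (intro mult_right_mono) auto
        then show ?thesis using h by (simp add: dist_norm)
      qed
      show "(\<phi> has_derivative D y) (at y within ball x d)" for y
        using C1_compact_GDERIV[OF assms(1)] unfolding gderiv_def D_def by (rule has_derivative_at_withinI)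
      show "onorm (D y - D x) \<le> e" if "y \<in> ball x d" for y
      proof (rule onorm_le)
        fix v
        have "\<bar>v \<bullet> (grad \<phi> y - grad \<phi> x)\<bar> \<le> norm v * norm (grad \<phi> y - grad \<phi> x)"
          by (rule Cauchy_Schwarz_ineq2)
        also have "\<dots> \<le> norm v * e"
          using d(2)[of y x] that by (intro mult_left_mono) (auto simp: dist_norm dist_commute norm_minus_commute)
        finally show "norm ((D y - D x) v) \<le> e * norm v"
          by (simp add: D_def inner_diff_right algebra_simps)
      qed
    qed (use d in auto)
    then show ?thesis by (simp add: D_def mult.commute)
  qed
  then show ?thesis using that d(1) by blast
qed

lemma C1_compact_integrable:
  assumes "C1_compact U \<phi>"
  shows "integrable lebesgue \<phi>" "integrable lebesgue (grad \<phi>)" "integrable lebesgue (\<lambda>x. grad \<phi> x $ i)"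
proof -
  obtain K where K: "compact K" "\<And>x. x \<notin> K \<Longrightarrow> \<phi> x = 0" "\<And>x. x \<notin> K \<Longrightarrow> grad \<phi> x = 0"
    using C1_compactE[OF assms] by metis
  show "integrable lebesgue \<phi>" "integrable lebesgue (grad \<phi>)" "integrable lebesgue (\<lambda>x. grad \<phi> x $ i)"
    by (rule continuous_compact_support_integrable[OF _ K(1)];
        use K C1_compact_continuous[OF assms] C1_compact_continuous_grad[OF assms]
          C1_compact_continuous_grad_nth[OF assms] in simp)+
qed

lemma lborel_distr_reflect:
  "distr lborel borel (\<lambda>x. a - x) = (lborel :: 'a::euclidean_space measure)"
  using lborel_affine[of "-1" a] by (simp add: density_1)

lemma has_bochner_integral_reflect:
  fixes f :: "'a::euclidean_space \<Rightarrow> real"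
  assumes "f \<in> borel_measurable borel" "has_bochner_integral lebesgue f I"
  shows "has_bochner_integral lebesgue (\<lambda>x. f (a - x)) I"
proof -
  have f: "f \<in> borel_measurable lborel" using assms(1) by simp
  have m: "(\<lambda>x. a - x) \<in> borel_measurable borel"
    by (intro borel_measurable_continuous_onI continuous_intros)
  have "integrable lborel f" "integral\<^sup>L lborel f = I"
    using assms(2) f by (auto simp: has_bochner_integral_iff integrable_completion integral_completion)
  then have "integrable (distr lborel borel (\<lambda>x. a - x)) f" "integral\<^sup>L (distr lborel borel (\<lambda>x. a - x)) f = I"
    unfolding lborel_distr_reflect by auto
  then have "integrable lborel (\<lambda>x. f (a - x))" "integral\<^sup>L lborel (\<lambda>x. f (a - x)) = I"
    using assms(1) m by (auto simp: integrable_distr_eq integral_distr)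
  moreover have "(\<lambda>x. f (a - x)) \<in> borel_measurable lborel"
    using measurable_compose[OF m assms(1)] by simp
  ultimately show ?thesis
    by (auto simp: has_bochner_integral_iff integrable_completion integral_completion)
qed

lemma has_bochner_integral_translate:
  fixes f :: "'a::euclidean_space \<Rightarrow> real"
  assumes "f \<in> borel_measurable borel" "has_bochner_integral lebesgue f I"
  shows "has_bochner_integral lebesgue (\<lambda>x. f (x + a)) I"
proof -
  have "has_bochner_integral lebesgue (\<lambda>x. (\<lambda>y. f (a - y)) (0 - x)) I"
    by (intro has_bochner_integral_reflect assms measurable_compose[OF _ assms(1)]
        borel_measurable_continuous_onI continuous_intros)
  then show ?thesis by (simp add: add.commute)
qed

text \<open>Translation invariance instead of iterated integration: the difference quotients of
  \<phi> in direction i have integral 0, and they converge to the partial derivative uniformly, with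
  supports in one fixed ball.\<close>

lemma C1_compact_integral_grad:
  fixes \<phi> :: "real^'n \<Rightarrow> real"
  assumes "C1_compact U \<phi>"
  shows "(\<integral>x. grad \<phi> x $ i \<partial>lebesgue) = 0"
proof -
  obtain K where K: "compact K" "\<And>x. x \<notin> K \<Longrightarrow> \<phi> x = 0" "\<And>x. x \<notin> K \<Longrightarrow> grad \<phi> x = 0"
    using C1_compactE[OF assms] by metis
  obtain R where R: "R > 0" "K \<subseteq> cball 0 R"
    using bounded_subset_ballD[OF compact_imp_bounded[OF K(1)], of 0] ball_subset_cball by (metis order_trans)
  let ?V = "measure lebesgue (cball 0 (R + 1) :: (real^'n) set)"
  define J where "J = (\<integral>x. grad \<phi> x $ i \<partial>lebesgue)"
  have small: "\<bar>J\<bar> \<le> e * ?V" if e: "e > 0" for e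
  proof -
    obtain d where d: "d > 0" "\<And>x h. norm h < d \<Longrightarrow> \<bar>\<phi> (x + h) - \<phi> x - h \<bullet> grad \<phi> x\<bar> \<le> e * norm h"
      using C1_compact_uniform_deriv[OF assms e] by blast
    \<comment> \<open>t < d makes the uniform expansion available; t \<le> 1 keeps the support of
      the translated function inside the ball of radius R + 1.\<close>
    define t where "t = min (d / 2) 1"
    have t: "0 < t" "t < d" "t \<le> 1" using d(1) by (auto simp: t_def)
    let ?h = "t *\<^sub>R axis i 1 :: real^'n"
    have nh: "norm ?h = t" using t by (simp add: norm_axis_1)
    have hg: "?h \<bullet> grad \<phi> x = t * grad \<phi> x $ i" for x by (simp add: inner_axis')
    have I\<phi>: "has_bochner_integral lebesgue \<phi> (integral\<^sup>L lebesgue \<phi>)"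
      using C1_compact_integrable(1)[OF assms] by (simp add: has_bochner_integral_integrable)
    have "has_bochner_integral lebesgue (\<lambda>x. \<phi> (x + ?h)) (integral\<^sup>L lebesgue \<phi>)"
      by (rule has_bochner_integral_translate[OF _ I\<phi>])
        (use C1_compact_continuous[OF assms] borel_measurable_continuous_onI in blast)
    then have "has_bochner_integral lebesgue (\<lambda>x. \<phi> (x + ?h) - \<phi> x - t * grad \<phi> x $ i)
        (integral\<^sup>L lebesgue \<phi> - integral\<^sup>L lebesgue \<phi> - t * J)"
      unfolding J_def
      by (intro has_bochner_integral_diff has_bochner_integral_mult_right I\<phi>
          has_bochner_integral_integrable[OF C1_compact_integrable(3)[OF assms]])
    then have 1: "has_bochner_integral lebesgue (\<lambda>x. \<phi> (x + ?h) - \<phi> x - t * grad \<phi> x $ i) (- t * J)"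
      by simp
    have "has_bochner_integral lebesgue (indicat_real (cball 0 (R + 1) :: (real^'n) set)) ?V"
      by (rule has_bochner_integral_real_indicator) (use emeasure_lborel_cball_finite in \<open>auto simp: less_top\<close>)
    then have 2: "has_bochner_integral lebesgue (\<lambda>x. e * t * indicat_real (cball 0 (R + 1)) (x::real^'n)) (e * t * ?V)"
      by (rule has_bochner_integral_mult_right) 
    have b: "\<bar>\<phi> (x + ?h) - \<phi> x - t * grad \<phi> x $ i\<bar> \<le> e * t * indicat_real (cball 0 (R + 1)) x" for x
    proof (cases "x \<in> cball 0 (R + 1)")
      case True
      then show ?thesis using d(2)[of ?h x] t nh hg by simp
    next
      case False
      have "norm x \<le> norm (x + ?h) + t"
        using norm_triangle_sub[of x "x + ?h"] nh by simp
      then have "x + ?h \<notin> K" "x \<notin> K"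
        using False t R by auto
      then show ?thesis using K False by simp
    qed
    have i1: "integrable lebesgue (\<lambda>x. \<phi> (x + ?h) - \<phi> x - t * grad \<phi> x $ i)"
      using 1 by (simp add: has_bochner_integral_iff)
    have "\<bar>- t * J\<bar> = norm (\<integral>x. \<phi> (x + ?h) - \<phi> x - t * grad \<phi> x $ i \<partial>lebesgue)"
      unfolding has_bochner_integral_integral_eq[OF 1] by simp
    also have "\<dots> \<le> (\<integral>x. \<bar>\<phi> (x + ?h) - \<phi> x - t * grad \<phi> x $ i\<bar> \<partial>lebesgue)"
      using integral_norm_bound[of lebesgue "\<lambda>x. \<phi> (x + ?h) - \<phi> x - t * grad \<phi> x $ i"] by simp
    also have "\<dots> \<le> (\<integral>x. e * t * indicat_real (cball 0 (R + 1)) (x::real^'n) \<partial>lebesgue)"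
    proof (rule Bochner_Integration.integral_mono)
      show "integrable lebesgue (\<lambda>x. \<bar>\<phi> (x + ?h) - \<phi> x - t * grad \<phi> x $ i\<bar>)"
        using integrable_norm[OF i1] by simp
      show "integrable lebesgue (\<lambda>x. e * t * indicat_real (cball 0 (R + 1)) (x::real^'n))"
        using 2 unfolding has_bochner_integral_iff by blast
    qed (use b in blast)
    also have "\<dots> = e * t * ?V"
      by (rule has_bochner_integral_integral_eq[OF 2])
    finally have "\<bar>- t * J\<bar> \<le> e * t * ?V" .
    then have "t * \<bar>J\<bar> \<le> t * (e * ?V)" using t by (simp add: abs_mult algebra_simps)
    then show ?thesis using t by (simp only: mult_le_cancel_left_pos)
  qed
  have "\<bar>J\<bar> \<le> 0 + e" if "e > 0" for e
  proof -
    define V where "V = ?V"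
    have V: "V \<ge> 0" by (simp add: V_def)
    have "\<bar>J\<bar> \<le> e / (V + 1) * ?V" using that V by (intro small divide_pos_pos) auto
    also have "\<dots> \<le> e" using that V unfolding V_def[symmetric] by (simp add: field_simps)
    finally show ?thesis by simp
  qed
  then show ?thesis unfolding J_def[symmetric] using field_le_epsilon[of "\<bar>J\<bar>" 0] by simp
qed

lemma mollifier_exists:
  fixes \<epsilon> :: real
  assumes "\<epsilon> > 0"
  obtains \<rho> :: "'a::euclidean_space \<Rightarrow> real" where "\<And>n. Ck_on n UNIV \<rho>" "\<And>x. 0 \<le> \<rho> x"
    "\<And>x. norm x \<ge> \<epsilon> \<Longrightarrow> \<rho> x = 0" "has_bochner_integral lebesgue \<rho> 1"
proof -
  define r :: "'a \<Rightarrow> real" where "r x = flat_exp 0 (\<epsilon>\<^sup>2 - x \<bullet> x)" for x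
  have C: "Ck_on n UNIV r" for n
    unfolding r_def by (intro Ck_on_flat_exp Ck_on_diff Ck_on_const Ck_on_inner_self) auto
  have nn: "0 \<le> r x" for x by (simp add: r_def flat_exp_def)
  have supp: "r x = 0" if "norm x \<ge> \<epsilon>" for x
  proof -
    have "\<epsilon>\<^sup>2 \<le> x \<bullet> x" using that assms by (metis less_eq_real_def power2_norm_eq_inner power_mono)
    then show ?thesis by (simp add: r_def flat_exp_def)
  qed
  have cont: "continuous_on UNIV r" using C Ck_on_continuous by blast
  have int: "integrable lebesgue r"
    by (rule continuous_compact_support_integrable[OF cont, of "cball 0 \<epsilon>"]) (use supp in auto)
  define c where "c = integral\<^sup>L lebesgue r"
  \<comment> \<open>If the integral vanished, r would be 0 almost everywhere; but the set where r is
    nonzero is open and contains 0.\<close>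
  have "c \<noteq> 0"
  proof
    assume "c = 0"
    then have "AE x in lebesgue. r x = 0"
      using int nn unfolding c_def by (simp add: integral_nonneg_eq_0_iff_AE)
    then have "AE x in lborel. r x = 0"
      using AE_completion_iff by blast
    moreover have "open {x. r x \<noteq> 0}"
      using cont by (intro open_Collect_neq) auto
    ultimately have "{x. r x \<noteq> 0} = {}"
      using AE_iff_measurable[of "{x. r x \<noteq> 0}" lborel "\<lambda>x. r x = 0"] open_not_negligible[of "{x. r x \<noteq> 0}"]
      by (auto simp: negligible_iff_null_sets null_sets_def emeasure_completion)
    moreover have "r 0 \<noteq> 0" using assms by (simp add: r_def flat_exp_def)
    ultimately show False by auto
  qed
  moreover have "c \<ge> 0" unfolding c_def using nn by simp
  ultimately have c: "c > 0" by simp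
  show ?thesis
  proof
    show "Ck_on n UNIV (\<lambda>x. (1 / c) * r x)" for n using C by (intro Ck_on_cmult) auto
    have "has_bochner_integral lebesgue (\<lambda>x. (1 / c) * r x) ((1 / c) * c)"
      using int unfolding c_def by (intro has_bochner_integral_mult_right has_bochner_integral_integrable)
    then show "has_bochner_integral lebesgue (\<lambda>x. (1 / c) * r x) 1" using c by simp
  qed (use nn supp c in auto)
qed


section \<open>Local square integrability and pairings with continuous functions\<close>

lemma continuous_borel_measurable_lebesgue:
  "continuous_on UNIV f \<Longrightarrow> (f :: 'a::euclidean_space \<Rightarrow> 'b::euclidean_space) \<in> borel_measurable lebesgue"
  by (simp add: borel_measurable_continuous_onI measurable_completion)

lemma has_bochner_integral_lebesgue_on_iff:
  fixes g :: "'a::euclidean_space \<Rightarrow> real"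
  assumes "S \<in> sets lebesgue" "\<And>x. x \<notin> S \<Longrightarrow> g x = 0"
  shows "has_bochner_integral (lebesgue_on S) g I \<longleftrightarrow> has_bochner_integral lebesgue g I"
proof -
  have "(\<lambda>x. indicat_real S x *\<^sub>R g x) = g"
  proof
    show "indicat_real S x *\<^sub>R g x = g x" for x
      using assms(2)[of x] by (cases "x \<in> S") auto
  qed
  then show ?thesis
    using assms(1) by (simp add: has_bochner_integral_restrict_space)
qed

lemma integrable_lebesgue_on_iff:
  fixes g :: "'a::euclidean_space \<Rightarrow> real"
  assumes "S \<in> sets lebesgue"
  shows "integrable (lebesgue_on S) g \<longleftrightarrow> integrable lebesgue (\<lambda>x. indicat_real S x * g x)"
  using assms by (simp add: integrable_restrict_space)

lemma integrable_bounded_mult: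
  fixes f g :: "'a \<Rightarrow> real"
  assumes "integrable M f" "g \<in> borel_measurable M" "\<And>x. x \<in> space M \<Longrightarrow> \<bar>g x\<bar> \<le> B"
  shows "integrable M (\<lambda>x. g x * f x)"
proof (rule Bochner_Integration.integrable_bound)
  show "integrable M (\<lambda>x. B * f x)" using assms(1) by simp
  show "AE x in M. norm (g x * f x) \<le> norm (B * f x)"
  proof (rule AE_I2)
    fix x assume "x \<in> space M"
    then have "\<bar>g x\<bar> \<le> \<bar>B\<bar>" using assms(3)[of x] by linarith
    then show "norm (g x * f x) \<le> norm (B * f x)"
      by (simp add: abs_mult mult_right_mono)
  qed
  show "(\<lambda>x. g x * f x) \<in> borel_measurable M"
    using assms(1,2) by (intro borel_measurable_times) auto
qed

lemma sq_integrable_imp_integrable_compact: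
  fixes f :: "'a::euclidean_space \<Rightarrow> real"
  assumes "compact K" "f \<in> borel_measurable lebesgue" "\<And>x. x \<notin> K \<Longrightarrow> f x = 0"
    and "integrable lebesgue (\<lambda>x. (f x)\<^sup>2)"
  shows "integrable lebesgue f"
proof (rule Bochner_Integration.integrable_bound)
  have K: "K \<in> sets lebesgue" "emeasure lebesgue K < \<infinity>"
    using assms(1) lmeasurable_compact[of K] by (auto simp: fmeasurable_def)
  then have "integrable lebesgue (indicat_real K)" by (intro integrable_real_indicator) auto
  then show "integrable lebesgue (\<lambda>x. indicat_real K x + (f x)\<^sup>2)" using assms(4) by simp
  have "\<bar>a\<bar> \<le> 1 + a\<^sup>2" for a :: real
    using sum_squares_bound[of 1 "\<bar>a\<bar>"] by (simp add: power2_eq_square)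
  then show "AE x in lebesgue. norm (f x) \<le> norm (indicat_real K x + (f x)\<^sup>2)"
    using assms(3) by (auto simp: indicator_def)
qed (use assms in auto)

lemma L2_loc_compact:
  assumes "L2_loc U f" "compact K" "K \<subseteq> U"
  shows "integrable lebesgue (\<lambda>x. indicat_real K x * f x)"
    and "integrable lebesgue (\<lambda>x. indicat_real K x * (f x)\<^sup>2)"
proof -
  have K: "K \<in> sets lebesgue" using lmeasurable_compact[OF assms(2)] by (simp add: fmeasurable_def)
  have s: "square_integrable (lebesgue_on K) f" using assms unfolding L2_loc_def by blast
  then have m: "(\<lambda>x. indicat_real K x * f x) \<in> borel_measurable lebesgue"
    using K unfolding square_integrable_def by (simp add: borel_measurable_restrict_space_iff)
  show i: "integrable lebesgue (\<lambda>x. indicat_real K x * (f x)\<^sup>2)"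
    using s unfolding square_integrable_def integrable_lebesgue_on_iff[OF K] by blast
  moreover have "(\<lambda>x. (indicat_real K x * f x)\<^sup>2) = (\<lambda>x. indicat_real K x * (f x)\<^sup>2)"
    by (auto simp: indicator_def)
  ultimately show "integrable lebesgue (\<lambda>x. indicat_real K x * f x)"
    by (intro sq_integrable_imp_integrable_compact[OF assms(2) m]) auto
qed

lemma L2_locI:
  assumes "f \<in> borel_measurable (lebesgue_on U)" "U \<in> sets lebesgue"
    and "\<And>K. compact K \<Longrightarrow> K \<subseteq> U \<Longrightarrow> integrable lebesgue (\<lambda>x. indicat_real K x * (f x)\<^sup>2)"
  shows "L2_loc U f"
proof -
  have "square_integrable (lebesgue_on K) f" if K: "compact K" "K \<subseteq> U" for K
  proof -
    have "K \<in> sets lebesgue" using lmeasurable_compact[OF K(1)] by (simp add: fmeasurable_def)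
    then show ?thesis
      unfolding square_integrable_def
      using assms(3)[OF K] measurable_restrict_mono[OF assms(1) K(2)] integrable_lebesgue_on_iff by blast
  qed
  then show ?thesis using assms unfolding L2_loc_def by blast
qed

lemma L2_loc_measurable: "L2_loc U f \<Longrightarrow> f \<in> borel_measurable (lebesgue_on U)"
  by (simp add: L2_loc_def)

lemma L2_loc_subset:
  assumes "L2_loc U f" "U' \<subseteq> U"
  shows "L2_loc U' f"
  unfolding L2_loc_def
proof (intro conjI allI impI)
  show "f \<in> borel_measurable (lebesgue_on U')"
    by (rule measurable_restrict_mono[OF L2_loc_measurable[OF assms(1)] assms(2)])
  show "square_integrable (lebesgue_on K) f" if "compact K \<and> K \<subseteq> U'" for K
    using assms that unfolding L2_loc_def by blast
qed

lemma L2_loc_add: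
  assumes "U \<in> sets lebesgue" "L2_loc U f" "L2_loc U g"
  shows "L2_loc U (\<lambda>x. f x + g x)"
proof (rule L2_locI)
  show "(\<lambda>x. f x + g x) \<in> borel_measurable (lebesgue_on U)"
    using assms L2_loc_measurable by (intro borel_measurable_add) auto
  fix K :: "'a set" assume K: "compact K" "K \<subseteq> U"
  have "(\<lambda>x. indicat_real K x * f x) \<in> borel_measurable lebesgue"
    "(\<lambda>x. indicat_real K x * g x) \<in> borel_measurable lebesgue"
    using L2_loc_compact(1)[OF assms(2) K] L2_loc_compact(1)[OF assms(3) K] by auto
  then have m: "(\<lambda>x. (indicat_real K x * f x + indicat_real K x * g x)\<^sup>2) \<in> borel_measurable lebesgue"
    by measurable
  have e: "(\<lambda>x. (indicat_real K x * f x + indicat_real K x * g x)\<^sup>2) = (\<lambda>x. indicat_real K x * (f x + g x)\<^sup>2)"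
    by (auto simp: indicator_def)
  show "integrable lebesgue (\<lambda>x. indicat_real K x * (f x + g x)\<^sup>2)"
  proof (rule Bochner_Integration.integrable_bound)
    show "integrable lebesgue (\<lambda>x. 2 * (indicat_real K x * (f x)\<^sup>2) + 2 * (indicat_real K x * (g x)\<^sup>2))"
      using L2_loc_compact(2)[OF assms(2) K] L2_loc_compact(2)[OF assms(3) K] by simp
    show "(\<lambda>x. indicat_real K x * (f x + g x)\<^sup>2) \<in> borel_measurable lebesgue"
      using m unfolding e .
    have "(a + b)\<^sup>2 \<le> 2 * a\<^sup>2 + 2 * b\<^sup>2" for a b :: real
      using sum_squares_bound[of a b] by (simp add: power2_sum)
    then show "AE x in lebesgue. norm (indicat_real K x * (f x + g x)\<^sup>2)
      \<le> norm (2 * (indicat_real K x * (f x)\<^sup>2) + 2 * (indicat_real K x * (g x)\<^sup>2))"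
      by (auto simp: indicator_def)
  qed
qed (use assms in auto)

lemma continuous_on_borel_measurable_lebesgue_on:
  fixes g :: "'a::euclidean_space \<Rightarrow> 'b::euclidean_space"
  assumes "open U" "continuous_on U g"
  shows "g \<in> borel_measurable (lebesgue_on U)"
  using assms by (intro continuous_imp_measurable_on_sets_lebesgue) auto

lemma continuous_on_compact_abs_bound:
  fixes c :: "'a::euclidean_space \<Rightarrow> real"
  assumes "continuous_on U c" "compact K" "K \<subseteq> U"
  obtains B where "B > 0" "\<And>x. x \<in> K \<Longrightarrow> \<bar>c x\<bar> \<le> B"
proof -
  have "bounded (c ` K)"
    using assms by (meson compact_continuous_image compact_imp_bounded continuous_on_subset)
  then show ?thesis
    unfolding bounded_pos using that by auto
qed

lemma L2_loc_continuous_mult: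
  assumes "open U" "L2_loc U f" "continuous_on U c"
  shows "L2_loc U (\<lambda>x. c x * f x)"
proof (rule L2_locI)
  have O: "U \<in> sets lebesgue" using assms(1) by auto
  show mm: "(\<lambda>x. c x * f x) \<in> borel_measurable (lebesgue_on U)"
    using L2_loc_measurable[OF assms(2)] continuous_on_borel_measurable_lebesgue_on[OF assms(1,3)]
    by (rule borel_measurable_times[rotated])
  fix K assume K: "compact K" "K \<subseteq> U"
  obtain B where B: "B > 0" "\<And>x. x \<in> K \<Longrightarrow> \<bar>c x\<bar> \<le> B"
    using continuous_on_compact_abs_bound[OF assms(3) K] by blast
  have KS: "K \<in> sets lebesgue" using lmeasurable_compact[OF K(1)] by (simp add: fmeasurable_def)
  have "(\<lambda>x. (c x * f x)\<^sup>2) \<in> borel_measurable (lebesgue_on K)"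
    using measurable_restrict_mono[OF mm K(2)] by measurable
  then have m: "(\<lambda>x. indicat_real K x * (c x * f x)\<^sup>2) \<in> borel_measurable lebesgue"
    using KS by (simp add: borel_measurable_restrict_space_iff)
  show "integrable lebesgue (\<lambda>x. indicat_real K x * (c x * f x)\<^sup>2)"
  proof (rule Bochner_Integration.integrable_bound[OF _ m])
    show "integrable lebesgue (\<lambda>x. B\<^sup>2 * (indicat_real K x * (f x)\<^sup>2))"
      using L2_loc_compact(2)[OF assms(2) K] by simp
    have "(c x * f x)\<^sup>2 \<le> B\<^sup>2 * (f x)\<^sup>2" if "x \<in> K" for x
      using B(2)[OF that] B(1) abs_le_square_iff[of "c x" B]
      by (simp add: power_mult_distrib mult_right_mono)
    then show "AE x in lebesgue. norm (indicat_real K x * (c x * f x)\<^sup>2) \<le> norm (B\<^sup>2 * (indicat_real K x * (f x)\<^sup>2))"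
      by (auto simp: indicator_def)
  qed
qed (use assms in auto)

lemma L2_loc_0: "U \<in> sets lebesgue \<Longrightarrow> L2_loc U (\<lambda>x. 0)"
  by (rule L2_locI) auto

lemma L2_loc_sum:
  "U \<in> sets lebesgue \<Longrightarrow> (\<And>i. i \<in> I \<Longrightarrow> L2_loc U (f i)) \<Longrightarrow> L2_loc U (\<lambda>x. \<Sum>i\<in>I. f i x)"
  by (induction I rule: infinite_finite_induct) (auto intro: L2_loc_0 L2_loc_add)

lemma L2_loc_cmult: "open U \<Longrightarrow> L2_loc U f \<Longrightarrow> L2_loc U (\<lambda>x. c * f x)"
  by (rule L2_loc_continuous_mult) (auto intro: continuous_intros)

lemma L2_loc_diff:
  "open U \<Longrightarrow> L2_loc U f \<Longrightarrow> L2_loc U g \<Longrightarrow> L2_loc U (\<lambda>x. f x - g x)"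
  using L2_loc_add[of U f "\<lambda>x. (-1) * g x"] L2_loc_cmult[of U g "-1"] by auto

lemma L2_loc_mult_integrable:
  assumes "L2_loc U f" "compact K" "K \<subseteq> U" "continuous_on UNIV g" "\<And>x. x \<notin> K \<Longrightarrow> g x = 0"
  shows "integrable lebesgue (\<lambda>x. f x * g x)"
proof -
  obtain B where B: "B > 0" "\<And>x. norm (g x) \<le> B"
    using continuous_compact_support_bounded[OF assms(4,2,5)] by blast
  have "integrable lebesgue (\<lambda>x. g x * (indicat_real K x * f x))"
    using B(2) by (intro integrable_bounded_mult[where B = B] L2_loc_compact(1)[OF assms(1-3)]
        continuous_borel_measurable_lebesgue[OF assms(4)]) auto
  moreover have "(\<lambda>x. g x * (indicat_real K x * f x)) = (\<lambda>x. f x * g x)"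
  proof
    show "g x * (indicat_real K x * f x) = f x * g x" for x
      using assms(5)[of x] by (cases "x \<in> K") auto
  qed
  ultimately show ?thesis by simp
qed

section \<open>Convolution with mollifiers, and cutoff functions\<close>

definition conv :: "('a::euclidean_space \<Rightarrow> real) \<Rightarrow> ('a \<Rightarrow> real) \<Rightarrow> 'a \<Rightarrow> real" where
  "conv \<rho> v x = (\<integral>y. \<rho> (x - y) * v y \<partial>lebesgue)"

lemma conv_integrable:
  fixes \<rho> v :: "'a::euclidean_space \<Rightarrow> real"
  assumes "continuous_on UNIV \<rho>" "compact K" "\<And>x. x \<notin> K \<Longrightarrow> \<rho> x = 0" "integrable lebesgue v"
  shows "integrable lebesgue (\<lambda>y. \<rho> (x - y) * v y)"
proof -
  obtain B where B: "B > 0" "\<And>x. norm (\<rho> x) \<le> B"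
    using continuous_compact_support_bounded[OF assms(1-3)] by blast
  have "continuous_on UNIV (\<lambda>y. \<rho> (x - y))"
    by (rule continuous_on_compose2[OF assms(1)]) (auto intro: continuous_intros)
  then show ?thesis
    using assms(4) B by (intro integrable_bounded_mult[where B = B] continuous_borel_measurable_lebesgue) auto
qed

text \<open>Differentiation under the integral: the remainder of the first order expansion of \<rho>
  is at most e' times the norm of h, uniformly in y, so the remainder of the convolution is at most
  this times the L^1 norm of v.\<close>

lemma conv_GDERIV:
  fixes \<rho> :: "real^'n \<Rightarrow> real"
  assumes \<rho>: "C1_compact U \<rho>" and v: "integrable lebesgue v"
  shows "GDERIV (conv \<rho> v) x :> (\<chi> i. conv (\<lambda>z. grad \<rho> z $ i) v x)"
proof -
  obtain K where K: "compact K" "\<And>x. x \<notin> K \<Longrightarrow> \<rho> x = 0" "\<And>x. x \<notin> K \<Longrightarrow> grad \<rho> x = 0"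
    using C1_compactE[OF \<rho>] by metis
  define D where "D = (\<chi> i. conv (\<lambda>z. grad \<rho> z $ i) v x)"
  define A where "A = (\<integral>y. \<bar>v y\<bar> \<partial>lebesgue)"
  have A: "A \<ge> 0" by (simp add: A_def)
  have i1: "integrable lebesgue (\<lambda>y. \<rho> (z - y) * v y)" for z
    by (rule conv_integrable[OF C1_compact_continuous[OF \<rho>] K(1,2) v])
  have i2: "integrable lebesgue (\<lambda>y. grad \<rho> (x - y) $ i * v y)" for i
    by (rule conv_integrable[OF C1_compact_continuous_grad_nth[OF \<rho>] K(1) _ v]) (simp add: K(3))
  have hD: "h \<bullet> D = (\<integral>y. (h \<bullet> grad \<rho> (x - y)) * v y \<partial>lebesgue)"
    and i3: "integrable lebesgue (\<lambda>y. (h \<bullet> grad \<rho> (x - y)) * v y)" for h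
  proof -
    have e: "(\<lambda>y. (h \<bullet> grad \<rho> (x - y)) * v y) = (\<lambda>y. \<Sum>i\<in>UNIV. h $ i * (grad \<rho> (x - y) $ i * v y))"
      by (simp add: inner_vec_def sum_distrib_left algebra_simps)
    show "integrable lebesgue (\<lambda>y. (h \<bullet> grad \<rho> (x - y)) * v y)"
      unfolding e using i2 by simp
    show "h \<bullet> D = (\<integral>y. (h \<bullet> grad \<rho> (x - y)) * v y \<partial>lebesgue)"
      unfolding e using i2 by (simp add: inner_vec_def D_def conv_def)
  qed
  have "((conv \<rho> v) has_derivative (\<lambda>h. h \<bullet> D)) (at x)"
    unfolding has_derivative_at_alt
  proof (intro conjI allI impI)
    show "bounded_linear (\<lambda>h. h \<bullet> D)" by (rule bounded_linear_inner_left)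
    fix e :: real assume "e > 0"
    define e' where "e' = e / (A + 1)"
    have e': "e' > 0" "e' * A \<le> e"
      using \<open>e > 0\<close> A by (auto simp: e'_def field_simps)
    obtain d where d: "d > 0" "\<And>x h. norm h < d \<Longrightarrow> \<bar>\<rho> (x + h) - \<rho> x - h \<bullet> grad \<rho> x\<bar> \<le> e' * norm h"
      using C1_compact_uniform_deriv[OF \<rho> e'(1)] by blast
    have "norm (conv \<rho> v z - conv \<rho> v x - (z - x) \<bullet> D) \<le> e * norm (z - x)" if z: "norm (z - x) < d" for z
    proof -
      define h where "h = z - x"
      have zx: "z - y = (x - y) + h" for y by (simp add: h_def)
      have "conv \<rho> v z - conv \<rho> v x - h \<bullet> D
          = (\<integral>y. \<rho> (z - y) * v y - \<rho> (x - y) * v y - (h \<bullet> grad \<rho> (x - y)) * v y \<partial>lebesgue)"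
        unfolding conv_def hD using i1 i3 by simp
      also have "norm \<dots> \<le> (\<integral>y. e' * norm h * \<bar>v y\<bar> \<partial>lebesgue)"
      proof (rule Bochner_Integration.integral_norm_bound_integral)
        show "integrable lebesgue (\<lambda>y. \<rho> (z - y) * v y - \<rho> (x - y) * v y - (h \<bullet> grad \<rho> (x - y)) * v y)"
          using i1 i3 by simp
        show "integrable lebesgue (\<lambda>y. e' * norm h * \<bar>v y\<bar>)" using v by simp
        fix y
        have "norm (\<rho> (z - y) * v y - \<rho> (x - y) * v y - (h \<bullet> grad \<rho> (x - y)) * v y)
           = \<bar>\<rho> (x - y + h) - \<rho> (x - y) - h \<bullet> grad \<rho> (x - y)\<bar> * \<bar>v y\<bar>"
          unfolding zx by (simp add: abs_mult[symmetric] algebra_simps)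
        also have "\<dots> \<le> e' * norm h * \<bar>v y\<bar>"
          by (intro mult_right_mono d(2)) (use z in \<open>auto simp: h_def\<close>)
        finally show "norm (\<rho> (z - y) * v y - \<rho> (x - y) * v y - (h \<bullet> grad \<rho> (x - y)) * v y)
          \<le> e' * norm h * \<bar>v y\<bar>" .
      qed
      also have "\<dots> = (e' * A) * norm h" by (simp add: A_def)
      also have "\<dots> \<le> e * norm h" using e'(2) by (intro mult_right_mono) auto
      finally show ?thesis by (simp add: h_def)
    qed
    then show "\<exists>d>0. \<forall>y. norm (y - x) < d \<longrightarrow> norm (conv \<rho> v y - conv \<rho> v x - (y - x) \<bullet> D) \<le> e * norm (y - x)"
      using d(1) by blast
  qed
  then show ?thesis unfolding gderiv_def D_def .
qed

lemma test_function_Ck: "test_function U \<phi> \<Longrightarrow> Ck_on n UNIV \<phi>"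
  unfolding test_function_def using smooth_on_openD[of UNIV] by auto

lemma test_function_grad:
  assumes "test_function U \<phi>"
  shows "test_function U (\<lambda>x. grad \<phi> x $ i)"
proof -
  have "Ck_on n UNIV (\<lambda>x. grad \<phi> x $ i)" for n
    using test_function_Ck[OF assms, of "Suc n"] by (auto simp: grad_nth axis_in_Basis_iff)
  moreover obtain K where "compact K" "K \<subseteq> U" "\<And>x. x \<notin> K \<Longrightarrow> grad \<phi> x = 0"
    using C1_compactE[OF test_function_C1_compact[OF assms]] by metis
  ultimately show ?thesis
    unfolding test_function_def by (auto intro!: smooth_on_openI exI[of _ K])
qed

text \<open>All derivatives fall on \<rho>. A partial derivative of a test function is again a test
  function, so the induction lets \<rho> vary; no regularity of v beyond integrability
  enters.\<close>

lemma conv_Ck: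
  fixes \<rho> :: "real^'n \<Rightarrow> real"
  assumes "test_function UNIV \<rho>" and v: "integrable lebesgue v"
  shows "Ck_on n UNIV (conv \<rho> v)"
  using assms(1)
proof (induction n arbitrary: \<rho>)
  case 0
  then have "isCont (conv \<rho> v) x" for x
    using conv_GDERIV[OF test_function_C1_compact v] GDERIV_continuous by blast
  then show ?case by (simp add: continuous_at_imp_continuous_on)
next
  case (Suc n)
  show ?case
  proof (rule Ck_on_SucI)
    show "(conv \<rho> v has_derivative (\<lambda>h. h \<bullet> (\<chi> i. conv (\<lambda>z. grad \<rho> z $ i) v x))) (at x)" for x
      using conv_GDERIV[OF test_function_C1_compact[OF Suc.prems] v] unfolding gderiv_def .
    fix b :: "real^'n" assume "b \<in> Basis"
    then obtain i where b: "b = axis i 1" by (auto simp: Basis_vec_def)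
    show "Ck_on n UNIV (\<lambda>x. b \<bullet> (\<chi> i. conv (\<lambda>z. grad \<rho> z $ i) v x))"
      using Suc.IH[OF test_function_grad[OF Suc.prems]] by (simp add: b inner_axis')
  qed auto
qed

definition mollifier :: "real \<Rightarrow> ('a::euclidean_space \<Rightarrow> real) \<Rightarrow> bool" where
  "mollifier \<epsilon> \<rho> \<longleftrightarrow> test_function UNIV \<rho> \<and> (\<forall>x. 0 \<le> \<rho> x) \<and> (\<forall>x. \<epsilon> \<le> norm x \<longrightarrow> \<rho> x = 0) \<and>
     has_bochner_integral lebesgue \<rho> 1"

lemma ex_mollifier:
  assumes "\<epsilon> > 0"
  obtains \<rho> :: "'a::euclidean_space \<Rightarrow> real" where "mollifier \<epsilon> \<rho>"
proof -
  obtain \<rho> :: "'a \<Rightarrow> real" where "\<And>n. Ck_on n UNIV \<rho>" "\<And>x. 0 \<le> \<rho> x"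
    "\<And>x. norm x \<ge> \<epsilon> \<Longrightarrow> \<rho> x = 0" "has_bochner_integral lebesgue \<rho> 1"
    using mollifier_exists[OF assms] by metis
  then have "mollifier \<epsilon> \<rho>"
    unfolding mollifier_def test_function_def
    by (auto intro!: smooth_on_openI exI[of _ "cball 0 \<epsilon>"])
  then show ?thesis using that by blast
qed

lemma mollifier_continuous: "mollifier \<epsilon> \<rho> \<Longrightarrow> continuous_on UNIV \<rho>"
  unfolding mollifier_def using test_function_Ck Ck_on_continuous by blast

lemma mollifier_conv_integrable:
  fixes \<rho> v :: "'a::euclidean_space \<Rightarrow> real"
  assumes "mollifier \<epsilon> \<rho>" "integrable lebesgue v"
  shows "integrable lebesgue (\<lambda>y. \<rho> (x - y) * v y)"
  by (rule conv_integrable[OF mollifier_continuous[OF assms(1)], of "cball 0 \<epsilon>"])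
    (use assms in \<open>auto simp: mollifier_def\<close>)

lemma mollifier_reflect_integral:
  fixes \<rho> :: "'a::euclidean_space \<Rightarrow> real"
  assumes "mollifier \<epsilon> \<rho>"
  shows "has_bochner_integral lebesgue (\<lambda>y. \<rho> (x - y)) 1"
  using assms mollifier_continuous[OF assms]
  by (intro has_bochner_integral_reflect) (auto simp: mollifier_def intro: borel_measurable_continuous_onI)

text \<open>\<open>conv \<rho> v x\<close> is a mean of v over the \<epsilon>-ball around x with
  weights of total mass 1, so it deviates from c no more than v does there. Besides approximation
  this yields the support of a convolution (c = 0, e = 0) and bounds on its range.\<close>

lemma conv_close:
  assumes \<rho>: "mollifier \<epsilon> \<rho>" and v: "integrable lebesgue v"
    and c: "\<And>y. norm (x - y) < \<epsilon> \<Longrightarrow> \<bar>v y - c\<bar> \<le> e"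
  shows "\<bar>conv \<rho> v x - c\<bar> \<le> e"
proof -
  have i1: "integrable lebesgue (\<lambda>y. \<rho> (x - y) * v y)"
    by (rule mollifier_conv_integrable[OF \<rho> v])
  have i2: "has_bochner_integral lebesgue (\<lambda>y. \<rho> (x - y)) 1"
    by (rule mollifier_reflect_integral[OF \<rho>])
  have i3: "integrable lebesgue (\<lambda>y. \<rho> (x - y))" "(\<integral>y. \<rho> (x - y) \<partial>lebesgue) = 1"
    using i2 by (auto simp: has_bochner_integral_iff)
  have "conv \<rho> v x - c = (\<integral>y. \<rho> (x - y) * v y - \<rho> (x - y) * c \<partial>lebesgue)"
    unfolding conv_def using i1 i3 by simp
  also have "norm \<dots> \<le> (\<integral>y. \<rho> (x - y) * e \<partial>lebesgue)"
  proof (rule Bochner_Integration.integral_norm_bound_integral)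
    show "integrable lebesgue (\<lambda>y. \<rho> (x - y) * v y - \<rho> (x - y) * c)" using i1 i3 by simp
    show "integrable lebesgue (\<lambda>y. \<rho> (x - y) * e)" using i3 by simp
    fix y
    have r: "\<rho> (x - y) \<ge> 0" "norm (x - y) \<ge> \<epsilon> \<Longrightarrow> \<rho> (x - y) = 0"
      using \<rho> by (auto simp: mollifier_def)
    have "norm (\<rho> (x - y) * v y - \<rho> (x - y) * c) = \<rho> (x - y) * \<bar>v y - c\<bar>"
      using r by (simp add: abs_mult right_diff_distrib[symmetric])
    also have "\<dots> \<le> \<rho> (x - y) * e"
      using r c[of y] by (cases "norm (x - y) < \<epsilon>") (auto intro: mult_left_mono)
    finally show "norm (\<rho> (x - y) * v y - \<rho> (x - y) * c) \<le> \<rho> (x - y) * e" .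
  qed
  also have "\<dots> = e" using i3 by simp
  finally show ?thesis by simp
qed

lemma compact_enlarge:
  fixes K :: "'a::euclidean_space set"
  assumes "compact K" "open U" "K \<subseteq> U"
  obtains e where "e > 0" "compact {x + y |x y. x \<in> K \<and> y \<in> cball 0 e}" "{x + y |x y. x \<in> K \<and> y \<in> cball 0 e} \<subseteq> U"
proof -
  obtain e where e: "e > 0" "(\<Union>x\<in>K. cball x e) \<subseteq> U"
    using compact_subset_open_imp_cball_epsilon_subset[OF assms] by blast
  have "x + y \<in> U" if "x \<in> K" "y \<in> cball 0 e" for x y
    using e(2) that by (force simp: dist_norm)
  then show ?thesis
    using that[OF e(1) compact_sums[OF assms(1) compact_cball]] by blast
qed

lemma enlarge_mem: "x \<in> K \<Longrightarrow> norm (z - x) \<le> e \<Longrightarrow> z \<in> {x + y |x y. x \<in> K \<and> y \<in> cball 0 e}"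
  by (intro CollectI exI[of _ x] exI[of _ "z - x"]) auto

text \<open>With d = e/3, the indicator of the 2d-neighbourhood of \<open>K\<close> is mollified at
  scale d: the result is 1 on the open d-neighbourhood \<open>W\<close> and 0 off the
  3d-neighbourhood, which still lies in \<open>U\<close>.\<close>

lemma bump_exists:
  fixes K :: "(real^'n) set"
  assumes "compact K" "open U" "K \<subseteq> U"
  obtains \<zeta> W where "test_function U \<zeta>" "\<And>x. 0 \<le> \<zeta> x" "\<And>x. \<zeta> x \<le> 1" "open W" "K \<subseteq> W" "W \<subseteq> U" "\<And>x. x \<in> W \<Longrightarrow> \<zeta> x = 1"
proof -
  define E where "E e = {x + y |x y. x \<in> K \<and> y \<in> cball 0 e}" for e
  obtain e where e: "e > 0" "E e \<subseteq> U"
    by (rule compact_enlarge[OF assms]) (auto simp: E_def)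
  have c: "compact (E r)" for r unfolding E_def by (rule compact_sums[OF assms(1) compact_cball])
  have E_mem: "z \<in> E r" if "x \<in> K" "norm (z - x) \<le> r" for x z r
    unfolding E_def by (rule enlarge_mem[OF that])
  define d where "d = e / 3"
  obtain \<rho> :: "real^'n \<Rightarrow> real" where \<rho>: "mollifier d \<rho>" using ex_mollifier[of d] e by (auto simp: d_def)
  define v where "v = indicat_real (E (2 * d))"
  have v: "integrable lebesgue v"
    unfolding v_def using lmeasurable_compact[OF c[of "2 * d"]] by (intro integrable_real_indicator) (auto simp: fmeasurable_def)
  define W where "W = (\<Union>x\<in>K. ball x d)"
  show ?thesis
  proof
    have out: "conv \<rho> v x = 0" if "x \<notin> E e" for x
    proof -
      have "v y = 0" if "norm (x - y) < d" for y
      proof -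
        have "y \<notin> E (2 * d)"
        proof
          assume "y \<in> E (2 * d)"
          then obtain a b where ab: "y = a + b" "a \<in> K" "norm b \<le> 2 * d" by (auto simp: E_def)
          have "norm (x - a) \<le> norm (x - y) + norm b"
            using norm_triangle_ineq[of "x - y" b] ab(1) by (simp add: algebra_simps)
          then have "x \<in> E e"
            using E_mem[OF ab(2), of x e] ab(3) \<open>norm (x - y) < d\<close> by (simp add: d_def)
          then show False using \<open>x \<notin> E e\<close> by blast
        qed
        then show ?thesis by (simp add: v_def)
      qed
      then show ?thesis using conv_close[OF \<rho> v, of x 0 0] by simp
    qed
    then show "test_function U (conv \<rho> v)"
      unfolding test_function_def using conv_Ck[OF _ v] \<rho> c e
      by (auto simp: mollifier_def intro!: smooth_on_openI exI[of _ "E e"])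
    show "0 \<le> conv \<rho> v x" for x
      unfolding conv_def using \<rho> by (intro integral_nonneg_AE) (auto simp: mollifier_def v_def)
    show "conv \<rho> v x \<le> 1" for x
    proof -
      \<comment> \<open>An indicator lies within 1/2 of the value 1/2 everywhere, hence so does its
        mean.\<close>
      have "\<bar>v y - 1 / 2\<bar> \<le> 1 / 2" for y by (simp add: v_def indicator_def)
      then have "\<bar>conv \<rho> v x - 1 / 2\<bar> \<le> 1 / 2" by (rule conv_close[OF \<rho> v])
      then show ?thesis by linarith
    qed
    show "open W" by (auto simp: W_def)
    show "K \<subseteq> W" using e by (force simp: W_def d_def)
    show "W \<subseteq> U"
    proof
      fix z assume "z \<in> W"
      then obtain x where "x \<in> K" "norm (z - x) < d" by (auto simp: W_def dist_norm norm_minus_commute)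
      then show "z \<in> U" using E_mem[of x z e] e by (auto simp: d_def)
    qed
    fix z assume "z \<in> W"
    then obtain x where x: "x \<in> K" "norm (z - x) < d" by (auto simp: W_def dist_norm norm_minus_commute)
    have "v y = 1" if "norm (z - y) < d" for y
    proof -
      have "norm (y - x) \<le> norm (z - x) + norm (z - y)"
        using norm_triangle_ineq4[of "z - x" "z - y"] by simp
      then show ?thesis using E_mem[OF x(1), of y "2 * d"] x that by (simp add: v_def)
    qed
    then show "conv \<rho> v z = 1" using conv_close[OF \<rho> v, of z 1 0] by simp
  qed
qed


text \<open>Mollification at a scale below the moduli of continuity of \<phi> and of its gradient.
  The compact set is chosen before e: the approximants are later integrated against fields that are
  integrable on compact subsets of \<open>U\<close> only.\<close>

lemma C1_compact_test_approx:
  fixes \<phi> :: "real^'n \<Rightarrow> real"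
  assumes \<phi>: "C1_compact U \<phi>" and U: "open U"
  obtains K where "compact K" "K \<subseteq> U" "\<And>e. e > 0 \<Longrightarrow> \<exists>\<psi>. test_function U \<psi> \<and>
    (\<forall>x. x \<notin> K \<longrightarrow> \<psi> x = 0 \<and> grad \<psi> x = 0 \<and> \<phi> x = 0 \<and> grad \<phi> x = 0) \<and>
    (\<forall>x. \<bar>\<psi> x - \<phi> x\<bar> \<le> e \<and> (\<forall>i. \<bar>grad \<psi> x $ i - grad \<phi> x $ i\<bar> \<le> e))"
proof -
  obtain K0 where K0: "compact K0" "K0 \<subseteq> U" "\<And>x. x \<notin> K0 \<Longrightarrow> \<phi> x = 0" "\<And>x. x \<notin> K0 \<Longrightarrow> grad \<phi> x = 0"
    using C1_compactE[OF \<phi>] by metis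
  define K where "K = (\<lambda>e. {x + y |x y. x \<in> K0 \<and> y \<in> cball 0 e})"
  obtain e0 where e0: "e0 > 0" "compact (K e0)" "K e0 \<subseteq> U"
    by (rule compact_enlarge[OF K0(1) U K0(2)]) (simp add: K_def)
  have Kmem: "z \<in> K e0" if "x \<in> K0" "norm (z - x) \<le> e0" for x z
    unfolding K_def by (rule enlarge_mem[OF that])
  have "\<exists>\<psi>. test_function U \<psi> \<and>
    (\<forall>x. x \<notin> K e0 \<longrightarrow> \<psi> x = 0 \<and> grad \<psi> x = 0 \<and> \<phi> x = 0 \<and> grad \<phi> x = 0) \<and>
    (\<forall>x. \<bar>\<psi> x - \<phi> x\<bar> \<le> e \<and> (\<forall>i. \<bar>grad \<psi> x $ i - grad \<phi> x $ i\<bar> \<le> e))" if e: "e > 0" for e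
  proof -
    obtain d1 where d1: "d1 > 0" "\<And>x y. dist x y < d1 \<Longrightarrow> dist (\<phi> x) (\<phi> y) < e"
      using continuous_compact_support_uniform[OF C1_compact_continuous[OF \<phi>] K0(1,3) e] by blast
    obtain d2 where d2: "d2 > 0" "\<And>x y. dist x y < d2 \<Longrightarrow> dist (grad \<phi> x) (grad \<phi> y) < e"
      using continuous_compact_support_uniform[OF C1_compact_continuous_grad[OF \<phi>] K0(1,4) e] by blast
    define d where "d = min e0 (min d1 d2)"
    have d: "d > 0" "d \<le> e0" "d \<le> d1" "d \<le> d2" using e0 d1 d2 by (auto simp: d_def)
    obtain \<rho> :: "real^'n \<Rightarrow> real" where \<rho>: "mollifier d \<rho>" using ex_mollifier[OF d(1)] by blast
    have \<rho>t: "test_function UNIV \<rho>" using \<rho> by (simp add: mollifier_def)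
    note int = C1_compact_integrable[OF \<phi>]
    have out: "conv \<rho> \<phi> x = 0" if "x \<notin> K e0" for x
    proof -
      have "\<bar>\<phi> y - 0\<bar> \<le> 0" if y: "norm (x - y) < d" for y
        using Kmem[of y x] K0(3)[of y] y d(2) \<open>x \<notin> K e0\<close> by auto
      then show ?thesis using conv_close[OF \<rho> int(1), of x 0 0] by simp
    qed
    have t: "test_function U (conv \<rho> \<phi>)"
      unfolding test_function_def using conv_Ck[OF \<rho>t int(1)] out e0
      by (auto intro!: smooth_on_openI exI[of _ "K e0"])
    have g: "grad (conv \<rho> \<phi>) x $ i = conv \<rho> (\<lambda>x. grad \<phi> x $ i) x" for x i
    proof -
      define r where "r y = \<rho> (x - y)" for y
      have rD: "GDERIV r y :> - grad \<rho> (x - y)" for y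
      proof -
        have "(\<rho> has_derivative (\<lambda>h. h \<bullet> grad \<rho> (x - y))) (at (x - y))"
          using C1_compact_GDERIV[OF test_function_C1_compact[OF \<rho>t]] unfolding gderiv_def .
        then have "((\<lambda>y. \<rho> (x - y)) has_derivative (\<lambda>h. (- h) \<bullet> grad \<rho> (x - y))) (at y)"
          by (rule has_derivative_compose[rotated]) (auto intro!: derivative_eq_intros)
        then show ?thesis unfolding gderiv_def r_def by simp
      qed
      have c: "continuous_on UNIV (\<lambda>y. - grad \<rho> (x - y))"
        by (rule continuous_on_minus,
            rule continuous_on_compose2[OF C1_compact_continuous_grad[OF test_function_C1_compact[OF \<rho>t]]])
          (auto intro!: continuous_on_diff continuous_on_const continuous_on_id)
      have p: "C1_compact UNIV (\<lambda>y. \<phi> y * r y)" "\<And>y. grad (\<lambda>y. \<phi> y * r y) y = \<phi> y *\<^sub>R (- grad \<rho> (x - y)) + r y *\<^sub>R grad \<phi> y"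
        using C1_compact_mult[OF open_UNIV C1_compact_mono[OF \<phi> subset_UNIV] rD c] by auto
      have i1: "integrable lebesgue (\<lambda>y. \<rho> (x - y) * grad \<phi> y $ i)"
        by (rule mollifier_conv_integrable[OF \<rho> int(3)])
      obtain K' where K': "compact K'" "\<And>x. x \<notin> K' \<Longrightarrow> grad \<rho> x = 0"
        using C1_compactE[OF test_function_C1_compact[OF \<rho>t]] by metis
      have i2: "integrable lebesgue (\<lambda>y. grad \<rho> (x - y) $ i * \<phi> y)"
        by (rule conv_integrable[OF C1_compact_continuous_grad_nth[OF test_function_C1_compact[OF \<rho>t]] K'(1) _ int(1)])
          (simp add: K'(2))
      \<comment> \<open>The integral over y of the i-th derivative of \<phi> y * \<rho> (x - y)
        vanishes; expanding by the product rule moves the derivative from \<rho> to \<phi>.\<close>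
      have "0 = (\<integral>y. grad (\<lambda>y. \<phi> y * r y) y $ i \<partial>lebesgue)"
        using C1_compact_integral_grad[OF p(1)] by simp
      also have "\<dots> = (\<integral>y. \<rho> (x - y) * grad \<phi> y $ i - grad \<rho> (x - y) $ i * \<phi> y \<partial>lebesgue)"
        unfolding p(2) by (simp add: r_def algebra_simps)
      also have "\<dots> = conv \<rho> (\<lambda>x. grad \<phi> x $ i) x - conv (\<lambda>z. grad \<rho> z $ i) \<phi> x"
        unfolding conv_def using i1 i2 by simp
      finally show ?thesis
        using GDERIV_imp_grad[OF conv_GDERIV[OF test_function_C1_compact[OF \<rho>t] int(1)]] by simp
    qed
    have "\<bar>conv \<rho> \<phi> x - \<phi> x\<bar> \<le> e" for x
    proof (rule conv_close[OF \<rho> int(1)])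
      fix y assume "norm (x - y) < d"
      then show "\<bar>\<phi> y - \<phi> x\<bar> \<le> e"
        using d1(2)[of y x] d by (simp add: dist_norm norm_minus_commute)
    qed
    moreover have "\<bar>grad (conv \<rho> \<phi>) x $ i - grad \<phi> x $ i\<bar> \<le> e" for x i
      unfolding g
    proof (rule conv_close[OF \<rho> int(3)])
      fix y assume "norm (x - y) < d"
      then have "norm (grad \<phi> y - grad \<phi> x) < e"
        using d2(2)[of y x] d by (simp add: dist_norm norm_minus_commute)
      then show "\<bar>grad \<phi> y $ i - grad \<phi> x $ i\<bar> \<le> e"
        using component_le_norm_cart[of "grad \<phi> y - grad \<phi> x" i] by simp
    qed
    moreover have "grad (conv \<rho> \<phi>) x = 0" if x: "x \<notin> K e0" for x
    proof -
      have "grad (conv \<rho> \<phi>) x = grad (\<lambda>_. 0) x"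
        by (rule grad_cong_open[of "- K e0"]) (use x out e0(2) compact_imp_closed in auto)
      then show ?thesis using GDERIV_imp_grad[OF GDERIV_const] by metis
    qed
    moreover have "x \<notin> K0" if "x \<notin> K e0" for x using Kmem[of x x] e0(1) that by auto
    ultimately show ?thesis
      using t out K0(3,4) by (intro exI[of _ "conv \<rho> \<phi>"]) auto
  qed
  then show ?thesis using that e0(2,3) by blast
qed

section \<open>Divergences in the sense of distributions\<close>

text \<open>Says div X = Y on \<open>U\<close> as distributions. The tests are C^1 rather than
  smooth so that the notion is invariant under C^1 diffeomorphisms, and integrability of each
  pairing is part of it.\<close>

definition weak_div :: "(real^'n) set \<Rightarrow> (real^'n \<Rightarrow> real^'n) \<Rightarrow> (real^'n \<Rightarrow> real) \<Rightarrow> bool" where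
  "weak_div U X Y \<longleftrightarrow> (\<forall>\<phi>. C1_compact U \<phi> \<longrightarrow>
     has_bochner_integral lebesgue (\<lambda>x. X x \<bullet> grad \<phi> x + Y x * \<phi> x) 0)"

definition L2_loc_vec :: "(real^'n) set \<Rightarrow> (real^'n \<Rightarrow> real^'n) \<Rightarrow> bool" where
  "L2_loc_vec U X \<longleftrightarrow> (\<forall>i. L2_loc U (\<lambda>x. X x $ i))"

lemma L2_loc_vec_subset: "L2_loc_vec U X \<Longrightarrow> U' \<subseteq> U \<Longrightarrow> L2_loc_vec U' X"
  unfolding L2_loc_vec_def using L2_loc_subset by blast

lemma weak_div_subset: "weak_div U X Y \<Longrightarrow> U' \<subseteq> U \<Longrightarrow> weak_div U' X Y"
  unfolding weak_div_def using C1_compact_mono by blast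

lemma weak_div_integrable:
  assumes "L2_loc_vec U X" "L2_loc U Y" "C1_compact U \<phi>"
  shows "integrable lebesgue (\<lambda>x. X x \<bullet> grad \<phi> x + Y x * \<phi> x)"
    and "integrable lebesgue (\<lambda>x. X x \<bullet> grad \<phi> x)" "integrable lebesgue (\<lambda>x. Y x * \<phi> x)"
proof -
  obtain K where K: "compact K" "K \<subseteq> U" "\<And>x. x \<notin> K \<Longrightarrow> \<phi> x = 0" "\<And>x. x \<notin> K \<Longrightarrow> grad \<phi> x = 0"
    using C1_compactE[OF assms(3)] by metis
  have "integrable lebesgue (\<lambda>x. X x $ i * grad \<phi> x $ i)" for i
    by (rule L2_loc_mult_integrable[OF _ K(1,2) C1_compact_continuous_grad_nth[OF assms(3)]])
      (use assms(1) K(4) in \<open>auto simp: L2_loc_vec_def\<close>)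
  then show i: "integrable lebesgue (\<lambda>x. X x \<bullet> grad \<phi> x)"
    unfolding inner_vec_def by (simp add: Bochner_Integration.integrable_sum)
  show j: "integrable lebesgue (\<lambda>x. Y x * \<phi> x)"
    by (rule L2_loc_mult_integrable[OF assms(2) K(1,2) C1_compact_continuous[OF assms(3)] K(3)])
  show "integrable lebesgue (\<lambda>x. X x \<bullet> grad \<phi> x + Y x * \<phi> x)"
    using i j by simp
qed

text \<open>A C^1 test function is a uniform limit, together with its gradient, of smooth ones
  supported in a fixed compact set. There X and Y are integrable, so the integrals converge.\<close>

lemma weak_divI_test:
  assumes U: "open U" and X: "L2_loc_vec U X" and Y: "L2_loc U Y"
    and t: "\<And>\<phi>. test_function U \<phi> \<Longrightarrow> (\<integral>x. X x \<bullet> grad \<phi> x + Y x * \<phi> x \<partial>lebesgue) = 0"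
  shows "weak_div U X Y"
  unfolding weak_div_def
proof (intro allI impI)
  fix \<phi> assume \<phi>: "C1_compact U \<phi>"
  obtain K where K: "compact K" "K \<subseteq> U" and appr: "\<And>e. e > 0 \<Longrightarrow> \<exists>\<psi>. test_function U \<psi> \<and>
    (\<forall>x. x \<notin> K \<longrightarrow> \<psi> x = 0 \<and> grad \<psi> x = 0 \<and> \<phi> x = 0 \<and> grad \<phi> x = 0) \<and>
    (\<forall>x. \<bar>\<psi> x - \<phi> x\<bar> \<le> e \<and> (\<forall>i. \<bar>grad \<psi> x $ i - grad \<phi> x $ i\<bar> \<le> e))"
    using C1_compact_test_approx[OF \<phi> U] by metis
  define Z where "Z x = (\<Sum>i\<in>UNIV. \<bar>indicat_real K x * X x $ i\<bar>) + \<bar>indicat_real K x * Y x\<bar>" for x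
  have Z: "integrable lebesgue Z"
    unfolding Z_def using L2_loc_compact(1)[OF _ K] X Y
    by (intro Bochner_Integration.integrable_add Bochner_Integration.integrable_sum integrable_abs)
      (auto simp: L2_loc_vec_def)
  define A where "A = integral\<^sup>L lebesgue Z"
  have A: "A \<ge> 0" unfolding A_def by (intro integral_nonneg_AE) (auto simp: Z_def intro!: sum_nonneg add_nonneg_nonneg)
  define J where "J = (\<integral>x. X x \<bullet> grad \<phi> x + Y x * \<phi> x \<partial>lebesgue)"
  note i\<phi> = weak_div_integrable(1)[OF X Y \<phi>]
  have small: "\<bar>J\<bar> \<le> e * A" if e: "e > 0" for e
  proof -
    obtain \<psi> where \<psi>: "test_function U \<psi>"
      "\<And>x. x \<notin> K \<Longrightarrow> \<psi> x = 0 \<and> grad \<psi> x = 0 \<and> \<phi> x = 0 \<and> grad \<phi> x = 0"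
      "\<And>x. \<bar>\<psi> x - \<phi> x\<bar> \<le> e" "\<And>x i. \<bar>grad \<psi> x $ i - grad \<phi> x $ i\<bar> \<le> e"
      using appr[OF e] by metis
    note i\<psi> = weak_div_integrable(1)[OF X Y test_function_C1_compact[OF \<psi>(1)]]
    have "- J = (\<integral>x. (X x \<bullet> grad \<psi> x + Y x * \<psi> x) - (X x \<bullet> grad \<phi> x + Y x * \<phi> x) \<partial>lebesgue)"
      unfolding J_def Bochner_Integration.integral_diff[OF i\<psi> i\<phi>] t[OF \<psi>(1)] by simp
    also have "norm \<dots> \<le> (\<integral>x. e * Z x \<partial>lebesgue)"
    proof (rule Bochner_Integration.integral_norm_bound_integral)
      fix x
      show "norm ((X x \<bullet> grad \<psi> x + Y x * \<psi> x) - (X x \<bullet> grad \<phi> x + Y x * \<phi> x)) \<le> e * Z x"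
      proof (cases "x \<in> K")
        case True
        have e1: "(X x \<bullet> grad \<psi> x + Y x * \<psi> x) - (X x \<bullet> grad \<phi> x + Y x * \<phi> x)
          = (\<Sum>i\<in>UNIV. X x $ i * (grad \<psi> x $ i - grad \<phi> x $ i)) + Y x * (\<psi> x - \<phi> x)"
          by (simp add: inner_vec_def sum_subtractf algebra_simps)
        have "\<bar>(\<Sum>i\<in>UNIV. X x $ i * (grad \<psi> x $ i - grad \<phi> x $ i))\<bar> \<le> (\<Sum>i\<in>UNIV. \<bar>X x $ i\<bar> * e)"
          using \<psi>(4) by (intro order_trans[OF sum_abs] sum_mono) (simp add: abs_mult mult_left_mono)
        moreover have "\<bar>Y x * (\<psi> x - \<phi> x)\<bar> \<le> \<bar>Y x\<bar> * e"
          using \<psi>(3) by (simp add: abs_mult mult_left_mono)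
        moreover have "e * Z x = (\<Sum>i\<in>UNIV. \<bar>X x $ i\<bar> * e) + \<bar>Y x\<bar> * e"
          using True by (simp add: Z_def sum_distrib_left algebra_simps)
        ultimately show ?thesis unfolding e1 real_norm_def by linarith
      next
        case False
        then show ?thesis using \<psi>(2)[OF False] by (simp add: Z_def)
      qed
    qed (use i\<phi> i\<psi> Z in auto)
    also have "\<dots> = e * A" by (simp add: A_def)
    finally show ?thesis by simp
  qed
  have "\<bar>J\<bar> \<le> 0 + e" if "e > 0" for e
  proof -
    have "\<bar>J\<bar> \<le> e / (A + 1) * A" using that A by (intro small divide_pos_pos) auto
    also have "\<dots> \<le> e" using that A by (simp add: field_simps)
    finally show ?thesis by simp
  qed
  then have "J = 0" using field_le_epsilon[of "\<bar>J\<bar>" 0] by simp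
  then show "has_bochner_integral lebesgue (\<lambda>x. X x \<bullet> grad \<phi> x + Y x * \<phi> x) 0"
    using i\<phi> by (simp add: has_bochner_integral_iff J_def)
qed

lemma weak_div_test:
  "weak_div U X Y \<Longrightarrow> test_function U \<phi> \<Longrightarrow>
    has_bochner_integral lebesgue (\<lambda>x. X x \<bullet> grad \<phi> x + Y x * \<phi> x) 0"
  unfolding weak_div_def using test_function_C1_compact by blast

text \<open>The i-th weak derivative of u is the divergence of u times the i-th unit vector. Weak
  gradients and the Helmholtz equation thus become instances of one notion, and transformation,
  gluing and removal of points need be proved only for \<open>weak_div\<close>.\<close>

lemma H1_loc_grad_iff_weak_div:
  assumes U: "open U"
  shows "H1_loc_grad U u Du \<longleftrightarrow> L2_loc U u \<and> L2_loc_vec U Du \<and>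
    (\<forall>i. weak_div U (\<lambda>x. u x *\<^sub>R axis i 1) (\<lambda>x. Du x $ i))"
proof -
  have O: "U \<in> sets lebesgue" using U by auto
  have "weak_div U (\<lambda>x. u x *\<^sub>R axis i 1) (\<lambda>x. Du x $ i) \<longleftrightarrow> (\<forall>\<phi>. test_function U \<phi> \<longrightarrow>
    (\<integral>x. u x * grad \<phi> x $ i \<partial>lebesgue_on U) = - (\<integral>x. Du x $ i * \<phi> x \<partial>lebesgue_on U))"
    if u: "L2_loc U u" and Du: "L2_loc_vec U Du" for i
  proof -
    have Y: "L2_loc U (\<lambda>x. Du x $ i)" using Du by (simp add: L2_loc_vec_def)
    have X: "L2_loc_vec U (\<lambda>x. u x *\<^sub>R axis i 1)"
      unfolding L2_loc_vec_def
    proof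
      show "L2_loc U (\<lambda>x. (u x *\<^sub>R axis i 1) $ j)" for j
        using u L2_loc_0[OF O] by (cases "i = j") (auto simp: axis_def)
    qed
    have *: "((\<integral>x. u x * grad \<phi> x $ i \<partial>lebesgue_on U) = - (\<integral>x. Du x $ i * \<phi> x \<partial>lebesgue_on U)) \<longleftrightarrow>
       (\<integral>x. (u x *\<^sub>R axis i 1) \<bullet> grad \<phi> x + Du x $ i * \<phi> x \<partial>lebesgue) = 0" if \<phi>: "test_function U \<phi>" for \<phi>
    proof -
      obtain K where K: "K \<subseteq> U" "\<And>x. x \<notin> K \<Longrightarrow> \<phi> x = 0" "\<And>x. x \<notin> K \<Longrightarrow> grad \<phi> x = 0"
        using C1_compactE[OF test_function_C1_compact[OF \<phi>]] by metis
      have out: "\<phi> x = 0" "grad \<phi> x = 0" if "x \<notin> U" for x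
        using K that by auto
      note int = weak_div_integrable[OF X Y test_function_C1_compact[OF \<phi>]]
      have "has_bochner_integral (lebesgue_on U) (\<lambda>x. (u x *\<^sub>R axis i 1) \<bullet> grad \<phi> x)
          (\<integral>x. (u x *\<^sub>R axis i 1) \<bullet> grad \<phi> x \<partial>lebesgue)"
        using int by (subst has_bochner_integral_lebesgue_on_iff[OF O]) (auto simp: has_bochner_integral_iff out)
      moreover have "has_bochner_integral (lebesgue_on U) (\<lambda>x. Du x $ i * \<phi> x)
          (\<integral>x. Du x $ i * \<phi> x \<partial>lebesgue)"
        using int by (subst has_bochner_integral_lebesgue_on_iff[OF O]) (auto simp: has_bochner_integral_iff out)
      ultimately show ?thesis
        using int by (simp add: has_bochner_integral_iff inner_axis' add_eq_0_iff2)
    qed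
    show ?thesis
    proof
      assume "weak_div U (\<lambda>x. u x *\<^sub>R axis i 1) (\<lambda>x. Du x $ i)"
      then show "\<forall>\<phi>. test_function U \<phi> \<longrightarrow>
          (\<integral>x. u x * grad \<phi> x $ i \<partial>lebesgue_on U) = - (\<integral>x. Du x $ i * \<phi> x \<partial>lebesgue_on U)"
        using weak_div_test[THEN has_bochner_integral_integral_eq] * by blast
    next
      assume "\<forall>\<phi>. test_function U \<phi> \<longrightarrow>
          (\<integral>x. u x * grad \<phi> x $ i \<partial>lebesgue_on U) = - (\<integral>x. Du x $ i * \<phi> x \<partial>lebesgue_on U)"
      then show "weak_div U (\<lambda>x. u x *\<^sub>R axis i 1) (\<lambda>x. Du x $ i)"
        by (intro weak_divI_test[OF U X Y]) (use * in blast)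
    qed
  qed
  then show ?thesis
    unfolding H1_loc_grad_def L2_loc_vec_def by blast
qed

text \<open>Product rule for weak derivatives: test the given identity with \<zeta> \<psi>. As
  \<zeta> has compact support in \<open>U\<close>, the conclusion holds on the whole space.\<close>

lemma weak_div_cutoff:
  assumes U: "open U" and "weak_div U (\<lambda>x. u x *\<^sub>R axis i 1) w" and \<zeta>: "C1_compact U \<zeta>"
  shows "weak_div UNIV (\<lambda>x. (\<zeta> x * u x) *\<^sub>R axis i 1) (\<lambda>x. \<zeta> x * w x + u x * grad \<zeta> x $ i)"
  unfolding weak_div_def
proof (intro allI impI)
  fix \<psi> :: "real^'a \<Rightarrow> real" assume \<psi>: "C1_compact UNIV \<psi>"
  have p: "C1_compact U (\<lambda>y. \<zeta> y * \<psi> y)"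
    by (rule C1_compact_mult[OF U \<zeta> C1_compact_GDERIV[OF \<psi>] continuous_on_subset[OF C1_compact_continuous_grad[OF \<psi>] subset_UNIV]])
  have g: "grad (\<lambda>y. \<zeta> y * \<psi> y) y = \<zeta> y *\<^sub>R grad \<psi> y + \<psi> y *\<^sub>R grad \<zeta> y" for y
    by (rule GDERIV_imp_grad[OF GDERIV_mult[OF C1_compact_GDERIV[OF \<zeta>] C1_compact_GDERIV[OF \<psi>]]])
  have "has_bochner_integral lebesgue (\<lambda>x. (u x *\<^sub>R axis i 1) \<bullet> grad (\<lambda>y. \<zeta> y * \<psi> y) x + w x * (\<zeta> x * \<psi> x)) 0"
    using assms(2) p unfolding weak_div_def by blast
  then show "has_bochner_integral lebesgue (\<lambda>x. ((\<zeta> x * u x) *\<^sub>R axis i 1) \<bullet> grad \<psi> x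
      + (\<zeta> x * w x + u x * grad \<zeta> x $ i) * \<psi> x) 0"
    unfolding g by (rule has_bochner_integral_cong[THEN iffD1, rotated -1]) (auto simp: inner_axis' algebra_simps)
qed


section \<open>Approximation in the Sobolev norm\<close>

text \<open>The square of the L^2 norm, valued in \<open>ennreal\<close> so that it is meaningful
  before integrability is known and matches the integrals in \<open>has_trace\<close>.\<close>

definition sq_norm :: "'a measure \<Rightarrow> ('a \<Rightarrow> real) \<Rightarrow> ennreal" where
  "sq_norm M f = (\<integral>\<^sup>+x. ennreal ((f x)\<^sup>2) \<partial>M)"

lemma sq_norm_cong_AE: "AE x in M. f x = g x \<Longrightarrow> sq_norm M f = sq_norm M g"
  unfolding sq_norm_def by (intro nn_integral_cong_AE) auto

lemma sq_norm_mono: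
  assumes "\<And>x. x \<in> space M \<Longrightarrow> \<bar>f x\<bar> \<le> \<bar>g x\<bar>"
  shows "sq_norm M f \<le> sq_norm M g"
  unfolding sq_norm_def by (intro nn_integral_mono ennreal_leI) (use assms abs_le_square_iff in blast)

lemma sq_norm_cmult:
  assumes "f \<in> borel_measurable M"
  shows "sq_norm M (\<lambda>x. c * f x) = ennreal (c\<^sup>2) * sq_norm M f"
  unfolding sq_norm_def using assms
  by (subst nn_integral_cmult[symmetric]) (auto simp: power_mult_distrib ennreal_mult)

lemma sq_norm_add:
  assumes "f \<in> borel_measurable M" "g \<in> borel_measurable M"
  shows "sq_norm M (\<lambda>x. f x + g x) \<le> 2 * sq_norm M f + 2 * sq_norm M g"
proof -
  have "(a + b)\<^sup>2 \<le> 2 * a\<^sup>2 + 2 * b\<^sup>2" for a b :: real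
    using sum_squares_bound[of a b] by (simp add: power2_sum)
  then have "sq_norm M (\<lambda>x. f x + g x) \<le> (\<integral>\<^sup>+x. ennreal (2 * (f x)\<^sup>2 + 2 * (g x)\<^sup>2) \<partial>M)"
    unfolding sq_norm_def by (intro nn_integral_mono ennreal_leI)
  also have "\<dots> = (\<integral>\<^sup>+x. 2 * ennreal ((f x)\<^sup>2) + 2 * ennreal ((g x)\<^sup>2) \<partial>M)"
    by (intro nn_integral_cong) (simp add: ennreal_mult)
  also have "\<dots> = 2 * sq_norm M f + 2 * sq_norm M g"
    unfolding sq_norm_def using assms by (simp add: nn_integral_add nn_integral_cmult)
  finally show ?thesis .
qed

lemma sq_norm_finite_iff:
  assumes "f \<in> borel_measurable M"
  shows "integrable M (\<lambda>x. (f x)\<^sup>2) \<longleftrightarrow> sq_norm M f < \<infinity>"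
  unfolding sq_norm_def integrable_iff_bounded using assms by simp

lemma sq_norm_eq_integral:
  assumes "integrable M (\<lambda>x. (f x)\<^sup>2)"
  shows "sq_norm M f = ennreal (\<integral>x. (f x)\<^sup>2 \<partial>M)"
  unfolding sq_norm_def using assms by (intro nn_integral_eq_integral) auto

lemma sq_norm_eq_0_AE:
  assumes "f \<in> borel_measurable M" "sq_norm M f = 0"
  shows "AE x in M. f x = 0"
  using assms unfolding sq_norm_def by (simp add: nn_integral_0_iff_AE)

lemma nn_integral_mollifier:
  fixes \<rho> :: "'a::euclidean_space \<Rightarrow> real"
  assumes \<rho>: "mollifier \<epsilon> \<rho>"
  shows "(\<integral>\<^sup>+x. ennreal (\<rho> (x - y)) \<partial>lborel) = 1" "(\<integral>\<^sup>+y. ennreal (\<rho> (x - y)) \<partial>lborel) = 1"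
proof -
  have m: "\<rho> \<in> borel_measurable borel" and h: "has_bochner_integral lebesgue \<rho> 1" and nn: "\<And>x. \<rho> x \<ge> 0"
    using mollifier_continuous[OF \<rho>] borel_measurable_continuous_onI \<rho> by (auto simp: mollifier_def)
  have "(\<integral>\<^sup>+x. ennreal (\<rho> (x + (- y))) \<partial>lebesgue) = ennreal 1"
    using has_bochner_integral_translate[OF m h, of "- y"] nn
    by (subst nn_integral_eq_integral) (auto simp: has_bochner_integral_iff)
  then show "(\<integral>\<^sup>+x. ennreal (\<rho> (x - y)) \<partial>lborel) = 1" by (simp add: nn_integral_completion)
  have "(\<integral>\<^sup>+y. ennreal (\<rho> (x - y)) \<partial>lebesgue) = ennreal 1"
    using mollifier_reflect_integral[OF \<rho>, of x] nn
    by (subst nn_integral_eq_integral) (auto simp: has_bochner_integral_iff)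
  then show "(\<integral>\<^sup>+y. ennreal (\<rho> (x - y)) \<partial>lborel) = 1" by (simp add: nn_integral_completion)
qed

text \<open>Jensen's inequality, in the form that the variance of v under the probability weight y
  to \<rho> (x - y) is nonnegative.\<close>

lemma conv_sq_le:
  fixes \<rho> v :: "'a::euclidean_space \<Rightarrow> real"
  assumes \<rho>: "mollifier \<epsilon> \<rho>" and v: "integrable lebesgue v" "integrable lebesgue (\<lambda>x. (v x)\<^sup>2)"
  shows "ennreal ((conv \<rho> v x)\<^sup>2) \<le> (\<integral>\<^sup>+y. ennreal (\<rho> (x - y) * (v y)\<^sup>2) \<partial>lebesgue)"
proof -
  define m where "m = conv \<rho> v x"
  have nn: "\<rho> z \<ge> 0" for z using \<rho> by (simp add: mollifier_def)
  have i0: "integrable lebesgue (\<lambda>y. \<rho> (x - y))" "(\<integral>y. \<rho> (x - y) \<partial>lebesgue) = 1"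
    using mollifier_reflect_integral[OF \<rho>, of x] by (auto simp: has_bochner_integral_iff)
  have i1: "integrable lebesgue (\<lambda>y. \<rho> (x - y) * v y)" "(\<integral>y. \<rho> (x - y) * v y \<partial>lebesgue) = m"
    using mollifier_conv_integrable[OF \<rho> v(1)] by (auto simp: m_def conv_def)
  have i2: "integrable lebesgue (\<lambda>y. \<rho> (x - y) * (v y)\<^sup>2)"
    by (rule mollifier_conv_integrable[OF \<rho> v(2)])
  have e: "(\<lambda>y. \<rho> (x - y) * (v y - m)\<^sup>2) = (\<lambda>y. \<rho> (x - y) * (v y)\<^sup>2 - 2 * m * (\<rho> (x - y) * v y) + m\<^sup>2 * \<rho> (x - y))"
    by (auto simp: power2_diff algebra_simps)
  have "0 \<le> (\<integral>y. \<rho> (x - y) * (v y - m)\<^sup>2 \<partial>lebesgue)"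
    using nn by (intro integral_nonneg_AE) auto
  also have "\<dots> = (\<integral>y. \<rho> (x - y) * (v y)\<^sup>2 \<partial>lebesgue) - 2 * m * m + m\<^sup>2"
    unfolding e using i0 i1 i2 by simp
  finally have "m\<^sup>2 \<le> (\<integral>y. \<rho> (x - y) * (v y)\<^sup>2 \<partial>lebesgue)" by (simp add: power2_eq_square)
  then have "ennreal (m\<^sup>2) \<le> ennreal (\<integral>y. \<rho> (x - y) * (v y)\<^sup>2 \<partial>lebesgue)" by (rule ennreal_leI)
  also have "\<dots> = (\<integral>\<^sup>+y. ennreal (\<rho> (x - y) * (v y)\<^sup>2) \<partial>lebesgue)"
    using i2 nn by (intro nn_integral_eq_integral[symmetric]) auto
  finally show ?thesis by (simp add: m_def)
qed

text \<open>Integrate \<open>conv_sq_le\<close> in x and exchange the integrals; for fixed y the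
  weight x to \<rho> (x - y) has mass 1.\<close>

lemma conv_L2_bound:
  fixes \<rho> v :: "'a::euclidean_space \<Rightarrow> real"
  assumes \<rho>: "mollifier \<epsilon> \<rho>" and v: "integrable lebesgue v" "integrable lebesgue (\<lambda>x. (v x)\<^sup>2)"
  shows "sq_norm lebesgue (conv \<rho> v) \<le> sq_norm lebesgue v"
proof -
  have "v \<in> borel_measurable lebesgue" using v(1) by auto
  \<comment> \<open>A Borel representative of v makes the integrand jointly measurable for the
    exchange over the product of two copies of \<open>lborel\<close>.\<close>
  then obtain w where w: "w \<in> borel_measurable lborel" "AE x in lborel. v x = w x"
    using completion_ex_borel_measurable_real[of v lborel] by blast
  have [measurable]: "w \<in> borel_measurable borel" using w(1) by simp
  have wl: "w \<in> borel_measurable lebesgue" using w(1) by (rule measurable_completion)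
  have wv: "AE x in lebesgue. v x = w x" using w(2) by (rule AE_completion)
  have [measurable]: "\<rho> \<in> borel_measurable borel"
    using mollifier_continuous[OF \<rho>] borel_measurable_continuous_onI by blast
  have nn: "\<rho> z \<ge> 0" for z using \<rho> by (simp add: mollifier_def)
  have "sq_norm lebesgue (conv \<rho> v) \<le> (\<integral>\<^sup>+x. (\<integral>\<^sup>+y. ennreal (\<rho> (x - y) * (v y)\<^sup>2) \<partial>lebesgue) \<partial>lebesgue)"
    unfolding sq_norm_def by (intro nn_integral_mono conv_sq_le[OF \<rho> v])
  also have "\<dots> = (\<integral>\<^sup>+x. (\<integral>\<^sup>+y. ennreal (\<rho> (x - y) * (w y)\<^sup>2) \<partial>lebesgue) \<partial>lebesgue)"
    using wv by (intro nn_integral_cong nn_integral_cong_AE) auto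
  also have "\<dots> = (\<integral>\<^sup>+x. (\<integral>\<^sup>+y. ennreal (\<rho> (x - y) * (w y)\<^sup>2) \<partial>lborel) \<partial>lborel)"
    by (simp add: nn_integral_completion)
  also have "\<dots> = (\<integral>\<^sup>+y. (\<integral>\<^sup>+x. ennreal (\<rho> (x - y) * (w y)\<^sup>2) \<partial>lborel) \<partial>lborel)"
    by (rule lborel_pair.Fubini'[symmetric]) measurable
  also have "\<dots> = (\<integral>\<^sup>+y. ennreal ((w y)\<^sup>2) \<partial>lborel)"
  proof (rule nn_integral_cong)
    fix y
    have "(\<integral>\<^sup>+x. ennreal (\<rho> (x - y) * (w y)\<^sup>2) \<partial>lborel) = (\<integral>\<^sup>+x. ennreal (\<rho> (x - y)) * ennreal ((w y)\<^sup>2) \<partial>lborel)"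
      using nn by (intro nn_integral_cong) (simp add: ennreal_mult)
    also have "\<dots> = (\<integral>\<^sup>+x. ennreal (\<rho> (x - y)) \<partial>lborel) * ennreal ((w y)\<^sup>2)"
      by (rule nn_integral_multc) measurable
    finally show "(\<integral>\<^sup>+x. ennreal (\<rho> (x - y) * (w y)\<^sup>2) \<partial>lborel) = ennreal ((w y)\<^sup>2)"
      using nn_integral_mollifier(1)[OF \<rho>] by simp
  qed
  also have "\<dots> = sq_norm lebesgue w" by (simp add: sq_norm_def nn_integral_completion)
  also have "\<dots> = sq_norm lebesgue v" using wv by (intro sq_norm_cong_AE) auto
  finally show ?thesis .
qed

lemma sq_integral_tendsto_0:
  assumes "\<And>n. f n \<in> borel_measurable M" "integrable M g"
    and "AE x in M. (\<lambda>n. f n x) \<longlonglongrightarrow> 0" "\<And>n. AE x in M. (f n x)\<^sup>2 \<le> g x" and "e > 0"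
  shows "\<exists>n. sq_norm M (f n) \<le> ennreal e"
proof -
  have "(\<lambda>n. \<integral>x. (f n x)\<^sup>2 \<partial>M) \<longlonglongrightarrow> (\<integral>x. 0 \<partial>M)"
  proof (rule integral_dominated_convergence[OF _ _ assms(2)])
    show "(\<lambda>x. (f n x)\<^sup>2) \<in> borel_measurable M" for n using assms(1)[of n] by simp
    show "AE x in M. (\<lambda>n. (f n x)\<^sup>2) \<longlonglongrightarrow> 0"
      using assms(3) by eventually_elim (auto intro: tendsto_eq_intros)
    show "AE x in M. norm ((f n x)\<^sup>2) \<le> g x" for n using assms(4)[of n] by eventually_elim auto
  qed simp
  then have "\<forall>\<^sub>F n in sequentially. (\<integral>x. (f n x)\<^sup>2 \<partial>M) < e"
    using \<open>e > 0\<close> by (auto intro: order_tendstoD)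
  then obtain n where n: "(\<integral>x. (f n x)\<^sup>2 \<partial>M) < e"
    using eventually_happens'[OF sequentially_bot] by blast
  have "integrable M (\<lambda>x. (f n x)\<^sup>2)"
    by (rule Bochner_Integration.integrable_bound[OF assms(2)])
      (use assms(1)[of n] assms(4)[of n] in \<open>auto elim!: eventually_mono\<close>)
  then show ?thesis using n by (intro exI[of _ n]) (simp add: sq_norm_eq_integral ennreal_leI)
qed

text \<open>Two dominated limits: v is truncated at height n, and the truncation is an almost
  everywhere limit of continuous functions. Clipping these at n and multiplying by a continuous
  cutoff \<theta>, which is 1 on the ball of radius R and 0 outside radius R + 1, supplies the
  dominating function.\<close>

lemma L2_continuous_dense:
  fixes v :: "'a::euclidean_space \<Rightarrow> real"
  assumes v: "v \<in> borel_measurable lebesgue" "integrable lebesgue (\<lambda>x. (v x)\<^sup>2)"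
    and R: "\<And>x. norm x > R \<Longrightarrow> v x = 0" "R > 0" and e: "e > 0"
  obtains w where "continuous_on UNIV w" "\<And>x. norm x > R + 1 \<Longrightarrow> w x = 0" "sq_norm lebesgue (\<lambda>x. v x - w x) \<le> ennreal e"
proof -
  define t where "t n x = max (- real n) (min (real n) (v x))" for n x
  have tm: "t n \<in> borel_measurable lebesgue" for n
    unfolding t_def using v(1) by measurable
  have "\<exists>n. sq_norm lebesgue (\<lambda>x. v x - t n x) \<le> ennreal (e / 4)"
  proof (rule sq_integral_tendsto_0[OF _ v(2)])
    show "(\<lambda>x. v x - t n x) \<in> borel_measurable lebesgue" for n using v(1) tm by measurable
    have "(\<lambda>n. v x - t n x) \<longlonglongrightarrow> 0" for x
    proof (rule tendsto_eventually)
      obtain n0 where "\<bar>v x\<bar> \<le> real n0" using real_arch_simple by blast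
      then show "\<forall>\<^sub>F n in sequentially. v x - t n x = 0"
        by (intro eventually_sequentiallyI[of n0]) (auto simp: t_def)
    qed
    then show "AE x in lebesgue. (\<lambda>n. v x - t n x) \<longlonglongrightarrow> 0" by simp
    have "(v x - t n x)\<^sup>2 \<le> (v x)\<^sup>2" for n x
      unfolding abs_le_square_iff[symmetric] t_def by auto
    then show "AE x in lebesgue. (v x - t n x)\<^sup>2 \<le> (v x)\<^sup>2" for n by simp
  qed (use e in auto)
  then obtain n where n: "sq_norm lebesgue (\<lambda>x. v x - t n x) \<le> ennreal (e / 4)" by blast
  have "t n measurable_on UNIV"
    by (rule lebesgue_measurable_imp_measurable_on_real[OF tm]) auto
  then obtain N g where N: "negligible N" and g: "\<And>k. continuous_on UNIV (g k)"
    and lim: "\<And>x. x \<notin> N \<Longrightarrow> (\<lambda>k. g k x) \<longlonglongrightarrow> t n x"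
    unfolding measurable_on_def by auto
  define \<theta> where "\<theta> x = max 0 (min 1 (R + 1 - norm x))" for x :: 'a
  define s where "s k x = max (- real n) (min (real n) (g k x)) * \<theta> x" for k x
  have sc: "continuous_on UNIV (s k)" for k
    unfolding s_def \<theta>_def by (intro continuous_intros g)
  have t0: "t n x = t n x * \<theta> x" for x
    using R by (cases "norm x > R") (auto simp: t_def \<theta>_def)
  have "\<exists>k. sq_norm lebesgue (\<lambda>x. t n x - s k x) \<le> ennreal (e / 4)"
  proof (rule sq_integral_tendsto_0)
    show "(\<lambda>x. t n x - s k x) \<in> borel_measurable lebesgue" for k
      using tm continuous_borel_measurable_lebesgue[OF sc] by measurable
    show "integrable lebesgue (\<lambda>x. (2 * real n)\<^sup>2 * indicat_real (cball (0::'a) (R + 1)) x)"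
      using lmeasurable_cball[of "0::'a" "R + 1"]
      by (intro integrable_mult_right integrable_real_indicator) (auto simp: fmeasurable_def)
    have "(\<lambda>k. t n x - s k x) \<longlonglongrightarrow> 0" if "x \<notin> N" for x
    proof -
      have "(\<lambda>k. s k x) \<longlonglongrightarrow> max (- real n) (min (real n) (t n x)) * \<theta> x"
        unfolding s_def by (intro tendsto_intros lim that)
      moreover have "max (- real n) (min (real n) (t n x)) = t n x" by (auto simp: t_def)
      ultimately have "(\<lambda>k. s k x) \<longlonglongrightarrow> t n x" using t0[of x] by simp
      then have "(\<lambda>k. t n x - s k x) \<longlonglongrightarrow> t n x - t n x" by (intro tendsto_intros)
      then show ?thesis by simp
    qed
    then show "AE x in lebesgue. (\<lambda>k. t n x - s k x) \<longlonglongrightarrow> 0"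
      using N by (intro AE_I'[of N]) (auto simp: negligible_iff_null_sets)
    have "(t n x - s k x)\<^sup>2 \<le> (2 * real n)\<^sup>2 * indicat_real (cball 0 (R + 1)) x" for k x
    proof (cases "norm x \<le> R + 1")
      case True
      have "\<bar>t n x\<bar> \<le> real n" by (auto simp: t_def)
      moreover have "\<bar>s k x\<bar> \<le> real n"
      proof -
        have "\<bar>max (- real n) (min (real n) (g k x))\<bar> * \<bar>\<theta> x\<bar> \<le> real n * 1"
          by (intro mult_mono) (auto simp: \<theta>_def)
        then show ?thesis by (simp add: s_def abs_mult)
      qed
      ultimately have "\<bar>t n x - s k x\<bar> \<le> \<bar>2 * real n\<bar>" by linarith
      then have "(t n x - s k x)\<^sup>2 \<le> (2 * real n)\<^sup>2" by (simp only: abs_le_square_iff)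
      then show ?thesis using True by simp
    next
      case False
      then show ?thesis using t0[of x] by (simp add: s_def \<theta>_def)
    qed
    then show "AE x in lebesgue. (t n x - s k x)\<^sup>2 \<le> (2 * real n)\<^sup>2 * indicat_real (cball 0 (R + 1)) x" for k
      by simp
  qed (use e in auto)
  then obtain k where k: "sq_norm lebesgue (\<lambda>x. t n x - s k x) \<le> ennreal (e / 4)" by blast
  show ?thesis
  proof
    show "continuous_on UNIV (s k)" by (rule sc)
    show "s k x = 0" if "norm x > R + 1" for x using that by (simp add: s_def \<theta>_def)
    have "sq_norm lebesgue (\<lambda>x. v x - s k x) = sq_norm lebesgue (\<lambda>x. (v x - t n x) + (t n x - s k x))" by simp
    also have "\<dots> \<le> 2 * sq_norm lebesgue (\<lambda>x. v x - t n x) + 2 * sq_norm lebesgue (\<lambda>x. t n x - s k x)"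
      using v(1) tm[of n] continuous_borel_measurable_lebesgue[OF sc[of k]]
      by (intro sq_norm_add borel_measurable_diff)
    also have "\<dots> \<le> 2 * ennreal (e / 4) + 2 * ennreal (e / 4)"
      using n k by (intro add_mono mult_left_mono) auto
    also have "\<dots> = ennreal 2 * ennreal (e / 4) + ennreal 2 * ennreal (e / 4)" by simp
    also have "\<dots> = ennreal e" using e
      by (simp only: ennreal_mult[symmetric] ennreal_plus[symmetric]) (simp add: ennreal_mult[symmetric] ennreal_plus[symmetric] del: ennreal_plus)
    finally show "sq_norm lebesgue (\<lambda>x. v x - s k x) \<le> ennreal e" .
  qed
qed


lemma conv_continuous:
  fixes \<rho> :: "real^'n \<Rightarrow> real"
  assumes "mollifier \<delta> \<rho>" "integrable lebesgue v"
  shows "continuous_on UNIV (conv \<rho> v)"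
  using conv_Ck[of \<rho> v 0] assms by (simp add: mollifier_def)

text \<open>Approximate v by a continuous w of compact support: mollification does not increase the
  norm of v - w, and it moves w by little in the uniform norm. The conclusion holds for all small
  scales and every mollifier at that scale, so that a function and all its derivatives can later
  share one mollifier.\<close>

lemma conv_L2_close:
  fixes v :: "real^'n \<Rightarrow> real"
  assumes v: "v \<in> borel_measurable lebesgue" "integrable lebesgue (\<lambda>x. (v x)\<^sup>2)"
    and K: "compact K" "\<And>x. x \<notin> K \<Longrightarrow> v x = 0" and e: "e > 0"
  shows "\<forall>\<^sub>F \<delta> in at_right 0. \<forall>\<rho>. mollifier \<delta> \<rho> \<longrightarrow> sq_norm lebesgue (\<lambda>x. conv \<rho> v x - v x) \<le> ennreal e"
proof -
  obtain R where R: "R > 0" "K \<subseteq> cball 0 R"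
    using bounded_subset_ballD[OF compact_imp_bounded[OF K(1)], of 0] ball_subset_cball by (metis order_trans)
  have v0: "v x = 0" if "norm x > R" for x 
  proof -
    have "x \<notin> K" using R(2) that by (meson mem_cball_0 not_le subsetD)
    then show ?thesis by (rule K(2))
  qed
  have vi: "integrable lebesgue v" by (rule sq_integrable_imp_integrable_compact[OF K(1) v(1) K(2) v(2)])
  obtain w where w: "continuous_on UNIV w" "\<And>x. norm x > R + 1 \<Longrightarrow> w x = 0"
    "sq_norm lebesgue (\<lambda>x. v x - w x) \<le> ennreal (e / 16)"
    using L2_continuous_dense[OF v v0 R(1), of "e / 16"] e by auto
  have w0: "w x = 0" if "x \<notin> cball 0 (R + 1)" for x using w(2)[of x] that by auto
  have wi: "integrable lebesgue w" by (rule continuous_compact_support_integrable[OF w(1) compact_cball w0])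
  have "continuous_on UNIV (\<lambda>x. (w x)\<^sup>2)" by (intro continuous_intros w(1))
  then have w2: "integrable lebesgue (\<lambda>x. (w x)\<^sup>2)"
    by (rule continuous_compact_support_integrable[OF _ compact_cball, of _ 0 "R + 1"]) (use w0 in auto)
  have wm: "w \<in> borel_measurable lebesgue" using wi by auto
  have vw: "integrable lebesgue (\<lambda>x. v x - w x)" using vi wi by simp
  have vwm: "(\<lambda>x. v x - w x) \<in> borel_measurable lebesgue" using vw by auto
  have vw2: "integrable lebesgue (\<lambda>x. (v x - w x)\<^sup>2)"
    using w(3) vwm by (subst sq_norm_finite_iff) (auto simp: less_top[symmetric] top_unique)
  define V where "V = measure lebesgue (cball 0 (R + 2) :: (real^'n) set)"
  have V: "V \<ge> 0" by (simp add: V_def)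
  \<comment> \<open>Uniform distance at which w and its mollification, both 0 outside the ball of
    radius R + 2 of volume V, have square distance at most e/16.\<close>
  define c where "c = sqrt (e / 16 / (V + 1))"
  have c: "c > 0" "c\<^sup>2 * V \<le> e / 16" using e V by (auto simp: c_def field_simps add_nonneg_pos)
  obtain d where d: "d > 0" "\<And>x y. dist x y < d \<Longrightarrow> dist (w x) (w y) < c"
    using continuous_compact_support_uniform[OF w(1) compact_cball w0 c(1)] by blast
  have "sq_norm lebesgue (\<lambda>x. conv \<rho> v x - v x) \<le> ennreal e" if \<delta>: "0 < \<delta>" "\<delta> < min d 1" and \<rho>: "mollifier \<delta> \<rho>" for \<delta> \<rho>
  proof -
    define A where "A = sq_norm lebesgue (conv \<rho> (\<lambda>x. v x - w x))"
    define B where "B = sq_norm lebesgue (\<lambda>x. conv \<rho> w x - w x)"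
    define C where "C = sq_norm lebesgue (\<lambda>x. w x - v x)"
    have C: "C \<le> ennreal (e / 16)" using w(3) unfolding C_def sq_norm_def by (simp add: power2_commute)
    have A: "A \<le> ennreal (e / 16)" using conv_L2_bound[OF \<rho> vw vw2] w(3) unfolding A_def by (rule order_trans)
    have bd: "\<bar>conv \<rho> w x - w x\<bar> \<le> c * indicat_real (cball 0 (R + 2)) x" for x
    proof (cases "norm x \<le> R + 2")
      case True
      have "\<bar>conv \<rho> w x - w x\<bar> \<le> c"
      proof (rule conv_close[OF \<rho> wi])
        fix y assume "norm (x - y) < \<delta>"
        then show "\<bar>w y - w x\<bar> \<le> c"
          using d(2)[of y x] \<delta> by (simp add: dist_norm norm_minus_commute)
      qed
      then show ?thesis using True by simp
    next
      case False
      have "\<bar>conv \<rho> w x - 0\<bar> \<le> 0"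
      proof (rule conv_close[OF \<rho> wi])
        fix y assume "norm (x - y) < \<delta>"
        then have "norm y > R + 1" using False \<delta> norm_triangle_sub[of x y] by simp
        then show "\<bar>w y - 0\<bar> \<le> 0" using w(2) by simp
      qed
      then show ?thesis using False w(2)[of x] by simp
    qed
    have "B \<le> sq_norm lebesgue (\<lambda>x. c * indicat_real (cball 0 (R + 2)) (x::real^'n))"
      unfolding B_def by (intro sq_norm_mono) (use bd abs_ge_self order_trans in blast)
    also have "\<dots> = ennreal (c\<^sup>2) * ennreal V"
    proof -
      have "sq_norm lebesgue (indicat_real (cball 0 (R + 2) :: (real^'n) set)) = (\<integral>\<^sup>+x. indicator (cball 0 (R + 2) :: (real^'n) set) x \<partial>lebesgue)"
        unfolding sq_norm_def by (intro nn_integral_cong) (auto simp: indicator_def)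
      also have "\<dots> = ennreal V"
        unfolding V_def using lmeasurable_cball[of "0::real^'n" "R + 2"]
        by (simp add: fmeasurable_def emeasure_eq_ennreal_measure less_top[symmetric])
      finally show ?thesis using lmeasurable_cball[of "0::real^'n" "R + 2"]
        by (subst sq_norm_cmult) (auto simp: fmeasurable_def intro!: borel_measurable_indicator)
    qed
    also have "\<dots> \<le> ennreal (e / 16)" using c V by (simp add: ennreal_mult[symmetric] ennreal_leI)
    finally have B: "B \<le> ennreal (e / 16)" .
    have m: "conv \<rho> (\<lambda>x. v x - w x) \<in> borel_measurable lebesgue" "conv \<rho> w \<in> borel_measurable lebesgue"
      by (intro continuous_borel_measurable_lebesgue conv_continuous[OF \<rho>] vw wi)+
    have lin: "conv \<rho> v x - v x = conv \<rho> (\<lambda>x. v x - w x) x + ((conv \<rho> w x - w x) + (w x - v x))" for x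
    proof -
      have "conv \<rho> (\<lambda>x. v x - w x) x = conv \<rho> v x - conv \<rho> w x"
        unfolding conv_def using mollifier_conv_integrable[OF \<rho> vi, of x] mollifier_conv_integrable[OF \<rho> wi, of x]
        by (simp add: right_diff_distrib)
      then show ?thesis by simp
    qed
    \<comment> \<open>\<open>sq_norm_add\<close> costs a factor 2 and is applied twice, giving 2A +
      4B + 4C; with each term at most e/16 the total is 10/16 of e.\<close>
    have "sq_norm lebesgue (\<lambda>x. conv \<rho> v x - v x)
        \<le> 2 * A + 2 * sq_norm lebesgue (\<lambda>x. (conv \<rho> w x - w x) + (w x - v x))"
      unfolding lin A_def using m wm v(1) by (intro sq_norm_add) auto
    also have "\<dots> \<le> 2 * A + 2 * (2 * B + 2 * C)"
      unfolding B_def C_def using m wm v(1) by (intro add_left_mono mult_left_mono sq_norm_add) auto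
    also have "\<dots> \<le> 2 * ennreal (e / 16) + 2 * (2 * ennreal (e / 16) + 2 * ennreal (e / 16))"
      by (intro add_mono mult_left_mono A B C) auto
    also have "\<dots> = 10 * ennreal (e / 16)"
      by (simp add: distrib_right[symmetric])
    also have "\<dots> = ennreal (10 * (e / 16))"
      using e by (subst ennreal_mult) auto
    also have "\<dots> \<le> ennreal e" using e by (intro ennreal_leI) simp
    finally show ?thesis .
  qed
  then show ?thesis
    unfolding eventually_at_right_field using d(1) by (intro exI[of _ "min d 1"]) auto
qed

text \<open>Convolution commutes with weak differentiation: the reflected kernel y to \<rho> (x - y)
  is itself an admissible test function.\<close>

lemma grad_conv_weak_div:
  fixes \<rho> :: "real^'n \<Rightarrow> real"
  assumes \<rho>: "mollifier \<delta> \<rho>" and v: "integrable lebesgue v" and w: "integrable lebesgue w"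
    and d: "weak_div UNIV (\<lambda>x. v x *\<^sub>R axis i 1) w"
  shows "grad (conv \<rho> v) x $ i = conv \<rho> w x"
proof -
  have \<rho>c: "C1_compact UNIV \<rho>" using \<rho> test_function_C1_compact by (auto simp: mollifier_def)
  define r where "r y = \<rho> (x - y)" for y
  have rD: "GDERIV r y :> - grad \<rho> (x - y)" for y
  proof -
    have "(\<rho> has_derivative (\<lambda>h. h \<bullet> grad \<rho> (x - y))) (at (x - y))"
      using C1_compact_GDERIV[OF \<rho>c] unfolding gderiv_def .
    then have "((\<lambda>y. \<rho> (x - y)) has_derivative (\<lambda>h. (- h) \<bullet> grad \<rho> (x - y))) (at y)"
      by (rule has_derivative_compose[rotated]) (auto intro!: derivative_eq_intros)
    then show ?thesis unfolding gderiv_def r_def by simp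
  qed
  have c: "continuous_on UNIV (\<lambda>y. - grad \<rho> (x - y))"
    by (rule continuous_on_minus, rule continuous_on_compose2[OF C1_compact_continuous_grad[OF \<rho>c]])
      (auto intro!: continuous_on_diff continuous_on_const continuous_on_id)
  have rc: "C1_compact UNIV r"
  proof (rule C1_compactI[OF open_UNIV compact_cball[of x \<delta>] subset_UNIV _ rD c])
    fix y assume "y \<notin> cball x \<delta>"
    then show "r y = 0" using \<rho> by (auto simp: r_def mollifier_def dist_norm)
  qed
  obtain K' where K': "compact K'" "\<And>x. x \<notin> K' \<Longrightarrow> grad \<rho> x = 0"
    using C1_compactE[OF \<rho>c] by metis
  have i1: "integrable lebesgue (\<lambda>y. \<rho> (x - y) * w y)" by (rule mollifier_conv_integrable[OF \<rho> w])
  have i2: "integrable lebesgue (\<lambda>y. grad \<rho> (x - y) $ i * v y)"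
    by (rule conv_integrable[OF C1_compact_continuous_grad_nth[OF \<rho>c] K'(1) _ v]) (simp add: K'(2))
  have "0 = (\<integral>y. (v y *\<^sub>R axis i 1) \<bullet> grad r y + w y * r y \<partial>lebesgue)"
    by (rule has_bochner_integral_integral_eq[symmetric]) (use d rc in \<open>auto simp: weak_div_def\<close>)
  also have "\<dots> = (\<integral>y. \<rho> (x - y) * w y - grad \<rho> (x - y) $ i * v y \<partial>lebesgue)"
    unfolding GDERIV_imp_grad[OF rD] by (simp add: r_def inner_axis' algebra_simps)
  also have "\<dots> = conv \<rho> w x - conv (\<lambda>z. grad \<rho> z $ i) v x"
    unfolding conv_def using i1 i2 by simp
  finally show ?thesis
    using GDERIV_imp_grad[OF conv_GDERIV[OF \<rho>c v]] by simp
qed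

text \<open>Mollify v: its gradient is then the mollification of \<open>Dv\<close>, so both converge
  in L^2. The scale is kept below the distance e0 by which \<open>K\<close> may be enlarged within
  \<open>U\<close>.\<close>

lemma H1_approximation:
  fixes v :: "real^'n \<Rightarrow> real" and Dv :: "real^'n \<Rightarrow> real^'n"
  assumes U: "open U" and K: "compact K" "K \<subseteq> U" "\<And>x. x \<notin> K \<Longrightarrow> v x = 0" "\<And>x. x \<notin> K \<Longrightarrow> Dv x = 0"
    and v: "v \<in> borel_measurable lebesgue" "integrable lebesgue (\<lambda>x. (v x)\<^sup>2)"
    and Dv: "\<And>i. (\<lambda>x. Dv x $ i) \<in> borel_measurable lebesgue" "\<And>i. integrable lebesgue (\<lambda>x. (Dv x $ i)\<^sup>2)"
    and d: "\<And>i. weak_div UNIV (\<lambda>x. v x *\<^sub>R axis i 1) (\<lambda>x. Dv x $ i)" and e: "e > 0"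
  shows "\<exists>w. test_function U w \<and> sq_norm lebesgue (\<lambda>x. w x - v x) \<le> ennreal e \<and>
    (\<forall>i. sq_norm lebesgue (\<lambda>x. grad w x $ i - Dv x $ i) \<le> ennreal e)"
proof -
  have vi: "integrable lebesgue v" by (rule sq_integrable_imp_integrable_compact[OF K(1) v(1) K(3) v(2)])
  have Di: "integrable lebesgue (\<lambda>x. Dv x $ i)" for i
    by (rule sq_integrable_imp_integrable_compact[OF K(1) Dv(1) _ Dv(2)]) (simp add: K(4))
  obtain e0 where e0: "e0 > 0" "compact {x + y |x y. x \<in> K \<and> y \<in> cball 0 e0}" "{x + y |x y. x \<in> K \<and> y \<in> cball 0 e0} \<subseteq> U"
    by (rule compact_enlarge[OF K(1) U K(2)])
  have "\<forall>\<^sub>F \<delta> in at_right 0. \<forall>\<rho>. mollifier \<delta> \<rho> \<longrightarrow> sq_norm lebesgue (\<lambda>x. conv \<rho> v x - v x) \<le> ennreal e"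
    by (rule conv_L2_close[OF v K(1,3) e])
  moreover have "\<forall>\<^sub>F \<delta> in at_right 0. \<forall>i. \<forall>\<rho>. mollifier \<delta> \<rho> \<longrightarrow>
      sq_norm lebesgue (\<lambda>x. conv \<rho> (\<lambda>x. Dv x $ i) x - Dv x $ i) \<le> ennreal e"
    by (intro eventually_all_finite conv_L2_close[OF Dv K(1) _ e]) (simp add: K(4))
  moreover have "\<forall>\<^sub>F \<delta> in at_right 0. 0 < \<delta> \<and> \<delta> < e0"
    unfolding eventually_at_right_field using e0(1) by blast
  ultimately have "\<forall>\<^sub>F \<delta> in at_right 0. (\<forall>\<rho>. mollifier \<delta> \<rho> \<longrightarrow> sq_norm lebesgue (\<lambda>x. conv \<rho> v x - v x) \<le> ennreal e) \<and>
      (\<forall>i. \<forall>\<rho>. mollifier \<delta> \<rho> \<longrightarrow> sq_norm lebesgue (\<lambda>x. conv \<rho> (\<lambda>x. Dv x $ i) x - Dv x $ i) \<le> ennreal e) \<and> 0 < \<delta> \<and> \<delta> < e0"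
    by eventually_elim auto
  then obtain \<delta> where \<delta>: "\<And>\<rho>. mollifier \<delta> \<rho> \<Longrightarrow> sq_norm lebesgue (\<lambda>x. conv \<rho> v x - v x) \<le> ennreal e"
    "\<And>i \<rho>. mollifier \<delta> \<rho> \<Longrightarrow> sq_norm lebesgue (\<lambda>x. conv \<rho> (\<lambda>x. Dv x $ i) x - Dv x $ i) \<le> ennreal e" "0 < \<delta>" "\<delta> < e0"
    using eventually_happens'[OF trivial_limit_at_right_real] by blast
  obtain \<rho> :: "real^'n \<Rightarrow> real" where \<rho>: "mollifier \<delta> \<rho>" using ex_mollifier[OF \<delta>(3)] by blast
  have out: "conv \<rho> v x = 0" if x: "x \<notin> {x + y |x y. x \<in> K \<and> y \<in> cball 0 e0}" for x
  proof -
    have "\<bar>v y - 0\<bar> \<le> 0" if y: "norm (x - y) < \<delta>" for y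
    proof -
      have "y \<notin> K" using enlarge_mem[of y K x e0] x y \<delta>(4) by force
      then show ?thesis using K(3) by simp
    qed
    then show ?thesis using conv_close[OF \<rho> vi, of x 0 0] by simp
  qed
  have "test_function U (conv \<rho> v)"
    unfolding test_function_def
  proof (intro conjI exI)
    show "smooth_on UNIV (conv \<rho> v)" using conv_Ck[OF _ vi] \<rho> by (auto simp: mollifier_def intro: smooth_on_openI)
    show "compact {x + y |x y. x \<in> K \<and> y \<in> cball 0 e0}" by (rule e0(2))
    show "{x + y |x y. x \<in> K \<and> y \<in> cball 0 e0} \<subseteq> U" by (rule e0(3))
    show "\<forall>x. x \<notin> {x + y |x y. x \<in> K \<and> y \<in> cball 0 e0} \<longrightarrow> conv \<rho> v x = 0"
      using out by blast
  qed
  then show ?thesis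
    using \<delta>(1)[OF \<rho>] \<delta>(2)[OF \<rho>] grad_conv_weak_div[OF \<rho> vi Di d] by (intro exI[of _ "conv \<rho> v"]) simp
qed

lemma L2_loc_mult_measurable:
  assumes f: "L2_loc U f" and K: "compact K" "K \<subseteq> U" "continuous_on UNIV g" "\<And>x. x \<notin> K \<Longrightarrow> g x = 0"
  shows "(\<lambda>x. g x * f x) \<in> borel_measurable lebesgue" "integrable lebesgue (\<lambda>x. (g x * f x)\<^sup>2)"
proof -
  show m: "(\<lambda>x. g x * f x) \<in> borel_measurable lebesgue"
    using L2_loc_mult_integrable[OF f K] by (simp add: mult.commute borel_measurable_integrable)
  obtain B where B: "B > 0" "\<And>x. norm (g x) \<le> B"
    using continuous_compact_support_bounded[OF K(3,1,4)] by blast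
  show "integrable lebesgue (\<lambda>x. (g x * f x)\<^sup>2)"
  proof (rule Bochner_Integration.integrable_bound)
    show "integrable lebesgue (\<lambda>x. B\<^sup>2 * (indicat_real K x * (f x)\<^sup>2))"
      by (intro integrable_mult_right L2_loc_compact(2)[OF f K(1,2)])
    have "(g x * f x)\<^sup>2 \<le> B\<^sup>2 * (indicat_real K x * (f x)\<^sup>2)" for x
    proof (cases "x \<in> K")
      case True
      have "(g x)\<^sup>2 \<le> B\<^sup>2" using B(2)[of x] B(1) abs_le_square_iff[of "g x" B] by simp
      then show ?thesis using True by (simp add: power_mult_distrib mult_right_mono)
    qed (simp add: K(4))
    then show "AE x in lebesgue. norm ((g x * f x)\<^sup>2) \<le> norm (B\<^sup>2 * (indicat_real K x * (f x)\<^sup>2))"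
      by simp
  qed (use m in measurable)
qed

text \<open>Multiplication by \<zeta> turns a local Sobolev function into one on the whole space
  with compact support, whose gradient is given by the product rule; this one can be
  mollified.\<close>

lemma H1_loc_cutoff_approximation:
  fixes u :: "real^'n \<Rightarrow> real"
  assumes U: "open U" and u: "H1_loc_grad U u Du" and \<zeta>: "C1_compact U \<zeta>" and e: "e > 0"
  shows "\<exists>w. test_function U w \<and> sq_norm lebesgue (\<lambda>x. w x - \<zeta> x * u x) \<le> ennreal e \<and>
    (\<forall>i. sq_norm lebesgue (\<lambda>x. grad w x $ i - (\<zeta> x * Du x $ i + u x * grad \<zeta> x $ i)) \<le> ennreal e)"
proof -
  have uL: "L2_loc U u" and DuL: "\<And>i. L2_loc U (\<lambda>x. Du x $ i)"
    and wd: "\<And>i. weak_div U (\<lambda>x. u x *\<^sub>R axis i 1) (\<lambda>x. Du x $ i)"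
    using u unfolding H1_loc_grad_iff_weak_div[OF U] L2_loc_vec_def by auto
  obtain K where K: "compact K" "K \<subseteq> U" "\<And>x. x \<notin> K \<Longrightarrow> \<zeta> x = 0" "\<And>x. x \<notin> K \<Longrightarrow> grad \<zeta> x = 0"
    using C1_compactE[OF \<zeta>] by metis
  define Dv where "Dv x = (\<chi> i. \<zeta> x * Du x $ i + u x * grad \<zeta> x $ i)" for x
  have z: "\<And>x. x \<notin> K \<Longrightarrow> grad \<zeta> x $ i = 0" for i using K(4) by simp
  note m0 = L2_loc_mult_measurable[OF uL K(1,2) C1_compact_continuous[OF \<zeta>] K(3)]
  note m1 = L2_loc_mult_measurable[OF DuL K(1,2) C1_compact_continuous[OF \<zeta>] K(3)]
  note m2 = L2_loc_mult_measurable[OF uL K(1,2) C1_compact_continuous_grad_nth[OF \<zeta>] z]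
  have Dv_eq: "Dv x $ i = \<zeta> x * Du x $ i + grad \<zeta> x $ i * u x" for x i by (simp add: Dv_def)
  have m: "(\<lambda>x. Dv x $ i) \<in> borel_measurable lebesgue" for i
    unfolding Dv_eq by (intro borel_measurable_add m1(1) m2(1))
  have Dv2: "integrable lebesgue (\<lambda>x. (Dv x $ i)\<^sup>2)" for i
  proof -
    have "sq_norm lebesgue (\<lambda>x. Dv x $ i) \<le> 2 * sq_norm lebesgue (\<lambda>x. \<zeta> x * Du x $ i) + 2 * sq_norm lebesgue (\<lambda>x. grad \<zeta> x $ i * u x)"
      unfolding Dv_eq by (intro sq_norm_add m1(1) m2(1))
    also have "\<dots> < \<infinity>"
      using m1[of i] m2[of i] by (simp add: sq_norm_finite_iff ennreal_mult_less_top)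
    finally show ?thesis by (simp add: sq_norm_finite_iff[OF m])
  qed
  have "\<exists>w. test_function U w \<and> sq_norm lebesgue (\<lambda>x. w x - \<zeta> x * u x) \<le> ennreal e \<and>
    (\<forall>i. sq_norm lebesgue (\<lambda>x. grad w x $ i - Dv x $ i) \<le> ennreal e)"
  proof (rule H1_approximation[OF U K(1,2) _ _ _ _ m Dv2 _ e])
    show "(\<lambda>x. \<zeta> x * u x) \<in> borel_measurable lebesgue" using m0(1) .
    show "integrable lebesgue (\<lambda>x. (\<zeta> x * u x)\<^sup>2)" using m0(2) .
    show "weak_div UNIV (\<lambda>x. (\<zeta> x * u x) *\<^sub>R axis i 1) (\<lambda>x. Dv x $ i)" for i
      using weak_div_cutoff[OF U wd \<zeta>, of i] by (simp add: Dv_def)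
    show "Dv x = 0" if "x \<notin> K" for x using K(3,4)[OF that] by (simp add: Dv_def vec_eq_iff)
  qed (use K(3) in auto)
  then show ?thesis by (simp add: Dv_def)
qed

text \<open>The fundamental lemma of the calculus of variations. Testing with \<zeta> y * \<rho> (x
  - y) shows that every mollification of \<zeta> w is 0, while these converge to \<zeta> w in L^2;
  then \<open>U\<close> is exhausted by compact sets.\<close>

lemma weak_div_zero_AE:
  fixes w :: "real^'n \<Rightarrow> real"
  assumes U: "open U" and w: "L2_loc U w" and d: "weak_div U (\<lambda>_. 0) w"
  shows "AE x in lebesgue. x \<in> U \<longrightarrow> w x = 0"
proof -
  have comp: "AE x in lebesgue. x \<in> K \<longrightarrow> w x = 0" if K: "compact K" "K \<subseteq> U" for K
  proof -
    obtain \<zeta> W where \<zeta>: "test_function U \<zeta>" "K \<subseteq> W" "\<And>x. x \<in> W \<Longrightarrow> \<zeta> x = 1"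
      using bump_exists[OF K(1) U K(2)] by metis
    have \<zeta>c: "C1_compact U \<zeta>" by (rule test_function_C1_compact[OF \<zeta>(1)])
    obtain K' where K': "compact K'" "K' \<subseteq> U" "\<And>x. x \<notin> K' \<Longrightarrow> \<zeta> x = 0"
      using C1_compactE[OF \<zeta>c] by metis
    define v where "v x = \<zeta> x * w x" for x
    have v: "v \<in> borel_measurable lebesgue" "integrable lebesgue (\<lambda>x. (v x)\<^sup>2)"
      using L2_loc_mult_measurable[OF w K'(1,2) C1_compact_continuous[OF \<zeta>c] K'(3)] by (simp_all add: v_def[abs_def])
    have v0: "v x = 0" if "x \<notin> K'" for x using K'(3)[OF that] by (simp add: v_def)
    have "sq_norm lebesgue v \<le> 0 + ennreal e" if e: "0 < e" for e
    proof -
      have "\<forall>\<^sub>F \<delta> in at_right 0. (\<forall>\<rho>. mollifier \<delta> \<rho> \<longrightarrow> sq_norm lebesgue (\<lambda>x. conv \<rho> v x - v x) \<le> ennreal e) \<and> 0 < \<delta>"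
        using conv_L2_close[OF v K'(1) v0 e] eventually_at_right_less by (rule eventually_conj)
      then obtain \<delta> where \<delta>: "\<And>\<rho>. mollifier \<delta> \<rho> \<Longrightarrow> sq_norm lebesgue (\<lambda>x. conv \<rho> v x - v x) \<le> ennreal e" "0 < \<delta>"
        using eventually_happens'[OF trivial_limit_at_right_real] by blast
      obtain \<rho> :: "real^'n \<Rightarrow> real" where \<rho>: "mollifier \<delta> \<rho>" using ex_mollifier[OF \<delta>(2)] by blast
      have \<rho>c: "C1_compact UNIV \<rho>" using \<rho> test_function_C1_compact by (auto simp: mollifier_def)
      have "conv \<rho> v x = 0" for x
      proof -
        have rD: "GDERIV (\<lambda>y. \<rho> (x - y)) y :> - grad \<rho> (x - y)" for y
        proof -
          have "(\<rho> has_derivative (\<lambda>h. h \<bullet> grad \<rho> (x - y))) (at (x - y))"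
            using C1_compact_GDERIV[OF \<rho>c] unfolding gderiv_def .
          then have "((\<lambda>y. \<rho> (x - y)) has_derivative (\<lambda>h. (- h) \<bullet> grad \<rho> (x - y))) (at y)"
            by (rule has_derivative_compose[rotated]) (auto intro!: derivative_eq_intros)
          then show ?thesis unfolding gderiv_def by simp
        qed
        have c: "continuous_on U (\<lambda>y. - grad \<rho> (x - y))"
          by (rule continuous_on_minus, rule continuous_on_compose2[OF C1_compact_continuous_grad[OF \<rho>c]])
            (auto intro!: continuous_on_diff continuous_on_const continuous_on_id)
        have "C1_compact U (\<lambda>y. \<zeta> y * \<rho> (x - y))"
          by (rule C1_compact_mult(1)[OF U \<zeta>c rD c])
        then have "has_bochner_integral lebesgue (\<lambda>y. w y * (\<zeta> y * \<rho> (x - y))) 0"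
          using d unfolding weak_div_def by force
        then have "(\<integral>y. w y * (\<zeta> y * \<rho> (x - y)) \<partial>lebesgue) = 0" by (rule has_bochner_integral_integral_eq)
        then show ?thesis by (simp add: conv_def v_def algebra_simps)
      qed
      then show ?thesis using \<delta>(1)[OF \<rho>] by (simp add: sq_norm_def)
    qed
    then have "sq_norm lebesgue v \<le> 0" using ennreal_le_epsilon[of 0] by blast
    then have "AE x in lebesgue. v x = 0" using v(1) by (intro sq_norm_eq_0_AE) auto
    then show ?thesis by eventually_elim (use \<zeta> in \<open>auto simp: v_def\<close>)
  qed
  obtain C where C: "\<And>n::nat. compact (C n)" "\<And>n. C n \<subseteq> U" "\<Union>(range C) = U"
    using open_Union_compact_subsets[OF U] by metis
  have "AE x in lebesgue. \<forall>n. x \<in> C n \<longrightarrow> w x = 0"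
    unfolding AE_all_countable using comp C(1,2) by blast
  then show ?thesis by eventually_elim (use C(3) in auto)
qed

text \<open>Serves to identify the gradients that two different charts provide for the same
  function.\<close>

lemma H1_loc_grad_unique:
  assumes U: "open U" and u: "H1_loc_grad U u Du" "H1_loc_grad U u Du'"
  shows "AE x in lebesgue. x \<in> U \<longrightarrow> Du x = Du' x"
proof -
  have "AE x in lebesgue. x \<in> U \<longrightarrow> Du x $ i - Du' x $ i = 0" for i
  proof (rule weak_div_zero_AE[OF U])
    show "L2_loc U (\<lambda>x. Du x $ i - Du' x $ i)"
      using u by (intro L2_loc_diff[OF U]) (auto simp: H1_loc_grad_def)
    show "weak_div U (\<lambda>_. 0) (\<lambda>x. Du x $ i - Du' x $ i)"
      unfolding weak_div_def
    proof (intro allI impI)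
      fix \<phi> assume \<phi>: "C1_compact U \<phi>"
      have "has_bochner_integral lebesgue (\<lambda>x. (u x *\<^sub>R axis i 1) \<bullet> grad \<phi> x + Du x $ i * \<phi> x) 0"
        "has_bochner_integral lebesgue (\<lambda>x. (u x *\<^sub>R axis i 1) \<bullet> grad \<phi> x + Du' x $ i * \<phi> x) 0"
        using u \<phi> unfolding H1_loc_grad_iff_weak_div[OF U] weak_div_def by blast+
      from has_bochner_integral_diff[OF this]
      show "has_bochner_integral lebesgue (\<lambda>x. 0 \<bullet> grad \<phi> x + (Du x $ i - Du' x $ i) * \<phi> x) 0"
        by (simp add: algebra_simps)
    qed
  qed
  then have "AE x in lebesgue. \<forall>i. x \<in> U \<longrightarrow> Du x $ i - Du' x $ i = 0"
    unfolding AE_all_countable by blast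
  then show ?thesis by eventually_elim (auto simp: vec_eq_iff)
qed


section \<open>Continuously differentiable changes of variables\<close>

definition jac :: "(real^'n \<Rightarrow> real^'m) \<Rightarrow> real^'n \<Rightarrow> real^'n^'m" where
  "jac \<tau> x = matrix (frechet_derivative \<tau> (at x))"

lemma jac_works:
  assumes "\<tau> differentiable (at x)"
  shows "(\<tau> has_derivative (\<lambda>h. jac \<tau> x *v h)) (at x)"
proof -
  have D: "(\<tau> has_derivative frechet_derivative \<tau> (at x)) (at x)"
    using assms frechet_derivative_works by blast
  have "(\<lambda>h. jac \<tau> x *v h) = frechet_derivative \<tau> (at x)"
    unfolding jac_def by (rule ext) (rule matrix_works[OF has_derivative_linear[OF D, folded linear_matrix_vector_mul_eq]])
  then show ?thesis using D by simp
qed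

lemma has_derivative_imp_jac:
  assumes "(\<tau> has_derivative (\<lambda>h. A *v h)) (at x)"
  shows "jac \<tau> x = A"
  unfolding jac_def using frechet_derivative_at[OF assms] matrix_of_matrix_vector_mul[of A] by simp

lemma jac_cong_open:
  assumes "open U" "x \<in> U" "\<And>y. y \<in> U \<Longrightarrow> f y = g y"
  shows "jac f x = jac g x"
  unfolding jac_def using frechet_derivative_cong_open[OF assms] by simp

lemma jac_compose:
  assumes "\<tau> differentiable (at x)" "\<kappa> differentiable (at (\<tau> x))"
  shows "((\<lambda>x. \<kappa> (\<tau> x)) has_derivative (\<lambda>h. (jac \<kappa> (\<tau> x) ** jac \<tau> x) *v h)) (at x)"
    and "jac (\<lambda>x. \<kappa> (\<tau> x)) x = jac \<kappa> (\<tau> x) ** jac \<tau> x"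
proof -
  show "((\<lambda>x. \<kappa> (\<tau> x)) has_derivative (\<lambda>h. (jac \<kappa> (\<tau> x) ** jac \<tau> x) *v h)) (at x)"
    using has_derivative_compose[OF jac_works[OF assms(1)] jac_works[OF assms(2)]]
    by (simp add: matrix_vector_mul_assoc)
  then show "jac (\<lambda>x. \<kappa> (\<tau> x)) x = jac \<kappa> (\<tau> x) ** jac \<tau> x"
    by (rule has_derivative_imp_jac)
qed

lemma pullback_metric_jac:
  "pullback_metric \<Phi> g y = transpose (jac \<Phi> y) ** g (\<Phi> y) ** jac \<Phi> y"
proof -
  have j: "jac \<Phi> y $ a $ b = frechet_derivative \<Phi> (at y) (axis b 1) $ a" for a b
    by (simp add: jac_def matrix_def)
  have "(\<Sum>a\<in>UNIV. jac \<Phi> y $ a $ i * (\<Sum>b\<in>UNIV. g (\<Phi> y) $ a $ b * jac \<Phi> y $ b $ j))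
    = (\<Sum>b\<in>UNIV. (\<Sum>a\<in>UNIV. jac \<Phi> y $ a $ i * g (\<Phi> y) $ a $ b) * jac \<Phi> y $ b $ j)" for i j
    unfolding sum_distrib_left sum_distrib_right by (subst sum.swap) (simp add: mult.assoc)
  then show ?thesis
    unfolding vec_eq_iff pullback_metric_def
    by (simp add: inner_vec_def matrix_vector_mult_def matrix_matrix_mult_def transpose_def j[symmetric])
qed

lemma pullback_metric_compose:
  assumes "\<tau> differentiable (at x)" "\<kappa> differentiable (at (\<tau> x))"
  shows "pullback_metric (\<lambda>x. \<kappa> (\<tau> x)) g x = pullback_metric \<tau> (pullback_metric \<kappa> g) x"
  by (simp add: pullback_metric_jac jac_compose[OF assms] matrix_transpose_mul matrix_mul_assoc)

lemma GDERIV_compose_jac: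
  assumes "\<tau> differentiable (at x)" "GDERIV \<psi> (\<tau> x) :> D"
  shows "GDERIV (\<lambda>x. \<psi> (\<tau> x)) x :> D v* jac \<tau> x"
proof -
  have "((\<lambda>x. \<psi> (\<tau> x)) has_derivative (\<lambda>h. (jac \<tau> x *v h) \<bullet> D)) (at x)"
    using has_derivative_compose[OF jac_works[OF assms(1)] assms(2)[unfolded gderiv_def]] .
  moreover have "(jac \<tau> x *v h) \<bullet> D = h \<bullet> (D v* jac \<tau> x)" for h
    by (metis dot_lmul_matrix inner_commute)
  ultimately show ?thesis unfolding gderiv_def by simp
qed

lemma continuous_on_vector_matrix_mult:
  fixes A :: "'a::topological_space \<Rightarrow> real^'n^'m"
  assumes "continuous_on S v" "continuous_on S A"
  shows "continuous_on S (\<lambda>x. v x v* A x)"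
  unfolding vector_matrix_mult_def using assms
  by (intro continuous_on_vec_lambda continuous_on_sum continuous_on_mult continuous_on_component)

lemma continuous_on_matrix_vector_mult:
  fixes A :: "'a::topological_space \<Rightarrow> real^'n^'m"
  assumes "continuous_on S A" "continuous_on S v"
  shows "continuous_on S (\<lambda>x. A x *v v x)"
  unfolding matrix_vector_mult_def using assms
  by (intro continuous_on_vec_lambda continuous_on_sum continuous_on_mult continuous_on_component)

lemma continuous_on_matrix_mult:
  fixes A :: "'a::topological_space \<Rightarrow> real^'n^'m"
  assumes "continuous_on S A" "continuous_on S B"
  shows "continuous_on S (\<lambda>x. A x ** B x)"
  unfolding matrix_matrix_mult_def using assms
  by (intro continuous_on_vec_lambda continuous_on_sum continuous_on_mult continuous_on_component)

lemma continuous_on_transpose: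
  fixes A :: "'a::topological_space \<Rightarrow> real^'n^'m"
  assumes "continuous_on S A"
  shows "continuous_on S (\<lambda>x. transpose (A x))"
  unfolding transpose_def using assms
  by (intro continuous_on_vec_lambda continuous_on_component)

lemma continuous_on_det:
  fixes A :: "'a::topological_space \<Rightarrow> real^'n^'n"
  assumes "continuous_on S A"
  shows "continuous_on S (\<lambda>x. det (A x))"
  unfolding det_def using assms
  by (intro continuous_on_sum continuous_on_mult continuous_on_prod continuous_on_component continuous_on_const)

lemma matrix_inv_mult:
  fixes A :: "real^'n^'n"
  assumes "det A \<noteq> 0"
  shows "A ** matrix_inv A = mat 1" "matrix_inv A ** A = mat 1"
proof -
  have "\<exists>B. A ** B = mat 1 \<and> B ** A = mat 1"
    using assms by (simp flip: invertible_def add: invertible_det_nz)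
  then have "A ** matrix_inv A = mat 1 \<and> matrix_inv A ** A = mat 1"
    unfolding matrix_inv_def by (rule someI_ex)
  then show "A ** matrix_inv A = mat 1" "matrix_inv A ** A = mat 1" by auto
qed

lemma matrix_inv_unique:
  fixes A B :: "real^'n^'n"
  assumes "A ** B = mat 1"
  shows "matrix_inv A = B" "det A \<noteq> 0"
proof -
  show d: "det A \<noteq> 0" using assms by (metis det_I det_mul mult_zero_left zero_neq_one)
  have "matrix_inv A = matrix_inv A ** (A ** B)" using assms by simp
  also have "\<dots> = B" using matrix_inv_mult(2)[OF d] by (simp add: matrix_mul_assoc)
  finally show "matrix_inv A = B" .
qed

text \<open>Cramer's rule writes the entries of the inverse as quotients of determinants, which are
  polynomials in the entries.\<close>

lemma continuous_on_matrix_inv: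
  fixes A :: "'a::topological_space \<Rightarrow> real^'n^'n"
  assumes "continuous_on S A" "\<And>x. x \<in> S \<Longrightarrow> det (A x) \<noteq> 0"
  shows "continuous_on S (\<lambda>x. matrix_inv (A x))"
proof -
  define E where "E x = (\<chi> k l. det (\<chi> i j. if j = k then axis l (1::real) $ i else A x $ i $ j) / det (A x))" for x
  have E: "matrix_inv (A x) = E x" if "x \<in> S" for x
  proof -
    have "matrix_inv (A x) *v axis l 1 = (\<chi> k. det (\<chi> i j. if j = k then axis l 1 $ i else A x $ i $ j) / det (A x))" for l
      using cramer[OF assms(2)[OF that], of "matrix_inv (A x) *v axis l 1" "axis l 1"] matrix_inv_mult(1)[OF assms(2)[OF that]]
      by (simp add: matrix_vector_mul_assoc)
    then have "matrix_inv (A x) $ k $ l = E x $ k $ l" for k l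
      by (simp add: matrix_vector_mult_basis column_def vec_eq_iff E_def)
    then show ?thesis by (simp add: vec_eq_iff)
  qed
  have "continuous_on S E"
    unfolding E_def
  proof (intro continuous_on_vec_lambda continuous_on_divide continuous_on_det assms)
    fix k l i j
    show "continuous_on S (\<lambda>x. if j = k then axis l (1::real) $ i else A x $ i $ j)"
      using assms(1) by (cases "j = k") (auto intro!: continuous_intros)
  qed (use assms in auto)
  then show ?thesis using E by (metis (no_types, lifting) continuous_on_cong)
qed

text \<open>The inverse is a parameter with regularity of its own, so the notion is symmetric in its
  two maps and every transfer result can be read in both directions.\<close>

definition C1_diffeo :: "(real^'n) set \<Rightarrow> (real^'n) set \<Rightarrow> (real^'n \<Rightarrow> real^'n) \<Rightarrow> (real^'n \<Rightarrow> real^'n) \<Rightarrow> bool" where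
  "C1_diffeo U U' \<tau> \<sigma> \<longleftrightarrow> open U \<and> open U' \<and>
     (\<forall>x\<in>U. \<tau> x \<in> U' \<and> \<sigma> (\<tau> x) = x \<and> \<tau> differentiable (at x)) \<and> continuous_on U (jac \<tau>) \<and>
     (\<forall>y\<in>U'. \<sigma> y \<in> U \<and> \<tau> (\<sigma> y) = y \<and> \<sigma> differentiable (at y)) \<and> continuous_on U' (jac \<sigma>)"

lemma C1_diffeo_sym: "C1_diffeo U U' \<tau> \<sigma> \<Longrightarrow> C1_diffeo U' U \<sigma> \<tau>"
  unfolding C1_diffeo_def by blast

lemma C1_diffeoD:
  assumes "C1_diffeo U U' \<tau> \<sigma>"
  shows "open U" "open U'" "\<And>x. x \<in> U \<Longrightarrow> \<tau> x \<in> U'" "\<And>x. x \<in> U \<Longrightarrow> \<sigma> (\<tau> x) = x"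
    "\<And>x. x \<in> U \<Longrightarrow> \<tau> differentiable (at x)" "continuous_on U (jac \<tau>)" "continuous_on U \<tau>"
    "\<And>y. y \<in> U' \<Longrightarrow> \<sigma> y \<in> U" "\<And>y. y \<in> U' \<Longrightarrow> \<tau> (\<sigma> y) = y"
    "\<And>y. y \<in> U' \<Longrightarrow> \<sigma> differentiable (at y)" "continuous_on U' (jac \<sigma>)" "continuous_on U' \<sigma>"
    "\<tau> ` U = U'" "inj_on \<tau> U"
proof -
  show "open U" "open U'" "\<And>x. x \<in> U \<Longrightarrow> \<tau> x \<in> U'" "\<And>x. x \<in> U \<Longrightarrow> \<sigma> (\<tau> x) = x"
    "continuous_on U (jac \<tau>)" "\<And>y. y \<in> U' \<Longrightarrow> \<sigma> y \<in> U" "\<And>y. y \<in> U' \<Longrightarrow> \<tau> (\<sigma> y) = y" "continuous_on U' (jac \<sigma>)"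
    using assms unfolding C1_diffeo_def by blast+
  show d: "\<And>x. x \<in> U \<Longrightarrow> \<tau> differentiable (at x)" "\<And>y. y \<in> U' \<Longrightarrow> \<sigma> differentiable (at y)"
    using assms unfolding C1_diffeo_def by blast+
  show "continuous_on U \<tau>" "continuous_on U' \<sigma>"
    using d by (auto intro!: continuous_at_imp_continuous_on differentiable_imp_continuous_within)
  show "\<tau> ` U = U'" using assms unfolding C1_diffeo_def by force
  show "inj_on \<tau> U" using assms unfolding C1_diffeo_def by (metis inj_onI)
qed

lemma C1_diffeo_subset:
  assumes "C1_diffeo \<Omega> \<Omega>' \<tau> \<sigma>" "open U" "U \<subseteq> \<Omega>"
  shows "C1_diffeo U (\<Omega>' \<inter> \<sigma> -` U) \<tau> \<sigma>"
proof -
  note D = C1_diffeoD[OF assms(1)]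
  have "open (\<Omega>' \<inter> \<sigma> -` U)"
    using D(2,12) assms(2) by (metis continuous_openin_preimage_gen inf_commute openin_open_eq)
  then show ?thesis
    using assms(2,3) D unfolding C1_diffeo_def by (auto intro: continuous_on_subset)
qed

lemma C1_diffeo_jac:
  assumes "C1_diffeo U U' \<tau> \<sigma>" "x \<in> U"
  shows "jac \<sigma> (\<tau> x) ** jac \<tau> x = mat 1" "jac \<tau> x ** jac \<sigma> (\<tau> x) = mat 1"
    "det (jac \<tau> x) \<noteq> 0" "\<bar>det (jac \<tau> x)\<bar> * \<bar>det (jac \<sigma> (\<tau> x))\<bar> = 1"
proof -
  note D = C1_diffeoD[OF assms(1)]
  have "jac (\<lambda>x. \<sigma> (\<tau> x)) x = jac \<sigma> (\<tau> x) ** jac \<tau> x"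
    by (rule jac_compose) (use D assms(2) in auto)
  moreover have "jac (\<lambda>x. \<sigma> (\<tau> x)) x = jac (\<lambda>x. x) x"
    by (rule jac_cong_open[OF D(1) assms(2)]) (rule D(4))
  moreover have "jac (\<lambda>x. x) x = mat 1"
    by (rule has_derivative_imp_jac) simp
  ultimately show 1: "jac \<sigma> (\<tau> x) ** jac \<tau> x = mat 1" by simp
  then show 2: "jac \<tau> x ** jac \<sigma> (\<tau> x) = mat 1" using matrix_left_right_inverse by blast
  show "det (jac \<tau> x) \<noteq> 0" using matrix_inv_unique(2)[OF 2] .
  have "det (jac \<tau> x) * det (jac \<sigma> (\<tau> x)) = 1" using 2 by (metis det_I det_mul)
  then show "\<bar>det (jac \<tau> x)\<bar> * \<bar>det (jac \<sigma> (\<tau> x))\<bar> = 1" by (metis abs_mult abs_one)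
qed

section \<open>Change of variables for integrals and local spaces\<close>

lemma has_bochner_integral_lebesgue_on_iff_HK:
  fixes f :: "'a::euclidean_space \<Rightarrow> real"
  assumes "S \<in> sets lebesgue"
  shows "has_bochner_integral (lebesgue_on S) f I \<longleftrightarrow> f absolutely_integrable_on S \<and> integral S f = I"
proof -
  have "integrable (lebesgue_on S) f \<longleftrightarrow> f absolutely_integrable_on S"
    using assms by (simp add: set_integrable_def integrable_restrict_space)
  then show ?thesis
    using assms lebesgue_integral_eq_integral[of S f] by (auto simp: has_bochner_integral_iff)
qed

lemma C1_diffeo_image_sets:
  assumes "C1_diffeo U U' \<tau> \<sigma>" "S \<subseteq> U" "S \<in> sets lebesgue"
  shows "\<tau> ` S \<in> sets lebesgue"
proof (rule differentiable_image_in_sets_lebesgue[OF assms(3)])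
  show "\<tau> differentiable_on S"
    unfolding differentiable_on_def using C1_diffeoD(5)[OF assms(1)] assms(2)
    by (meson differentiable_at_withinI subsetD)
qed simp

lemma C1_diffeo_change_of_variables:
  fixes \<tau> :: "real^'n::{finite,wellorder} \<Rightarrow> real^'n::_"
  assumes "C1_diffeo U U' \<tau> \<sigma>" "S \<subseteq> U" "S \<in> sets lebesgue"
  shows "has_bochner_integral (lebesgue_on (\<tau> ` S)) f I \<longleftrightarrow>
    has_bochner_integral (lebesgue_on S) (\<lambda>x. \<bar>det (jac \<tau> x)\<bar> * f (\<tau> x)) I"
proof -
  note D = C1_diffeoD[OF assms(1)]
  have der: "(\<tau> has_derivative (\<lambda>h. jac \<tau> x *v h)) (at x within S)" if "x \<in> S" for x
    using jac_works[OF D(5)] assms(2) that by (auto intro: has_derivative_at_withinI)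
  have inj: "inj_on \<tau> S" using D(14) assms(2) inj_on_subset by blast
  \<comment> \<open>The change of variables theorem concerns vector valued functions and gauge
    integrals; \<open>vec\<close> embeds the reals as \<open>real^1\<close>, and absolute
    integrability links back to the Bochner integral.\<close>
  have "(\<lambda>x. \<bar>det (matrix (\<lambda>h. jac \<tau> x *v h))\<bar> *\<^sub>R vec (f (\<tau> x)) :: real^1) absolutely_integrable_on S \<and>
      integral S (\<lambda>x. \<bar>det (matrix (\<lambda>h. jac \<tau> x *v h))\<bar> *\<^sub>R vec (f (\<tau> x))) = (vec I :: real^1)
    \<longleftrightarrow> (\<lambda>x. vec (f x) :: real^1) absolutely_integrable_on (\<tau> ` S) \<and>
      integral (\<tau> ` S) (\<lambda>x. vec (f x)) = (vec I :: real^1)"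
    by (rule has_absolute_integral_change_of_variables[OF assms(3) der inj])
  then have "(\<lambda>x. \<bar>det (jac \<tau> x)\<bar> * f (\<tau> x)) absolutely_integrable_on S \<and> integral S (\<lambda>x. \<bar>det (jac \<tau> x)\<bar> * f (\<tau> x)) = I
    \<longleftrightarrow> f absolutely_integrable_on (\<tau> ` S) \<and> integral (\<tau> ` S) f = I"
    by (simp add: matrix_of_matrix_vector_mul absolutely_integrable_on_1_iff integral_on_1_eq)
  then show ?thesis
    unfolding has_bochner_integral_lebesgue_on_iff_HK[OF assms(3)]
      has_bochner_integral_lebesgue_on_iff_HK[OF C1_diffeo_image_sets[OF assms]] by blast
qed

lemma C1_diffeo_change_of_variables_integrable:
  fixes \<tau> :: "real^'n::{finite,wellorder} \<Rightarrow> real^'n::_"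
  assumes "C1_diffeo U U' \<tau> \<sigma>" "S \<subseteq> U" "S \<in> sets lebesgue"
  shows "integrable (lebesgue_on (\<tau> ` S)) f \<longleftrightarrow> integrable (lebesgue_on S) (\<lambda>x. \<bar>det (jac \<tau> x)\<bar> * f (\<tau> x))"
  using C1_diffeo_change_of_variables[OF assms] unfolding integrable.simps by blast

lemma C1_diffeo_has_bochner_integral:
  fixes \<tau> :: "real^'n::{finite,wellorder} \<Rightarrow> real^'n::_"
  assumes "C1_diffeo U U' \<tau> \<sigma>"
  shows "has_bochner_integral (lebesgue_on U') f I \<longleftrightarrow>
    has_bochner_integral (lebesgue_on U) (\<lambda>x. \<bar>det (jac \<tau> x)\<bar> * f (\<tau> x)) I"
  using C1_diffeo_change_of_variables[OF assms subset_refl] C1_diffeoD[OF assms] by auto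

lemma C1_diffeo_integrable:
  fixes \<tau> :: "real^'n::{finite,wellorder} \<Rightarrow> real^'n::_"
  assumes "C1_diffeo U U' \<tau> \<sigma>"
  shows "integrable (lebesgue_on U') f \<longleftrightarrow> integrable (lebesgue_on U) (\<lambda>x. \<bar>det (jac \<tau> x)\<bar> * f (\<tau> x))"
  using C1_diffeo_has_bochner_integral[OF assms] unfolding integrable.simps by blast

text \<open>A preimage under \<tau> is an image under \<sigma>, and differentiable maps between
  spaces of equal dimension send Lebesgue sets to Lebesgue sets. Continuity alone would handle Borel
  sets only.\<close>

lemma C1_diffeo_measurable:
  assumes "C1_diffeo U U' \<tau> \<sigma>" "f \<in> borel_measurable (lebesgue_on U')"
  shows "(\<lambda>x. f (\<tau> x)) \<in> borel_measurable (lebesgue_on U)"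
proof (rule measurableI)
  note D = C1_diffeoD[OF assms(1)]
  fix A :: "'b set" assume A: "A \<in> sets borel"
  have O: "U \<in> sets lebesgue" "U' \<in> sets lebesgue" using D by auto
  have "f -` A \<inter> U' \<in> sets (lebesgue_on U')"
    using measurable_sets[OF assms(2) A] by (simp add: space_restrict_space)
  then have "f -` A \<inter> U' \<in> sets lebesgue" using O by (simp add: sets_restrict_space_iff)
  then have "\<sigma> ` (f -` A \<inter> U') \<in> sets lebesgue"
    by (intro C1_diffeo_image_sets[OF C1_diffeo_sym[OF assms(1)]]) auto
  moreover have "(\<lambda>x. f (\<tau> x)) -` A \<inter> space (lebesgue_on U) = \<sigma> ` (f -` A \<inter> U')"
    using D(3,4,8,9) by (auto simp: space_restrict_space image_iff) (metis IntI vimageI)+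
  moreover have "\<sigma> ` (f -` A \<inter> U') \<subseteq> U" using D(8) by auto
  ultimately show "(\<lambda>x. f (\<tau> x)) -` A \<inter> space (lebesgue_on U) \<in> sets (lebesgue_on U)"
    using O by (simp add: sets_restrict_space_iff)
qed simp

lemma compact_in_sets_lebesgue: "compact K \<Longrightarrow> (K :: 'a::euclidean_space set) \<in> sets lebesgue"
  using lmeasurable_compact[of K] by (simp add: fmeasurable_def)

lemma C1_diffeo_abs_det_bounds:
  assumes "C1_diffeo U U' \<tau> \<sigma>" "compact K" "K \<subseteq> U"
  obtains c C where "c > 0" "\<And>x. x \<in> K \<Longrightarrow> c \<le> \<bar>det (jac \<tau> x)\<bar>" "\<And>x. x \<in> K \<Longrightarrow> \<bar>det (jac \<tau> x)\<bar> \<le> C"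
proof -
  note D = C1_diffeoD[OF assms(1)]
  have c: "continuous_on U (\<lambda>x. det (jac \<tau> x))" by (rule continuous_on_det[OF D(6)])
  have "continuous_on U (\<lambda>x. inverse (det (jac \<tau> x)))"
    using C1_diffeo_jac(3)[OF assms(1)] by (intro continuous_on_inverse c) auto
  then obtain B where B: "B > 0" "\<And>x. x \<in> K \<Longrightarrow> \<bar>inverse (det (jac \<tau> x))\<bar> \<le> B"
    using continuous_on_compact_abs_bound assms(2,3) by metis
  obtain C where C: "C > 0" "\<And>x. x \<in> K \<Longrightarrow> \<bar>det (jac \<tau> x)\<bar> \<le> C"
    using continuous_on_compact_abs_bound[OF c assms(2,3)] by metis
  have "1 / B \<le> \<bar>det (jac \<tau> x)\<bar>" if "x \<in> K" for x
    using B(2)[OF that] B(1) C1_diffeo_jac(3)[OF assms(1), of x] assms(3) that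
    by (auto simp: field_simps abs_inverse)
  then show ?thesis using that[of "1 / B" C] B(1) C(2) by simp
qed

lemma C1_diffeo_L2_loc:
  fixes \<tau> :: "real^'n::{finite,wellorder} \<Rightarrow> real^'n::_"
  assumes "C1_diffeo U U' \<tau> \<sigma>" "L2_loc U' f"
  shows "L2_loc U (\<lambda>x. f (\<tau> x))"
proof (rule L2_locI)
  note D = C1_diffeoD[OF assms(1)]
  show m: "(\<lambda>x. f (\<tau> x)) \<in> borel_measurable (lebesgue_on U)"
    by (rule C1_diffeo_measurable[OF assms(1) L2_loc_measurable[OF assms(2)]])
  show "U \<in> sets lebesgue" using D(1) by auto
  fix K assume K: "compact K" "K \<subseteq> U"
  note KS = compact_in_sets_lebesgue[OF K(1)]
  have "compact (\<tau> ` K)" "\<tau> ` K \<subseteq> U'"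
    using K D(3,7) by (auto intro: compact_continuous_image continuous_on_subset)
  then have "integrable (lebesgue_on (\<tau> ` K)) (\<lambda>x. (f x)\<^sup>2)"
    using assms(2) by (auto simp: L2_loc_def square_integrable_def)
  then have i: "integrable (lebesgue_on K) (\<lambda>x. \<bar>det (jac \<tau> x)\<bar> * (f (\<tau> x))\<^sup>2)"
    by (rule C1_diffeo_change_of_variables_integrable[OF assms(1) K(2) KS, THEN iffD1])
  obtain c C where c: "c > 0" "\<And>x. x \<in> K \<Longrightarrow> c \<le> \<bar>det (jac \<tau> x)\<bar>"
    using C1_diffeo_abs_det_bounds[OF assms(1) K] by metis
  have "integrable (lebesgue_on K) (\<lambda>x. (f (\<tau> x))\<^sup>2)"
  proof (rule Bochner_Integration.integrable_bound)
    show "integrable (lebesgue_on K) (\<lambda>x. (1 / c) * (\<bar>det (jac \<tau> x)\<bar> * (f (\<tau> x))\<^sup>2))"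
      using i by (rule integrable_mult_right)
    show "(\<lambda>x. (f (\<tau> x))\<^sup>2) \<in> borel_measurable (lebesgue_on K)"
      using measurable_restrict_mono[OF m K(2)] by measurable
    show "AE x in lebesgue_on K. norm ((f (\<tau> x))\<^sup>2) \<le> norm ((1 / c) * (\<bar>det (jac \<tau> x)\<bar> * (f (\<tau> x))\<^sup>2))"
    proof (rule AE_I2)
      fix x assume "x \<in> space (lebesgue_on K)"
      then have "c \<le> \<bar>det (jac \<tau> x)\<bar>" using c(2) by (simp add: space_restrict_space)
      then have "c * (f (\<tau> x))\<^sup>2 \<le> \<bar>det (jac \<tau> x)\<bar> * (f (\<tau> x))\<^sup>2" by (rule mult_right_mono) simp
      then show "norm ((f (\<tau> x))\<^sup>2) \<le> norm ((1 / c) * (\<bar>det (jac \<tau> x)\<bar> * (f (\<tau> x))\<^sup>2))"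
        using c(1) by (simp add: field_simps abs_mult)
    qed
  qed
  then show "integrable lebesgue (\<lambda>x. indicat_real K x * (f (\<tau> x))\<^sup>2)"
    by (simp add: integrable_lebesgue_on_iff[OF KS])
qed

text \<open>Push-forward of a test function. A gradient is a covector, so it transforms by
  multiplication from the left with the Jacobian of the inverse map.\<close>

lemma C1_diffeo_C1_compact:
  assumes "C1_diffeo U U' \<tau> \<sigma>" "C1_compact U \<phi>"
  defines "\<psi> \<equiv> \<lambda>y. if y \<in> U' then \<phi> (\<sigma> y) else 0"
  shows "C1_compact U' \<psi>" "\<And>x. x \<in> U \<Longrightarrow> \<psi> (\<tau> x) = \<phi> x"
    "\<And>x. x \<in> U \<Longrightarrow> grad \<psi> (\<tau> x) = grad \<phi> x v* jac \<sigma> (\<tau> x)"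
proof -
  note D = C1_diffeoD[OF assms(1)]
  obtain K where K: "compact K" "K \<subseteq> U" "\<And>x. x \<notin> K \<Longrightarrow> \<phi> x = 0"
    using C1_compactE[OF assms(2)] by metis
  have G: "GDERIV \<psi> y :> grad \<phi> (\<sigma> y) v* jac \<sigma> y" if y: "y \<in> U'" for y
  proof -
    have "GDERIV (\<lambda>y. \<phi> (\<sigma> y)) y :> grad \<phi> (\<sigma> y) v* jac \<sigma> y"
      by (rule GDERIV_compose_jac[OF D(10)[OF y] C1_compact_GDERIV[OF assms(2)]])
    moreover have "GDERIV (\<lambda>y. \<phi> (\<sigma> y)) y :> d \<longleftrightarrow> GDERIV \<psi> y :> d" for d
      by (rule GDERIV_cong_open[OF D(2) y]) (simp add: \<psi>_def)
    ultimately show ?thesis by blast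
  qed
  show "C1_compact U' \<psi>"
  proof (rule C1_compactI[OF D(2) _ _ _ G])
    show "compact (\<tau> ` K)" using K(1,2) D(7) by (auto intro: compact_continuous_image continuous_on_subset)
    show "\<tau> ` K \<subseteq> U'" using K(2) D(3) by auto
    show "\<psi> y = 0" if "y \<notin> \<tau> ` K" for y
    proof (cases "y \<in> U'")
      case True
      then have "\<sigma> y \<notin> K" using that D(9) by (metis imageI)
      then show ?thesis using K(3) by (simp add: \<psi>_def)
    qed (simp add: \<psi>_def)
    show "continuous_on U' (\<lambda>y. grad \<phi> (\<sigma> y) v* jac \<sigma> y)"
      by (intro continuous_on_vector_matrix_mult D(11)
          continuous_on_compose2[OF C1_compact_continuous_grad[OF assms(2)] D(12)]) auto
  qed
  show "\<psi> (\<tau> x) = \<phi> x" if "x \<in> U" for x using D(3,4)[OF that] by (simp add: \<psi>_def)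
  show "grad \<psi> (\<tau> x) = grad \<phi> x v* jac \<sigma> (\<tau> x)" if "x \<in> U" for x
    using GDERIV_imp_grad[OF G[OF D(3)[OF that]]] D(4)[OF that] by simp
qed


lemma continuous_on_zero_extension:
  fixes g :: "'a::euclidean_space \<Rightarrow> 'b::real_normed_vector"
  assumes "open U" "continuous_on U g" "compact K" "K \<subseteq> U" "\<And>x. x \<notin> K \<Longrightarrow> g x = 0"
  shows "continuous_on UNIV g"
proof -
  have "continuous_on (U \<union> - K) g"
  proof (rule continuous_on_open_Un)
    show "continuous_on (- K) g" by (rule continuous_on_eq[OF continuous_on_const[of _ 0]]) (use assms(5) in auto)
  qed (use assms compact_imp_closed in auto)
  moreover have "U \<union> - K = UNIV" using assms(4) by auto
  ultimately show ?thesis by simp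
qed

text \<open>Instead of Cauchy-Schwarz, the elementary bound of the absolute value of a by s + a^2 /
  s: if the L^2 norm of a is at most s, its pairing with a bounded function supported in
  \<open>K\<close> is of order s.\<close>

lemma L2_pairing_small:
  fixes a b :: "'a::euclidean_space \<Rightarrow> real"
  assumes a: "a \<in> borel_measurable lebesgue" "sq_norm lebesgue a \<le> ennreal (s\<^sup>2)" and s: "s > 0"
    and b: "b \<in> borel_measurable lebesgue" "\<And>x. \<bar>b x\<bar> \<le> C * indicat_real K x" and K: "compact K" and C: "C \<ge> 0"
  shows "integrable lebesgue (\<lambda>x. a x * b x)" "\<bar>\<integral>x. a x * b x \<partial>lebesgue\<bar> \<le> C * s * (measure lebesgue K + 1)"
proof -
  have a2: "integrable lebesgue (\<lambda>x. (a x)\<^sup>2)"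
    using a by (subst sq_norm_finite_iff) (auto simp: less_top[symmetric] top_unique)
  have a2le: "(\<integral>x. (a x)\<^sup>2 \<partial>lebesgue) \<le> s\<^sup>2"
    using a(2) unfolding sq_norm_eq_integral[OF a2] by (simp add: ennreal_le_iff)
  have Ki: "integrable lebesgue (indicat_real K)" "(\<integral>x. indicat_real K x \<partial>lebesgue) = measure lebesgue K"
    using lmeasurable_compact[OF K] by (auto simp: fmeasurable_def intro!: integrable_real_indicator)
  have bd: "\<bar>a x * b x\<bar> \<le> C * (s * indicat_real K x + (1 / s) * (a x)\<^sup>2)" for x
  proof -
    have "\<bar>a x\<bar> \<le> s + (1 / s) * (a x)\<^sup>2"
    proof (cases "\<bar>a x\<bar> \<le> s")
      case True
      then show ?thesis using s by (smt (verit) divide_nonneg_pos mult_nonneg_nonneg zero_le_power2)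
    next
      case False
      then have "s * \<bar>a x\<bar> \<le> \<bar>a x\<bar> * \<bar>a x\<bar>" by (intro mult_right_mono) auto
      then have "\<bar>a x\<bar> \<le> (1 / s) * (a x)\<^sup>2" using s by (simp add: field_simps power2_eq_square)
      then show ?thesis using s by simp
    qed
    then have "\<bar>a x\<bar> * indicat_real K x \<le> s * indicat_real K x + (1 / s) * (a x)\<^sup>2"
      using s by (auto simp: indicator_def)
    then have "C * (\<bar>a x\<bar> * indicat_real K x) \<le> C * (s * indicat_real K x + (1 / s) * (a x)\<^sup>2)"
      using C by (rule mult_left_mono)
    moreover have "\<bar>a x * b x\<bar> \<le> \<bar>a x\<bar> * (C * indicat_real K x)"
      unfolding abs_mult by (intro mult_left_mono b(2)) auto
    ultimately show ?thesis by (simp add: algebra_simps)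
  qed
  have i: "integrable lebesgue (\<lambda>x. C * (s * indicat_real K x + (1 / s) * (a x)\<^sup>2))"
    by (intro integrable_mult_right Bochner_Integration.integrable_add Ki(1) a2)
  show ab: "integrable lebesgue (\<lambda>x. a x * b x)"
  proof (rule Bochner_Integration.integrable_bound[OF i])
    show "(\<lambda>x. a x * b x) \<in> borel_measurable lebesgue" using a(1) b(1) by measurable
    show "AE x in lebesgue. norm (a x * b x) \<le> norm (C * (s * indicat_real K x + (1 / s) * (a x)\<^sup>2))"
      using bd by (intro AE_I2) (metis abs_ge_self order_trans real_norm_def)
  qed
  have "\<bar>\<integral>x. a x * b x \<partial>lebesgue\<bar> \<le> (\<integral>x. C * (s * indicat_real K x + (1 / s) * (a x)\<^sup>2) \<partial>lebesgue)"
    using Bochner_Integration.integral_norm_bound_integral[OF ab i] bd by simp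
  also have "\<dots> = C * (s * measure lebesgue K + (1 / s) * (\<integral>x. (a x)\<^sup>2 \<partial>lebesgue))"
    using Ki a2 by simp
  also have "\<dots> \<le> C * (s * measure lebesgue K + (1 / s) * s\<^sup>2)"
    using C s a2le by (intro mult_left_mono add_left_mono) auto
  also have "\<dots> = C * s * (measure lebesgue K + 1)" using s by (simp add: power2_eq_square algebra_simps)
  finally show "\<bar>\<integral>x. a x * b x \<partial>lebesgue\<bar> \<le> C * s * (measure lebesgue K + 1)" .
qed

lemma vector_matrix_mult_nth: "(v v* A) $ i = (\<Sum>j\<in>UNIV. v $ j * A $ j $ i)"
  by (simp add: vector_matrix_mult_def mult.commute)

text \<open>The transformed field is the Piola transform of X: inverse Jacobian times X, scaled by
  the volume factor. The proof substitutes \<phi> \<circ> \<sigma> into the identity on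
  \<open>U'\<close> and changes variables.\<close>

lemma C1_diffeo_weak_div:
  fixes \<tau> :: "real^'n::{finite,wellorder} \<Rightarrow> real^'n::_"
  assumes "C1_diffeo U U' \<tau> \<sigma>" "weak_div U' X Y"
  shows "weak_div U (\<lambda>x. \<bar>det (jac \<tau> x)\<bar> *\<^sub>R (jac \<sigma> (\<tau> x) *v X (\<tau> x))) (\<lambda>x. \<bar>det (jac \<tau> x)\<bar> * Y (\<tau> x))"
  unfolding weak_div_def
proof (intro allI impI)
  note D = C1_diffeoD[OF assms(1)]
  have O: "U \<in> sets lebesgue" "U' \<in> sets lebesgue" using D(1,2) by auto
  fix \<phi> assume \<phi>: "C1_compact U \<phi>"
  obtain K where K: "K \<subseteq> U" "\<And>x. x \<notin> K \<Longrightarrow> \<phi> x = 0" "\<And>x. x \<notin> K \<Longrightarrow> grad \<phi> x = 0"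
    using C1_compactE[OF \<phi>] by metis
  define \<psi> where "\<psi> = (\<lambda>y. if y \<in> U' then \<phi> (\<sigma> y) else 0)"
  note \<psi> = C1_diffeo_C1_compact[OF assms(1) \<phi>, folded \<psi>_def]
  obtain K' where K': "K' \<subseteq> U'" "\<And>x. x \<notin> K' \<Longrightarrow> \<psi> x = 0" "\<And>x. x \<notin> K' \<Longrightarrow> grad \<psi> x = 0"
    using C1_compactE[OF \<psi>(1)] by metis
  have out: "\<phi> x = 0" "grad \<phi> x = 0" if "x \<notin> U" for x using K that by auto
  have out': "\<psi> x = 0" "grad \<psi> x = 0" if "x \<notin> U'" for x using K' that by auto
  have "has_bochner_integral lebesgue (\<lambda>y. X y \<bullet> grad \<psi> y + Y y * \<psi> y) 0"
    using assms(2) \<psi>(1) unfolding weak_div_def by blast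
  then have "has_bochner_integral (lebesgue_on U') (\<lambda>y. X y \<bullet> grad \<psi> y + Y y * \<psi> y) 0"
    by (subst has_bochner_integral_lebesgue_on_iff[OF O(2)]) (simp add: out')
  then have "has_bochner_integral (lebesgue_on U)
      (\<lambda>x. \<bar>det (jac \<tau> x)\<bar> * (X (\<tau> x) \<bullet> grad \<psi> (\<tau> x) + Y (\<tau> x) * \<psi> (\<tau> x))) 0"
    by (rule C1_diffeo_has_bochner_integral[OF assms(1), THEN iffD1])
  moreover have "\<bar>det (jac \<tau> x)\<bar> * (X (\<tau> x) \<bullet> grad \<psi> (\<tau> x) + Y (\<tau> x) * \<psi> (\<tau> x))
    = (\<bar>det (jac \<tau> x)\<bar> *\<^sub>R (jac \<sigma> (\<tau> x) *v X (\<tau> x))) \<bullet> grad \<phi> x + \<bar>det (jac \<tau> x)\<bar> * Y (\<tau> x) * \<phi> x"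
    if "x \<in> U" for x
  proof -
    have "X (\<tau> x) \<bullet> (grad \<phi> x v* jac \<sigma> (\<tau> x)) = (jac \<sigma> (\<tau> x) *v X (\<tau> x)) \<bullet> grad \<phi> x"
      by (metis dot_lmul_matrix inner_commute)
    moreover have "\<psi> (\<tau> x) = \<phi> x" using D(3,4)[OF that] by (simp add: \<psi>_def)
    ultimately show ?thesis using \<psi>(3)[OF that] by (simp add: algebra_simps)
  qed
  ultimately have "has_bochner_integral (lebesgue_on U)
      (\<lambda>x. (\<bar>det (jac \<tau> x)\<bar> *\<^sub>R (jac \<sigma> (\<tau> x) *v X (\<tau> x))) \<bullet> grad \<phi> x + \<bar>det (jac \<tau> x)\<bar> * Y (\<tau> x) * \<phi> x) 0"
    by (subst has_bochner_integral_cong[OF refl _ refl]) (auto simp: space_restrict_space)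
  then show "has_bochner_integral lebesgue
      (\<lambda>x. (\<bar>det (jac \<tau> x)\<bar> *\<^sub>R (jac \<sigma> (\<tau> x) *v X (\<tau> x))) \<bullet> grad \<phi> x + \<bar>det (jac \<tau> x)\<bar> * Y (\<tau> x) * \<phi> x) 0"
    by (subst (asm) has_bochner_integral_lebesgue_on_iff[OF O(1)]) (simp add: out)
qed

text \<open>The chain rule passes through smooth approximations of \<open>u\<close>: integrating by parts directly would
  require second derivatives of \<open>\<tau>\<close>.\<close>

lemma C1_diffeo_H1_loc_grad:
  fixes \<tau> :: "real^'n::{finite,wellorder} \<Rightarrow> real^'n::_"
  assumes diff: "C1_diffeo U U' \<tau> \<sigma>" and u: "H1_loc_grad U' u Du"
  shows "H1_loc_grad U (\<lambda>x. u (\<tau> x)) (\<lambda>x. Du (\<tau> x) v* jac \<tau> x)"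
proof -
  note D = C1_diffeoD[OF diff]
  have O: "U \<in> sets lebesgue" "U' \<in> sets lebesgue" using D(1,2) by auto
  have uL: "L2_loc U' u" and DuL: "\<And>j. L2_loc U' (\<lambda>x. Du x $ j)"
    using u unfolding H1_loc_grad_def by auto
  have jc: "continuous_on U (\<lambda>x. jac \<tau> x $ j $ i)" for i j
    by (intro continuous_on_component D(6))
  have "L2_loc U (\<lambda>x. (Du (\<tau> x) v* jac \<tau> x) $ i)" for i
    unfolding vector_matrix_mult_nth
    using L2_loc_continuous_mult[OF D(1) C1_diffeo_L2_loc[OF diff DuL] jc]
    by (intro L2_loc_sum[OF O(1)]) (simp add: mult.commute)
  moreover have "weak_div U (\<lambda>x. u (\<tau> x) *\<^sub>R axis i 1) (\<lambda>x. (Du (\<tau> x) v* jac \<tau> x) $ i)" for i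
    unfolding weak_div_def
  proof (intro allI impI)
    fix \<phi> assume \<phi>: "C1_compact U \<phi>"
    obtain K where K: "compact K" "K \<subseteq> U" "\<And>x. x \<notin> K \<Longrightarrow> \<phi> x = 0" "\<And>x. x \<notin> K \<Longrightarrow> grad \<phi> x = 0"
      using C1_compactE[OF \<phi>] by metis
    have out: "\<phi> x = 0" "grad \<phi> x = 0" if "x \<notin> U" for x using K that by auto
    define L where "L = \<tau> ` K"
    have L: "compact L" "L \<subseteq> U'"
      using K D(3,7) by (auto simp: L_def intro: compact_continuous_image continuous_on_subset)
    have \<sigma>L: "\<sigma> y \<notin> K" if "y \<in> U'" "y \<notin> L" for y using D(9)[OF that(1)] that(2) unfolding L_def by (metis imageI)
    \<comment> \<open>After the substitution y = \<tau> x the desired identity says that a linear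
      functional of u and Du, with continuous coefficients b0 and b j supported in the compact set
      L, is 0. In this form it passes to L^2 limits.\<close>
    define b0 where "b0 y = (if y \<in> U' then \<bar>det (jac \<sigma> y)\<bar> * grad \<phi> (\<sigma> y) $ i else 0)" for y
    define b where "b j y = (if y \<in> U' then \<bar>det (jac \<sigma> y)\<bar> * (\<phi> (\<sigma> y) * jac \<tau> (\<sigma> y) $ j $ i) else 0)" for j y
    have b0z: "b0 y = 0" if "y \<notin> L" for y using \<sigma>L[OF _ that] K(4) by (simp add: b0_def)
    have bz: "b j y = 0" if "y \<notin> L" for j y using \<sigma>L[OF _ that] K(3) by (simp add: b_def)
    have \<sigma>O: "\<sigma> ` U' \<subseteq> U" using D(8) by auto
    have "continuous_on U' (\<lambda>y. \<bar>det (jac \<sigma> y)\<bar> * grad \<phi> (\<sigma> y) $ i)"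
      by (intro continuous_on_mult continuous_on_rabs continuous_on_det D(11)
          continuous_on_compose2[OF C1_compact_continuous_grad_nth[OF \<phi>] D(12)]) auto
    then have "continuous_on U' b0" by (rule continuous_on_eq) (simp add: b0_def)
    then have b0c: "continuous_on UNIV b0" by (rule continuous_on_zero_extension[OF D(2) _ L b0z])
    have cj: "continuous_on U' (\<lambda>y. \<bar>det (jac \<sigma> y)\<bar> * (\<phi> (\<sigma> y) * jac \<tau> (\<sigma> y) $ j $ i))" for j
      by (intro continuous_on_mult continuous_on_rabs continuous_on_det D(11)
          continuous_on_compose2[OF C1_compact_continuous[OF \<phi>] D(12)] continuous_on_compose2[OF jc D(12)] \<sigma>O) auto
    have "continuous_on U' (b j)" for j by (rule continuous_on_eq[OF cj[of j]]) (simp add: b_def)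
    then have bc: "continuous_on UNIV (b j)" for j by (rule continuous_on_zero_extension[OF D(2) _ L bz])
    have transfer: "has_bochner_integral lebesgue
        (\<lambda>x. w (\<tau> x) * grad \<phi> x $ i + (\<Sum>j\<in>UNIV. Dw (\<tau> x) $ j * jac \<tau> x $ j $ i) * \<phi> x) I \<longleftrightarrow>
      has_bochner_integral lebesgue (\<lambda>y. w y * b0 y + (\<Sum>j\<in>UNIV. Dw y $ j * b j y)) I" for w and Dw :: "real^'n::_ \<Rightarrow> real^'n::_" and I
    proof -
      have "has_bochner_integral lebesgue (\<lambda>y. w y * b0 y + (\<Sum>j\<in>UNIV. Dw y $ j * b j y)) I \<longleftrightarrow>
        has_bochner_integral (lebesgue_on U') (\<lambda>y. w y * b0 y + (\<Sum>j\<in>UNIV. Dw y $ j * b j y)) I"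
        by (rule has_bochner_integral_lebesgue_on_iff[OF O(2), symmetric]) (simp add: b0_def b_def)
      also have "\<dots> \<longleftrightarrow> has_bochner_integral (lebesgue_on U)
        (\<lambda>x. \<bar>det (jac \<tau> x)\<bar> * (w (\<tau> x) * b0 (\<tau> x) + (\<Sum>j\<in>UNIV. Dw (\<tau> x) $ j * b j (\<tau> x)))) I"
        by (rule C1_diffeo_has_bochner_integral[OF diff])
      also have "\<dots> \<longleftrightarrow> has_bochner_integral (lebesgue_on U)
        (\<lambda>x. w (\<tau> x) * grad \<phi> x $ i + (\<Sum>j\<in>UNIV. Dw (\<tau> x) $ j * jac \<tau> x $ j $ i) * \<phi> x) I"
      proof (rule has_bochner_integral_cong[OF refl _ refl])
        fix x assume "x \<in> space (lebesgue_on U)"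
        then have x: "x \<in> U" by (simp add: space_restrict_space)
        have d1: "\<bar>det (jac \<tau> x)\<bar> * \<bar>det (jac \<sigma> (\<tau> x))\<bar> = 1" by (rule C1_diffeo_jac(4)[OF diff x])
        have "\<bar>det (jac \<tau> x)\<bar> * (w (\<tau> x) * b0 (\<tau> x) + (\<Sum>j\<in>UNIV. Dw (\<tau> x) $ j * b j (\<tau> x)))
          = (\<bar>det (jac \<tau> x)\<bar> * \<bar>det (jac \<sigma> (\<tau> x))\<bar>) * (w (\<tau> x) * grad \<phi> x $ i + (\<Sum>j\<in>UNIV. Dw (\<tau> x) $ j * jac \<tau> x $ j $ i) * \<phi> x)"
          using D(3,4)[OF x] by (simp add: b0_def b_def sum_distrib_left sum_distrib_right algebra_simps)
        then show "\<bar>det (jac \<tau> x)\<bar> * (w (\<tau> x) * b0 (\<tau> x) + (\<Sum>j\<in>UNIV. Dw (\<tau> x) $ j * b j (\<tau> x)))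
          = w (\<tau> x) * grad \<phi> x $ i + (\<Sum>j\<in>UNIV. Dw (\<tau> x) $ j * jac \<tau> x $ j $ i) * \<phi> x"
          unfolding d1 by simp
      qed
      also have "\<dots> \<longleftrightarrow> has_bochner_integral lebesgue
        (\<lambda>x. w (\<tau> x) * grad \<phi> x $ i + (\<Sum>j\<in>UNIV. Dw (\<tau> x) $ j * jac \<tau> x $ j $ i) * \<phi> x) I"
        by (rule has_bochner_integral_lebesgue_on_iff[OF O(1)]) (simp add: out)
      finally show ?thesis by blast
    qed
    \<comment> \<open>For smooth w the classical chain rule applies, and the identity states that
      the i-th derivative of the compactly supported C^1 function \<phi> (w \<circ> \<tau>) has
      integral 0.\<close>
    have smooth: "has_bochner_integral lebesgue (\<lambda>y. w y * b0 y + (\<Sum>j\<in>UNIV. grad w y $ j * b j y)) 0"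
      if w: "test_function U' w" for w
    proof -
      note wG = C1_compact_GDERIV[OF test_function_C1_compact[OF w]]
      note wc = C1_compact_continuous_grad[OF test_function_C1_compact[OF w]]
      have G: "GDERIV (\<lambda>x. w (\<tau> x)) x :> grad w (\<tau> x) v* jac \<tau> x" if "x \<in> U" for x
        by (rule GDERIV_compose_jac[OF D(5)[OF that] wG])
      have Gc: "continuous_on U (\<lambda>x. grad w (\<tau> x) v* jac \<tau> x)"
        by (intro continuous_on_vector_matrix_mult D(6) continuous_on_compose2[OF wc D(7)]) auto
      note P = C1_compact_mult[OF D(1) \<phi> G Gc]
      obtain K' where K': "K' \<subseteq> U" "\<And>x. x \<notin> K' \<Longrightarrow> grad (\<lambda>x. \<phi> x * w (\<tau> x)) x = 0"
        using C1_compactE[OF P(1)] by metis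
      have "has_bochner_integral lebesgue (\<lambda>x. grad (\<lambda>x. \<phi> x * w (\<tau> x)) x $ i) 0"
        using C1_compact_integrable(3)[OF P(1)] C1_compact_integral_grad[OF P(1)] by (simp add: has_bochner_integral_iff)
      moreover have "grad (\<lambda>x. \<phi> x * w (\<tau> x)) x $ i =
          w (\<tau> x) * grad \<phi> x $ i + (\<Sum>j\<in>UNIV. grad w (\<tau> x) $ j * jac \<tau> x $ j $ i) * \<phi> x" for x
      proof (cases "x \<in> U")
        case True
        then show ?thesis by (simp add: P(2) vector_matrix_mult_nth algebra_simps)
      next
        case False
        then have "x \<notin> K'" "x \<notin> K" using K'(1) K(2) by auto
        then show ?thesis using K'(2) K(3,4) by simp
      qed
      ultimately show ?thesis using transfer[of w "grad w" 0] by simp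
    qed
    \<comment> \<open>As \<zeta> is 1 near L, the functions \<zeta> u and u have the same values and
      the same gradient wherever a coefficient is nonzero; so approximating \<zeta> u is
      enough.\<close>
    obtain \<zeta> W where \<zeta>: "test_function U' \<zeta>" "open W" "L \<subseteq> W" "\<And>x. x \<in> W \<Longrightarrow> \<zeta> x = 1"
      using bump_exists[OF L(1) D(2) L(2)] by metis
    have \<zeta>g: "grad \<zeta> y = 0" if "y \<in> L" for y
    proof -
      have "grad \<zeta> y = grad (\<lambda>_. 1) y" by (rule grad_cong_open[OF \<zeta>(2)]) (use \<zeta> that in auto)
      then show ?thesis using GDERIV_imp_grad[OF GDERIV_const] by metis
    qed
    note \<zeta>c = test_function_C1_compact[OF \<zeta>(1)]
    obtain M where M: "compact M" "M \<subseteq> U'" "\<And>x. x \<notin> M \<Longrightarrow> \<zeta> x = 0" "\<And>x. x \<notin> M \<Longrightarrow> grad \<zeta> x = 0"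
      using C1_compactE[OF \<zeta>c] by metis
    have Mz: "\<And>x. x \<notin> M \<Longrightarrow> grad \<zeta> x $ j = 0" for j using M(4) by simp
    obtain C0 where C0: "C0 > 0" "\<And>x. norm (b0 x) \<le> C0"
      using continuous_compact_support_bounded[OF b0c L(1) b0z] by blast
    have "\<exists>C. C > 0 \<and> (\<forall>x. norm (b j x) \<le> C)" for j
      using continuous_compact_support_bounded[OF bc L(1) bz] by metis
    then obtain C where C: "\<And>j. C j > 0" "\<And>j x. norm (b j x) \<le> C j" by metis
    define T where "T = C0 + (\<Sum>j\<in>UNIV. C j)"
    have i0: "integrable lebesgue (\<lambda>y. u y * b0 y)" by (rule L2_loc_mult_integrable[OF uL L b0c b0z])
    have ij: "integrable lebesgue (\<lambda>y. Du y $ j * b j y)" for j by (rule L2_loc_mult_integrable[OF DuL L bc bz])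
    have ii: "integrable lebesgue (\<lambda>y. u y * b0 y + (\<Sum>j\<in>UNIV. Du y $ j * b j y))"
      using i0 ij by simp
    define J where "J = (\<integral>y. u y * b0 y + (\<Sum>j\<in>UNIV. Du y $ j * b j y) \<partial>lebesgue)"
    define V where "V = measure lebesgue L + 1"
    have small: "\<bar>J\<bar> \<le> T * s * V" if s: "s > 0" for s
    proof -
      obtain w where w: "test_function U' w" "sq_norm lebesgue (\<lambda>x. w x - \<zeta> x * u x) \<le> ennreal (s\<^sup>2)"
        "\<And>j. sq_norm lebesgue (\<lambda>x. grad w x $ j - (\<zeta> x * Du x $ j + u x * grad \<zeta> x $ j)) \<le> ennreal (s\<^sup>2)"
        using H1_loc_cutoff_approximation[OF D(2) u \<zeta>c, of "s\<^sup>2"] s by auto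
      note wc = test_function_C1_compact[OF w(1)]
      define a0 where "a0 x = w x - \<zeta> x * u x" for x
      define a where "a j x = grad w x $ j - (\<zeta> x * Du x $ j + u x * grad \<zeta> x $ j)" for j x
      have a0m: "a0 \<in> borel_measurable lebesgue"
        unfolding a0_def
        by (rule borel_measurable_diff[OF continuous_borel_measurable_lebesgue[OF C1_compact_continuous[OF wc]]
            L2_loc_mult_measurable(1)[OF uL M(1,2) C1_compact_continuous[OF \<zeta>c] M(3)]])
      have am: "a j \<in> borel_measurable lebesgue" for j
        unfolding a_def mult.commute[of "u _"]
        by (rule borel_measurable_diff[OF continuous_borel_measurable_lebesgue[OF C1_compact_continuous_grad_nth[OF wc]]
            borel_measurable_add[OF L2_loc_mult_measurable(1)[OF DuL M(1,2) C1_compact_continuous[OF \<zeta>c] M(3)]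
              L2_loc_mult_measurable(1)[OF uL M(1,2) C1_compact_continuous_grad_nth[OF \<zeta>c] Mz]]])
      have s0: "sq_norm lebesgue a0 \<le> ennreal (s\<^sup>2)" using w(2) by (simp add: a0_def[abs_def])
      have sj: "sq_norm lebesgue (a j) \<le> ennreal (s\<^sup>2)" for j using w(3)[of j] by (simp add: a_def[abs_def])
      have bd0: "\<bar>b0 x\<bar> \<le> C0 * indicat_real L x" for x using C0(2)[of x] b0z[of x] by (cases "x \<in> L") auto
      have bdj: "\<bar>b j x\<bar> \<le> C j * indicat_real L x" for j x using C(2)[of j x] bz[of x j] by (cases "x \<in> L") auto
      note p0 = L2_pairing_small[OF a0m s0 s continuous_borel_measurable_lebesgue[OF b0c] bd0 L(1) less_imp_le[OF C0(1)], folded V_def]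
      note pj = L2_pairing_small[OF am sj s continuous_borel_measurable_lebesgue[OF bc] bdj L(1) less_imp_le[OF C(1)], folded V_def]
      have e: "w y * b0 y + (\<Sum>j\<in>UNIV. grad w y $ j * b j y) - (u y * b0 y + (\<Sum>j\<in>UNIV. Du y $ j * b j y))
          = a0 y * b0 y + (\<Sum>j\<in>UNIV. a j y * b j y)" for y
      proof (cases "y \<in> L")
        case True
        then have "\<zeta> y = 1" "grad \<zeta> y = 0" using \<zeta> \<zeta>g by auto
        then show ?thesis by (simp add: a0_def a_def algebra_simps sum_subtractf)
      next
        case False
        then show ?thesis using b0z bz by simp
      qed
      have "- J = (\<integral>y. a0 y * b0 y + (\<Sum>j\<in>UNIV. a j y * b j y) \<partial>lebesgue)"
        unfolding J_def e[symmetric] using smooth[OF w(1)] ii by (simp add: has_bochner_integral_iff)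
      also have "\<dots> = (\<integral>y. a0 y * b0 y \<partial>lebesgue) + (\<Sum>j\<in>UNIV. (\<integral>y. a j y * b j y \<partial>lebesgue))"
        using p0(1) pj(1) by simp
      finally have "\<bar>J\<bar> \<le> \<bar>\<integral>y. a0 y * b0 y \<partial>lebesgue\<bar> + (\<Sum>j\<in>UNIV. \<bar>\<integral>y. a j y * b j y \<partial>lebesgue\<bar>)"
        using sum_abs[of "\<lambda>j. \<integral>y. a j y * b j y \<partial>lebesgue" UNIV] by linarith
      also have "\<dots> \<le> C0 * s * V + (\<Sum>j\<in>UNIV. C j * s * V)"
        by (intro add_mono sum_mono p0(2) pj(2))
      also have "\<dots> = T * s * V" by (simp add: T_def distrib_right sum_distrib_right)
      finally show ?thesis .
    qed
    have TV: "T * V \<ge> 0" unfolding T_def V_def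
      by (intro mult_nonneg_nonneg add_nonneg_nonneg sum_nonneg less_imp_le[OF C0(1)] less_imp_le[OF C(1)]) auto
    have "\<bar>J\<bar> \<le> 0 + e" if "e > 0" for e
    proof -
      have "\<bar>J\<bar> \<le> T * (e / (T * V + 1)) * V" using that TV by (intro small divide_pos_pos) auto
      also have "\<dots> = e * ((T * V) / (T * V + 1))" by simp
      also have "\<dots> \<le> e * 1" using that TV by (intro mult_left_mono) auto
      finally show ?thesis by simp
    qed
    then have "J = 0" using field_le_epsilon[of "\<bar>J\<bar>" 0] by simp
    then have "has_bochner_integral lebesgue (\<lambda>y. u y * b0 y + (\<Sum>j\<in>UNIV. Du y $ j * b j y)) 0"
      using ii by (simp add: has_bochner_integral_iff J_def)
    then show "has_bochner_integral lebesgue (\<lambda>x. (u (\<tau> x) *\<^sub>R axis i 1) \<bullet> grad \<phi> x + (Du (\<tau> x) v* jac \<tau> x) $ i * \<phi> x) 0"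
      unfolding transfer[of u Du 0, symmetric] by (simp add: inner_axis' vector_matrix_mult_nth)
  qed
  ultimately show ?thesis
    unfolding H1_loc_grad_iff_weak_div[OF D(1)] L2_loc_vec_def
    using C1_diffeo_L2_loc[OF diff uL] by blast
qed


section \<open>The Helmholtz equation under changes of variables\<close>

text \<open>Only continuity is asked for, because pulling back by a C^1 map multiplies by a Jacobian
  that is merely continuous.\<close>

definition metric_field :: "(real^'n) set \<Rightarrow> (real^'n \<Rightarrow> real^'n^'n) \<Rightarrow> bool" where
  "metric_field U G \<longleftrightarrow> continuous_on U G \<and>
     (\<forall>x\<in>U. transpose (G x) = G x \<and> (\<forall>v. v \<noteq> 0 \<longrightarrow> 0 < v \<bullet> (G x *v v)))"

lemma positive_definite_det_nonzero:
  fixes A :: "real^'n^'n"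
  assumes "\<And>v. v \<noteq> 0 \<Longrightarrow> 0 < v \<bullet> (A *v v)"
  shows "det A \<noteq> 0"
proof -
  have "A *v x = 0 \<Longrightarrow> x = 0" for x
    using assms[of x] by force
  then have "invertible A"
    unfolding invertible_left_inverse matrix_left_invertible_ker by blast
  then show ?thesis by (simp add: invertible_det_nz)
qed

text \<open>The segment from the identity matrix to A consists of positive definite matrices, so the
  determinant has no zero along it and keeps the sign it has at the identity.\<close>

lemma positive_definite_det_pos:
  fixes A :: "real^'n^'n"
  assumes "\<And>v. v \<noteq> 0 \<Longrightarrow> 0 < v \<bullet> (A *v v)"
  shows "det A > 0"
proof (rule ccontr)
  assume n: "\<not> det A > 0"
  define B where "B t = (1 - t) *\<^sub>R mat 1 + t *\<^sub>R A" for t :: real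
  have nz: "det (B t) \<noteq> 0" if "0 \<le> t" "t \<le> 1" for t
  proof (rule positive_definite_det_nonzero)
    fix v :: "real^'n" assume v: "v \<noteq> 0"
    have "B t *v v = (1 - t) *\<^sub>R v + t *\<^sub>R (A *v v)"
      unfolding B_def by (simp add: matrix_vector_mult_add_rdistrib scaleR_matrix_vector_assoc[symmetric])
    then have "v \<bullet> (B t *v v) = (1 - t) * (v \<bullet> v) + t * (v \<bullet> (A *v v))"
      by (simp add: inner_add_right)
    moreover have "0 < v \<bullet> v" "0 < v \<bullet> (A *v v)" using v assms by auto
    ultimately show "0 < v \<bullet> (B t *v v)"
      using that by (cases "t = 0") (auto intro!: add_nonneg_pos mult_pos_pos mult_nonneg_nonneg)
  qed
  have "continuous_on {0..1} (\<lambda>t. det (B t))"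
    unfolding B_def by (intro continuous_on_det continuous_intros)
  moreover have "det (B 1) \<le> 0" "0 \<le> det (B 0)" using n by (auto simp: B_def)
  ultimately have "\<exists>t\<ge>0. t \<le> 1 \<and> det (B t) = 0"
    by (intro IVT2') auto
  then show False using nz by blast
qed

lemma metric_fieldD:
  assumes "metric_field U G"
  shows "continuous_on U G" "\<And>x. x \<in> U \<Longrightarrow> transpose (G x) = G x"
    "\<And>x v. x \<in> U \<Longrightarrow> v \<noteq> 0 \<Longrightarrow> 0 < v \<bullet> (G x *v v)" "\<And>x. x \<in> U \<Longrightarrow> det (G x) > 0"
    "continuous_on U (\<lambda>x. matrix_inv (G x))" "continuous_on U (\<lambda>x. sqrt (det (G x)))"
    "\<And>x v. x \<in> U \<Longrightarrow> v \<noteq> 0 \<Longrightarrow> 0 < v \<bullet> (matrix_inv (G x) *v v)"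
proof -
  show c: "continuous_on U G" and "\<And>x. x \<in> U \<Longrightarrow> transpose (G x) = G x"
    and pd: "\<And>x v. x \<in> U \<Longrightarrow> v \<noteq> 0 \<Longrightarrow> 0 < v \<bullet> (G x *v v)"
    using assms unfolding metric_field_def by blast+
  show d: "det (G x) > 0" if "x \<in> U" for x
    by (rule positive_definite_det_pos) (use pd that in blast)
  show "continuous_on U (\<lambda>x. matrix_inv (G x))"
    by (rule continuous_on_matrix_inv[OF c]) (use d in force)
  show "continuous_on U (\<lambda>x. sqrt (det (G x)))"
    by (intro continuous_on_real_sqrt continuous_on_det c)
  show "0 < v \<bullet> (matrix_inv (G x) *v v)" if "x \<in> U" "v \<noteq> 0" for x v
  proof -
    define w where "w = matrix_inv (G x) *v v"
    have "G x *v w = v"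
      using matrix_inv_mult(1)[of "G x"] d[OF that(1)] by (simp add: w_def matrix_vector_mul_assoc)
    moreover from this have "w \<noteq> 0" using that(2) by (metis matrix_vector_mult_0_right)
    ultimately show ?thesis using pd[OF that(1), of w] by (simp add: w_def inner_commute)
  qed
qed

lemma metric_field_subset: "metric_field U G \<Longrightarrow> U' \<subseteq> U \<Longrightarrow> metric_field U' G"
  unfolding metric_field_def using continuous_on_subset by blast

text \<open>Row vector times \<open>matrix_inv\<close>, the form in which the quadratic term of
  \<open>weak_integrand\<close> becomes an inner product with the gradient of the test function. The
  Helmholtz equation then reads: divergence of \<open>flux\<close> equals
  \<open>source\<close>.\<close>

definition flux :: "(real^'n \<Rightarrow> real^'n^'n) \<Rightarrow> (real^'n \<Rightarrow> real^'n) \<Rightarrow> real^'n \<Rightarrow> real^'n" where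
  "flux G Du x = (- sqrt (det (G x))) *\<^sub>R (Du x v* matrix_inv (G x))"

definition source :: "(real^'n \<Rightarrow> real^'n^'n) \<Rightarrow> real \<Rightarrow> (real^'n \<Rightarrow> real) \<Rightarrow> (real^'n \<Rightarrow> real) \<Rightarrow> real^'n \<Rightarrow> real" where
  "source G k u f x = sqrt (det (G x)) * (k\<^sup>2 * u x - f x)"

definition energy :: "(real^'n \<Rightarrow> real^'n^'n) \<Rightarrow> (real^'n \<Rightarrow> real^'n) \<Rightarrow> real^'n \<Rightarrow> real" where
  "energy G Du x = sqrt (det (G x)) * (Du x \<bullet> (matrix_inv (G x) *v Du x))"

lemma weak_integrand_eq:
  "weak_integrand G k u Du f \<psi> x = flux G Du x \<bullet> grad \<psi> x + source G k u f x * \<psi> x"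
  by (simp add: weak_integrand_def flux_def source_def dot_lmul_matrix algebra_simps)

lemma L2_loc_flux:
  assumes "open U" "metric_field U G" "L2_loc_vec U Du"
  shows "L2_loc_vec U (flux G Du)"
  unfolding L2_loc_vec_def
proof
  note M = metric_fieldD[OF assms(2)]
  fix i
  have e: "flux G Du x $ i = (\<Sum>j\<in>UNIV. (- sqrt (det (G x)) * matrix_inv (G x) $ j $ i) * Du x $ j)" for x
    by (simp add: flux_def vector_matrix_mult_nth sum_distrib_left mult_ac sum_negf)
  show "L2_loc U (\<lambda>x. flux G Du x $ i)"
    unfolding e using assms(1,3)
    by (intro L2_loc_sum L2_loc_continuous_mult continuous_on_mult continuous_on_minus continuous_on_component M(5,6))
      (auto simp: L2_loc_vec_def)
qed

lemma L2_loc_source: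
  assumes "open U" "metric_field U G" "L2_loc U u" "L2_loc U f"
  shows "L2_loc U (source G k u f)"
  unfolding source_def[abs_def] using assms
  by (intro L2_loc_continuous_mult metric_fieldD(6) L2_loc_diff L2_loc_cmult)

text \<open>The two integrands coincide; what is gained is the passage from smooth to C^1 test
  functions, possible since flux and source are locally square integrable.\<close>

lemma weak_helmholtz_iff_weak_div:
  assumes U: "open U" and G: "metric_field U G" and f: "L2_loc U f"
  shows "weak_helmholtz U G k u Du f \<longleftrightarrow> H1_loc_grad U u Du \<and> weak_div U (flux G Du) (source G k u f)"
proof -
  have O: "U \<in> sets lebesgue" using U by auto
  have *: "has_bochner_integral (lebesgue_on U) (weak_integrand G k u Du f \<phi>) 0 \<longleftrightarrow>
      has_bochner_integral lebesgue (\<lambda>x. flux G Du x \<bullet> grad \<phi> x + source G k u f x * \<phi> x) 0"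
    if \<phi>: "test_function U \<phi>" for \<phi>
  proof -
    obtain K where K: "K \<subseteq> U" "\<And>x. x \<notin> K \<Longrightarrow> \<phi> x = 0" "\<And>x. x \<notin> K \<Longrightarrow> grad \<phi> x = 0"
      using C1_compactE[OF test_function_C1_compact[OF \<phi>]] by metis
    have "\<phi> x = 0" "grad \<phi> x = 0" if "x \<notin> U" for x using K that by auto
    then show ?thesis
      unfolding weak_integrand_eq[abs_def] by (intro has_bochner_integral_lebesgue_on_iff[OF O]) simp
  qed
  show ?thesis
  proof
    assume w: "weak_helmholtz U G k u Du f"
    then have H: "H1_loc_grad U u Du" by (simp add: weak_helmholtz_def)
    have "L2_loc U u" "L2_loc_vec U Du" using H by (auto simp: H1_loc_grad_def L2_loc_vec_def)
    then have "weak_div U (flux G Du) (source G k u f)"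
    proof (intro weak_divI_test[OF U] L2_loc_flux[OF U G] L2_loc_source[OF U G] f)
      fix \<phi> assume \<phi>: "test_function U \<phi>"
      show "(\<integral>x. flux G Du x \<bullet> grad \<phi> x + source G k u f x * \<phi> x \<partial>lebesgue) = 0"
        using *[OF \<phi>] w \<phi> by (intro has_bochner_integral_integral_eq) (simp add: weak_helmholtz_def)
    qed
    then show "H1_loc_grad U u Du \<and> weak_div U (flux G Du) (source G k u f)" using H by blast
  next
    assume w: "H1_loc_grad U u Du \<and> weak_div U (flux G Du) (source G k u f)"
    then show "weak_helmholtz U G k u Du f"
      unfolding weak_helmholtz_def using * weak_div_test by blast
  qed
qed

lemma H1_loc_grad_subset:
  assumes "H1_loc_grad U u Du" "open U" "open U'" "U' \<subseteq> U"
  shows "H1_loc_grad U' u Du"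
  using assms L2_loc_subset[of U] L2_loc_vec_subset[of U] weak_div_subset[of U]
  unfolding H1_loc_grad_iff_weak_div[OF assms(2)] H1_loc_grad_iff_weak_div[OF assms(3)] by blast

lemma weak_helmholtz_subset:
  assumes "weak_helmholtz U G k u Du f" "open U" "open U'" "U' \<subseteq> U" "metric_field U G" "L2_loc U f"
  shows "weak_helmholtz U' G k u Du f"
  using assms H1_loc_grad_subset[OF _ assms(2-4)] weak_div_subset[OF _ assms(4)] L2_loc_subset[OF assms(6,4)]
    metric_field_subset[OF assms(5,4)]
  by (simp add: weak_helmholtz_iff_weak_div)

text \<open>The Jacobian of \<sigma> at \<tau> x inverts that of \<tau> at x. Hence the inverse
  metric is conjugated by it, and the volume density picks up the absolute Jacobian
  determinant.\<close>

lemma pullback_inverse: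
  assumes "C1_diffeo U U' \<tau> \<sigma>" "x \<in> U" "det (G (\<tau> x)) \<noteq> 0"
  shows "matrix_inv (pullback_metric \<tau> G x) = jac \<sigma> (\<tau> x) ** matrix_inv (G (\<tau> x)) ** transpose (jac \<sigma> (\<tau> x))"
    and "sqrt (det (pullback_metric \<tau> G x)) = \<bar>det (jac \<tau> x)\<bar> * sqrt (det (G (\<tau> x)))"
proof -
  let ?J = "jac \<tau> x" and ?S = "jac \<sigma> (\<tau> x)" and ?G = "G (\<tau> x)"
  note J = C1_diffeo_jac[OF assms(1,2)]
  have "(transpose ?J ** ?G ** ?J) ** (?S ** matrix_inv ?G ** transpose ?S)
    = transpose ?J ** ?G ** (?J ** ?S) ** matrix_inv ?G ** transpose ?S"
    by (simp add: matrix_mul_assoc)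
  also have "\<dots> = transpose ?J ** (?G ** matrix_inv ?G) ** transpose ?S"
    unfolding J(2) by (simp add: matrix_mul_assoc)
  also have "\<dots> = transpose (?S ** ?J)"
    unfolding matrix_inv_mult(1)[OF assms(3)] by (simp add: matrix_transpose_mul)
  also have "\<dots> = mat 1" unfolding J(1) by simp
  finally show "matrix_inv (pullback_metric \<tau> G x) = ?S ** matrix_inv ?G ** transpose ?S"
    unfolding pullback_metric_jac by (rule matrix_inv_unique)
  have "det (pullback_metric \<tau> G x) = (det ?J)\<^sup>2 * det ?G"
    by (simp add: pullback_metric_jac det_mul power2_eq_square)
  then show "sqrt (det (pullback_metric \<tau> G x)) = \<bar>det ?J\<bar> * sqrt (det ?G)"
    by (simp add: real_sqrt_mult)
qed

lemma vector_matrix_mul_assoc: "(v v* A) v* B = v v* (A ** (B :: real^'n^'m))"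
  by (metis matrix_transpose_mul matrix_vector_mul_assoc transpose_matrix_vector)

text \<open>The flux of the pulled back data is the Piola transform of the flux, exactly the field
  in \<open>C1_diffeo_weak_div\<close>. This is the coordinate invariance of the equation.\<close>

lemma pullback_flux:
  assumes "C1_diffeo U U' \<tau> \<sigma>" "x \<in> U" "det (G (\<tau> x)) \<noteq> 0"
  shows "flux (pullback_metric \<tau> G) (\<lambda>x. Du (\<tau> x) v* jac \<tau> x) x =
    \<bar>det (jac \<tau> x)\<bar> *\<^sub>R (jac \<sigma> (\<tau> x) *v flux G Du (\<tau> x))"
proof -
  let ?J = "jac \<tau> x" and ?S = "jac \<sigma> (\<tau> x)" and ?G = "G (\<tau> x)"
  note J = C1_diffeo_jac[OF assms(1,2)]
  have "(Du (\<tau> x) v* ?J) v* (?S ** matrix_inv ?G ** transpose ?S) = Du (\<tau> x) v* ((?J ** ?S) ** matrix_inv ?G ** transpose ?S)"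
    by (simp add: vector_matrix_mul_assoc matrix_mul_assoc)
  also have "\<dots> = ?S *v (Du (\<tau> x) v* matrix_inv ?G)"
    unfolding J(2) by (simp add: vector_matrix_mul_assoc[symmetric])
  finally show ?thesis
    unfolding flux_def pullback_inverse[where G = G, OF assms]
    by (simp only: matrix_vector_mult_scaleR scaleR_scaleR) simp
qed

lemma pullback_source:
  assumes "C1_diffeo U U' \<tau> \<sigma>" "x \<in> U" "det (G (\<tau> x)) \<noteq> 0"
  shows "source (pullback_metric \<tau> G) k (\<lambda>x. u (\<tau> x)) (\<lambda>x. f (\<tau> x)) x = \<bar>det (jac \<tau> x)\<bar> * source G k u f (\<tau> x)"
  unfolding source_def pullback_inverse[where G = G, OF assms] by simp

lemma pullback_energy:
  assumes "C1_diffeo U U' \<tau> \<sigma>" "x \<in> U" "det (G (\<tau> x)) \<noteq> 0"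
  shows "energy (pullback_metric \<tau> G) (\<lambda>x. Du (\<tau> x) v* jac \<tau> x) x = \<bar>det (jac \<tau> x)\<bar> * energy G Du (\<tau> x)"
proof -
  let ?J = "jac \<tau> x" and ?S = "jac \<sigma> (\<tau> x)" and ?G = "G (\<tau> x)" and ?v = "Du (\<tau> x)"
  note J = C1_diffeo_jac[OF assms(1,2)]
  have vJS: "(?v v* ?J) v* ?S = ?v" unfolding vector_matrix_mul_assoc J(2) by simp
  have "(?S ** matrix_inv ?G ** transpose ?S) *v (?v v* ?J) = ?S *v (matrix_inv ?G *v ((?v v* ?J) v* ?S))"
    by (simp flip: matrix_vector_mul_assoc)
  also have "\<dots> = ?S *v (matrix_inv ?G *v ?v)" unfolding vJS ..
  finally have "(?v v* ?J) \<bullet> ((?S ** matrix_inv ?G ** transpose ?S) *v (?v v* ?J)) = ?v \<bullet> (matrix_inv ?G *v ?v)"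
    using dot_lmul_matrix[of "?v v* ?J" ?S "matrix_inv ?G *v ?v"] vJS by simp
  then show ?thesis unfolding energy_def pullback_inverse[where G = G, OF assms] by simp
qed

lemma pullback_weak_integrand:
  assumes "C1_diffeo U U' \<tau> \<sigma>" "x \<in> U" "det (G (\<tau> x)) \<noteq> 0" and \<psi>: "GDERIV \<psi> (\<tau> x) :> grad \<psi> (\<tau> x)"
  shows "weak_integrand (pullback_metric \<tau> G) k (\<lambda>x. u (\<tau> x)) (\<lambda>x. Du (\<tau> x) v* jac \<tau> x) (\<lambda>x. f (\<tau> x)) (\<lambda>x. \<psi> (\<tau> x)) x
    = \<bar>det (jac \<tau> x)\<bar> * weak_integrand G k u Du f \<psi> (\<tau> x)"
proof -
  let ?J = "jac \<tau> x" and ?S = "jac \<sigma> (\<tau> x)"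
  note J = C1_diffeo_jac[OF assms(1,2)]
  have g: "grad (\<lambda>x. \<psi> (\<tau> x)) x = grad \<psi> (\<tau> x) v* ?J"
    by (rule GDERIV_imp_grad[OF GDERIV_compose_jac[OF C1_diffeoD(5)[OF assms(1,2)] \<psi>]])
  have "(?S *v flux G Du (\<tau> x)) \<bullet> (grad \<psi> (\<tau> x) v* ?J) = grad \<psi> (\<tau> x) \<bullet> (?J *v (?S *v flux G Du (\<tau> x)))"
    using dot_lmul_matrix[of "grad \<psi> (\<tau> x)" ?J "?S *v flux G Du (\<tau> x)"] by (simp add: inner_commute)
  also have "\<dots> = flux G Du (\<tau> x) \<bullet> grad \<psi> (\<tau> x)"
    by (simp add: matrix_vector_mul_assoc J(2) inner_commute)
  finally show ?thesis
    unfolding weak_integrand_eq g pullback_flux[where G = G, OF assms(1-3)] pullback_source[where G = G, OF assms(1-3)] by (simp add: algebra_simps)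
qed

lemma metric_field_pullback:
  assumes "C1_diffeo U U' \<tau> \<sigma>" "metric_field U' G"
  shows "metric_field U (pullback_metric \<tau> G)"
  unfolding metric_field_def
proof (intro conjI ballI allI impI)
  note D = C1_diffeoD[OF assms(1)]
  note M = metric_fieldD[OF assms(2)]
  show "continuous_on U (pullback_metric \<tau> G)"
    unfolding pullback_metric_jac[abs_def]
    by (intro continuous_on_matrix_mult continuous_on_transpose D(6) continuous_on_compose2[OF M(1) D(7)]) (use D(3) in auto)
  fix x assume x: "x \<in> U"
  show "transpose (pullback_metric \<tau> G x) = pullback_metric \<tau> G x"
    using M(2)[OF D(3)[OF x]] by (simp add: pullback_metric_jac matrix_transpose_mul matrix_mul_assoc)
  fix v :: "real^'a" assume v: "v \<noteq> 0"
  have "jac \<tau> x *v v \<noteq> 0"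
  proof
    assume "jac \<tau> x *v v = 0"
    then have "jac \<sigma> (\<tau> x) *v (jac \<tau> x *v v) = 0" by simp
    then show False using v C1_diffeo_jac(1)[OF assms(1) x] by (simp add: matrix_vector_mul_assoc)
  qed
  then have "0 < (jac \<tau> x *v v) \<bullet> (G (\<tau> x) *v (jac \<tau> x *v v))" using M(3)[OF D(3)[OF x]] by blast
  also have "\<dots> = v \<bullet> (pullback_metric \<tau> G x *v v)"
    unfolding pullback_metric_jac
    by (simp flip: matrix_vector_mul_assoc) (metis dot_lmul_matrix inner_commute)
  finally show "0 < v \<bullet> (pullback_metric \<tau> G x *v v)" .
qed

lemma weak_div_cong:
  assumes "\<And>x. x \<in> U \<Longrightarrow> X x = X' x" "\<And>x. x \<in> U \<Longrightarrow> Y x = Y' x" "weak_div U X Y"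
  shows "weak_div U X' Y'"
  unfolding weak_div_def
proof (intro allI impI)
  fix \<phi> assume \<phi>: "C1_compact U \<phi>"
  obtain K where K: "K \<subseteq> U" "\<And>x. x \<notin> K \<Longrightarrow> \<phi> x = 0" "\<And>x. x \<notin> K \<Longrightarrow> grad \<phi> x = 0"
    using C1_compactE[OF \<phi>] by metis
  have "(\<lambda>x. X x \<bullet> grad \<phi> x + Y x * \<phi> x) = (\<lambda>x. X' x \<bullet> grad \<phi> x + Y' x * \<phi> x)"
  proof
    show "X x \<bullet> grad \<phi> x + Y x * \<phi> x = X' x \<bullet> grad \<phi> x + Y' x * \<phi> x" for x
    proof (cases "x \<in> U")
      case False
      then have "x \<notin> K" using K(1) by auto
      then show ?thesis using K(2,3) by simp
    qed (simp add: assms(1,2))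
  qed
  then show "has_bochner_integral lebesgue (\<lambda>x. X' x \<bullet> grad \<phi> x + Y' x * \<phi> x) 0"
    using assms(3) \<phi> unfolding weak_div_def by auto
qed

lemma weak_helmholtz_pullback:
  fixes \<tau> :: "real^'n::{finite,wellorder} \<Rightarrow> real^'n::_"
  assumes diff: "C1_diffeo U U' \<tau> \<sigma>" and G: "metric_field U' G" and f: "L2_loc U' f"
    and w: "weak_helmholtz U' G k u Du f"
  shows "weak_helmholtz U (pullback_metric \<tau> G) k (\<lambda>x. u (\<tau> x)) (\<lambda>x. Du (\<tau> x) v* jac \<tau> x) (\<lambda>x. f (\<tau> x))"
proof -
  note D = C1_diffeoD[OF diff]
  have H: "H1_loc_grad U' u Du" and wd: "weak_div U' (flux G Du) (source G k u f)"
    using w unfolding weak_helmholtz_iff_weak_div[OF D(2) G f] by auto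
  have nz: "det (G (\<tau> x)) \<noteq> 0" if "x \<in> U" for x
    using metric_fieldD(4)[OF G D(3)[OF that]] by simp
  have "weak_div U (flux (pullback_metric \<tau> G) (\<lambda>x. Du (\<tau> x) v* jac \<tau> x)) (source (pullback_metric \<tau> G) k (\<lambda>x. u (\<tau> x)) (\<lambda>x. f (\<tau> x)))"
    by (rule weak_div_cong[OF _ _ C1_diffeo_weak_div[OF diff wd]])
      (simp_all add: pullback_flux[OF diff] pullback_source[OF diff] nz)
  then show ?thesis
    unfolding weak_helmholtz_iff_weak_div[OF D(1) metric_field_pullback[OF diff G] C1_diffeo_L2_loc[OF diff f]]
    using C1_diffeo_H1_loc_grad[OF diff H] by blast
qed

text \<open>The energy is quadratic in the gradient, so its extrema over the compact product of
  \<open>K\<close> with the unit sphere bound it. One pair of constants is made to serve the volume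
  density as well.\<close>

lemma metric_field_bounds:
  fixes G :: "real^'n \<Rightarrow> real^'n^'n"
  assumes G: "metric_field U G" and K: "compact K" "K \<subseteq> U"
  obtains c C where "c > 0" "C > 0" "\<And>x. x \<in> K \<Longrightarrow> c \<le> sqrt (det (G x))" "\<And>x. x \<in> K \<Longrightarrow> sqrt (det (G x)) \<le> C"
    "\<And>x Du. x \<in> K \<Longrightarrow> c * (norm (Du x))\<^sup>2 \<le> energy G Du x" "\<And>x Du. x \<in> K \<Longrightarrow> energy G Du x \<le> C * (norm (Du x))\<^sup>2"
proof (cases "K = {}")
  case True
  then show ?thesis using that[of 1 1] by auto
next
  case False
  note M = metric_fieldD[OF G]
  define e where "e z = sqrt (det (G (fst z))) * (snd z \<bullet> (matrix_inv (G (fst z)) *v snd z))" for z :: "(real^'n) \<times> (real^'n)"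
  let ?Z = "K \<times> sphere (0::real^'n) 1"
  have Z: "compact ?Z" "?Z \<noteq> {}" using K False by (auto intro: compact_Times)
  have f: "continuous_on ?Z fst" "fst ` ?Z \<subseteq> U" using K by (auto intro: continuous_intros)
  have ec: "continuous_on ?Z e"
    unfolding e_def
    by (intro continuous_on_mult continuous_on_inner continuous_on_matrix_vector_mult
        continuous_on_compose2[OF M(5) f] continuous_on_compose2[OF M(6) f] continuous_on_snd continuous_on_id)
  have ep: "e z > 0" if "z \<in> ?Z" for z
  proof -
    have z: "fst z \<in> U" "snd z \<noteq> 0" using that K(2) by auto
    show ?thesis unfolding e_def using M(4)[OF z(1)] M(7)[OF z] by simp
  qed
  obtain z1 where z1: "z1 \<in> ?Z" "\<And>z. z \<in> ?Z \<Longrightarrow> e z1 \<le> e z" using continuous_attains_inf[OF Z ec] by blast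
  obtain z2 where z2: "z2 \<in> ?Z" "\<And>z. z \<in> ?Z \<Longrightarrow> e z \<le> e z2" using continuous_attains_sup[OF Z ec] by blast
  have sc: "continuous_on K (\<lambda>x. sqrt (det (G x)))" using M(6) K(2) continuous_on_subset by blast
  have sp: "sqrt (det (G x)) > 0" if "x \<in> K" for x using M(4) K(2) that by auto
  obtain x1 where x1: "x1 \<in> K" "\<And>x. x \<in> K \<Longrightarrow> sqrt (det (G x1)) \<le> sqrt (det (G x))"
    using continuous_attains_inf[OF K(1) False sc] by blast
  obtain x2 where x2: "x2 \<in> K" "\<And>x. x \<in> K \<Longrightarrow> sqrt (det (G x)) \<le> sqrt (det (G x2))"
    using continuous_attains_sup[OF K(1) False sc] by blast
  define c where "c = min (e z1) (sqrt (det (G x1)))"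
  define C where "C = max (e z2) (sqrt (det (G x2)))"
  have hom: "energy G Du x = (norm (Du x))\<^sup>2 * e (x, sgn (Du x))" for Du x
  proof (cases "Du x = 0")
    case False
    define n where "n = norm (Du x)"
    have v: "Du x = n *\<^sub>R sgn (Du x)" using False by (simp add: n_def sgn_div_norm)
    have "energy G Du x = sqrt (det (G x)) * ((n *\<^sub>R sgn (Du x)) \<bullet> (matrix_inv (G x) *v (n *\<^sub>R sgn (Du x))))"
      unfolding energy_def using v by metis
    also have "\<dots> = n\<^sup>2 * e (x, sgn (Du x))"
      by (simp add: e_def matrix_vector_mult_scaleR power2_eq_square)
    finally show ?thesis by (simp add: n_def)
  qed (simp add: energy_def)
  show ?thesis
  proof (rule that)
    show "c > 0" using ep[OF z1(1)] sp[OF x1(1)] by (simp add: c_def)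
    show "C > 0" using ep[OF z2(1)] by (simp add: C_def)
    show "c \<le> sqrt (det (G x))" "sqrt (det (G x)) \<le> C" if "x \<in> K" for x
      unfolding c_def C_def by (rule min.coboundedI2[OF x1(2)[OF that]], rule max.coboundedI2[OF x2(2)[OF that]])
    show "c * (norm (Du x))\<^sup>2 \<le> energy G Du x" "energy G Du x \<le> C * (norm (Du x))\<^sup>2" if "x \<in> K" for x Du
    proof -
      have *: "c \<le> e (x, sgn (Du x)) \<and> e (x, sgn (Du x)) \<le> C" if "Du x \<noteq> 0"
      proof -
        have "(x, sgn (Du x)) \<in> ?Z" using \<open>x \<in> K\<close> that by (simp add: norm_sgn)
        then show ?thesis using z1(2) z2(2) unfolding c_def C_def by (meson max.coboundedI1 min.coboundedI1)
      qed
      then show "c * (norm (Du x))\<^sup>2 \<le> energy G Du x" "energy G Du x \<le> C * (norm (Du x))\<^sup>2"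
        unfolding hom by (cases "Du x = 0"; simp add: mult.commute mult_left_mono)+
    qed
  qed
qed


section \<open>Removable points\<close>

text \<open>Dyadic balls around p: where the distance exceeds R / 2^(n+1) the integrand is at most
  4^(n+1) / R^2, and the ball of radius R / 2^n has volume of order R^3 / 8^n, so the sum is
  geometric with ratio 1/2. This is where dimension three enters.\<close>

lemma inverse_square_integrable:
  fixes p :: "real^3"
  assumes "compact K"
  shows "integrable lebesgue (\<lambda>x. indicat_real K x * (1 / (norm (x - p))\<^sup>2))"
proof -
  obtain R where R: "R > 0" "K \<subseteq> ball p R"
    using bounded_subset_ballD[OF compact_imp_bounded[OF assms], of p] by blast
  define A where "A n = cball p (R / 2 ^ n)" for n
  let ?h = "\<lambda>n x. ennreal (4 ^ Suc n / R\<^sup>2) * indicator (A n) x"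
  have le: "ennreal (indicat_real K x * (1 / (norm (x - p))\<^sup>2)) \<le> (\<Sum>n. ?h n x)" for x
  proof (cases "x \<in> K \<and> x \<noteq> p")
    case True
    define r where "r = norm (x - p)"
    have r: "0 < r" "r < R" using True R(2) by (auto simp: r_def dist_norm norm_minus_commute)
    have "\<exists>n. r > R / 2 ^ n"
    proof -
      obtain n where "R / r < 2 ^ n" using real_arch_pow[of 2 "R / r"] by auto
      then show ?thesis using r by (auto simp: field_simps intro!: exI[of _ n])
    qed
    then obtain m where m: "r > R / 2 ^ m" "\<And>k. k < m \<Longrightarrow> \<not> r > R / 2 ^ k"
      using exists_least_iff[of "\<lambda>n. r > R / 2 ^ n"] by auto
    have "m \<noteq> 0" using m(1) r by (cases m) auto
    then obtain n where n: "m = Suc n" by (cases m) auto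
    have rn: "r \<le> R / 2 ^ n" "r > R / 2 ^ Suc n" using m n by force+
    have "(R / 2 ^ Suc n)\<^sup>2 \<le> r\<^sup>2" using rn(2) R(1) by (intro power_mono) auto
    moreover have "(2 ^ Suc n)\<^sup>2 = (4::real) ^ Suc n"
      unfolding power2_eq_square power_mult_distrib[symmetric] by simp
    ultimately have "R\<^sup>2 / 4 ^ Suc n \<le> r\<^sup>2" by (simp only: power_divide)
    then have "1 / r\<^sup>2 \<le> 4 ^ Suc n / R\<^sup>2" using r R(1) by (simp add: field_simps)
    moreover have "x \<in> A n" using rn(1) by (simp add: A_def r_def dist_norm norm_minus_commute)
    ultimately have "ennreal (indicat_real K x * (1 / (norm (x - p))\<^sup>2)) \<le> ?h n x"
      using True by (simp add: r_def ennreal_leI)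
    also have "\<dots> \<le> (\<Sum>n. ?h n x)"
    proof -
      have "f n \<le> suminf f" for f :: "nat \<Rightarrow> ennreal"
        using sum_le_suminf[of f "{n}"] by simp
      then show ?thesis .
    qed
    finally show ?thesis .
  next
    case False
    then have "indicat_real K x * (1 / (norm (x - p))\<^sup>2) = 0" by auto
    then show ?thesis by (metis ennreal_0 zero_le)
  qed
  define v where "v = unit_ball_vol (real DIM(real^3))"
  have v: "v \<ge> 0" by (simp add: v_def)
  have A_em: "emeasure lebesgue (A n) = ennreal (v * (R / 2 ^ n) ^ 3)" for n
    unfolding A_def v_def using R(1) by (simp add: emeasure_cball)
  have "(\<integral>\<^sup>+x. ennreal (indicat_real K x * (1 / (norm (x - p))\<^sup>2)) \<partial>lebesgue) \<le> (\<integral>\<^sup>+x. (\<Sum>n. ?h n x) \<partial>lebesgue)"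
    by (intro nn_integral_mono le)
  also have "\<dots> = (\<Sum>n. (\<integral>\<^sup>+x. ?h n x \<partial>lebesgue))"
  proof (rule nn_integral_suminf)
    fix n
    have [measurable]: "A n \<in> sets lebesgue" by (simp add: A_def)
    show "?h n \<in> borel_measurable lebesgue" by measurable
  qed
  also have "\<dots> = (\<Sum>n. ennreal (4 * v * R * (1 / 2) ^ n))"
  proof (rule suminf_cong)
    fix n
    have "(\<integral>\<^sup>+x. ?h n x \<partial>lebesgue) = ennreal (4 ^ Suc n / R\<^sup>2) * ennreal (v * (R / 2 ^ n) ^ 3)"
    proof -
      have AS: "A n \<in> sets lebesgue" by (simp add: A_def)
      show ?thesis unfolding nn_integral_cmult_indicator[OF AS] A_em ..
    qed
    also have "\<dots> = ennreal (4 ^ Suc n / R\<^sup>2 * (v * (R / 2 ^ n) ^ 3))"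
      using v R(1) by (intro ennreal_mult[symmetric]) auto
    also have "4 ^ Suc n / R\<^sup>2 * (v * (R / 2 ^ n) ^ 3) = 4 * v * R * (1 / 2) ^ n"
    proof -
      have "(4::real) ^ n = 2 ^ n * 2 ^ n" by (simp flip: power_mult_distrib)
      then show ?thesis using R(1) by (simp add: field_simps power2_eq_square power3_eq_cube)
    qed
    finally show "(\<integral>\<^sup>+x. ?h n x \<partial>lebesgue) = ennreal (4 * v * R * (1 / 2) ^ n)" .
  qed
  also have "\<dots> < \<infinity>"
  proof -
    have s: "summable (\<lambda>n. 4 * v * R * (1 / 2) ^ n :: real)" by (intro summable_mult summable_geometric) auto
    show ?thesis
      using v R(1) by (subst suminf_ennreal2[OF _ s]) auto
  qed
  finally have fin: "(\<integral>\<^sup>+x. ennreal (indicat_real K x * (1 / (norm (x - p))\<^sup>2)) \<partial>lebesgue) < \<infinity>" .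
  have "(\<lambda>x. 1 / (norm (x - p))\<^sup>2) \<in> borel_measurable lebesgue"
    by (intro measurable_completion) measurable
  then have m: "(\<lambda>x. indicat_real K x * (1 / (norm (x - p))\<^sup>2)) \<in> borel_measurable lebesgue"
    by (intro borel_measurable_times borel_measurable_indicator compact_in_sets_lebesgue[OF assms])
  show ?thesis
    unfolding integrable_iff_bounded
    using m fin by (auto simp: abs_mult)
qed

text \<open>Cutoffs \<open>\<eta>(n (x - p))\<close> have gradients bounded by \<open>C / \<bar>x - p\<bar>\<close>, uniformly in \<open>n\<close>, and this
  is locally square integrable in dimension three.\<close>

lemma weak_div_point_test:
  fixes p :: "real^3"
  assumes \<Omega>: "open \<Omega>" and X: "L2_loc_vec \<Omega> X" and Y: "L2_loc \<Omega> Y" and d: "weak_div (\<Omega> - {p}) X Y"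
    and \<phi>: "\<And>x. x \<in> \<Omega> - {p} \<Longrightarrow> GDERIV \<phi> x :> grad \<phi> x" "continuous_on (\<Omega> - {p}) (grad \<phi>)"
    and K: "compact K" "K \<subseteq> \<Omega>" "\<And>x. x \<in> \<Omega> - {p} \<Longrightarrow> x \<notin> K \<Longrightarrow> \<phi> x = 0"
    and C: "\<And>x. x \<in> \<Omega> - {p} \<Longrightarrow> \<bar>\<phi> x\<bar> \<le> C" "\<And>x. x \<in> \<Omega> - {p} \<Longrightarrow> norm (grad \<phi> x) \<le> C / norm (x - p)"
  shows "has_bochner_integral (lebesgue_on (\<Omega> - {p})) (\<lambda>x. X x \<bullet> grad \<phi> x + Y x * \<phi> x) 0"
proof -
  define U where "U = \<Omega> - {p}"
  have U: "open U" "U \<subseteq> \<Omega>" "p \<notin> U" using \<Omega> by (auto simp: U_def)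
  have US: "U \<in> sets lebesgue" using U by auto
  note \<phi> = \<phi>[folded U_def] and K = K[folded U_def] and C = C[folded U_def]
  have gK: "grad \<phi> x = 0" if "x \<in> U" "x \<notin> K" for x
  proof -
    have "grad \<phi> x = grad (\<lambda>_. 0) x"
      by (rule grad_cong_open[OF open_Diff[OF U(1) compact_imp_closed[OF K(1)]]]) (use that K(3) in auto)
    then show ?thesis using GDERIV_imp_grad[OF GDERIV_const] by metis
  qed
  have sub: "cball 0 (1 / 2) \<subseteq> ball (0::real^3) 1" by auto
  obtain \<zeta> :: "real^3 \<Rightarrow> real" and W where \<zeta>: "test_function (ball 0 1) \<zeta>" "\<And>x. 0 \<le> \<zeta> x" "\<And>x. \<zeta> x \<le> 1" "cball 0 (1 / 2) \<subseteq> W" "\<And>x. x \<in> W \<Longrightarrow> \<zeta> x = 1"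
    using bump_exists[OF compact_cball open_ball sub] by metis
  note \<zeta>c = test_function_C1_compact[OF \<zeta>(1)]
  obtain L where L: "compact L" "L \<subseteq> ball 0 1" "\<And>x. x \<notin> L \<Longrightarrow> \<zeta> x = 0" "\<And>x. x \<notin> L \<Longrightarrow> grad \<zeta> x = 0"
    using C1_compactE[OF \<zeta>c] by metis
  obtain B where B: "B > 0" "\<And>x. norm (grad \<zeta> x) \<le> B"
    using continuous_compact_support_bounded[OF C1_compact_continuous_grad[OF \<zeta>c] L(1,4)] by blast
  \<comment> \<open>\<eta> n vanishes within distance 1 / (2 (n + 1)) of p and is 1 beyond distance
    1 / (n + 1). \<open>Suc n\<close> keeps the scale positive for n = 0.\<close>
  define \<eta> where "\<eta> n x = 1 - \<zeta> (real (Suc n) *\<^sub>R (x - p))" for n x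
  define D\<eta> where "D\<eta> n x = - (real (Suc n) *\<^sub>R grad \<zeta> (real (Suc n) *\<^sub>R (x - p)))" for n x
  have \<eta>D: "GDERIV (\<eta> n) x :> D\<eta> n x" for n x
  proof -
    have "(\<zeta> has_derivative (\<lambda>h. h \<bullet> grad \<zeta> (real (Suc n) *\<^sub>R (x - p)))) (at (real (Suc n) *\<^sub>R (x - p)))"
      using C1_compact_GDERIV[OF \<zeta>c] unfolding gderiv_def .
    moreover have "((\<lambda>x. real (Suc n) *\<^sub>R (x - p)) has_derivative (\<lambda>h. real (Suc n) *\<^sub>R h)) (at x)"
      by (auto intro!: derivative_eq_intros)
    ultimately have "((\<lambda>x. \<zeta> (real (Suc n) *\<^sub>R (x - p))) has_derivative
        (\<lambda>h. (real (Suc n) *\<^sub>R h) \<bullet> grad \<zeta> (real (Suc n) *\<^sub>R (x - p)))) (at x)"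
      by (rule has_derivative_compose[rotated])
    then have "((\<lambda>x. 1 - \<zeta> (real (Suc n) *\<^sub>R (x - p))) has_derivative
        (\<lambda>h. 0 - (real (Suc n) *\<^sub>R h) \<bullet> grad \<zeta> (real (Suc n) *\<^sub>R (x - p)))) (at x)"
      by (intro has_derivative_diff has_derivative_const)
    then show ?thesis unfolding gderiv_def \<eta>_def[abs_def] D\<eta>_def by simp
  qed
  have D\<eta>c: "continuous_on UNIV (D\<eta> n)" for n
    unfolding D\<eta>_def
    by (rule continuous_on_minus, rule continuous_on_scaleR, rule continuous_on_const,
        rule continuous_on_compose2[OF C1_compact_continuous_grad[OF \<zeta>c]])
      (auto intro!: continuous_intros)
  have \<eta>b: "\<bar>\<eta> n x\<bar> \<le> 1" for n x using \<zeta>(2,3) by (simp add: \<eta>_def)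
  \<comment> \<open>The gradient carries a factor n + 1 but is nonzero only where (n + 1) times the
    distance to p is below 1. At x = p the right side is 0 by the convention on division, and the
    left side is 0 because \<zeta> is constant near the origin.\<close>
  have D\<eta>b: "norm (D\<eta> n x) \<le> B / norm (x - p)" for n x
  proof (cases "real (Suc n) *\<^sub>R (x - p) \<in> L")
    case True
    then have 1: "real (Suc n) * norm (x - p) < 1" using L(2) by auto
    show ?thesis
    proof (cases "x = p")
      case False
      then have "real (Suc n) \<le> 1 / norm (x - p)" using 1 by (simp add: field_simps)
      then have "real (Suc n) * norm (grad \<zeta> (real (Suc n) *\<^sub>R (x - p))) \<le> 1 / norm (x - p) * B"
        by (intro mult_mono B(2)) auto
      then show ?thesis by (simp add: D\<eta>_def)
    next
      case True
      have "grad \<zeta> 0 = 0"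
      proof -
        have "grad \<zeta> 0 = grad (\<lambda>_. 1) 0"
          by (rule grad_cong_open[of "ball 0 (1 / 2)"]) (use \<zeta>(4,5) in \<open>auto simp: subset_iff\<close>)
        then show ?thesis using GDERIV_imp_grad[OF GDERIV_const] by metis
      qed
      then show ?thesis using True by (simp add: D\<eta>_def)
    qed
  qed (use B(1) in \<open>simp add: D\<eta>_def L(4)\<close>)
  have \<eta>_near: "\<eta> n x = 0" if "real (Suc n) * norm (x - p) \<le> 1 / 2" for n x
  proof -
    have "real (Suc n) *\<^sub>R (x - p) \<in> W" using that \<zeta>(4) by (auto simp: subset_iff)
    then show ?thesis using \<zeta>(5) by (simp add: \<eta>_def)
  qed
  define f where "f x = X x \<bullet> grad \<phi> x + Y x * \<phi> x" for x
  define F' where "F' n x = \<eta> n x * f x + \<phi> x * (X x \<bullet> D\<eta> n x)" for n x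
  have F'0: "has_bochner_integral (lebesgue_on U) (F' n) 0" for n
  proof -
    define \<psi> where "\<psi> x = (if x \<in> U then \<eta> n x * \<phi> x else 0)" for x
    define D\<psi> where "D\<psi> x = \<eta> n x *\<^sub>R grad \<phi> x + \<phi> x *\<^sub>R D\<eta> n x" for x
    have G: "GDERIV \<psi> x :> D\<psi> x" if x: "x \<in> U" for x
    proof -
      have "GDERIV (\<lambda>x. \<eta> n x * \<phi> x) x :> D\<psi> x"
        unfolding D\<psi>_def by (rule GDERIV_mult[OF \<eta>D \<phi>(1)[OF x]])
      moreover have "GDERIV (\<lambda>x. \<eta> n x * \<phi> x) x :> d \<longleftrightarrow> GDERIV \<psi> x :> d" for d
        by (rule GDERIV_cong_open[OF U(1) x]) (simp add: \<psi>_def)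
      ultimately show ?thesis by blast
    qed
    \<comment> \<open>Radius within which \<eta> n vanishes: removing this ball from
      \<open>K\<close> leaves a compact subset of the punctured set, so the truncated function is an
      admissible test.\<close>
    define r where "r = 1 / (2 * real (Suc n))"
    have r: "r > 0" by (simp add: r_def)
    have "continuous_on U \<phi>"
      by (rule continuous_at_imp_continuous_on) (use \<phi>(1) GDERIV_continuous in blast)
    moreover have "continuous_on U (\<eta> n)"
      by (rule continuous_at_imp_continuous_on) (use \<eta>D GDERIV_continuous in blast)
    ultimately have D\<psi>c: "continuous_on U D\<psi>"
      unfolding D\<psi>_def using \<phi>(2) continuous_on_subset[OF D\<eta>c subset_UNIV]
      by (intro continuous_on_add continuous_on_scaleR)
    have \<psi>c: "C1_compact U \<psi>"
    proof (rule C1_compactI[OF U(1) _ _ _ G D\<psi>c])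
      show "compact (K - ball p r)" using K(1) by (intro compact_diff) auto
      show "K - ball p r \<subseteq> U" using K(2) r by (auto simp: U_def)
      show "\<psi> x = 0" if "x \<notin> K - ball p r" for x
      proof (cases "x \<in> U \<and> x \<in> K")
        case True
        then have "norm (x - p) < r" using that by (simp add: dist_norm norm_minus_commute)
        then have "real (Suc n) * norm (x - p) \<le> real (Suc n) * r" by (intro mult_left_mono) auto
        moreover have "real (Suc n) * r = 1 / 2" by (simp add: r_def)
        ultimately have "real (Suc n) * norm (x - p) \<le> 1 / 2" by linarith
        then show ?thesis using \<eta>_near by (simp add: \<psi>_def)
      next
        case False
        then show ?thesis using K(3)[of x] by (auto simp: \<psi>_def)
      qed
    qed
    obtain K1 where K1: "K1 \<subseteq> U" "\<And>x. x \<notin> K1 \<Longrightarrow> \<psi> x = 0" "\<And>x. x \<notin> K1 \<Longrightarrow> grad \<psi> x = 0"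
      using C1_compactE[OF \<psi>c] by metis
    have out: "\<psi> x = 0" "grad \<psi> x = 0" if "x \<notin> U" for x using K1 that by auto
    have "has_bochner_integral lebesgue (\<lambda>x. X x \<bullet> grad \<psi> x + Y x * \<psi> x) 0"
      using d \<psi>c unfolding weak_div_def U_def by blast
    then have "has_bochner_integral (lebesgue_on U) (\<lambda>x. X x \<bullet> grad \<psi> x + Y x * \<psi> x) 0"
      by (subst has_bochner_integral_lebesgue_on_iff[OF US]) (simp add: out)
    moreover have "X x \<bullet> grad \<psi> x + Y x * \<psi> x = F' n x" if "x \<in> space (lebesgue_on U)" for x
    proof -
      have x: "x \<in> U" using that by (simp add: space_restrict_space)
      show ?thesis
        unfolding GDERIV_imp_grad[OF G[OF x]] using x
        by (simp add: D\<psi>_def F'_def f_def \<psi>_def inner_add_right algebra_simps)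
    qed
    ultimately show ?thesis
      by (subst has_bochner_integral_cong[OF refl _ refl, of _ "F' n" "\<lambda>x. X x \<bullet> grad \<psi> x + Y x * \<psi> x"]) auto
  qed
  have C0: "C \<ge> 0" if "x \<in> U" for x using C(1)[OF that] by (metis abs_ge_zero order_trans)
  define Q where "Q x = (\<Sum>i\<in>UNIV. (X x $ i)\<^sup>2)" for x
  have Q: "(norm (X x))\<^sup>2 = Q x" for x by (simp add: Q_def norm_vec_def L2_set_def sum_nonneg)
  \<comment> \<open>Dominating function independent of n: each product is split by a b \<le> a^2 +
    b^2 into the square of X or Y and a multiple of 1 or of the inverse square distance. All three
    are integrable over \<open>K\<close>.\<close>
  define g where "g x = indicat_real K x * (2 * Q x + (Y x)\<^sup>2 + C\<^sup>2 + (C\<^sup>2 + (C * B)\<^sup>2) * (1 / (norm (x - p))\<^sup>2))" for x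
  have ab: "a * b \<le> a\<^sup>2 + b\<^sup>2" for a b :: real
    using sum_squares_bound[of a b] zero_le_power2[of a] zero_le_power2[of b] by linarith
  have bnd: "\<bar>f x\<bar> \<le> g x \<and> \<bar>F' n x\<bar> \<le> g x" if x: "x \<in> U" for n x
  proof (cases "x \<in> K")
    case True
    note C0 = C0[OF x]
    have n0: "norm (x - p) > 0" using x U(3) by auto
    have "\<bar>X x \<bullet> grad \<phi> x\<bar> \<le> norm (X x) * (C / norm (x - p))"
      using C(2)[OF x] by (intro order_trans[OF Cauchy_Schwarz_ineq2] mult_left_mono) auto
    also have "\<dots> \<le> (norm (X x))\<^sup>2 + (C / norm (x - p))\<^sup>2" by (rule ab)
    finally have 1: "\<bar>X x \<bullet> grad \<phi> x\<bar> \<le> Q x + C\<^sup>2 * (1 / (norm (x - p))\<^sup>2)" by (simp add: Q power_divide)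
    have "\<bar>Y x * \<phi> x\<bar> \<le> \<bar>Y x\<bar> * C" unfolding abs_mult using C(1)[OF x] by (intro mult_left_mono) auto
    also have "\<dots> \<le> \<bar>Y x\<bar>\<^sup>2 + C\<^sup>2" by (rule ab)
    finally have 2: "\<bar>Y x * \<phi> x\<bar> \<le> (Y x)\<^sup>2 + C\<^sup>2" by simp
    have "\<bar>\<phi> x * (X x \<bullet> D\<eta> n x)\<bar> \<le> C * (norm (X x) * (B / norm (x - p)))"
      unfolding abs_mult using C(1)[OF x] C0 D\<eta>b[of n x]
      by (intro mult_mono order_trans[OF Cauchy_Schwarz_ineq2] mult_left_mono) auto
    also have "\<dots> = norm (X x) * (C * B / norm (x - p))" by simp
    also have "\<dots> \<le> (norm (X x))\<^sup>2 + (C * B / norm (x - p))\<^sup>2" by (rule ab)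
    finally have 3: "\<bar>\<phi> x * (X x \<bullet> D\<eta> n x)\<bar> \<le> Q x + (C * B)\<^sup>2 * (1 / (norm (x - p))\<^sup>2)"
      by (simp add: Q power_divide)
    have f: "\<bar>f x\<bar> \<le> Q x + (Y x)\<^sup>2 + C\<^sup>2 + C\<^sup>2 * (1 / (norm (x - p))\<^sup>2)"
      unfolding f_def using 1 2 by linarith
    have Q0: "Q x \<ge> 0" using Q[of x] by (metis zero_le_power2)
    have gx: "g x = 2 * Q x + (Y x)\<^sup>2 + C\<^sup>2 + (C\<^sup>2 * (1 / (norm (x - p))\<^sup>2) + (C * B)\<^sup>2 * (1 / (norm (x - p))\<^sup>2))"
      using True by (simp add: g_def algebra_simps)
    have pos: "0 \<le> (C * B)\<^sup>2 * (1 / (norm (x - p))\<^sup>2)" by simp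
    have "\<bar>\<eta> n x * f x\<bar> \<le> 1 * \<bar>f x\<bar>" unfolding abs_mult by (intro mult_right_mono \<eta>b) auto
    then have "\<bar>F' n x\<bar> \<le> \<bar>f x\<bar> + \<bar>\<phi> x * (X x \<bullet> D\<eta> n x)\<bar>" unfolding F'_def by linarith
    then show ?thesis using f 3 Q0 pos unfolding gx by linarith
  next
    case False
    then have "\<phi> x = 0" "grad \<phi> x = 0" using x K(3) gK by auto
    then show ?thesis using False by (simp add: f_def F'_def g_def)
  qed
  have gi: "integrable lebesgue g"
  proof -
    have e: "g = (\<lambda>x. 2 * (\<Sum>i\<in>UNIV. indicat_real K x * (X x $ i)\<^sup>2) + indicat_real K x * (Y x)\<^sup>2 + C\<^sup>2 * indicat_real K x
        + (C\<^sup>2 + (C * B)\<^sup>2) * (indicat_real K x * (1 / (norm (x - p))\<^sup>2)))"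
      by (auto simp: g_def Q_def sum_distrib_left algebra_simps)
    have "integrable lebesgue (indicat_real K)"
      using lmeasurable_compact[OF K(1)] by (auto simp: fmeasurable_def intro!: integrable_real_indicator)
    then show ?thesis
      unfolding e using X Y K(1,2)
      by (intro Bochner_Integration.integrable_add integrable_mult_right Bochner_Integration.integrable_sum
          L2_loc_compact(2) inverse_square_integrable) (auto simp: L2_loc_vec_def)
  qed
  have giU: "integrable (lebesgue_on U) g"
    unfolding integrable_lebesgue_on_iff[OF US]
    by (rule integrable_bounded_mult[OF gi, of _ 1]) (use US in \<open>auto simp: indicator_def\<close>)
  have fm: "f \<in> borel_measurable (lebesgue_on U)"
  proof -
    have "(\<lambda>x. X x $ i) \<in> borel_measurable (lebesgue_on U)" for i
      using L2_loc_measurable[OF L2_loc_subset[OF _ U(2)]] X unfolding L2_loc_vec_def by blast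
    moreover have "(\<lambda>x. grad \<phi> x $ i) \<in> borel_measurable (lebesgue_on U)" for i
      by (intro continuous_on_borel_measurable_lebesgue_on[OF U(1)] continuous_on_component \<phi>(2))
    moreover have "\<phi> \<in> borel_measurable (lebesgue_on U)"
      by (intro continuous_on_borel_measurable_lebesgue_on[OF U(1)] continuous_at_imp_continuous_on)
        (use \<phi>(1) GDERIV_continuous in blast)
    moreover have "Y \<in> borel_measurable (lebesgue_on U)"
      by (rule L2_loc_measurable[OF L2_loc_subset[OF Y U(2)]])
    ultimately show ?thesis
      unfolding f_def[abs_def] inner_vec_def inner_real_def
      by (intro borel_measurable_add borel_measurable_times borel_measurable_sum)
  qed
  have lim: "(\<lambda>n. F' n x) \<longlonglongrightarrow> f x" if x: "x \<in> U" for x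
  proof (rule tendsto_eventually)
    have n0: "norm (x - p) > 0" using x U(3) by auto
    obtain N where N: "1 / norm (x - p) < real N" using reals_Archimedean2 by blast
    show "\<forall>\<^sub>F n in sequentially. F' n x = f x"
    proof (rule eventually_sequentiallyI[of N])
      fix n assume "N \<le> n"
      then have "1 / norm (x - p) < real (Suc n)" using N by linarith
      then have "1 < real (Suc n) * norm (x - p)" using n0 by (simp add: field_simps)
      then have "real (Suc n) *\<^sub>R (x - p) \<notin> L" using L(2) by auto
      then show "F' n x = f x" using L(3,4) by (simp add: F'_def \<eta>_def D\<eta>_def)
    qed
  qed
  have AEb: "AE x in lebesgue_on U. norm (F' n x) \<le> g x" for n
    by (rule AE_I2) (use bnd in \<open>auto simp: space_restrict_space\<close>)
  have "(\<lambda>n. integral\<^sup>L (lebesgue_on U) (F' n)) \<longlonglongrightarrow> integral\<^sup>L (lebesgue_on U) f"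
  proof (rule integral_dominated_convergence[OF fm _ giU _ AEb])
    show "F' n \<in> borel_measurable (lebesgue_on U)" for n
      using F'0[of n] by (auto simp: has_bochner_integral_iff)
    show "AE x in lebesgue_on U. (\<lambda>n. F' n x) \<longlonglongrightarrow> f x"
      by (rule AE_I2) (use lim in \<open>auto simp: space_restrict_space\<close>)
  qed
  moreover have "integral\<^sup>L (lebesgue_on U) (F' n) = 0" for n
    using F'0[of n] by (simp add: has_bochner_integral_iff)
  ultimately have "integral\<^sup>L (lebesgue_on U) f = 0"
    by (simp add: LIMSEQ_const_iff)
  moreover have "integrable (lebesgue_on U) f"
    by (rule Bochner_Integration.integrable_bound[OF giU fm], rule AE_I2)
      (use bnd in \<open>auto simp: space_restrict_space intro: order_trans[OF _ abs_ge_self]\<close>)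
  ultimately show ?thesis
    unfolding has_bochner_integral_iff U_def f_def[abs_def] by blast
qed

lemma AE_lebesgue_neq: "AE x in lebesgue. x \<noteq> (p :: 'a::euclidean_space)"
  by (rule AE_I'[of "{p}"]) (auto simp: negligible_iff_null_sets[symmetric])

text \<open>A point is a null set; measurability is transferred too, the two integrands differing by
  a multiple of the indicator of at most one point.\<close>

lemma has_bochner_integral_delete_point:
  fixes f :: "'a::euclidean_space \<Rightarrow> real"
  assumes "open U"
  shows "has_bochner_integral (lebesgue_on (U - {p})) f I \<longleftrightarrow> has_bochner_integral (lebesgue_on U) f I"
proof -
  have O: "U \<in> sets lebesgue" "U - {p} \<in> sets lebesgue" using assms by auto
  have ae: "AE x in lebesgue. indicat_real (U - {p}) x *\<^sub>R f x = indicat_real U x *\<^sub>R f x"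
    using AE_lebesgue_neq[of p] by eventually_elim (auto simp: indicator_def)
  have "(\<lambda>x. indicat_real (U - {p}) x *\<^sub>R f x) \<in> borel_measurable lebesgue \<longleftrightarrow> (\<lambda>x. indicat_real U x *\<^sub>R f x) \<in> borel_measurable lebesgue"
  proof -
    let ?c = "\<lambda>x. indicat_real (U \<inter> {p}) x * f p"
    have c: "?c \<in> borel_measurable lebesgue" using O by (intro borel_measurable_times borel_measurable_indicator) auto
    have e: "indicat_real U x *\<^sub>R f x = indicat_real (U - {p}) x *\<^sub>R f x + ?c x"
      "indicat_real (U - {p}) x *\<^sub>R f x = indicat_real U x *\<^sub>R f x - ?c x" for x
      by (auto simp: indicator_def)
    show ?thesis
      using borel_measurable_add[OF _ c, of "\<lambda>x. indicat_real (U - {p}) x *\<^sub>R f x"]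
        borel_measurable_diff[OF _ c, of "\<lambda>x. indicat_real U x *\<^sub>R f x"]
      unfolding e(1)[symmetric] e(2)[symmetric] by blast
  qed
  then have "has_bochner_integral lebesgue (\<lambda>x. indicat_real (U - {p}) x *\<^sub>R f x) I \<longleftrightarrow>
      has_bochner_integral lebesgue (\<lambda>x. indicat_real U x *\<^sub>R f x) I"
    using has_bochner_integral_cong_AE[OF _ _ ae] by (meson borel_measurable_has_bochner_integral)
  then show ?thesis using O by (simp add: has_bochner_integral_restrict_space)
qed


text \<open>The gradient of \<phi> is bounded by B' and vanishes outside \<open>K\<close>, which
  lies in the ball of radius R around p; there B' \<le> B' R / norm (x - p). So C = B + B' R meets
  both bounds of \<open>weak_div_point_test\<close>.\<close>

lemma weak_div_remove_point:
  fixes p :: "real^3"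
  assumes U: "open U" and X: "L2_loc_vec U X" and Y: "L2_loc U Y" and d: "weak_div (U - {p}) X Y"
  shows "weak_div U X Y"
  unfolding weak_div_def
proof (intro allI impI)
  have O: "U \<in> sets lebesgue" using U by auto
  fix \<phi> assume \<phi>: "C1_compact U \<phi>"
  obtain K where K: "compact K" "K \<subseteq> U" "\<And>x. x \<notin> K \<Longrightarrow> \<phi> x = 0" "\<And>x. x \<notin> K \<Longrightarrow> grad \<phi> x = 0"
    using C1_compactE[OF \<phi>] by metis
  obtain B where B: "B > 0" "\<And>x. norm (\<phi> x) \<le> B"
    using continuous_compact_support_bounded[OF C1_compact_continuous[OF \<phi>] K(1,3)] by blast
  obtain B' where B': "B' > 0" "\<And>x. norm (grad \<phi> x) \<le> B'"
    using continuous_compact_support_bounded[OF C1_compact_continuous_grad[OF \<phi>] K(1,4)] by blast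
  obtain R where R: "R > 0" "K \<subseteq> ball p R"
    using bounded_subset_ballD[OF compact_imp_bounded[OF K(1)], of p] by blast
  define C where "C = B + B' * R"
  have "has_bochner_integral (lebesgue_on (U - {p})) (\<lambda>x. X x \<bullet> grad \<phi> x + Y x * \<phi> x) 0"
  proof (rule weak_div_point_test[OF U X Y d _ _ K(1,2)])
    show "GDERIV \<phi> x :> grad \<phi> x" for x by (rule C1_compact_GDERIV[OF \<phi>])
    show "continuous_on (U - {p}) (grad \<phi>)"
      by (rule continuous_on_subset[OF C1_compact_continuous_grad[OF \<phi>] subset_UNIV])
    show "\<phi> x = 0" if "x \<notin> K" for x by (rule K(3)[OF that])
    show "\<bar>\<phi> x\<bar> \<le> C" for x using B(2)[of x] mult_pos_pos[OF B'(1) R(1)] by (simp add: C_def)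
    show "norm (grad \<phi> x) \<le> C / norm (x - p)" if x: "x \<in> U - {p}" for x
    proof (cases "x \<in> K")
      case True
      have r: "0 < norm (x - p)" "norm (x - p) \<le> R" using x True R(2) by (auto simp: dist_norm norm_minus_commute)
      have "norm (grad \<phi> x) * norm (x - p) \<le> B' * R" using r B' by (intro mult_mono) auto
      also have "\<dots> \<le> C" using B(1) by (simp add: C_def)
      finally show ?thesis using r by (simp add: field_simps)
    next
      case False
      then show ?thesis using K(4) B(1) B'(1) R(1) by (simp add: C_def)
    qed
  qed
  then have "has_bochner_integral (lebesgue_on U) (\<lambda>x. X x \<bullet> grad \<phi> x + Y x * \<phi> x) 0"
    by (simp only: has_bochner_integral_delete_point[OF U])
  moreover have "\<phi> x = 0" "grad \<phi> x = 0" if "x \<notin> U" for x using K that by auto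
  ultimately show "has_bochner_integral lebesgue (\<lambda>x. X x \<bullet> grad \<phi> x + Y x * \<phi> x) 0"
    by (subst (asm) has_bochner_integral_lebesgue_on_iff[OF O]) auto
qed

lemma L2_loc_vec_axis:
  assumes "U \<in> sets lebesgue" "L2_loc U u"
  shows "L2_loc_vec U (\<lambda>x. u x *\<^sub>R axis i 1)"
  unfolding L2_loc_vec_def
proof
  show "L2_loc U (\<lambda>x. (u x *\<^sub>R axis i 1) $ j)" for j
    using assms L2_loc_0[OF assms(1)] by (cases "i = j") (auto simp: axis_def)
qed

text \<open>Each component of the weak gradient is a divergence, so the removal of p from
  divergences applies to it. That \<open>Du\<close> is square integrable up to p excludes a
  concentration of the derivative there.\<close>

lemma H1_loc_grad_remove_point:
  fixes p :: "real^3"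
  assumes U: "open U" and u: "L2_loc U u" and Du: "L2_loc_vec U Du" and h: "H1_loc_grad (U - {p}) u Du"
  shows "H1_loc_grad U u Du"
proof -
  have o: "open (U - {p})" using U by auto
  have "weak_div U (\<lambda>x. u x *\<^sub>R axis i 1) (\<lambda>x. Du x $ i)" for i
    using h U Du unfolding H1_loc_grad_iff_weak_div[OF o]
    by (intro weak_div_remove_point[OF U L2_loc_vec_axis[OF _ u], of _ p]) (auto simp: L2_loc_vec_def)
  then show ?thesis unfolding H1_loc_grad_iff_weak_div[OF U] using u Du by blast
qed

lemma weak_helmholtz_remove_point:
  fixes p :: "real^3"
  assumes U: "open U" and G: "metric_field U G" and u: "L2_loc U u" and Du: "L2_loc_vec U Du" and f: "L2_loc U f"
    and h: "weak_helmholtz (U - {p}) G k u Du f"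
  shows "weak_helmholtz U G k u Du f"
proof -
  have o: "open (U - {p})" using U by auto
  have "H1_loc_grad (U - {p}) u Du \<and> weak_div (U - {p}) (flux G Du) (source G k u f)"
    using h unfolding weak_helmholtz_iff_weak_div[OF o metric_field_subset[OF G Diff_subset] L2_loc_subset[OF f Diff_subset]] .
  then show ?thesis
    unfolding weak_helmholtz_iff_weak_div[OF U G f]
    using H1_loc_grad_remove_point[OF U u Du] weak_div_remove_point[OF U L2_loc_flux[OF U G Du] L2_loc_source[OF U G u f]]
    by blast
qed

text \<open>A coordinate chart of the sphere may contain both poles, hence finitely many points
  instead of one.\<close>

lemma weak_helmholtz_remove_finite:
  fixes P :: "(real^3) set"
  assumes "finite P" and U: "open U" and G: "metric_field U G" and u: "L2_loc U u" and Du: "L2_loc_vec U Du" and f: "L2_loc U f"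
    and h: "weak_helmholtz (U - P) G k u Du f"
  shows "weak_helmholtz U G k u Du f"
  using assms(1) h
proof (induction P)
  case (insert p P)
  have o: "open (U - P)" using U insert.hyps(1) finite_imp_closed open_Diff by blast
  have "U - insert p P = U - P - {p}" by auto
  then have "weak_helmholtz (U - P) G k u Du f"
    using insert.prems
    by (intro weak_helmholtz_remove_point[OF o metric_field_subset[OF G Diff_subset] L2_loc_subset[OF u Diff_subset]
        L2_loc_vec_subset[OF Du Diff_subset] L2_loc_subset[OF f Diff_subset], of p]) simp
  then show ?case by (rule insert.IH)
qed simp

lemma borel_measurable_lebesgue_on_finite_extension:
  fixes f :: "'a::euclidean_space \<Rightarrow> real"
  assumes "open U" "finite P" "f \<in> borel_measurable (lebesgue_on (U - P))"
  shows "f \<in> borel_measurable (lebesgue_on U)"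
proof (rule measurableI)
  have "open (U - P)" by (rule open_Diff[OF assms(1) finite_imp_closed[OF assms(2)]])
  then have O: "U \<in> sets lebesgue" "U - P \<in> sets lebesgue" using assms(1) by auto
  fix A :: "real set" assume A: "A \<in> sets borel"
  have "f -` A \<inter> (U - P) \<in> sets lebesgue"
    using measurable_sets[OF assms(3) A] O by (simp add: space_restrict_space sets_restrict_space_iff)
  moreover have "f -` A \<inter> (U \<inter> P) \<in> sets lebesgue"
    by (rule negligible_imp_sets[OF negligible_finite]) (use assms(2) in auto)
  moreover have "f -` A \<inter> U = (f -` A \<inter> (U - P)) \<union> (f -` A \<inter> (U \<inter> P))" by auto
  ultimately have "f -` A \<inter> U \<in> sets lebesgue" by (metis sets.Un)
  then show "f -` A \<inter> space (lebesgue_on U) \<in> sets (lebesgue_on U)"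
    using O by (simp add: space_restrict_space sets_restrict_space_iff)
qed simp

lemma AE_lebesgue_notin_finite:
  assumes "finite (P :: 'a::euclidean_space set)"
  shows "AE x in lebesgue. x \<notin> P"
  by (rule AE_I'[of P]) (use assms in \<open>auto simp: negligible_iff_null_sets[symmetric] negligible_finite\<close>)

text \<open>Turns the integrability of a weighted square or of an energy density, known off finitely
  many points, into local square integrability across them.\<close>

lemma L2_locI_weighted:
  fixes w :: "'a::euclidean_space \<Rightarrow> real"
  assumes U: "open U" and P: "finite P" and w: "w \<in> borel_measurable (lebesgue_on (U - P))"
    and g: "integrable (lebesgue_on (U - P)) g"
    and b: "\<And>K. compact K \<Longrightarrow> K \<subseteq> U \<Longrightarrow> \<exists>C. \<forall>x\<in>K - P. (w x)\<^sup>2 \<le> C * g x"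
  shows "L2_loc U w"
proof (rule L2_locI)
  have "open (U - P)" by (rule open_Diff[OF U finite_imp_closed[OF P]])
  then have O: "U - P \<in> sets lebesgue" by auto
  show m: "w \<in> borel_measurable (lebesgue_on U)"
    by (rule borel_measurable_lebesgue_on_finite_extension[OF U P w])
  show "U \<in> sets lebesgue" using U by auto
  fix K assume K: "compact K" "K \<subseteq> U"
  note KS = compact_in_sets_lebesgue[OF K(1)]
  obtain C where C: "\<And>x. x \<in> K - P \<Longrightarrow> (w x)\<^sup>2 \<le> C * g x" using b[OF K] by blast
  show "integrable lebesgue (\<lambda>x. indicat_real K x * (w x)\<^sup>2)"
  proof (rule Bochner_Integration.integrable_bound)
    show "integrable lebesgue (\<lambda>x. C * (indicat_real (U - P) x * g x))"
      using g unfolding integrable_lebesgue_on_iff[OF O] by (rule integrable_mult_right)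
    have "(\<lambda>x. (w x)\<^sup>2) \<in> borel_measurable (lebesgue_on K)"
      using measurable_restrict_mono[OF m K(2)] by measurable
    then show "(\<lambda>x. indicat_real K x * (w x)\<^sup>2) \<in> borel_measurable lebesgue"
      using KS by (simp add: borel_measurable_restrict_space_iff)
    show "AE x in lebesgue. norm (indicat_real K x * (w x)\<^sup>2) \<le> norm (C * (indicat_real (U - P) x * g x))"
      using AE_lebesgue_notin_finite[OF P]
    proof eventually_elim
      case (elim x)
      show ?case
      proof (cases "x \<in> K")
        case True
        then have "(w x)\<^sup>2 \<le> \<bar>C * g x\<bar>" "x \<in> U - P" using C[of x] elim K(2) by auto
        then show ?thesis using True by simp
      qed simp
    qed
  qed
qed

section \<open>C^1 maps given by components, and their inverses\<close>

lemma Ck_on_1_imp_jac: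
  fixes \<tau> :: "real^'n \<Rightarrow> real^'m"
  assumes "\<And>i. Ck_on 1 U (\<lambda>x. \<tau> x $ i)"
  shows "\<And>x. x \<in> U \<Longrightarrow> \<tau> differentiable (at x)" "continuous_on U (jac \<tau>)"
    "\<And>x i j. x \<in> U \<Longrightarrow> jac \<tau> x $ i $ j = frechet_derivative (\<lambda>x. \<tau> x $ i) (at x) (axis j 1)"
proof -
  define J where "J x = (\<chi> i j. frechet_derivative (\<lambda>x. \<tau> x $ i) (at x) (axis j 1))" for x
  have D: "(\<tau> has_derivative (\<lambda>h. J x *v h)) (at x)" if "x \<in> U" for x
  proof -
    have c: "((\<lambda>x. \<tau> x $ i) has_derivative (\<lambda>h. h \<bullet> grad (\<lambda>x. \<tau> x $ i) x)) (at x)" for i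
      using GDERIV_grad[of "\<lambda>x. \<tau> x $ i" x] assms[of i] that unfolding gderiv_def by simp
    have "(\<tau> has_derivative (\<lambda>h. \<chi> i. h \<bullet> grad (\<lambda>x. \<tau> x $ i) x)) (at x)"
      unfolding has_derivative_componentwise_within[of \<tau>]
    proof
      fix b :: "real^'m" assume "b \<in> Basis"
      then obtain i where b: "b = axis i 1" by (auto simp: Basis_vec_def)
      show "((\<lambda>x. \<tau> x \<bullet> b) has_derivative (\<lambda>h. (\<chi> i. h \<bullet> grad (\<lambda>x. \<tau> x $ i) x) \<bullet> b)) (at x)"
        using c[of i] by (simp add: b inner_axis)
    qed
    moreover have "(\<chi> i. h \<bullet> grad (\<lambda>x. \<tau> x $ i) x) = J x *v h" for h
      by (simp add: vec_eq_iff matrix_vector_mult_def J_def inner_vec_def grad_nth mult.commute)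
    ultimately show ?thesis by simp
  qed
  then show "\<And>x. x \<in> U \<Longrightarrow> \<tau> differentiable (at x)" unfolding differentiable_def by blast
  have J: "jac \<tau> x = J x" if "x \<in> U" for x by (rule has_derivative_imp_jac[OF D[OF that]])
  then show "\<And>x i j. x \<in> U \<Longrightarrow> jac \<tau> x $ i $ j = frechet_derivative (\<lambda>x. \<tau> x $ i) (at x) (axis j 1)"
    by (simp add: J_def)
  have "continuous_on U J"
    unfolding J_def using assms by (intro continuous_on_vec_lambda) (auto simp: axis_in_Basis_iff)
  then show "continuous_on U (jac \<tau>)" by (rule continuous_on_eq) (simp add: J)
qed

text \<open>Invariance of domain makes the image open, the inverse function theorem differentiates
  the inverse, and its Jacobian is continuous because matrix inversion is.\<close>

lemma C1_diffeo_inv_into: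
  fixes \<tau> :: "real^'n \<Rightarrow> real^'n"
  assumes U: "open U" and inj: "inj_on \<tau> U" and D: "\<And>x. x \<in> U \<Longrightarrow> \<tau> differentiable (at x)"
    and J: "continuous_on U (jac \<tau>)" and nz: "\<And>x. x \<in> U \<Longrightarrow> det (jac \<tau> x) \<noteq> 0"
  shows "C1_diffeo U (\<tau> ` U) \<tau> (inv_into U \<tau>)"
proof -
  define \<sigma> where "\<sigma> = inv_into U \<tau>"
  have \<sigma>: "\<sigma> (\<tau> x) = x" if "x \<in> U" for x using inj that by (simp add: \<sigma>_def)
  have c: "continuous_on U \<tau>"
    using D by (auto intro!: continuous_at_imp_continuous_on differentiable_imp_continuous_within)
  have o: "open (\<tau> ` U)" by (rule invariance_of_domain[OF c U inj])
  have \<sigma>D: "(\<sigma> has_derivative (\<lambda>h. matrix_inv (jac \<tau> x) *v h)) (at (\<tau> x))" if x: "x \<in> U" for x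
  proof (rule has_derivative_inverse_strong[OF U x c \<sigma> jac_works[OF D[OF x]]])
    show "(\<lambda>h. jac \<tau> x *v h) \<circ> (\<lambda>h. matrix_inv (jac \<tau> x) *v h) = id"
      using matrix_inv_mult(1)[OF nz[OF x]] by (auto simp: fun_eq_iff matrix_vector_mul_assoc)
  qed
  have d: "\<sigma> differentiable (at y)" if "y \<in> \<tau> ` U" for y
    using that \<sigma>D unfolding differentiable_def by auto
  then have \<sigma>c: "continuous_on (\<tau> ` U) \<sigma>"
    by (auto intro!: continuous_at_imp_continuous_on differentiable_imp_continuous_within)
  have "continuous_on (\<tau> ` U) (\<lambda>y. matrix_inv (jac \<tau> (\<sigma> y)))"
    by (rule continuous_on_compose2[OF continuous_on_matrix_inv[OF J nz] \<sigma>c]) (auto simp: \<sigma>)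
  then have "continuous_on (\<tau> ` U) (jac \<sigma>)"
    by (rule continuous_on_eq) (auto simp: \<sigma> has_derivative_imp_jac[OF \<sigma>D])
  then show ?thesis
    unfolding C1_diffeo_def \<sigma>_def[symmetric] using U o D J d \<sigma> by auto
qed

section \<open>Radial maps\<close>

text \<open>Keeps the ray through x, up to sign, and acts on the norm by r to a r + b. Three maps
  are of this kind: \<open>F1\<close> with (1/2, 1), its inverse with (2, -2), and the passage
  between antipodal geodesic coordinates with (-1, 1).\<close>

definition radial :: "real \<Rightarrow> real \<Rightarrow> real^'n \<Rightarrow> real^'n" where
  "radial a b x = (a + b * (1 / norm x)) *\<^sub>R x"

lemma norm_radial: "x \<noteq> 0 \<Longrightarrow> norm (radial a b x) = \<bar>a * norm x + b\<bar>"
  by (simp add: radial_def) (simp add: field_simps flip: abs_mult_pos)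

text \<open>The two equations on the coefficients say that r to c r + d inverts r to a r + b;
  positivity of the new norm keeps the ray from being reversed.\<close>

lemma radial_radial:
  assumes "x \<noteq> 0" "a * norm x + b > 0" "a * c = 1" "c * b + d = 0"
  shows "radial c d (radial a b x) = x"
proof -
  define r where "r = norm x"
  have r: "r > 0" "a * r + b > 0" using assms by (auto simp: r_def)
  have n: "norm (radial a b x) = a * r + b" using norm_radial[OF assms(1), of a b] r by (simp add: r_def)
  have "radial c d (radial a b x) = ((c + d * (1 / (a * r + b))) * (a + b * (1 / r))) *\<^sub>R x"
    unfolding radial_def[of c d] n by (simp add: radial_def r_def)
  also have "(c + d * (1 / (a * r + b))) * (a + b * (1 / r)) = (c * (a * r + b) + d) / r"
  proof -
    define s where "s = a * r + b"
    have s: "s > 0" using r by (simp add: s_def)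
    have "a + b * (1 / r) = s / r" using r by (simp add: s_def add_divide_distrib)
    moreover have "c + d * (1 / s) = (c * s + d) / s" using s by (simp add: add_divide_distrib)
    ultimately show ?thesis using r s by (simp add: s_def[symmetric])
  qed
  also have "c * (a * r + b) + d = r"
  proof -
    have "c * (a * r + b) + d = (a * c) * r + (c * b + d)" by (simp add: algebra_simps)
    then show ?thesis using assms(3,4) by simp
  qed
  finally show ?thesis using r by simp
qed

lemma radial_smooth: "open U \<Longrightarrow> 0 \<notin> U \<Longrightarrow> Ck_on n U (\<lambda>x. radial a b x $ i)"
  unfolding radial_def
  by (simp del: Ck_on.simps) (intro Ck_on_mult Ck_on_add Ck_on_const Ck_on_nth Ck_on_cmult[OF _ Ck_on_inverse_norm, simplified]; assumption)

lemma radial_has_derivative: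
  fixes x :: "real^'n"
  assumes "x \<noteq> 0"
  shows "(radial a b has_derivative (\<lambda>h. (a + b * (1 / norm x)) *\<^sub>R h - (b * (x \<bullet> h) / (norm x) ^ 3) *\<^sub>R x)) (at x)"
proof -
  have d1: "((\<lambda>x. (a + b * inverse (norm x)) *\<^sub>R x) has_derivative
      (\<lambda>h. (a + b * inverse (norm x)) *\<^sub>R h + (0 + b * (- (inverse (norm x) * (h \<bullet> sgn x) * inverse (norm x)))) *\<^sub>R x)) (at x)"
    using assms
    by (intro has_derivative_scaleR has_derivative_add has_derivative_mult_right has_derivative_const
        has_derivative_ident Deriv.has_derivative_inverse has_derivative_norm) auto
  have d2: "(a + b * inverse (norm x)) *\<^sub>R h + (0 + b * (- (inverse (norm x) * (h \<bullet> sgn x) * inverse (norm x)))) *\<^sub>R x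
      = (a + b * (1 / norm x)) *\<^sub>R h - (b * (x \<bullet> h) / (norm x) ^ 3) *\<^sub>R x" for h
  proof -
    have "b * (inverse (norm x) * (h \<bullet> sgn x) * inverse (norm x)) = b * (x \<bullet> h) / (norm x) ^ 3"
      using assms by (simp add: sgn_div_norm inner_commute power3_eq_cube field_simps)
    then show ?thesis by (simp add: inverse_eq_divide)
  qed
  show ?thesis
    unfolding radial_def[abs_def] using d1 unfolding d2 by (simp only: inverse_eq_divide)
qed

text \<open>The derivative is a h plus b / norm x times the part of h orthogonal to x, whence a
  singularity of order 1 / norm x. The bound passes to the transposed action by pairing w = v v* J
  with itself. This is the source of the gradient bound needed at the removed points.\<close>

lemma radial_jac_bound:
  fixes x :: "real^'n"
  assumes "x \<noteq> 0"
  shows "norm (v v* jac (radial a b) x) \<le> (\<bar>a\<bar> + 2 * \<bar>b\<bar> / norm x) * norm v"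
proof -
  let ?w = "v v* jac (radial a b) x"
  have D: "(radial a b has_derivative (\<lambda>h. jac (radial a b) x *v h)) (at x)"
    by (rule jac_works) (use radial_has_derivative[OF assms] in \<open>auto simp: differentiable_def\<close>)
  have J: "jac (radial a b) x *v h = (a + b * (1 / norm x)) *\<^sub>R h - (b * (x \<bullet> h) / (norm x) ^ 3) *\<^sub>R x" for h
    using has_derivative_unique[OF D radial_has_derivative[OF assms]] by (metis (no_types))
  have Jb: "norm (jac (radial a b) x *v h) \<le> (\<bar>a\<bar> + 2 * \<bar>b\<bar> / norm x) * norm h" for h
  proof -
    have r: "norm x > 0" using assms by simp
    have "\<bar>b * (x \<bullet> h) / (norm x) ^ 3\<bar> * norm x \<le> \<bar>b\<bar> * (norm x * norm h) / (norm x) ^ 3 * norm x"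
    proof -
      have "\<bar>b * (x \<bullet> h)\<bar> \<le> \<bar>b\<bar> * (norm x * norm h)"
        unfolding abs_mult by (intro mult_left_mono Cauchy_Schwarz_ineq2) auto
      then have "\<bar>b * (x \<bullet> h)\<bar> / (norm x) ^ 3 \<le> \<bar>b\<bar> * (norm x * norm h) / (norm x) ^ 3"
        by (rule divide_right_mono) simp
      then show ?thesis by (intro mult_right_mono) (simp_all add: abs_divide)
    qed
    also have "\<dots> = \<bar>b\<bar> / norm x * norm h" using r by (simp add: power3_eq_cube field_simps)
    finally have 1: "norm ((b * (x \<bullet> h) / (norm x) ^ 3) *\<^sub>R x) \<le> \<bar>b\<bar> / norm x * norm h" by simp
    have "\<bar>a + b * (1 / norm x)\<bar> \<le> \<bar>a\<bar> + \<bar>b\<bar> / norm x" using abs_triangle_ineq[of a "b * (1 / norm x)"] by simp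
    then have 2: "norm ((a + b * (1 / norm x)) *\<^sub>R h) \<le> (\<bar>a\<bar> + \<bar>b\<bar> / norm x) * norm h" by (simp add: mult_right_mono)
    have "norm (jac (radial a b) x *v h) \<le> (\<bar>a\<bar> + \<bar>b\<bar> / norm x) * norm h + \<bar>b\<bar> / norm x * norm h"
      unfolding J by (rule order_trans[OF norm_triangle_ineq4 add_mono[OF 2 1]])
    then show ?thesis by (simp add: algebra_simps)
  qed
  have "norm ?w * norm ?w = ?w \<bullet> ?w" by (simp add: power2_norm_eq_inner[symmetric] power2_eq_square)
  also have "\<dots> = v \<bullet> (jac (radial a b) x *v ?w)" by (rule dot_lmul_matrix)
  also have "\<dots> \<le> norm v * norm (jac (radial a b) x *v ?w)" using norm_cauchy_schwarz .
  also have "\<dots> \<le> norm v * ((\<bar>a\<bar> + 2 * \<bar>b\<bar> / norm x) * norm ?w)" by (intro mult_left_mono Jb) auto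
  finally have "norm ?w * norm ?w \<le> ((\<bar>a\<bar> + 2 * \<bar>b\<bar> / norm x) * norm v) * norm ?w" by (simp add: mult_ac)
  then show ?thesis
    by (cases "norm ?w = 0") (auto simp: mult_le_cancel_right)
qed

lemma radial_C1_diffeo:
  fixes U U' :: "(real^'n) set"
  assumes "open U" "0 \<notin> U" "open U'" "0 \<notin> U'" and c: "a * c = 1" "c * b + d = 0"
    and 1: "\<And>x. x \<in> U \<Longrightarrow> a * norm x + b > 0 \<and> radial a b x \<in> U'"
    and 2: "\<And>x. x \<in> U' \<Longrightarrow> c * norm x + d > 0 \<and> radial c d x \<in> U"
  shows "C1_diffeo U U' (radial a b) (radial c d)"
proof -
  have c': "c * a = 1" "a * d + b = 0"
  proof -
    show "c * a = 1" using c(1) by (simp add: mult.commute)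
    have "a * d + b = a * (c * b + d) + (1 - a * c) * b" by (simp add: algebra_simps)
    then show "a * d + b = 0" using c by simp
  qed
  have "radial c d (radial a b x) = x" if "x \<in> U" for x
    using 1[OF that] that assms(2) c by (intro radial_radial) auto
  moreover have "radial a b (radial c d x) = x" if "x \<in> U'" for x
    using 2[OF that] that assms(4) c' by (intro radial_radial) auto
  ultimately show ?thesis
    unfolding C1_diffeo_def
    using assms(1,3) 1 2 Ck_on_1_imp_jac(1,2)[OF radial_smooth[OF assms(1,2), of 1 a b]]
      Ck_on_1_imp_jac(1,2)[OF radial_smooth[OF assms(3,4), of 1 c d]] by blast
qed


section \<open>Geodesic coordinates on the sphere\<close>

text \<open>A form of the frame condition that is symmetric under P to -P: the tangent spaces at
  antipodal points are the same subspace, so one \<iota> provides geodesic coordinates at both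
  poles.\<close>

definition sphere_frame :: "real^4 \<Rightarrow> (real^3 \<Rightarrow> real^4) \<Rightarrow> bool" where
  "sphere_frame P \<iota> \<longleftrightarrow> norm P = 1 / pi \<and> linear \<iota> \<and> (\<forall>v. norm (\<iota> v) = norm v) \<and> range \<iota> = {v. P \<bullet> v = 0}"

lemma sphere_frame_minus: "sphere_frame P \<iota> \<Longrightarrow> sphere_frame (- P) \<iota>"
  by (simp add: sphere_frame_def)

lemma sphere_frameD:
  assumes "sphere_frame P \<iota>"
  shows "norm P = 1 / pi" "linear \<iota>" "norm (\<iota> v) = norm v" "P \<bullet> \<iota> v = 0" "P \<noteq> 0" "P \<bullet> P = 1 / pi\<^sup>2" "\<iota> u \<bullet> \<iota> v = u \<bullet> v"
proof -
  show P: "norm P = 1 / pi" and l: "linear \<iota>" and n: "\<And>v. norm (\<iota> v) = norm v"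
    using assms by (auto simp: sphere_frame_def)
  show "P \<bullet> \<iota> v = 0" using assms unfolding sphere_frame_def by (metis (mono_tags) mem_Collect_eq rangeI)
  show "P \<noteq> 0" using P by force
  show "P \<bullet> P = 1 / pi\<^sup>2" using P by (simp add: power2_norm_eq_inner[symmetric] power_divide)
  have "\<iota> u \<bullet> \<iota> v = ((norm (\<iota> u + \<iota> v))\<^sup>2 - (norm (\<iota> u))\<^sup>2 - (norm (\<iota> v))\<^sup>2) / 2" by (rule dot_norm)
  also have "\<dots> = u \<bullet> v" using n[of "u + v"] by (simp add: n linear_add[OF l] dot_norm)
  finally show "\<iota> u \<bullet> \<iota> v = u \<bullet> v" .
qed

text \<open>The function sin (pi r) / (pi r) of r = norm v; \<open>cosc\<close> is likewise cos (pi
  r). Written as series in v \<bullet> v they are visibly smooth through the origin.\<close>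

definition sinc :: "real^3 \<Rightarrow> real" where
  "sinc v = (\<Sum>k. ((- 1) ^ k * pi ^ (2 * k) / fact (2 * k + 1)) * (v \<bullet> v) ^ k)"

definition cosc :: "real^3 \<Rightarrow> real" where
  "cosc v = (\<Sum>k. ((- 1) ^ k * pi ^ (2 * k) / fact (2 * k)) * (v \<bullet> v) ^ k)"

lemma cosc_sums:
  fixes x :: real
  assumes "x \<ge> 0"
  shows "(\<lambda>k. ((- 1) ^ k * pi ^ (2 * k) / fact (2 * k)) * x ^ k) sums cos (pi * sqrt x)"
proof -
  have "(pi * sqrt x) ^ (2 * k) = pi ^ (2 * k) * x ^ k" for k
    using assms by (simp add: power_mult_distrib power_mult)
  then show ?thesis using cos_paired[of "pi * sqrt x"] by (simp add: mult.assoc)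
qed

lemma sinc_sums:
  fixes x :: real
  assumes "x > 0"
  shows "(\<lambda>k. ((- 1) ^ k * pi ^ (2 * k) / fact (2 * k + 1)) * x ^ k) sums (sin (pi * sqrt x) / (pi * sqrt x))"
proof -
  have p: "(pi * sqrt x) ^ (2 * k) = pi ^ (2 * k) * x ^ k" for k
    using assms by (simp add: power_mult_distrib power_mult)
  have e: "(- 1) ^ k / fact (2 * k + 1) * (pi * sqrt x) ^ (2 * k + 1) / (pi * sqrt x)
      = ((- 1) ^ k * pi ^ (2 * k) / fact (2 * k + 1)) * x ^ k" for k
    unfolding power_add p power_one_right using assms by simp
  show ?thesis
    using sums_divide[OF sin_paired[of "pi * sqrt x"], of "pi * sqrt x"] unfolding e .
qed

lemma cosc_series_summable: "summable (\<lambda>k. ((- 1) ^ k * pi ^ (2 * k) / fact (2 * k)) * t ^ k)" for t :: real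
  by (rule powser_inside[OF sums_summable[OF cosc_sums[of "\<bar>t\<bar> + 1"]]]) auto

lemma sinc_series_summable: "summable (\<lambda>k. ((- 1) ^ k * pi ^ (2 * k) / fact (2 * k + 1)) * t ^ k)" for t :: real
  by (rule powser_inside[OF sums_summable[OF sinc_sums[of "\<bar>t\<bar> + 1"]]]) auto

lemma Ck_on_sinc: "open U \<Longrightarrow> Ck_on n U sinc"
  unfolding sinc_def[abs_def] by (rule Ck_on_powser[OF _ sinc_series_summable Ck_on_inner_self])

lemma Ck_on_cosc: "open U \<Longrightarrow> Ck_on n U cosc"
  unfolding cosc_def[abs_def] by (rule Ck_on_powser[OF _ cosc_series_summable Ck_on_inner_self])

lemma cosc_eq: "cosc v = cos (pi * norm v)"
  unfolding cosc_def norm_eq_sqrt_inner by (rule sums_unique[OF cosc_sums, symmetric]) simp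

lemma sinc_eq: "v \<noteq> 0 \<Longrightarrow> sinc v = sin (pi * norm v) / (pi * norm v)"
  unfolding sinc_def norm_eq_sqrt_inner by (rule sums_unique[OF sinc_sums, symmetric]) simp

lemma sinc_0: "sinc 0 = 1"
  using sums_unique[OF powser_sums_zero[of "\<lambda>k. (- 1) ^ k * pi ^ (2 * k) / fact (2 * k + 1)"]]
  by (simp add: sinc_def)

lemma pi_norm_bounds:
  assumes "v \<in> ball (0::real^3) 1"
  shows "0 \<le> pi * norm v" "pi * norm v \<le> pi"
  using assms mult_left_mono[of "norm v" 1 pi] by auto

lemma sinc_pos: "norm v < 1 \<Longrightarrow> sinc v > 0"
proof (cases "v = 0")
  case False
  assume "norm v < 1"
  then have "sin (pi * norm v) > 0" using False by (intro sin_gt_zero) auto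
  then show ?thesis using False by (simp add: sinc_eq)
qed (simp add: sinc_0)

definition expc :: "real^4 \<Rightarrow> (real^3 \<Rightarrow> real^4) \<Rightarrow> real^3 \<Rightarrow> real^4" where
  "expc P \<iota> v = sphere_exp P (\<iota> v)"

context
  fixes P \<iota> assumes F: "sphere_frame P \<iota>"
begin

lemma expc_eq: "expc P \<iota> v = cosc v *\<^sub>R P + sinc v *\<^sub>R \<iota> v"
proof (cases "v = 0")
  case True
  then show ?thesis using linear_0[OF sphere_frameD(2)[OF F]] by (simp add: expc_def sphere_exp_def cosc_eq)
next
  case False
  then show ?thesis
    by (simp add: expc_def sphere_exp_def cosc_eq sinc_eq sphere_frameD[OF F] mult.commute)
qed

lemma expc_smooth: "open U \<Longrightarrow> Ck_on n U (\<lambda>v. expc P \<iota> v $ i)"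
proof -
  assume U: "open U"
  have "bounded_linear (\<lambda>v. \<iota> v $ i)"
    using bounded_linear_compose[OF bounded_linear_vec_nth] sphere_frameD(2)[OF F] linear_conv_bounded_linear by blast
  then show ?thesis
    unfolding expc_eq by (simp del: Ck_on.simps) (intro Ck_on_add Ck_on_mult Ck_on_sinc Ck_on_cosc Ck_on_const Ck_on_bounded_linear U)
qed

lemma expc_in_sphere: "expc P \<iota> v \<in> dom_M2"
proof -
  have "\<iota> v \<in> tangent_sphere P" using sphere_frameD(4)[OF F] by (simp add: tangent_sphere_def)
  then have "norm (sphere_exp P (1 *\<^sub>R \<iota> v)) = norm P"
    by (rule sphere_exp_geodesic(1)[OF sphere_frameD(5)[OF F]])
  then show ?thesis by (simp add: dom_M2_def expc_def sphere_frameD[OF F])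
qed

lemma expc_inner_P: "P \<bullet> expc P \<iota> v = cosc v / pi\<^sup>2"
  by (simp add: expc_eq inner_add_right sphere_frameD[OF F])

lemma adjoint_frame: "adjoint \<iota> x \<bullet> w = x \<bullet> \<iota> w"
  using adjoint_works[OF sphere_frameD(2)[OF F]] by (metis inner_commute)

text \<open>The adjoint of \<iota> annihilates P and is a left inverse of \<iota>, so it reads off
  the tangential part of the exponential map.\<close>

lemma expc_adjoint: "adjoint \<iota> (expc P \<iota> v) = sinc v *\<^sub>R v"
proof -
  have "adjoint \<iota> (expc P \<iota> v) \<bullet> w = (sinc v *\<^sub>R v) \<bullet> w" for w
    by (simp add: adjoint_frame expc_eq inner_add_left sphere_frameD[OF F])
  then show ?thesis using vector_eq_rdot by blast
qed

text \<open>The component along P determines cos (pi r) and hence r = norm v, since pi r stays in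
  [0, pi]; the tangential component is then a known positive multiple of v.\<close>

lemma expc_inj: "inj_on (expc P \<iota>) (ball 0 1)"
proof (rule inj_onI)
  fix v w assume v: "v \<in> ball 0 1" and w: "w \<in> ball 0 1" and e: "expc P \<iota> v = expc P \<iota> w"
  have "cosc v = cosc w" using expc_inner_P[of v] expc_inner_P[of w] e by simp
  then have "pi * norm v = pi * norm w"
    unfolding cosc_eq by (rule cos_inj_pi[OF pi_norm_bounds(1)[OF v] pi_norm_bounds(2)[OF v] pi_norm_bounds(1)[OF w] pi_norm_bounds(2)[OF w]])
  then have n: "norm v = norm w" by simp
  have "sinc v = sinc w"
    using n by (cases "v = 0"; cases "w = 0") (auto simp: sinc_eq)
  moreover have "sinc v *\<^sub>R v = sinc w *\<^sub>R w" using expc_adjoint[of v] expc_adjoint[of w] e by simp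
  moreover have "sinc v > 0" using v by (intro sinc_pos) simp
  ultimately show "v = w" by simp
qed

text \<open>Write x = a P + \<iota> s, where a is the cosine of the angle \<theta> between P and x,
  so that pi * norm s = sin \<theta>. The preimage has the direction of s and length \<theta> / pi;
  it is below 1 because x \<noteq> - P forces a > -1.\<close>

lemma expc_surj:
  assumes x: "x \<in> dom_M2" "x \<noteq> - P"
  obtains v where "v \<in> ball 0 1" "expc P \<iota> v = x"
proof -
  note f = sphere_frameD[OF F]
  have xx: "x \<bullet> x = 1 / pi\<^sup>2" using x(1) by (simp add: dom_M2_def power2_norm_eq_inner[symmetric] power_divide)
  define a where "a = pi\<^sup>2 * (P \<bullet> x)"
  have Px: "P \<bullet> x = a / pi\<^sup>2" by (simp add: a_def)
  have "(x + P) \<bullet> (x + P) > 0" using x(2) by (simp add: add_eq_0_iff2)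
  then have "0 < (2 + 2 * a) / pi\<^sup>2"
    using xx f(6) Px by (simp add: inner_add_left inner_add_right inner_commute add_divide_distrib)
  then have a1: "a > - 1" by (simp add: zero_less_divide_iff)
  have "(x - P) \<bullet> (x - P) \<ge> 0" by simp
  then have "0 \<le> (2 - 2 * a) / pi\<^sup>2"
    using xx f(6) Px by (simp add: inner_diff_left inner_diff_right inner_commute diff_divide_distrib)
  then have a2: "a \<le> 1" by (simp add: zero_le_divide_iff)
  have "P \<bullet> (x - a *\<^sub>R P) = 0" using Px f(6) by (simp add: inner_diff_right)
  then obtain s where s: "\<iota> s = x - a *\<^sub>R P" using F unfolding sphere_frame_def by (metis (mono_tags) imageE mem_Collect_eq)
  have "s \<bullet> s = (x - a *\<^sub>R P) \<bullet> (x - a *\<^sub>R P)" using f(7)[of s s] s by simp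
  also have "\<dots> = (1 - a\<^sup>2) / pi\<^sup>2"
    using xx f(6) Px by (simp add: inner_diff_left inner_diff_right inner_commute diff_divide_distrib power2_eq_square)
  finally have ss: "(norm s)\<^sup>2 = (1 - a\<^sup>2) / pi\<^sup>2" by (simp add: power2_norm_eq_inner)
  show ?thesis
  proof (cases "s = 0")
    case True
    then have "a\<^sup>2 = 1" using ss by simp
    then have "a = 1" using a1 by (auto simp: power2_eq_1_iff)
    moreover have "expc P \<iota> 0 = P" using linear_0[OF f(2)] by (simp add: expc_eq cosc_eq)
    ultimately have "expc P \<iota> 0 = x" using s True linear_0[OF f(2)] by simp
    then show ?thesis using that[of 0] by simp
  next
    case False
    define \<theta> where "\<theta> = arccos a"
    have \<theta>: "cos \<theta> = a" "0 \<le> \<theta>" "\<theta> \<le> pi" using a1 a2 by (auto simp: \<theta>_def arccos_lbound arccos_ubound)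
    have sn: "sin \<theta> = pi * norm s"
    proof -
      have "sin \<theta> = sqrt (1 - a\<^sup>2)" using sin_arccos_abs[of a] a1 a2 by (simp add: \<theta>_def)
      also have "\<dots> = sqrt ((pi * norm s)\<^sup>2)" using ss by (simp add: power_mult_distrib)
      finally show ?thesis by simp
    qed
    then have "sin \<theta> > 0" using False by simp
    then have t: "0 < \<theta>" "\<theta> < pi" using \<theta> by (auto simp: less_le)
    define v where "v = (\<theta> / (pi * norm s)) *\<^sub>R s"
    have nv: "norm v = \<theta> / pi" using False t by (simp add: v_def)
    have v0: "v \<noteq> 0" using False t by (simp add: v_def)
    have "pi * norm v = \<theta>" by (simp add: nv)
    then have "expc P \<iota> v = a *\<^sub>R P + (sin \<theta> / \<theta>) *\<^sub>R ((\<theta> / (pi * norm s)) *\<^sub>R \<iota> s)"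
      by (simp add: expc_eq cosc_eq sinc_eq[OF v0] \<theta>(1)) (simp add: v_def linear_scale[OF f(2)])
    also have "\<dots> = a *\<^sub>R P + \<iota> s" using t False by (simp add: sn)
    also have "\<dots> = x" by (simp add: s)
    finally have "expc P \<iota> v = x" .
    moreover have "v \<in> ball 0 1" using t by (simp add: nv)
    ultimately show ?thesis using that by blast
  qed
qed

lemma expc_neq_antipode: "v \<in> ball 0 1 \<Longrightarrow> expc P \<iota> v \<noteq> - P"
proof
  assume v: "v \<in> ball 0 1" and e: "expc P \<iota> v = - P"
  have "cosc v = cos pi" using expc_inner_P[of v] e by (simp add: sphere_frameD[OF F] field_simps)
  then have "pi * norm v = pi"
    unfolding cosc_eq by (rule cos_inj_pi[OF pi_norm_bounds[OF v] pi_ge_zero order_refl])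
  then show False using v by simp
qed

lemma expc_eq_P_iff: "v \<in> ball 0 1 \<Longrightarrow> expc P \<iota> v = P \<longleftrightarrow> v = 0"
proof -
  assume v: "v \<in> ball 0 1"
  have "expc P \<iota> 0 = P" using linear_0[OF sphere_frameD(2)[OF F]] by (simp add: expc_eq cosc_eq)
  then show ?thesis using inj_on_eq_iff[OF expc_inj v, of 0] by simp
qed

text \<open>Half a great circle on the sphere of radius 1/pi has length 1. Hence the point at
  distance r from -P in a given direction is the point at distance 1 - r from P in the same
  direction.\<close>

lemma expc_antipodal:
  assumes "v \<in> ball 0 1 - {0}"
  shows "expc (- P) \<iota> v = expc P \<iota> (radial (- 1) 1 v)"
proof -
  define w where "w = radial (- 1) 1 v"
  have v: "0 < norm v" "norm v < 1" using assms by auto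
  have nw: "norm w = 1 - norm v" unfolding w_def using norm_radial[of v "-1" 1] v by auto
  have w0: "w \<noteq> 0" using nw v by auto
  have wv: "w = ((1 - norm v) / norm v) *\<^sub>R v"
    using v by (simp add: w_def radial_def diff_divide_distrib)
  have c: "cosc w = - cosc v" by (simp add: cosc_eq nw right_diff_distrib cos_diff)
  have "sin (pi * norm w) = sin (pi * norm v)" by (simp add: nw right_diff_distrib sin_diff)
  then have "sinc w * ((1 - norm v) / norm v) = sinc v"
    using v w0 by (simp add: sinc_eq nw)
  then have "sinc w *\<^sub>R \<iota> w = sinc v *\<^sub>R \<iota> v"
    unfolding wv[THEN arg_cong, of \<iota>] linear_scale[OF sphere_frameD(2)[OF F]] by simp
  moreover have "expc (- P) \<iota> v = cosc v *\<^sub>R (- P) + sinc v *\<^sub>R \<iota> v"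
    using linear_0[OF sphere_frameD(2)[OF F]] v
    by (simp add: expc_def sphere_exp_def cosc_eq sinc_eq sphere_frameD[OF F] mult.commute)
  ultimately show ?thesis by (simp add: w_def[symmetric] expc_eq c)
qed

text \<open>Differentiate the two component identities. The one along P gives v \<bullet> h = 0, as
  sin (pi r) > 0 for 0 < r < 1; the tangential one gives sinc v h + S h v = 0, and its inner product
  with h leaves sinc v (h \<bullet> h) = 0.\<close>

lemma expc_jac_inj:
  assumes v: "v \<in> ball 0 1" and h: "jac (expc P \<iota>) v *v h = 0"
  shows "h = 0"
proof -
  have D: "(expc P \<iota> has_derivative (\<lambda>h. jac (expc P \<iota>) v *v h)) (at v)"
    by (rule jac_works, rule Ck_on_1_imp_jac(1)[of UNIV]) (auto intro!: expc_smooth simp del: Ck_on.simps)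
  have "((\<lambda>v. pi\<^sup>2 * (P \<bullet> expc P \<iota> v)) has_derivative (\<lambda>h. pi\<^sup>2 * (P \<bullet> (jac (expc P \<iota>) v *v h)))) (at v)"
    by (intro has_derivative_mult_right has_derivative_inner_right D)
  then have Dc: "(cosc has_derivative (\<lambda>h. pi\<^sup>2 * (P \<bullet> (jac (expc P \<iota>) v *v h)))) (at v)"
    by (simp add: expc_inner_P)
  have vh: "v \<bullet> h = 0"
  proof (cases "v = 0")
    case False
    have "((\<lambda>v. cos (pi * norm v)) has_derivative (\<lambda>h. - sin (pi * norm v) * (pi * (h \<bullet> sgn v)))) (at v)"
      using has_derivative_compose[OF has_derivative_mult_right[OF has_derivative_norm[OF False], of pi]
          DERIV_cos[unfolded has_field_derivative_def]] .
    then have "(cosc has_derivative (\<lambda>h. - sin (pi * norm v) * (pi * (h \<bullet> sgn v)))) (at v)"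
      by (simp add: cosc_eq[abs_def])
    then have "pi\<^sup>2 * (P \<bullet> (jac (expc P \<iota>) v *v h)) = - sin (pi * norm v) * (pi * (h \<bullet> sgn v))"
      using has_derivative_unique[OF Dc] by metis
    then have "sin (pi * norm v) * (h \<bullet> sgn v) = 0" using h by simp
    moreover have "sin (pi * norm v) > 0" using False v by (intro sin_gt_zero) auto
    ultimately have "h \<bullet> sgn v = 0" by simp
    then show ?thesis using False by (simp add: sgn_div_norm inner_commute)
  qed simp
  have "sinc differentiable (at v)" using Ck_on_sinc[of UNIV 1] by auto
  then obtain S where S: "(sinc has_derivative S) (at v)" unfolding differentiable_def by blast
  have D1: "((\<lambda>v. sinc v *\<^sub>R v) has_derivative (\<lambda>h. sinc v *\<^sub>R h + S h *\<^sub>R v)) (at v)"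
    by (intro has_derivative_scaleR S has_derivative_ident)
  have "bounded_linear (adjoint \<iota>)"
    using adjoint_linear[OF sphere_frameD(2)[OF F]] linear_conv_bounded_linear by blast
  from bounded_linear.has_derivative[OF this D]
  have D2: "((\<lambda>v. sinc v *\<^sub>R v) has_derivative (\<lambda>h. adjoint \<iota> (jac (expc P \<iota>) v *v h))) (at v)"
    by (simp add: expc_adjoint)
  have "sinc v *\<^sub>R h + S h *\<^sub>R v = adjoint \<iota> (jac (expc P \<iota>) v *v h)"
    using has_derivative_unique[OF D1 D2] by metis
  also have "\<dots> = 0" using h linear_0[OF adjoint_linear[OF sphere_frameD(2)[OF F]]] by simp
  finally have "h \<bullet> (sinc v *\<^sub>R h + S h *\<^sub>R v) = 0" by simp
  then have "sinc v * (h \<bullet> h) = 0" using vh by (simp add: inner_add_right inner_commute)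
  moreover have "sinc v > 0" using v by (intro sinc_pos) simp
  ultimately show ?thesis by simp
qed

lemma expc_chart: "chart_M2 (ball 0 1) (expc P \<iota>)"
  unfolding chart_M2_def
proof (intro conjI ballI allI)
  show "inj_on (expc P \<iota>) (ball 0 1)" by (rule expc_inj)
  show "expc P \<iota> ` ball 0 1 \<subseteq> dom_M2" using expc_in_sphere by auto
  show "smooth_on (ball 0 1) (\<lambda>x. expc P \<iota> x $ i)" for i by (intro smooth_on_openI expc_smooth) auto
  fix v :: "real^3" assume v: "v \<in> ball 0 1"
  have d: "expc P \<iota> differentiable (at v)"
    by (rule Ck_on_1_imp_jac(1)[of UNIV]) (auto intro!: expc_smooth simp del: Ck_on.simps)
  have e: "frechet_derivative (expc P \<iota>) (at v) = (\<lambda>h. jac (expc P \<iota>) v *v h)"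
    using frechet_derivative_at[OF jac_works[OF d]] by simp
  show "inj (frechet_derivative (expc P \<iota>) (at v))"
    unfolding e
  proof (rule injI)
    fix h k assume "jac (expc P \<iota>) v *v h = jac (expc P \<iota>) v *v k"
    then have "jac (expc P \<iota>) v *v (h - k) = 0" by (simp add: matrix_vector_mult_diff_distrib)
    then show "h = k" using expc_jac_inj[OF v] by fastforce
  qed
qed auto

text \<open>Away from the two poles the geodesic coordinates are explicit, with \<open>\<theta> = arccos a\<close> and
  \<open>\<theta> / sin \<theta> = arccos a / sqrt (1 - a\<^sup>2)\<close>.\<close>

lemma expc_inverse_explicit:
  assumes v: "v \<in> ball 0 1 - {0}"
  defines "a \<equiv> pi\<^sup>2 * (P \<bullet> expc P \<iota> v)"
  shows "v = (arccos a * (1 / sqrt (1 - a\<^sup>2))) *\<^sub>R adjoint \<iota> (expc P \<iota> v)" "-1 < a" "a < 1"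
proof -
  have a: "a = cos (pi * norm v)" by (simp add: a_def expc_inner_P cosc_eq)
  have r: "0 < pi * norm v" "pi * norm v < pi" using v by auto
  show "-1 < a" unfolding a using cos_monotone_0_pi[of "pi * norm v" pi] r by simp
  show "a < 1" unfolding a using cos_monotone_0_pi[of 0 "pi * norm v"] r by simp
  have ar: "arccos a = pi * norm v" unfolding a using r by (intro arccos_cos) auto
  have s: "sin (pi * norm v) > 0" using r by (intro sin_gt_zero) auto
  have "1 - a\<^sup>2 = (sin (pi * norm v))\<^sup>2" unfolding a by (simp add: sin_squared_eq)
  then have sq: "sqrt (1 - a\<^sup>2) = sin (pi * norm v)" using s by simp
  have E: "(arccos a * (1 / sqrt (1 - a\<^sup>2))) * sinc v = 1"
    unfolding ar sq using v s r by (simp add: sinc_eq)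
  then show "v = (arccos a * (1 / sqrt (1 - a\<^sup>2))) *\<^sub>R adjoint \<iota> (expc P \<iota> v)"
    by (simp only: expc_adjoint scaleR_scaleR E scaleR_one)
qed

end

section \<open>Metrics and charts on the sphere\<close>

lemma smooth_on_continuous: "smooth_on S f \<Longrightarrow> continuous_on S f"
proof -
  assume "smooth_on S f"
  then obtain U f' where U: "open U" "S \<subseteq> U" "\<And>n. Ck_on n U f'" "\<And>x. x \<in> S \<Longrightarrow> f x = f' x"
    unfolding smooth_on_def by metis
  have "continuous_on S f'" using Ck_on_continuous[OF U(3)] U(2) continuous_on_subset by blast
  then show ?thesis by (rule continuous_on_eq) (simp add: U(4))
qed

lemma riemannian_metric_continuous:
  assumes "riemannian_metric S T g"
  shows "continuous_on S g"
proof -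
  have "continuous_on S (\<lambda>p. \<chi> i j. g p $ i $ j)"
    using assms smooth_on_continuous unfolding riemannian_metric_def by (intro continuous_on_vec_lambda) blast
  then show ?thesis by simp
qed

lemma chart_M2D:
  assumes "chart_M2 U \<kappa>"
  shows "open U" "inj_on \<kappa> U" "\<And>x. x \<in> U \<Longrightarrow> \<kappa> x \<in> dom_M2" "\<And>n i. Ck_on n U (\<lambda>x. \<kappa> x $ i)"
    "\<And>x. x \<in> U \<Longrightarrow> \<kappa> differentiable (at x)" "continuous_on U (jac \<kappa>)" "continuous_on U \<kappa>"
    "\<And>x v. x \<in> U \<Longrightarrow> jac \<kappa> x *v v = 0 \<Longrightarrow> v = 0" "\<And>x v. x \<in> U \<Longrightarrow> \<kappa> x \<bullet> (jac \<kappa> x *v v) = 0"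
proof -
  show U: "open U" and "inj_on \<kappa> U" and S: "\<And>x. x \<in> U \<Longrightarrow> \<kappa> x \<in> dom_M2"
    using assms unfolding chart_M2_def by auto
  show C: "\<And>n i. Ck_on n U (\<lambda>x. \<kappa> x $ i)"
    using assms smooth_on_openD unfolding chart_M2_def by blast
  show d: "\<And>x. x \<in> U \<Longrightarrow> \<kappa> differentiable (at x)" and "continuous_on U (jac \<kappa>)"
    by (rule Ck_on_1_imp_jac[OF C]; assumption)+
  then show "continuous_on U \<kappa>"
    by (auto intro!: continuous_at_imp_continuous_on differentiable_imp_continuous_within)
  show "v = 0" if x: "x \<in> U" and j: "jac \<kappa> x *v v = 0" for x v
  proof -
    have e: "frechet_derivative \<kappa> (at x) = (\<lambda>h. jac \<kappa> x *v h)"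
      using frechet_derivative_at[OF jac_works[OF d[OF x]]] by simp
    have "inj (\<lambda>h. jac \<kappa> x *v h)" using assms x unfolding chart_M2_def e[symmetric] by blast
    then show ?thesis using j by (metis injD matrix_vector_mult_0_right)
  qed
  show "\<kappa> x \<bullet> (jac \<kappa> x *v v) = 0" if x: "x \<in> U" for x v
  proof -
    note D = jac_works[OF d[OF x]]
    \<comment> \<open>Differentiating the constant function \<kappa> \<bullet> \<kappa> shows that
      the Jacobian of a chart takes values in the tangent spaces.\<close>
    have D1: "((\<lambda>x. \<kappa> x \<bullet> \<kappa> x) has_derivative (\<lambda>h. \<kappa> x \<bullet> (jac \<kappa> x *v h) + (jac \<kappa> x *v h) \<bullet> \<kappa> x)) (at x)"
      by (rule has_derivative_inner[OF D D])
    have "((\<lambda>x. \<kappa> x \<bullet> \<kappa> x) has_derivative (\<lambda>h. 0)) (at x) \<longleftrightarrow> ((\<lambda>x. (1 / pi)\<^sup>2) has_derivative (\<lambda>h. 0)) (at x)"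
      by (rule has_derivative_cong_open[OF U x]) (use S in \<open>simp add: dom_M2_def power2_norm_eq_inner[symmetric]\<close>)
    then have D2: "((\<lambda>x. \<kappa> x \<bullet> \<kappa> x) has_derivative (\<lambda>h. 0)) (at x)" by simp
    have "\<kappa> x \<bullet> (jac \<kappa> x *v v) + (jac \<kappa> x *v v) \<bullet> \<kappa> x = 0"
      using fun_cong[OF has_derivative_unique[OF D1 D2], of v] .
    then show ?thesis by (simp add: inner_commute)
  qed
qed

lemma chart_metric_field:
  assumes "chart_M2 U \<kappa>" and g: "riemannian_metric dom_M2 tangent_sphere g"
  shows "metric_field U (pullback_metric \<kappa> g)"
  unfolding metric_field_def
proof (intro conjI ballI allI impI)
  note C = chart_M2D[OF assms(1)]
  show "continuous_on U (pullback_metric \<kappa> g)"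
    unfolding pullback_metric_jac[abs_def]
    by (intro continuous_on_matrix_mult continuous_on_transpose C(6)
        continuous_on_compose2[OF riemannian_metric_continuous[OF g] C(7)]) (use C(3) in auto)
  fix x assume x: "x \<in> U"
  show "transpose (pullback_metric \<kappa> g x) = pullback_metric \<kappa> g x"
    using g C(3)[OF x] by (simp add: riemannian_metric_def pullback_metric_jac matrix_transpose_mul matrix_mul_assoc)
  fix v :: "real^3" assume v: "v \<noteq> 0"
  \<comment> \<open>The form \<open>g\<close> is positive only on tangent vectors, so tangency is
    needed in addition to injectivity.\<close>
  have "jac \<kappa> x *v v \<noteq> 0" "jac \<kappa> x *v v \<in> tangent_sphere (\<kappa> x)"
    using C(8,9)[OF x] v by (auto simp: tangent_sphere_def)
  then have "0 < (jac \<kappa> x *v v) \<bullet> (g (\<kappa> x) *v (jac \<kappa> x *v v))"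
    using g C(3)[OF x] unfolding riemannian_metric_def by blast
  also have "\<dots> = v \<bullet> (pullback_metric \<kappa> g x *v v)"
    unfolding pullback_metric_jac
    by (simp flip: matrix_vector_mul_assoc) (metis dot_lmul_matrix inner_commute)
  finally show "0 < v \<bullet> (pullback_metric \<kappa> g x *v v)" .
qed


section \<open>Transfer between the two sides\<close>

lemma weak_integrand_cong_open:
  assumes "open U" "x \<in> U" "G x = G' x" "u x = u' x" "Du x = Du' x" "f x = f' x" "\<And>y. y \<in> U \<Longrightarrow> \<psi> y = \<psi>' y"
  shows "weak_integrand G k u Du f \<psi> x = weak_integrand G' k u' Du' f' \<psi>' x"
  using assms grad_cong_open[OF assms(1,2,7)] by (simp add: weak_integrand_def)

lemma L2_loc_cong:
  assumes "\<And>x. x \<in> U \<Longrightarrow> f x = g x" "L2_loc U f"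
  shows "L2_loc U g"
  unfolding L2_loc_def square_integrable_def
proof (intro conjI allI impI)
  show "g \<in> borel_measurable (lebesgue_on U)"
    using L2_loc_measurable[OF assms(2)] assms(1)
    by (subst measurable_cong[of _ g f]) (auto simp: space_restrict_space)
  fix K assume K: "compact K \<and> K \<subseteq> U"
  then have s: "square_integrable (lebesgue_on K) f" using assms(2) by (simp add: L2_loc_def)
  have e: "g x = f x" if "x \<in> space (lebesgue_on K)" for x using that K assms(1) by (auto simp: space_restrict_space)
  show "g \<in> borel_measurable (lebesgue_on K)"
    using s by (subst measurable_cong[of _ g f]) (auto simp: e square_integrable_def)
  show "integrable (lebesgue_on K) (\<lambda>x. (g x)\<^sup>2)"
    using s by (subst Bochner_Integration.integrable_cong[OF refl, of _ _ "\<lambda>x. (f x)\<^sup>2"]) (auto simp: e square_integrable_def)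
qed

lemma H1_loc_grad_cong:
  assumes "open U" "\<And>x. x \<in> U \<Longrightarrow> u x = u' x" "\<And>x. x \<in> U \<Longrightarrow> Du x = Du' x" "H1_loc_grad U u Du"
  shows "H1_loc_grad U u' Du'"
proof -
  have "L2_loc U u'"
    by (rule L2_loc_cong[of U u]) (use assms(2,4) in \<open>auto simp: H1_loc_grad_def\<close>)
  moreover have "L2_loc_vec U Du'"
    unfolding L2_loc_vec_def
  proof
    show "L2_loc U (\<lambda>x. Du' x $ i)" for i
      by (rule L2_loc_cong[of U "\<lambda>x. Du x $ i"]) (use assms(3,4) in \<open>auto simp: H1_loc_grad_def\<close>)
  qed
  moreover have "weak_div U (\<lambda>x. u' x *\<^sub>R axis i 1) (\<lambda>x. Du' x $ i)" for i
    using assms(4) unfolding H1_loc_grad_iff_weak_div[OF assms(1)]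
    by (rule_tac weak_div_cong[of U "\<lambda>x. u x *\<^sub>R axis i 1" _ "\<lambda>x. Du x $ i"]) (auto simp: assms(2,3))
  ultimately show ?thesis unfolding H1_loc_grad_iff_weak_div[OF assms(1)] by blast
qed

lemma weak_helmholtz_cong:
  assumes U: "open U" and e: "\<And>x. x \<in> U \<Longrightarrow> G x = G' x" "\<And>x. x \<in> U \<Longrightarrow> u x = u' x"
    "\<And>x. x \<in> U \<Longrightarrow> Du x = Du' x" "\<And>x. x \<in> U \<Longrightarrow> f x = f' x"
    and w: "weak_helmholtz U G k u Du f"
  shows "weak_helmholtz U G' k u' Du' f'"
  unfolding weak_helmholtz_def
proof (intro conjI allI impI)
  show "H1_loc_grad U u' Du'"
    by (rule H1_loc_grad_cong[OF U e(2,3)]) (use w in \<open>auto simp: weak_helmholtz_def\<close>)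
  fix \<phi> assume "test_function U \<phi>"
  then have "has_bochner_integral (lebesgue_on U) (weak_integrand G k u Du f \<phi>) 0"
    using w by (simp add: weak_helmholtz_def)
  then show "has_bochner_integral (lebesgue_on U) (weak_integrand G' k u' Du' f' \<phi>) 0"
    by (subst has_bochner_integral_cong[OF refl _ refl, of _ _ "weak_integrand G k u Du f \<phi>"])
      (auto simp: space_restrict_space e weak_integrand_def)
qed

lemma metric_field_cong:
  "(\<And>x. x \<in> U \<Longrightarrow> G x = G' x) \<Longrightarrow> metric_field U G \<Longrightarrow> metric_field U G'"
  unfolding metric_field_def using continuous_on_eq by force

lemma square_integrable_L2_loc:
  assumes "open U" "square_integrable (lebesgue_on U) f"
  shows "L2_loc U f"
proof (rule L2_locI_weighted[OF assms(1) finite.emptyI])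
  show "integrable (lebesgue_on (U - {})) (\<lambda>x. (f x)\<^sup>2)" "f \<in> borel_measurable (lebesgue_on (U - {}))"
    using assms(2) by (simp_all add: square_integrable_def)
  show "\<exists>C. \<forall>x\<in>K - {}. (f x)\<^sup>2 \<le> C * (f x)\<^sup>2" for K by (rule exI[of _ 1]) simp
qed

lemma square_integrable_weighted:
  fixes w :: "'a::euclidean_space \<Rightarrow> real"
  assumes U: "open U" and P: "finite P" and w: "w \<in> borel_measurable (lebesgue_on (U - P))"
    and g: "integrable (lebesgue_on (U - P)) g" and b: "\<And>x. x \<in> U - P \<Longrightarrow> (w x)\<^sup>2 \<le> C * g x"
  shows "square_integrable (lebesgue_on U) w"
  unfolding square_integrable_def
proof
  have "open (U - P)" by (rule open_Diff[OF U finite_imp_closed[OF P]])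
  then have O: "U - P \<in> sets lebesgue" "U \<in> sets lebesgue" using U by auto
  show m: "w \<in> borel_measurable (lebesgue_on U)"
    by (rule borel_measurable_lebesgue_on_finite_extension[OF U P w])
  show "integrable (lebesgue_on U) (\<lambda>x. (w x)\<^sup>2)"
    unfolding integrable_lebesgue_on_iff[OF O(2)]
  proof (rule Bochner_Integration.integrable_bound)
    show "integrable lebesgue (\<lambda>x. C * (indicat_real (U - P) x * g x))"
      using g unfolding integrable_lebesgue_on_iff[OF O(1)] by (rule integrable_mult_right)
    have "(\<lambda>x. (w x)\<^sup>2) \<in> borel_measurable (lebesgue_on U)" using m by measurable
    then show "(\<lambda>x. indicat_real U x * (w x)\<^sup>2) \<in> borel_measurable lebesgue"
      using O by (simp add: borel_measurable_restrict_space_iff)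
    show "AE x in lebesgue. norm (indicat_real U x * (w x)\<^sup>2) \<le> norm (C * (indicat_real (U - P) x * g x))"
      using AE_lebesgue_notin_finite[OF P]
    proof eventually_elim
      case (elim x)
      show ?case
      proof (cases "x \<in> U")
        case True
        then have "(w x)\<^sup>2 \<le> \<bar>C * g x\<bar>" using b[of x] elim by auto
        then show ?thesis using True elim by simp
      qed simp
    qed
  qed
qed

lemma indicator_mult_measurable:
  fixes f :: "'a::euclidean_space \<Rightarrow> real"
  assumes "f \<in> borel_measurable (lebesgue_on U)" "K \<subseteq> U" "K \<in> sets lebesgue"
  shows "(\<lambda>x. indicat_real K x * f x) \<in> borel_measurable lebesgue"
  using measurable_restrict_mono[OF assms(1,2)] assms(3) by (simp add: borel_measurable_restrict_space_iff)

lemma energy_measurable: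
  assumes "open U" "metric_field U G" "\<And>i. (\<lambda>x. Du x $ i) \<in> borel_measurable (lebesgue_on U)"
  shows "energy G Du \<in> borel_measurable (lebesgue_on U)"
proof -
  note M = metric_fieldD[OF assms(2)]
  have s: "(\<lambda>x. sqrt (det (G x))) \<in> borel_measurable (lebesgue_on U)"
    by (rule continuous_on_borel_measurable_lebesgue_on[OF assms(1) M(6)])
  have i: "(\<lambda>x. matrix_inv (G x) $ a $ b) \<in> borel_measurable (lebesgue_on U)" for a b
    by (intro continuous_on_borel_measurable_lebesgue_on[OF assms(1)] continuous_on_component M(5))
  show ?thesis
    unfolding energy_def[abs_def] inner_vec_def inner_real_def matrix_vector_mult_def vec_lambda_beta
    by (intro borel_measurable_times borel_measurable_sum s i assms(3))
qed

lemma norm_sq_sum: "(norm (v :: real^'n))\<^sup>2 = (\<Sum>i\<in>UNIV. (v $ i)\<^sup>2)"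
  by (simp add: norm_vec_def L2_set_def sum_nonneg)

lemma energy_integrable_compact:
  assumes "open U" "metric_field U G" "L2_loc_vec U Du" and K: "compact K" "K \<subseteq> U"
  shows "integrable lebesgue (\<lambda>x. indicat_real K x * energy G Du x)"
proof -
  obtain c C where C: "c > 0" "C > 0" "\<And>x Du. x \<in> K \<Longrightarrow> energy G Du x \<le> C * (norm (Du x))\<^sup>2"
    "\<And>x Du. x \<in> K \<Longrightarrow> c * (norm (Du x))\<^sup>2 \<le> energy G Du x"
    by (rule metric_field_bounds[OF assms(2) K]) blast
  note KS = compact_in_sets_lebesgue[OF K(1)]
  show ?thesis
  proof (rule Bochner_Integration.integrable_bound)
    show "integrable lebesgue (\<lambda>x. C * (\<Sum>i\<in>UNIV. indicat_real K x * (Du x $ i)\<^sup>2))"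
      using assms(3) K by (intro integrable_mult_right Bochner_Integration.integrable_sum L2_loc_compact(2)) (auto simp: L2_loc_vec_def)
    have "energy G Du \<in> borel_measurable (lebesgue_on U)"
      using assms(3) L2_loc_measurable by (intro energy_measurable[OF assms(1,2)]) (auto simp: L2_loc_vec_def)
    then show "(\<lambda>x. indicat_real K x * energy G Du x) \<in> borel_measurable lebesgue"
      by (rule indicator_mult_measurable[OF _ K(2) KS])
    show "AE x in lebesgue. norm (indicat_real K x * energy G Du x) \<le> norm (C * (\<Sum>i\<in>UNIV. indicat_real K x * (Du x $ i)\<^sup>2))"
    proof (rule AE_I2)
      fix x
      show "norm (indicat_real K x * energy G Du x) \<le> norm (C * (\<Sum>i\<in>UNIV. indicat_real K x * (Du x $ i)\<^sup>2))"
      proof (cases "x \<in> K")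
        case True
        have "0 \<le> c * (norm (Du x))\<^sup>2" using C(1) by simp
        then have "0 \<le> energy G Du x" using C(4)[OF True, of Du] by linarith
        then have "\<bar>energy G Du x\<bar> \<le> C * (norm (Du x))\<^sup>2" using C(3)[OF True, of Du] by simp
        then show ?thesis using True C(2) by (simp add: norm_sq_sum sum_nonneg)
      qed simp
    qed
  qed
qed

lemma L2_weight_integrable_compact:
  assumes "open U" "metric_field U G" "L2_loc U u" and K: "compact K" "K \<subseteq> U"
  shows "integrable lebesgue (\<lambda>x. indicat_real K x * ((u x)\<^sup>2 * sqrt (det (G x))))"
proof -
  note M = metric_fieldD[OF assms(2)]
  obtain C where C: "C > 0" "\<And>x. x \<in> K \<Longrightarrow> \<bar>sqrt (det (G x))\<bar> \<le> C"
    using continuous_on_compact_abs_bound[OF M(6) K] by metis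
  note KS = compact_in_sets_lebesgue[OF K(1)]
  show ?thesis
  proof (rule Bochner_Integration.integrable_bound)
    show "integrable lebesgue (\<lambda>x. C * (indicat_real K x * (u x)\<^sup>2))"
      by (intro integrable_mult_right L2_loc_compact(2)[OF assms(3) K])
    have "(\<lambda>x. (u x)\<^sup>2 * sqrt (det (G x))) \<in> borel_measurable (lebesgue_on U)"
      using L2_loc_measurable[OF assms(3)] continuous_on_borel_measurable_lebesgue_on[OF assms(1) M(6)]
      by (intro borel_measurable_times borel_measurable_power)
    then show "(\<lambda>x. indicat_real K x * ((u x)\<^sup>2 * sqrt (det (G x)))) \<in> borel_measurable lebesgue"
      by (rule indicator_mult_measurable[OF _ K(2) KS])
    show "AE x in lebesgue. norm (indicat_real K x * ((u x)\<^sup>2 * sqrt (det (G x)))) \<le> norm (C * (indicat_real K x * (u x)\<^sup>2))"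
    proof (rule AE_I2)
      fix x
      have "(u x)\<^sup>2 * \<bar>sqrt (det (G x))\<bar> \<le> (u x)\<^sup>2 * C" if "x \<in> K"
        by (intro mult_left_mono C(2)[OF that]) simp
      then show "norm (indicat_real K x * ((u x)\<^sup>2 * sqrt (det (G x)))) \<le> norm (C * (indicat_real K x * (u x)\<^sup>2))"
        using C(1) by (cases "x \<in> K") (auto simp: abs_mult mult.commute)
    qed
  qed
qed

lemma C1_diffeo_inverse_metric:
  assumes "C1_diffeo U U' \<tau> \<sigma>" "\<And>y. y \<in> U' \<Longrightarrow> G y = pullback_metric \<sigma> g y" "x \<in> U"
  shows "pullback_metric \<tau> G x = g x"
proof -
  note J = C1_diffeo_jac[OF assms(1,3)]
  note D = C1_diffeoD[OF assms(1)]
  have "pullback_metric \<tau> G x = transpose (jac \<tau> x) ** (transpose (jac \<sigma> (\<tau> x)) ** g x ** jac \<sigma> (\<tau> x)) ** jac \<tau> x"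
    using assms(2)[OF D(3)[OF assms(3)]] D(4)[OF assms(3)] by (simp add: pullback_metric_jac)
  also have "\<dots> = transpose (jac \<sigma> (\<tau> x) ** jac \<tau> x) ** g x ** (jac \<sigma> (\<tau> x) ** jac \<tau> x)"
    by (simp add: matrix_transpose_mul matrix_mul_assoc)
  also have "\<dots> = g x" unfolding J(1) by simp
  finally show ?thesis .
qed

text \<open>The weight \<open>c\<close> localises: besides the constant 1 it will be the indicator
  of the closed half ball, which separates a neighbourhood of each pole.\<close>

lemma C1_diffeo_energy_integrable:
  fixes \<tau> :: "real^'n::{finite,wellorder} \<Rightarrow> real^'n::_"
  assumes "C1_diffeo U U' \<tau> \<sigma>" "metric_field U' G" "\<And>x. x \<in> U \<Longrightarrow> g x = pullback_metric \<tau> G x"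
  shows "integrable (lebesgue_on U') (\<lambda>y. c y * energy G Du y) \<longleftrightarrow>
      integrable (lebesgue_on U) (\<lambda>x. c (\<tau> x) * energy g (\<lambda>x. Du (\<tau> x) v* jac \<tau> x) x)"
    and "integrable (lebesgue_on U') (\<lambda>y. c y * ((u y)\<^sup>2 * sqrt (det (G y)))) \<longleftrightarrow>
      integrable (lebesgue_on U) (\<lambda>x. c (\<tau> x) * ((u (\<tau> x))\<^sup>2 * sqrt (det (g x))))"
proof -
  note D = C1_diffeoD[OF assms(1)]
  have nz: "det (G (\<tau> x)) \<noteq> 0" if "x \<in> U" for x
    using metric_fieldD(4)[OF assms(2) D(3)[OF that]] by simp
  have e1: "\<bar>det (jac \<tau> x)\<bar> * (c (\<tau> x) * energy G Du (\<tau> x)) = c (\<tau> x) * energy g (\<lambda>x. Du (\<tau> x) v* jac \<tau> x) x" if "x \<in> U" for x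
    using pullback_energy[where G = G and Du = Du, OF assms(1) that nz[OF that]] assms(3)[OF that] by (simp add: energy_def)
  have e2: "\<bar>det (jac \<tau> x)\<bar> * (c (\<tau> x) * ((u (\<tau> x))\<^sup>2 * sqrt (det (G (\<tau> x))))) = c (\<tau> x) * ((u (\<tau> x))\<^sup>2 * sqrt (det (g x)))" if "x \<in> U" for x
    using pullback_inverse(2)[where G = G, OF assms(1) that nz[OF that]] assms(3)[OF that] by simp
  show "integrable (lebesgue_on U') (\<lambda>y. c y * energy G Du y) \<longleftrightarrow>
      integrable (lebesgue_on U) (\<lambda>x. c (\<tau> x) * energy g (\<lambda>x. Du (\<tau> x) v* jac \<tau> x) x)"
    unfolding C1_diffeo_integrable[OF assms(1)]
    by (rule Bochner_Integration.integrable_cong[OF refl]) (simp add: e1 space_restrict_space)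
  show "integrable (lebesgue_on U') (\<lambda>y. c y * ((u y)\<^sup>2 * sqrt (det (G y)))) \<longleftrightarrow>
      integrable (lebesgue_on U) (\<lambda>x. c (\<tau> x) * ((u (\<tau> x))\<^sup>2 * sqrt (det (g x))))"
    unfolding C1_diffeo_integrable[OF assms(1)]
    by (rule Bochner_Integration.integrable_cong[OF refl]) (simp add: e2 space_restrict_space)
qed

lemma C1_diffeo_weak_integrand:
  fixes \<tau> :: "real^'n::{finite,wellorder} \<Rightarrow> real^'n::_"
  assumes "C1_diffeo U U' \<tau> \<sigma>" "metric_field U' G" "\<And>x. x \<in> U \<Longrightarrow> g x = pullback_metric \<tau> G x"
    and \<psi>: "\<And>y. y \<in> U' \<Longrightarrow> GDERIV \<psi> y :> grad \<psi> y"
    and e: "\<And>x. x \<in> U \<Longrightarrow> u' x = u (\<tau> x)" "\<And>x. x \<in> U \<Longrightarrow> f' x = f (\<tau> x)" "\<And>x. x \<in> U \<Longrightarrow> \<phi> x = \<psi> (\<tau> x)"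
      "\<And>x. x \<in> U \<Longrightarrow> Du' x = Du (\<tau> x) v* jac \<tau> x"
  shows "has_bochner_integral (lebesgue_on U') (weak_integrand G k u Du f \<psi>) I \<longleftrightarrow>
    has_bochner_integral (lebesgue_on U) (weak_integrand g k u' Du' f' \<phi>) I"
  unfolding C1_diffeo_has_bochner_integral[OF assms(1)]
proof (rule has_bochner_integral_cong[OF refl _ refl])
  note D = C1_diffeoD[OF assms(1)]
  fix x assume "x \<in> space (lebesgue_on U)"
  then have x: "x \<in> U" by (simp add: space_restrict_space)
  have nz: "det (G (\<tau> x)) \<noteq> 0" using metric_fieldD(4)[OF assms(2) D(3)[OF x]] by simp
  have "weak_integrand g k u' Du' f' \<phi> x = weak_integrand (pullback_metric \<tau> G) k (\<lambda>x. u (\<tau> x)) (\<lambda>x. Du (\<tau> x) v* jac \<tau> x) (\<lambda>x. f (\<tau> x)) (\<lambda>x. \<psi> (\<tau> x)) x"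
    by (rule weak_integrand_cong_open[OF D(1) x]) (use e x assms(3) in auto)
  then show "\<bar>det (jac \<tau> x)\<bar> * weak_integrand G k u Du f \<psi> (\<tau> x) = weak_integrand g k u' Du' f' \<phi> x"
    using pullback_weak_integrand[where G = G, OF assms(1) x nz \<psi>[OF D(3)[OF x]]] by simp
qed


section \<open>The outer annulus and the Euclidean ball\<close>

abbreviation "punctured_M1 \<equiv> dom_M1 - {0}"
abbreviation "\<Phi> \<equiv> radial 2 (- 2) :: real^3 \<Rightarrow> real^3"

lemma F1_eq_radial: "F1 = radial (1 / 2) 1"
proof
  fix x show "F1 x = radial (1 / 2) 1 x"
    by (cases "x = 0") (simp_all add: F1_def radial_def add_divide_distrib distrib_right)
qed

lemma mem_dom_N1: "y \<in> dom_N1 \<longleftrightarrow> 1 < norm y \<and> norm y < 2"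
  by (auto simp: dom_N1_def)

lemma open_domains: "open dom_N1" "open dom_N2" "open dom_M1" "open punctured_M1"
  by (auto simp: dom_N1_def dom_N2_def dom_M1_def)

lemma F1_diffeo: "C1_diffeo punctured_M1 dom_N1 F1 \<Phi>"
  unfolding F1_eq_radial
proof (rule radial_C1_diffeo)
  fix x assume "x \<in> punctured_M1"
  then have x: "x \<noteq> 0" "norm x < 2" by (auto simp: dom_M1_def)
  have "norm (radial (1 / 2) 1 x) = norm x / 2 + 1" using norm_radial[OF x(1), of "1 / 2" 1] by simp
  then show "1 / 2 * norm x + 1 > 0 \<and> radial (1 / 2) 1 x \<in> dom_N1" using x by (auto simp: mem_dom_N1 add_nonneg_pos)
next
  fix x assume "x \<in> dom_N1"
  then have x: "1 < norm x" "norm x < 2" by (auto simp: mem_dom_N1)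
  then have x0: "x \<noteq> 0" by auto
  have "norm (radial 2 (- 2) x) = 2 * norm x - 2" using norm_radial[OF x0, of 2 "- 2"] x by simp
  then show "2 * norm x + - 2 > 0 \<and> radial 2 (- 2) x \<in> punctured_M1" using x by (auto simp: dom_M1_def)
qed (use open_domains in \<open>auto simp: dom_N1_def\<close>)

lemma norm_F1: "x \<noteq> 0 \<Longrightarrow> norm (F1 x) = norm x / 2 + 1"
  unfolding F1_eq_radial using norm_radial[of x "1 / 2" 1] by simp

lemma inv_into_F1: "y \<in> dom_N1 \<Longrightarrow> inv_into (dom_M1 - {0}) F1 y = \<Phi> y"
  using C1_diffeoD(8,9)[OF F1_diffeo, of y] C1_diffeoD(14)[OF F1_diffeo] inv_into_f_f by metis

lemma push_metric_N1:
  assumes "y \<in> dom_N1"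
  shows "push_metric NP \<iota> g1 g2 y = pullback_metric \<Phi> g1 y"
proof -
  have "jac (inv_into (dom_M1 - {0}) F1) y = jac \<Phi> y"
    by (rule jac_cong_open[OF open_domains(1) assms inv_into_F1])
  moreover have "y \<notin> dom_N2" using assms by (auto simp: dom_N2_def mem_dom_N1)
  ultimately show ?thesis
    using inv_into_F1[OF assms] by (simp add: push_metric_def pullback_metric_jac)
qed

lemma riemannian_metric_M1:
  assumes "riemannian_metric (closure dom_M1) (\<lambda>_. UNIV) g1"
  shows "metric_field (cball 0 2) g1"
proof -
  have "closure dom_M1 = cball 0 2" by (simp add: dom_M1_def)
  then show ?thesis
    using assms riemannian_metric_continuous[OF assms] unfolding riemannian_metric_def metric_field_def by auto
qed

lemma sum_component_square: "(v $ i)\<^sup>2 \<le> (norm (v :: real^'n))\<^sup>2"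
  using component_le_norm_cart[of v i] by (simp add: abs_le_square_iff[symmetric])

text \<open>\<open>g1\<close> is positive definite on the closed ball, so by compactness its weights
  are bounded below: finite mass and energy on the annulus become square integrability of u and its
  gradient on the punctured ball. This is also what is required to fill in the origin.\<close>

lemma M1_forward:
  fixes ut ft :: "real^3 \<Rightarrow> real" and u1 f1 :: "real^3 \<Rightarrow> real"
  assumes g1: "metric_field (cball 0 2) g1" and G: "\<And>y. y \<in> dom_N1 \<Longrightarrow> G y = pullback_metric \<Phi> g1 y"
    and utm: "ut \<in> borel_measurable (lebesgue_on dom_N1)"
    and ut2: "integrable (lebesgue_on dom_N1) (\<lambda>y. (ut y)\<^sup>2 * sqrt (det (G y)))"
    and en: "integrable (lebesgue_on dom_N1) (energy G Du)"
    and wh: "weak_helmholtz dom_N1 G k ut Du ft"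
    and ft: "L2_loc dom_N1 ft" and f1: "square_integrable (lebesgue_on punctured_M1) f1"
    and e: "\<And>x. x \<in> punctured_M1 \<Longrightarrow> u1 x = ut (F1 x)" "\<And>x. x \<in> punctured_M1 \<Longrightarrow> f1 x = ft (F1 x)"
  defines "D1 \<equiv> \<lambda>x. Du (F1 x) v* jac F1 x"
  shows "square_integrable (lebesgue_on dom_M1) u1" "\<And>i. square_integrable (lebesgue_on dom_M1) (\<lambda>x. D1 x $ i)"
    "weak_helmholtz dom_M1 g1 k u1 D1 f1"
proof -
  note D = C1_diffeoD[OF F1_diffeo]
  note o = open_domains
  have sub: "dom_M1 \<subseteq> cball 0 2" "punctured_M1 \<subseteq> cball 0 2" by (auto simp: dom_M1_def)
  have mG: "metric_field dom_N1 G"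
    by (rule metric_field_cong[OF _ metric_field_pullback[OF C1_diffeo_sym[OF F1_diffeo] metric_field_subset[OF g1 sub(2)]]])
      (simp add: G)
  have gG: "g1 x = pullback_metric F1 G x" if "x \<in> punctured_M1" for x
    using C1_diffeo_inverse_metric[OF F1_diffeo G that] by simp
  obtain c C where c: "c > 0" "\<And>x. x \<in> cball 0 2 \<Longrightarrow> c \<le> sqrt (det (g1 x))"
    "\<And>x Du. x \<in> cball 0 2 \<Longrightarrow> c * (norm (Du x))\<^sup>2 \<le> energy g1 Du x"
    by (rule metric_field_bounds[OF g1 compact_cball order_refl]) blast
  have i1: "integrable (lebesgue_on punctured_M1) (\<lambda>x. (ut (F1 x))\<^sup>2 * sqrt (det (g1 x)))"
    using C1_diffeo_energy_integrable(2)[OF F1_diffeo mG gG, where c = "\<lambda>_. 1"] ut2 by simp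
  have i2: "integrable (lebesgue_on punctured_M1) (energy g1 D1)"
    using C1_diffeo_energy_integrable(1)[OF F1_diffeo mG gG, where c = "\<lambda>_. 1" and Du = Du] en by (simp add: D1_def)
  have um: "u1 \<in> borel_measurable (lebesgue_on punctured_M1)"
    using C1_diffeo_measurable[OF F1_diffeo utm] e(1) by (subst measurable_cong[of _ u1 "\<lambda>x. ut (F1 x)"]) (auto simp: space_restrict_space)
  show u1: "square_integrable (lebesgue_on dom_M1) u1"
  proof (rule square_integrable_weighted[OF o(3) _ um i1, where C = "1 / c"])
    fix x assume x: "x \<in> punctured_M1"
    have "c * (ut (F1 x))\<^sup>2 \<le> sqrt (det (g1 x)) * (ut (F1 x))\<^sup>2"
      using sub(2) x by (intro mult_right_mono c(2)) auto
    then show "(u1 x)\<^sup>2 \<le> 1 / c * ((ut (F1 x))\<^sup>2 * sqrt (det (g1 x)))"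
      using c(1) e(1)[OF x] by (simp add: field_simps)
  qed simp
  have f1': "square_integrable (lebesgue_on dom_M1) f1"
    using f1 by (intro square_integrable_weighted[OF o(3), where P = "{0}" and g = "\<lambda>x. (f1 x)\<^sup>2" and C = 1]) (auto simp: square_integrable_def)
  have wh1: "weak_helmholtz punctured_M1 (pullback_metric F1 G) k (\<lambda>x. ut (F1 x)) (\<lambda>x. Du (F1 x) v* jac F1 x) (\<lambda>x. ft (F1 x))"
    by (rule weak_helmholtz_pullback[OF F1_diffeo mG ft wh])
  have wh2: "weak_helmholtz punctured_M1 g1 k u1 D1 f1"
    by (rule weak_helmholtz_cong[OF o(4) _ _ _ _ wh1]) (simp_all add: gG e D1_def)
  have D1m: "(\<lambda>x. D1 x $ i) \<in> borel_measurable (lebesgue_on punctured_M1)" for i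
    using wh2 by (intro L2_loc_measurable) (auto simp: weak_helmholtz_def H1_loc_grad_def)
  show D1: "square_integrable (lebesgue_on dom_M1) (\<lambda>x. D1 x $ i)" for i
  proof (rule square_integrable_weighted[OF o(3) _ D1m i2, where C = "1 / c"])
    fix x assume x: "x \<in> punctured_M1"
    have "c * (D1 x $ i)\<^sup>2 \<le> c * (norm (D1 x))\<^sup>2" using c(1) sum_component_square by (intro mult_left_mono) auto
    also have "\<dots> \<le> energy g1 D1 x" using c(3) sub(2) x by auto
    finally show "(D1 x $ i)\<^sup>2 \<le> 1 / c * energy g1 D1 x" using c(1) by (simp add: field_simps)
  qed simp
  show "weak_helmholtz dom_M1 g1 k u1 D1 f1"
    using square_integrable_L2_loc[OF o(3) u1] square_integrable_L2_loc[OF o(3) D1] square_integrable_L2_loc[OF o(3) f1']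
    by (intro weak_helmholtz_remove_point[OF o(3) metric_field_subset[OF g1 sub(1)] _ _ _ wh2]) (auto simp: L2_loc_vec_def)
qed

text \<open>A function smooth up to the boundary extends smoothly to a neighbourhood of the compact
  closure, which bounds it and its gradient.\<close>

lemma smooth_on_closure_bounds:
  fixes \<psi> :: "real^'n \<Rightarrow> real"
  assumes "smooth_on (closure \<Omega>) \<psi>" "open \<Omega>" "bounded \<Omega>"
  obtains B where "B > 0" "\<And>y. y \<in> \<Omega> \<Longrightarrow> \<bar>\<psi> y\<bar> \<le> B" "\<And>y. y \<in> \<Omega> \<Longrightarrow> norm (grad \<psi> y) \<le> B"
    "\<And>y. y \<in> \<Omega> \<Longrightarrow> GDERIV \<psi> y :> grad \<psi> y" "continuous_on \<Omega> (grad \<psi>)"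
proof -
  obtain U \<psi>' where U: "open U" "closure \<Omega> \<subseteq> U" "\<And>n. Ck_on n U \<psi>'" "\<And>x. x \<in> closure \<Omega> \<Longrightarrow> \<psi> x = \<psi>' x"
    using assms(1) unfolding smooth_on_def by metis
  have sub: "\<Omega> \<subseteq> closure \<Omega>" by (rule closure_subset)
  have d: "\<psi>' differentiable (at y)" if "y \<in> U" for y using U(3)[of 1] that by auto
  have gc: "continuous_on U (grad \<psi>')"
    unfolding grad_def using U(3)[of 1] by (intro continuous_on_vec_lambda) (auto simp: axis_in_Basis_iff)
  have c: "compact (closure \<Omega>)" using assms(3) by simp
  have "bounded (\<psi>' ` closure \<Omega>)" "bounded (grad \<psi>' ` closure \<Omega>)"
    using c U(2) gc Ck_on_continuous[OF U(3)[of 0]]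
    by (meson compact_continuous_image compact_imp_bounded continuous_on_subset)+
  then obtain B1 B2 where B: "B1 > 0" "\<And>y. y \<in> closure \<Omega> \<Longrightarrow> norm (\<psi>' y) \<le> B1" "B2 > 0" "\<And>y. y \<in> closure \<Omega> \<Longrightarrow> norm (grad \<psi>' y) \<le> B2"
    unfolding bounded_pos by auto
  have e: "\<And>y. y \<in> \<Omega> \<Longrightarrow> \<psi> y = \<psi>' y" using U(4) sub by blast
  have ge: "grad \<psi> y = grad \<psi>' y" if "y \<in> \<Omega>" for y by (rule grad_cong_open[OF assms(2) that e])
  show ?thesis
  proof (rule that[of "B1 + B2"])
    show "B1 + B2 > 0" using B by simp
    show "\<bar>\<psi> y\<bar> \<le> B1 + B2" if "y \<in> \<Omega>" for y using B(2)[of y] B(3) e that sub by auto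
    show "norm (grad \<psi> y) \<le> B1 + B2" if "y \<in> \<Omega>" for y using B(4)[of y] B(1) ge that sub by force
    show "GDERIV \<psi> y :> grad \<psi> y" if y: "y \<in> \<Omega>" for y
    proof -
      have "GDERIV \<psi>' y :> grad \<psi>' y" using GDERIV_grad[OF d] U(2) sub y by blast
      then have "GDERIV \<psi>' y :> grad \<psi> y" using ge[OF y] by simp
      then show ?thesis using GDERIV_cong_open[OF assms(2) y, of \<psi> \<psi>'] e by blast
    qed
    show "continuous_on \<Omega> (grad \<psi>)"
      by (rule continuous_on_eq[of _ "grad \<psi>'"]) (use continuous_on_subset[OF gc order_trans[OF sub U(2)]] ge in auto)
  qed
qed

lemma frontier_collar:
  assumes "open V" "sphere (0::real^3) 2 \<subseteq> V"
  obtains r where "1 < r" "r < 2" "\<And>y. r < norm y \<Longrightarrow> norm y \<le> 2 \<Longrightarrow> y \<in> V"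
proof -
  obtain e where e: "e > 0" "(\<Union>x\<in>sphere 0 2. ball x e) \<subseteq> V"
    using compact_subset_open_imp_ball_epsilon_subset[OF compact_sphere assms] by blast
  define r where "r = max (3 / 2) (2 - e)"
  show ?thesis
  proof (rule that[of r])
    show "1 < r" "r < 2" using e(1) by (auto simp: r_def)
    fix y :: "real^3" assume y: "r < norm y" "norm y \<le> 2"
    then have y0: "norm y > 0" by (auto simp: r_def)
    define x where "x = (2 / norm y) *\<^sub>R y"
    have "x \<in> sphere 0 2" using y0 by (simp add: x_def)
    have "x - y = ((2 - norm y) / norm y) *\<^sub>R y" using y0 by (simp add: x_def scaleR_left_diff_distrib diff_divide_distrib)
    then have "norm (x - y) = 2 - norm y" using y0 y by simp
    also have "\<dots> < e" using y by (simp add: r_def)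
    finally have "y \<in> ball x e" by (simp add: dist_norm)
    then show "y \<in> V" using e(2) \<open>x \<in> sphere 0 2\<close> by blast
  qed
qed

text \<open>The composite has a bounded gradient multiplied by a Jacobian of order 1 / norm x. For
  \<open>F1\<close> on radius 2 the coefficient is 1/2 * 2 + 2 * 1 = 3, for the reflection on radius
  1 it is 1 + 2 = 3, the constant used in both applications.\<close>

lemma radial_composition_bound:
  fixes \<psi> :: "real^'n \<Rightarrow> real"
  assumes "x \<noteq> 0" "GDERIV \<psi> (radial a b x) :> grad \<psi> (radial a b x)" "norm (grad \<psi> (radial a b x)) \<le> B" "norm x \<le> R"
  shows "GDERIV (\<lambda>x. \<psi> (radial a b x)) x :> grad \<psi> (radial a b x) v* jac (radial a b) x"
    "norm (grad \<psi> (radial a b x) v* jac (radial a b) x) \<le> ((\<bar>a\<bar> * R + 2 * \<bar>b\<bar>) * B) / norm x"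
proof -
  have "radial a b differentiable (at x)" using radial_has_derivative[OF assms(1)] by (auto simp: differentiable_def)
  then show "GDERIV (\<lambda>x. \<psi> (radial a b x)) x :> grad \<psi> (radial a b x) v* jac (radial a b) x"
    using GDERIV_compose_jac[of "radial a b" x \<psi>] assms(2) by blast
  have r: "norm x > 0" using assms(1) by simp
  have B: "0 \<le> B" using assms(3) norm_ge_zero order_trans by blast
  have "\<bar>a\<bar> \<le> \<bar>a\<bar> * R / norm x" using r mult_left_mono[OF assms(4), of "\<bar>a\<bar>"] by (simp add: field_simps)
  then have "\<bar>a\<bar> + 2 * \<bar>b\<bar> / norm x \<le> (\<bar>a\<bar> * R + 2 * \<bar>b\<bar>) / norm x" by (simp add: add_divide_distrib)
  then have "(\<bar>a\<bar> + 2 * \<bar>b\<bar> / norm x) * norm (grad \<psi> (radial a b x)) \<le> (\<bar>a\<bar> * R + 2 * \<bar>b\<bar>) / norm x * B"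
    using assms(3) B by (intro mult_mono) (auto intro!: add_nonneg_nonneg divide_nonneg_nonneg mult_nonneg_nonneg order_trans[OF norm_ge_zero assms(4)])
  then show "norm (grad \<psi> (radial a b x) v* jac (radial a b) x) \<le> ((\<bar>a\<bar> * R + 2 * \<bar>b\<bar>) * B) / norm x"
    using radial_jac_bound[OF assms(1), of "grad \<psi> (radial a b x)" a b] by simp
qed

lemma weighted_square_integrable:
  fixes w :: "'a::euclidean_space \<Rightarrow> real"
  assumes "square_integrable (lebesgue_on B) w" "open B" "continuous_on S r" "compact S" "B \<subseteq> S"
  shows "integrable (lebesgue_on B) (\<lambda>x. (w x)\<^sup>2 * r x)"
proof -
  obtain C where C: "\<And>x. x \<in> S \<Longrightarrow> \<bar>r x\<bar> \<le> C" using continuous_on_compact_abs_bound[OF assms(3,4) order_refl] by metis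
  have "integrable (lebesgue_on B) (\<lambda>x. r x * (w x)\<^sup>2)"
  proof (rule integrable_bounded_mult)
    show "r \<in> borel_measurable (lebesgue_on B)" by (rule continuous_on_borel_measurable_lebesgue_on[OF assms(2) continuous_on_subset[OF assms(3,5)]])
    show "integrable (lebesgue_on B) (\<lambda>x. (w x)\<^sup>2)" using assms(1) by (simp add: square_integrable_def)
  qed (use C assms(5) in \<open>auto simp: space_restrict_space\<close>)
  then show ?thesis by (simp add: mult.commute)
qed

text \<open>The last conclusion contains the Neumann condition on the outer face of \<Sigma>: \<psi>
  need not vanish there, and its pullback by \<open>F1\<close> is a function on the ball that may
  have a different limit along each ray into the origin, to which \<open>weak_div_point_test\<close>
  applies.\<close>

lemma M1_backward:
  fixes ut ft :: "real^3 \<Rightarrow> real" and u1 f1 :: "real^3 \<Rightarrow> real"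
  assumes g1: "metric_field (cball 0 2) g1" and G: "\<And>y. y \<in> dom_N1 \<Longrightarrow> G y = pullback_metric \<Phi> g1 y"
    and u1: "square_integrable (lebesgue_on dom_M1) u1" and D1: "\<And>i. square_integrable (lebesgue_on dom_M1) (\<lambda>x. D1 x $ i)"
    and wh: "weak_helmholtz dom_M1 g1 k u1 D1 f1"
    and f1: "square_integrable (lebesgue_on punctured_M1) f1"
    and e: "\<And>x. x \<in> punctured_M1 \<Longrightarrow> u1 x = ut (F1 x)" "\<And>x. x \<in> punctured_M1 \<Longrightarrow> f1 x = ft (F1 x)"
  defines "Du \<equiv> \<lambda>y. D1 (\<Phi> y) v* jac \<Phi> y"
  shows "integrable (lebesgue_on dom_N1) (\<lambda>y. (ut y)\<^sup>2 * sqrt (det (G y)))"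
    "integrable (lebesgue_on dom_N1) (energy G Du)"
    "weak_helmholtz dom_N1 G k ut Du ft"
    "\<And>\<psi> V. smooth_on (closure dom_N1) \<psi> \<Longrightarrow> open V \<Longrightarrow> frontier dom_N \<subseteq> V \<Longrightarrow> (\<And>y. y \<in> V \<inter> closure dom_N1 \<Longrightarrow> \<psi> y = 0) \<Longrightarrow>
      has_bochner_integral (lebesgue_on dom_N1) (weak_integrand G k ut Du ft \<psi>) 0"
proof -
  note diff = C1_diffeo_sym[OF F1_diffeo]
  note D = C1_diffeoD[OF diff]
  note o = open_domains
  have sub: "dom_M1 \<subseteq> cball 0 2" "punctured_M1 \<subseteq> cball 0 2" by (auto simp: dom_M1_def)
  note m1 = metric_field_subset[OF g1 sub(1)] and m1' = metric_field_subset[OF g1 sub(2)]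
  have eN: "ut y = u1 (\<Phi> y)" "ft y = f1 (\<Phi> y)" if "y \<in> dom_N1" for y
    using e[OF D(3)[OF that]] D(4)[OF that] by auto
  obtain c C where C: "c > 0" "C > 0" "\<And>x. x \<in> cball 0 2 \<Longrightarrow> c \<le> sqrt (det (g1 x))" "\<And>x. x \<in> cball 0 2 \<Longrightarrow> sqrt (det (g1 x)) \<le> C"
    "\<And>x Du. x \<in> cball 0 2 \<Longrightarrow> c * (norm (Du x))\<^sup>2 \<le> energy g1 Du x" "\<And>x Du. x \<in> cball 0 2 \<Longrightarrow> energy g1 Du x \<le> C * (norm (Du x))\<^sup>2"
    by (rule metric_field_bounds[OF g1 compact_cball order_refl]) blast
  have f1': "square_integrable (lebesgue_on dom_M1) f1"
    using f1 by (intro square_integrable_weighted[OF o(3), where P = "{0}" and g = "\<lambda>x. (f1 x)\<^sup>2" and C = 1]) (auto simp: square_integrable_def)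
  note L = square_integrable_L2_loc[OF o(3) u1] square_integrable_L2_loc[OF o(3) f1']
  have LD: "L2_loc_vec dom_M1 D1" using square_integrable_L2_loc[OF o(3) D1] by (simp add: L2_loc_vec_def)
  have restr: "integrable (lebesgue_on punctured_M1) w" if "integrable (lebesgue_on dom_M1) w" for w :: "real^3 \<Rightarrow> real"
    using that has_bochner_integral_delete_point[OF o(3), of 0 w] unfolding integrable.simps by blast
  have i1: "integrable (lebesgue_on punctured_M1) (\<lambda>x. (u1 x)\<^sup>2 * sqrt (det (g1 x)))"
    by (rule restr[OF weighted_square_integrable[OF u1 o(3) metric_fieldD(6)[OF g1] compact_cball sub(1)]])
  have i2: "integrable (lebesgue_on punctured_M1) (energy g1 D1)"
  proof (rule restr, rule Bochner_Integration.integrable_bound)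
    show "integrable (lebesgue_on dom_M1) (\<lambda>x. C * (\<Sum>i\<in>UNIV. (D1 x $ i)\<^sup>2))"
      using D1 by (intro integrable_mult_right Bochner_Integration.integrable_sum) (simp add: square_integrable_def)
    show "energy g1 D1 \<in> borel_measurable (lebesgue_on dom_M1)"
      using D1 by (intro energy_measurable[OF o(3) m1]) (simp add: square_integrable_def)
    show "AE x in lebesgue_on dom_M1. norm (energy g1 D1 x) \<le> norm (C * (\<Sum>i\<in>UNIV. (D1 x $ i)\<^sup>2))"
    proof (rule AE_I2)
      fix x assume "x \<in> space (lebesgue_on dom_M1)"
      then have x: "x \<in> cball 0 2" using sub by (auto simp: space_restrict_space)
      have "0 \<le> c * (norm (D1 x))\<^sup>2" using C(1) by simp
      then have "\<bar>energy g1 D1 x\<bar> \<le> C * (norm (D1 x))\<^sup>2" using C(5,6)[OF x, of D1] by linarith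
      then show "norm (energy g1 D1 x) \<le> norm (C * (\<Sum>i\<in>UNIV. (D1 x $ i)\<^sup>2))" by (simp add: norm_sq_sum)
    qed
  qed
  have "integrable (lebesgue_on dom_N1) (\<lambda>y. (u1 (\<Phi> y))\<^sup>2 * sqrt (det (G y)))"
    using C1_diffeo_energy_integrable(2)[OF diff m1' G, where c = "\<lambda>_. 1" and u = u1] i1 by simp
  then show "integrable (lebesgue_on dom_N1) (\<lambda>y. (ut y)\<^sup>2 * sqrt (det (G y)))"
    by (subst Bochner_Integration.integrable_cong[OF refl, of _ _ "\<lambda>y. (u1 (\<Phi> y))\<^sup>2 * sqrt (det (G y))"])
      (auto simp: space_restrict_space eN)
  show "integrable (lebesgue_on dom_N1) (energy G Du)"
    using C1_diffeo_energy_integrable(1)[OF diff m1' G, where c = "\<lambda>_. 1" and Du = D1] i2 by (simp add: Du_def)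
  have wh0: "weak_helmholtz punctured_M1 g1 k u1 D1 f1"
    by (rule weak_helmholtz_subset[OF wh o(3,4) Diff_subset m1 L(2)])
  have wh1: "weak_helmholtz dom_N1 (pullback_metric \<Phi> g1) k (\<lambda>x. u1 (\<Phi> x)) (\<lambda>x. D1 (\<Phi> x) v* jac \<Phi> x) (\<lambda>x. f1 (\<Phi> x))"
    by (rule weak_helmholtz_pullback[OF diff m1' L2_loc_subset[OF L(2) Diff_subset] wh0])
  show "weak_helmholtz dom_N1 G k ut Du ft"
    by (rule weak_helmholtz_cong[OF o(1) _ _ _ _ wh1]) (simp_all add: G eN Du_def)
  fix \<psi> V assume \<psi>: "smooth_on (closure dom_N1) \<psi>" and V: "open V" "frontier dom_N \<subseteq> V" "\<And>y. y \<in> V \<inter> closure dom_N1 \<Longrightarrow> \<psi> y = 0"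
  have "sphere 0 2 \<subseteq> V" using V(2) by (simp add: dom_N_def frontier_ball)
  then obtain r where r: "1 < r" "r < 2" "\<And>y. r < norm y \<Longrightarrow> norm y \<le> 2 \<Longrightarrow> y \<in> V"
    using frontier_collar[OF V(1)] by metis
  have "bounded dom_N1" unfolding dom_N1_def by (meson bounded_ball bounded_diff)
  then obtain B where B: "B > 0" "\<And>y. y \<in> dom_N1 \<Longrightarrow> \<bar>\<psi> y\<bar> \<le> B" "\<And>y. y \<in> dom_N1 \<Longrightarrow> norm (grad \<psi> y) \<le> B"
    "\<And>y. y \<in> dom_N1 \<Longrightarrow> GDERIV \<psi> y :> grad \<psi> y" "continuous_on dom_N1 (grad \<psi>)"
    using smooth_on_closure_bounds[OF \<psi> o(1)] by (metis (no_types, lifting))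
  define \<phi> where "\<phi> x = \<psi> (F1 x)" for x
  note D' = C1_diffeoD[OF F1_diffeo]
  have x0: "x \<noteq> 0" "norm x \<le> 2" if "x \<in> punctured_M1" for x using that by (auto simp: dom_M1_def)
  have \<phi>b: "GDERIV \<phi> x :> grad \<psi> (F1 x) v* jac F1 x" "norm (grad \<psi> (F1 x) v* jac F1 x) \<le> (3 * B) / norm x" if x: "x \<in> punctured_M1" for x
    using radial_composition_bound[OF x0(1)[OF x], of \<psi> "1 / 2" 1 B 2] B(3,4)[OF D'(3)[OF x]] x0[OF x]
    unfolding \<phi>_def[abs_def] F1_eq_radial[symmetric] by auto
  have g\<phi>: "grad \<phi> x = grad \<psi> (F1 x) v* jac F1 x" if "x \<in> punctured_M1" for x by (rule GDERIV_imp_grad[OF \<phi>b(1)[OF that]])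
  have "weak_div punctured_M1 (flux g1 D1) (source g1 k u1 f1)"
    using wh0 unfolding weak_helmholtz_iff_weak_div[OF o(4) m1' L2_loc_subset[OF L(2) Diff_subset]] by blast
  then have "has_bochner_integral (lebesgue_on punctured_M1) (\<lambda>x. flux g1 D1 x \<bullet> grad \<phi> x + source g1 k u1 f1 x * \<phi> x) 0"
  proof (rule weak_div_point_test[OF o(3) L2_loc_flux[OF o(3) m1 LD] L2_loc_source[OF o(3) m1 L]])
    show "GDERIV \<phi> x :> grad \<phi> x" if "x \<in> punctured_M1" for x using \<phi>b(1)[OF that] g\<phi>[OF that] by simp
    have "continuous_on punctured_M1 (\<lambda>x. grad \<psi> (F1 x) v* jac F1 x)"
      by (intro continuous_on_vector_matrix_mult D'(6) continuous_on_compose2[OF B(5) D'(7)]) (use D'(3) in auto)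
    then show "continuous_on punctured_M1 (grad \<phi>)" by (rule continuous_on_eq) (simp add: g\<phi>)
    \<comment> \<open>\<open>F1\<close> has norm above r exactly when norm x > 2 (r - 1); the collar
      beyond radius r lies in V, where \<psi> vanishes.\<close>
    show "compact (cball (0::real^3) (2 * (r - 1)))" by simp
    show "cball (0::real^3) (2 * (r - 1)) \<subseteq> dom_M1" using r by (auto simp: dom_M1_def)
    show "\<phi> x = 0" if x: "x \<in> punctured_M1" "x \<notin> cball 0 (2 * (r - 1))" for x
    proof -
      have "norm (F1 x) = norm x / 2 + 1" by (rule norm_F1[OF x0(1)[OF x(1)]])
      then have "F1 x \<in> V" using r(3)[of "F1 x"] x x0(2)[OF x(1)] by simp
      then show ?thesis using V(3) D'(3)[OF x(1)] closure_subset[of dom_N1] by (auto simp: \<phi>_def)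
    qed
    show "\<bar>\<phi> x\<bar> \<le> 3 * B" if "x \<in> punctured_M1" for x using B(1,2) D'(3)[OF that] by (fastforce simp: \<phi>_def)
    show "norm (grad \<phi> x) \<le> (3 * B) / norm (x - 0)" if "x \<in> punctured_M1" for x using \<phi>b(2)[OF that] g\<phi>[OF that] by simp
  qed
  then have "has_bochner_integral (lebesgue_on punctured_M1) (weak_integrand g1 k u1 D1 f1 \<phi>) 0"
    by (simp add: weak_integrand_eq[abs_def])
  then show "has_bochner_integral (lebesgue_on dom_N1) (weak_integrand G k ut Du ft \<psi>) 0"
    by (rule C1_diffeo_weak_integrand[OF diff m1' G, THEN iffD1, rotated -1])
      (use \<phi>b(1) g\<phi> eN D(4) in \<open>auto simp: \<phi>_def Du_def D(9)\<close>)
qed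


section \<open>Traces\<close>

lemma Ck_on_Un:
  assumes "open U" "open V" "Ck_on n U f" "Ck_on n V f"
  shows "Ck_on n (U \<union> V) f"
  using assms(3,4)
proof (induction n arbitrary: f)
  case 0
  then show ?case using assms(1,2) by (simp add: continuous_on_open_Un)
qed auto

lemma nn_integral_indicat:
  assumes "open U" "open S" "S \<subseteq> U"
  shows "(\<integral>\<^sup>+x. ennreal (indicat_real S x * g x) \<partial>lebesgue_on U) = (\<integral>\<^sup>+x. ennreal (g x) \<partial>lebesgue_on S)"
proof -
  have "ennreal (indicat_real S x * g x) * indicator U x = ennreal (g x) * indicator S x" for x
    using assms(3) by (auto simp: indicator_def)
  then show ?thesis using assms(1,2) by (simp add: nn_integral_restrict_space)
qed

text \<open>M is the inverse of a lower bound for the Jacobian determinant on \<open>K\<close>. It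
  is chosen before the integrand, so it serves a whole sequence of errors, and infinite integrals
  are included.\<close>

lemma C1_diffeo_nn_integral_le:
  fixes \<tau> :: "real^'n::{finite,wellorder} \<Rightarrow> real^'n::_"
  assumes d: "C1_diffeo \<Lambda> \<Lambda>' \<tau> \<sigma>" and K: "compact K" "K \<subseteq> \<Lambda>"
  obtains M where "M > 0"
    "\<And>S U g. open S \<Longrightarrow> S \<subseteq> K \<Longrightarrow> open U \<Longrightarrow> \<tau> ` S \<subseteq> U \<Longrightarrow> g \<in> borel_measurable (lebesgue_on U) \<Longrightarrow> (\<And>y. 0 \<le> g y) \<Longrightarrow>
      (\<integral>\<^sup>+x. ennreal (g (\<tau> x)) \<partial>lebesgue_on S) \<le> ennreal M * (\<integral>\<^sup>+y. ennreal (g y) \<partial>lebesgue_on U)"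
proof -
  obtain c C where c: "c > 0" "\<And>x. x \<in> K \<Longrightarrow> c \<le> \<bar>det (jac \<tau> x)\<bar>"
    using C1_diffeo_abs_det_bounds[OF d K] by metis
  show ?thesis
  proof (rule that[of "1 / c"])
    show "1 / c > 0" using c(1) by simp
    fix S U :: "(real^'n::{finite,wellorder}) set" and g :: "real^'n::{finite,wellorder} \<Rightarrow> real"
    assume S: "open S" "S \<subseteq> K" and U: "open U" "\<tau> ` S \<subseteq> U" and g: "g \<in> borel_measurable (lebesgue_on U)" "\<And>y. 0 \<le> g y"
    have SL: "S \<subseteq> \<Lambda>" using S K by auto
    note dS = C1_diffeo_subset[OF d S(1) SL]
    note D = C1_diffeoD[OF dS]
    define T where "T = \<Lambda>' \<inter> \<sigma> -` S"
    have T: "open T" "T \<subseteq> U" "C1_diffeo S T \<tau> \<sigma>" using D(2,13) U(2) dS by (auto simp: T_def)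
    have gT: "g \<in> borel_measurable (lebesgue_on T)" by (rule measurable_restrict_mono[OF g(1) T(2)])
    have le: "(\<integral>\<^sup>+y. ennreal (g y) \<partial>lebesgue_on T) \<le> (\<integral>\<^sup>+y. ennreal (g y) \<partial>lebesgue_on U)"
      using T U(1) by (auto simp: nn_integral_restrict_space indicator_def intro!: nn_integral_mono)
    show "(\<integral>\<^sup>+x. ennreal (g (\<tau> x)) \<partial>lebesgue_on S) \<le> ennreal (1 / c) * (\<integral>\<^sup>+y. ennreal (g y) \<partial>lebesgue_on U)"
    proof (cases "(\<integral>\<^sup>+y. ennreal (g y) \<partial>lebesgue_on T) = \<infinity>")
      case True
      then have "(\<integral>\<^sup>+y. ennreal (g y) \<partial>lebesgue_on U) = top" using le by (simp add: top_unique)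
      then show ?thesis using c(1) by (simp add: ennreal_mult_top)
    next
      case False
      then have "integrable (lebesgue_on T) g"
        using gT g(2) by (intro integrableI_nonneg) (auto simp: less_top)
      then obtain I where I: "has_bochner_integral (lebesgue_on T) g I" by (auto simp: integrable.simps)
      then have I': "has_bochner_integral (lebesgue_on S) (\<lambda>x. \<bar>det (jac \<tau> x)\<bar> * g (\<tau> x)) I"
        unfolding C1_diffeo_has_bochner_integral[OF T(3)] .
      have e1: "(\<integral>\<^sup>+y. ennreal (g y) \<partial>lebesgue_on T) = ennreal I"
        using I g(2) nn_integral_eq_integral[of "lebesgue_on T" g] by (auto simp: has_bochner_integral_iff)
      have e2: "(\<integral>\<^sup>+x. ennreal (\<bar>det (jac \<tau> x)\<bar> * g (\<tau> x)) \<partial>lebesgue_on S) = ennreal I"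
        using I' g(2) nn_integral_eq_integral[of "lebesgue_on S" "\<lambda>x. \<bar>det (jac \<tau> x)\<bar> * g (\<tau> x)"] by (auto simp: has_bochner_integral_iff)
      have "(\<integral>\<^sup>+x. ennreal (g (\<tau> x)) \<partial>lebesgue_on S) \<le> (\<integral>\<^sup>+x. ennreal (1 / c) * ennreal (\<bar>det (jac \<tau> x)\<bar> * g (\<tau> x)) \<partial>lebesgue_on S)"
      proof (rule nn_integral_mono)
        fix x assume "x \<in> space (lebesgue_on S)"
        then have "c \<le> \<bar>det (jac \<tau> x)\<bar>" using c(2) S(2) by (auto simp: space_restrict_space)
        then have "c * g (\<tau> x) \<le> \<bar>det (jac \<tau> x)\<bar> * g (\<tau> x)" by (rule mult_right_mono[OF _ g(2)])
        then have "g (\<tau> x) \<le> (1 / c) * (\<bar>det (jac \<tau> x)\<bar> * g (\<tau> x))" using c(1) by (simp add: field_simps)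
        then show "ennreal (g (\<tau> x)) \<le> ennreal (1 / c) * ennreal (\<bar>det (jac \<tau> x)\<bar> * g (\<tau> x))"
          using c(1) by (subst ennreal_mult'[symmetric]) (auto intro!: ennreal_leI)
      qed
      also have "\<dots> = ennreal (1 / c) * ennreal I"
        using borel_measurable_integrable[OF integrable.intros[OF I']] unfolding e2[symmetric]
        by (intro nn_integral_cmult) simp
      also have "\<dots> \<le> ennreal (1 / c) * (\<integral>\<^sup>+y. ennreal (g y) \<partial>lebesgue_on U)"
        unfolding e1[symmetric] by (intro mult_left_mono le) simp
      finally show ?thesis .
    qed
  qed
qed

lemma ennreal_null_sequences:
  fixes a b c :: "nat \<Rightarrow> ennreal"
  assumes "\<And>n. a n \<le> ennreal p * b n + ennreal q * c n" "b \<longlonglongrightarrow> 0" "c \<longlonglongrightarrow> 0"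
  shows "a \<longlonglongrightarrow> 0"
proof (rule tendsto_sandwich[of "\<lambda>_. 0" a _ "\<lambda>n. ennreal p * b n + ennreal q * c n"])
  have "(\<lambda>n. ennreal p * b n + ennreal q * c n) \<longlonglongrightarrow> ennreal p * 0 + ennreal q * 0"
    by (intro tendsto_add ennreal_tendsto_cmult assms(2,3)) (auto simp: less_top[symmetric])
  then show "(\<lambda>n. ennreal p * b n + ennreal q * c n) \<longlonglongrightarrow> 0" by simp
qed (use assms(1) in auto)

lemma vector_matrix_diff: "(a - b) v* A = a v* A - b v* (A :: real^'n^'m)"
  by (simp add: vec_eq_iff vector_matrix_mult_def left_diff_distrib right_diff_distrib sum_subtractf)

lemma norm_sum3_sq_le: "(norm (a + b + c :: 'a::real_normed_vector))\<^sup>2 \<le> 3 * (norm a)\<^sup>2 + 3 * (norm b)\<^sup>2 + 3 * (norm c)\<^sup>2"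
proof -
  have "(norm (a + b + c))\<^sup>2 \<le> (norm a + norm b + norm c)\<^sup>2"
    by (intro power_mono norm_triangle_le add_mono norm_triangle_ineq order_refl) simp_all
  also have "\<dots> \<le> 3 * (norm a)\<^sup>2 + 3 * (norm b)\<^sup>2 + 3 * (norm c)\<^sup>2"
    using sum_squares_ge_zero[of "norm a - norm b" 0] zero_le_power2[of "norm a - norm b"] zero_le_power2[of "norm b - norm c"] zero_le_power2[of "norm a - norm c"]
    by (simp add: power2_eq_square algebra_simps)
  finally show ?thesis .
qed

text \<open>The new approximants are \<open>(1 - \<zeta>) (\<phi>\<^sub>n \<circ> \<tau>) + w\<^sub>n\<close>, where the test functions \<open>w\<^sub>n\<close> approximate
  \<open>\<zeta> u'\<close>, so that nothing happens to the boundary values.\<close>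

lemma has_trace_transport:
  fixes \<tau> :: "real^3 \<Rightarrow> real^3"
  assumes tr: "has_trace 2 \<Omega> u Du h"
    and \<Omega>: "open \<Omega>" "bounded \<Omega>" "u \<in> borel_measurable (lebesgue_on \<Omega>)" "\<And>i. (\<lambda>x. Du x $ i) \<in> borel_measurable (lebesgue_on \<Omega>)"
    and u': "open \<Omega>'" "\<Omega>' \<subseteq> ball 0 2" "H1_loc_grad \<Omega>' u' D'"
    and d: "C1_diffeo \<Lambda> \<Lambda>' \<tau> \<sigma>" "\<And>n i. Ck_on n \<Lambda> (\<lambda>x. \<tau> x $ i)" and K: "compact K" "K \<subseteq> \<Lambda>"
    and \<zeta>: "test_function \<Omega>' \<zeta>" "\<And>x. 0 \<le> \<zeta> x" "\<And>x. \<zeta> x \<le> 1" "open W" "\<And>x. x \<in> W \<Longrightarrow> \<zeta> x = 1"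
    and E: "open E" "closure \<Omega>' \<subseteq> W \<union> E" "E \<inter> \<Omega>' \<subseteq> K" "E \<subseteq> \<Lambda>" "\<tau> ` (E \<inter> closure \<Omega>') \<subseteq> closure \<Omega>" "\<tau> ` (E \<inter> \<Omega>') \<subseteq> \<Omega>"
    and e: "\<And>x. x \<in> E \<inter> \<Omega>' \<Longrightarrow> u' x = u (\<tau> x)" "\<And>x. x \<in> E \<inter> \<Omega>' \<Longrightarrow> D' x = Du (\<tau> x) v* jac \<tau> x"
    and h: "\<And>x. x \<in> sphere 0 2 \<Longrightarrow> h' x = h x" "\<And>x. x \<in> sphere 0 2 \<Longrightarrow> \<tau> x = x"
  shows "has_trace 2 \<Omega>' u' D' h'"
proof -
  let ?\<mu> = "completion (sphere_measure 2) :: (real^3) measure"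
  let ?S = "E \<inter> \<Omega>'"
  have spc: "space ?\<mu> = sphere 0 2" by (simp add: sphere_measure_def space_scale_measure space_restrict_space)
  have S: "open ?S" "?S \<subseteq> \<Lambda>" "?S \<subseteq> \<Omega>'" using E(1,4) u'(1) by auto
  note D = C1_diffeoD[OF d(1)]
  obtain \<phi> where \<phi>: "\<And>n. smooth_on (closure \<Omega>) (\<phi> n)"
    "(\<lambda>n. \<integral>\<^sup>+x. ennreal ((\<phi> n x - u x)\<^sup>2) \<partial>lebesgue_on \<Omega>) \<longlonglongrightarrow> 0"
    "(\<lambda>n. \<integral>\<^sup>+x. ennreal ((norm (grad (\<phi> n) x - Du x))\<^sup>2) \<partial>lebesgue_on \<Omega>) \<longlonglongrightarrow> 0"
    "(\<lambda>n. \<integral>\<^sup>+x. ennreal ((\<phi> n x - h x)\<^sup>2) \<partial>?\<mu>) \<longlonglongrightarrow> 0"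
    using tr unfolding has_trace_def by blast
  have C1\<zeta>: "C1_compact \<Omega>' \<zeta>" by (rule test_function_C1_compact[OF \<zeta>(1)])
  have "\<forall>n. \<exists>w. test_function \<Omega>' w \<and> sq_norm lebesgue (\<lambda>x. w x - \<zeta> x * u' x) \<le> ennreal (1 / real (Suc n)) \<and>
    (\<forall>i. sq_norm lebesgue (\<lambda>x. grad w x $ i - (\<zeta> x * D' x $ i + u' x * grad \<zeta> x $ i)) \<le> ennreal (1 / real (Suc n)))"
    by (rule allI, rule H1_loc_cutoff_approximation[OF u'(1,3) C1\<zeta>]) simp
  from choice[OF this] obtain w where w0: "\<forall>n. test_function \<Omega>' (w n) \<and> sq_norm lebesgue (\<lambda>x. w n x - \<zeta> x * u' x) \<le> ennreal (1 / real (Suc n)) \<and>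
    (\<forall>i. sq_norm lebesgue (\<lambda>x. grad (w n) x $ i - (\<zeta> x * D' x $ i + u' x * grad \<zeta> x $ i)) \<le> ennreal (1 / real (Suc n)))" ..
  have w: "test_function \<Omega>' (w n)" "sq_norm lebesgue (\<lambda>x. w n x - \<zeta> x * u' x) \<le> ennreal (1 / real (Suc n))"
    "sq_norm lebesgue (\<lambda>x. grad (w n) x $ i - (\<zeta> x * D' x $ i + u' x * grad \<zeta> x $ i)) \<le> ennreal (1 / real (Suc n))" for n i
    using w0 by simp_all
  define v where "v n x = (1 - \<zeta> x) * \<phi> n (\<tau> x) + w n x" for n x
  have tf0: "\<psi> x = 0" if "test_function \<Omega>' \<psi>" "x \<notin> \<Omega>'" for \<psi> x
    using that unfolding test_function_def by blast
  have sph: "v n x = \<phi> n x" if "x \<in> sphere 0 2" for n x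
  proof -
    have "x \<notin> \<Omega>'" using that u'(2) by auto
    then show ?thesis using tf0[OF \<zeta>(1)] tf0[OF w(1)] h(2)[OF that] by (simp add: v_def)
  qed
  have smooth: "smooth_on (closure \<Omega>') (v n)" for n
  proof -
    obtain U f where U: "open U" "closure \<Omega> \<subseteq> U" "\<And>m. Ck_on m U f" "\<And>x. x \<in> closure \<Omega> \<Longrightarrow> \<phi> n x = f x"
      using \<phi>(1)[of n] unfolding smooth_on_def by metis
    define V where "V = \<Lambda> \<inter> \<tau> -` U"
    have V: "open V" using continuous_on_open_vimage[OF D(1), of \<tau>] D(7) U(1) by (simp add: V_def Int_commute)
    \<comment> \<open>\<tau> is smooth on \<Lambda> only, while W may contain points outside it. On
      W the factor 1 - \<zeta> is 0, so continuing by 0 gives a smooth function on the union of W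
      and V.\<close>
    define q where "q x = (if x \<in> W then 0 else (1 - \<zeta> x) * f (\<tau> x))" for x
    have "Ck_on m (W \<union> V) q" for m
    proof (rule Ck_on_Un[OF \<zeta>(4) V])
      show "Ck_on m W q" by (rule Ck_on_cong_open[OF \<zeta>(4) _ Ck_on_const[OF \<zeta>(4), of _ 0]]) (simp add: q_def)
      have "Ck_on m V (\<lambda>x. f (\<tau> x))"
        by (rule Ck_on_compose_vec[OF V, where V = U]) (auto intro: Ck_on_subset[OF d(2)] U(3) simp: V_def)
      then have "Ck_on m V (\<lambda>x. (1 - \<zeta> x) * f (\<tau> x))"
        using Ck_on_subset[OF test_function_Ck[OF \<zeta>(1)]] by (intro Ck_on_mult Ck_on_diff Ck_on_const V) auto
      then show "Ck_on m V q" by (rule Ck_on_cong_open[OF V, rotated]) (simp add: q_def \<zeta>(5))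
    qed
    moreover have "closure \<Omega>' \<subseteq> W \<union> V" using E(2,4,5) U(2) by (fastforce simp: V_def)
    moreover have "(1 - \<zeta> x) * \<phi> n (\<tau> x) = q x" if "x \<in> closure \<Omega>'" for x
      using that E(2,5) U(4)[of "\<tau> x"] \<zeta>(5)[of x] by (auto simp: q_def)
    ultimately have "smooth_on (closure \<Omega>') (\<lambda>x. (1 - \<zeta> x) * \<phi> n (\<tau> x))"
      unfolding smooth_on_def using \<zeta>(4) V by blast
    note s1 = this
    have s2: "smooth_on (closure \<Omega>') (w n)"
      using w(1)[of n] smooth_on_subset unfolding test_function_def by blast
    show ?thesis unfolding v_def[abs_def] by (rule smooth_on_binop[where p = "(+)", OF _ s1 s2], rule Ck_on_add)
  qed
  obtain M where M: "M > 0" "\<And>g. g \<in> borel_measurable (lebesgue_on \<Omega>) \<Longrightarrow> (\<And>y. 0 \<le> g y) \<Longrightarrow>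
      (\<integral>\<^sup>+x. ennreal (g (\<tau> x)) \<partial>lebesgue_on ?S) \<le> ennreal M * (\<integral>\<^sup>+y. ennreal (g y) \<partial>lebesgue_on \<Omega>)"
    by (rule C1_diffeo_nn_integral_le[OF d(1) K]) (use S(1) E(3,6) \<Omega>(1) in blast)
  define A where "A n y = (\<phi> n y - u y)\<^sup>2" for n y
  define B where "B n y = (norm (grad (\<phi> n) y - Du y))\<^sup>2" for n y
  have Am: "A n \<in> borel_measurable (lebesgue_on \<Omega>)" and Bm: "B n \<in> borel_measurable (lebesgue_on \<Omega>)"
    and \<phi>D: "\<And>y. y \<in> \<Omega> \<Longrightarrow> GDERIV (\<phi> n) y :> grad (\<phi> n) y" for n
  proof -
    obtain b where b: "\<And>y. y \<in> \<Omega> \<Longrightarrow> GDERIV (\<phi> n) y :> grad (\<phi> n) y" "continuous_on \<Omega> (grad (\<phi> n))"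
      using smooth_on_closure_bounds[OF \<phi>(1) \<Omega>(1,2)] by metis
    then show "\<And>y. y \<in> \<Omega> \<Longrightarrow> GDERIV (\<phi> n) y :> grad (\<phi> n) y" by blast
    have "continuous_on \<Omega> (\<phi> n)" using b(1) GDERIV_continuous continuous_at_imp_continuous_on by blast
    then have "\<phi> n \<in> borel_measurable (lebesgue_on \<Omega>)" by (rule continuous_on_borel_measurable_lebesgue_on[OF \<Omega>(1)])
    then show "A n \<in> borel_measurable (lebesgue_on \<Omega>)"
      unfolding A_def[abs_def] by (intro borel_measurable_power borel_measurable_diff \<Omega>(3))
    have "(\<lambda>y. grad (\<phi> n) y $ i) \<in> borel_measurable (lebesgue_on \<Omega>)" for i
      by (intro continuous_on_borel_measurable_lebesgue_on[OF \<Omega>(1)] continuous_on_component b(2))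
    then show "B n \<in> borel_measurable (lebesgue_on \<Omega>)"
      unfolding B_def[abs_def] norm_sq_sum vector_minus_component
      by (intro borel_measurable_sum borel_measurable_power borel_measurable_diff \<Omega>(4))
  qed
  have meas: "(\<lambda>x. indicat_real ?S x * g (\<tau> x)) \<in> borel_measurable lebesgue" if "g \<in> borel_measurable (lebesgue_on \<Omega>)" for g :: "real^3 \<Rightarrow> real"
  proof -
    note dS = C1_diffeo_subset[OF d(1) S(1,2)]
    have "\<Lambda>' \<inter> \<sigma> -` ?S \<subseteq> \<Omega>" using C1_diffeoD(13)[OF dS] E(6) by blast
    then have "(\<lambda>x. g (\<tau> x)) \<in> borel_measurable (lebesgue_on ?S)"
      using C1_diffeo_measurable[OF dS measurable_restrict_mono[OF that]] by simp
    then show ?thesis by (rule indicator_mult_measurable) (use S(1) in auto)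
  qed
  have bound: "(\<integral>\<^sup>+x. ennreal (indicat_real ?S x * g (\<tau> x)) \<partial>lebesgue_on \<Omega>') \<le> ennreal M * (\<integral>\<^sup>+y. ennreal (g y) \<partial>lebesgue_on \<Omega>)"
    if "g \<in> borel_measurable (lebesgue_on \<Omega>)" "\<And>y. 0 \<le> g y" for g
    unfolding nn_integral_indicat[OF u'(1) S(1,3)] by (rule M(2)[OF that])
  define R where "R n x = w n x - \<zeta> x * u' x" for n x
  define Q where "Q n x = grad (w n) x - (\<zeta> x *\<^sub>R D' x + u' x *\<^sub>R grad \<zeta> x)" for n x
  have L: "L2_loc \<Omega>' u'" "L2_loc \<Omega>' (\<lambda>x. D' x $ i)" for i using u'(3) by (auto simp: H1_loc_grad_def)
  obtain Kz where Kz: "compact Kz" "Kz \<subseteq> \<Omega>'" "\<And>x. x \<notin> Kz \<Longrightarrow> \<zeta> x = 0" "\<And>x. x \<notin> Kz \<Longrightarrow> grad \<zeta> x = 0"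
    using C1_compactE[OF C1\<zeta>] by metis
  have Rm: "R n \<in> borel_measurable lebesgue" for n
    unfolding R_def[abs_def]
    by (intro borel_measurable_diff L2_loc_mult_measurable(1)[OF L(1) Kz(1,2)] C1_compact_continuous[OF C1\<zeta>] Kz(3)
      continuous_borel_measurable_lebesgue C1_compact_continuous[OF test_function_C1_compact[OF w(1)]])
  have Qm: "(\<lambda>x. Q n x $ i) \<in> borel_measurable lebesgue" for n i
  proof -
    have "(\<lambda>x. grad \<zeta> x $ i * u' x) \<in> borel_measurable lebesgue" "(\<lambda>x. \<zeta> x * D' x $ i) \<in> borel_measurable lebesgue"
      by (intro L2_loc_mult_measurable(1)[OF L(1) Kz(1,2)] C1_compact_continuous_grad_nth[OF C1\<zeta>], simp add: Kz(4))
        (intro L2_loc_mult_measurable(1)[OF L(2) Kz(1,2)] C1_compact_continuous[OF C1\<zeta>] Kz(3))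
    moreover have "(\<lambda>x. grad (w n) x $ i) \<in> borel_measurable lebesgue"
      by (intro continuous_borel_measurable_lebesgue C1_compact_continuous_grad_nth[OF test_function_C1_compact[OF w(1)]])
    ultimately show ?thesis unfolding Q_def[abs_def] by (simp add: mult.commute)
  qed
  have OL: "\<Omega>' \<in> sets lebesgue" using u'(1) by auto
  have lim: "(\<lambda>n. ennreal (1 / real (Suc n))) \<longlonglongrightarrow> 0"
    using LIMSEQ_inverse_real_of_nat by (subst ennreal_0[symmetric], intro tendsto_ennrealI) (simp add: inverse_eq_divide)
  have le_leb: "(\<integral>\<^sup>+x. g x \<partial>lebesgue_on \<Omega>') \<le> (\<integral>\<^sup>+x. g x \<partial>lebesgue)" for g
    using OL by (auto simp: nn_integral_restrict_space indicator_def intro!: nn_integral_mono)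
  have rm: "g \<in> borel_measurable (lebesgue_on \<Omega>')" if "g \<in> borel_measurable lebesgue" for g :: "real^3 \<Rightarrow> real"
    by (rule measurable_restrict_space1[OF that])
  have Rb: "(\<integral>\<^sup>+x. ennreal ((R n x)\<^sup>2) \<partial>lebesgue_on \<Omega>') \<le> ennreal (1 / real (Suc n))" for n
    using order_trans[OF le_leb w(2)[unfolded sq_norm_def]] by (simp add: R_def)
  have Qb: "(\<integral>\<^sup>+x. ennreal ((norm (Q n x))\<^sup>2) \<partial>lebesgue_on \<Omega>') \<le> ennreal 3 * ennreal (1 / real (Suc n))" for n
  proof -
    have "(\<integral>\<^sup>+x. ennreal ((norm (Q n x))\<^sup>2) \<partial>lebesgue_on \<Omega>') = (\<Sum>i\<in>UNIV. \<integral>\<^sup>+x. ennreal ((Q n x $ i)\<^sup>2) \<partial>lebesgue_on \<Omega>')"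
      unfolding norm_sq_sum using rm[OF Qm] by (subst nn_integral_sum[symmetric]) (auto simp: sum_ennreal)
    also have "\<dots> \<le> (\<Sum>i\<in>(UNIV::3 set). ennreal (1 / real (Suc n)))"
      using order_trans[OF le_leb w(3)[unfolded sq_norm_def]] by (intro sum_mono) (simp add: Q_def)
    finally show ?thesis by simp
  qed
  obtain C where C: "C > 0" "\<And>x v. x \<in> K \<Longrightarrow> norm (v v* jac \<tau> x) \<le> C * norm v"
  proof -
    have "compact (jac \<tau> ` K)" by (rule compact_continuous_image[OF continuous_on_subset[OF D(6) K(2)] K(1)])
    from compact_imp_bounded[OF this] obtain b where b0: "b > 0 \<and> (\<forall>A\<in>jac \<tau> ` K. norm A \<le> b)" unfolding bounded_pos ..
    then have b: "b > 0" "\<And>x. x \<in> K \<Longrightarrow> norm (jac \<tau> x) \<le> b" by auto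
    have bl: "bounded_bilinear ((v*) :: real^3 \<Rightarrow> real^3^3 \<Rightarrow> real^3)"
      by (simp add: bilinear_conv_bounded_bilinear[symmetric] bilinear_def linear_iff vec_eq_iff vector_matrix_mult_def
          sum_distrib_left distrib_left distrib_right sum.distrib mult.assoc mult.left_commute)
    obtain a where a: "a > 0" "\<And>v A. norm ((v::real^3) v* (A::real^3^3)) \<le> norm v * norm A * a"
      using bounded_bilinear.pos_bounded[OF bl] by blast
    show ?thesis
    proof (rule that[of "b * a"])
      show "norm (v v* jac \<tau> x) \<le> b * a * norm v" if "x \<in> K" for x v
        using order_trans[OF a(2) mult_right_mono[OF mult_left_mono[OF b(2)[OF that] norm_ge_zero[of v]]]] a(1) by (simp add: mult.commute mult.left_commute)
    qed (use a b in simp)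
  qed
  obtain Z where Z: "Z > 0" "\<And>x. norm (grad \<zeta> x) \<le> Z"
    using continuous_compact_support_bounded[OF C1_compact_continuous_grad[OF C1\<zeta>] Kz(1,4)] by metis
  have f1: "(v n x - u' x)\<^sup>2 \<le> 2 * (indicat_real ?S x * A n (\<tau> x)) + 2 * (R n x)\<^sup>2" if x: "x \<in> \<Omega>'" for n x
  proof (cases "x \<in> E")
    case True
    define b where "b = (1 - \<zeta> x) * (\<phi> n (\<tau> x) - u (\<tau> x))"
    have "v n x - u' x = b + R n x"
      using e(1)[of x] True x by (simp add: v_def R_def b_def algebra_simps)
    moreover have "b\<^sup>2 \<le> A n (\<tau> x)"
      using \<zeta>(2,3)[of x] by (simp add: A_def b_def power_mult_distrib power_le_one mult_left_le_one_le)
    moreover have "(b + R n x)\<^sup>2 \<le> 2 * b\<^sup>2 + 2 * (R n x)\<^sup>2"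
      using zero_le_power2[of "b - R n x"] by (simp add: power2_eq_square algebra_simps)
    ultimately show ?thesis using True x by simp
  next
    case False
    then have "x \<in> W" using E(2) x closure_subset[of \<Omega>'] by blast
    then show ?thesis using False \<zeta>(5) by (simp add: v_def R_def)
  qed
  have f2: "(norm (grad (v n) x - D' x))\<^sup>2 \<le> 3 * C\<^sup>2 * (indicat_real ?S x * B n (\<tau> x)) + 3 * Z\<^sup>2 * (indicat_real ?S x * A n (\<tau> x)) + 3 * (norm (Q n x))\<^sup>2"
    if x: "x \<in> \<Omega>'" for n x
  proof (cases "x \<in> E")
    case True
    then have xS: "x \<in> ?S" "x \<in> K" "\<tau> x \<in> \<Omega>" "x \<in> \<Lambda>" using x E(3,4,6) by auto
    have "GDERIV (\<lambda>x. \<phi> n (\<tau> x)) x :> grad (\<phi> n) (\<tau> x) v* jac \<tau> x"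
      by (rule GDERIV_compose_jac[OF D(5)[OF xS(4)] \<phi>D[OF xS(3)]])
    then have "GDERIV (v n) x :> (1 - \<zeta> x) *\<^sub>R (grad (\<phi> n) (\<tau> x) v* jac \<tau> x) + \<phi> n (\<tau> x) *\<^sub>R (0 - grad \<zeta> x) + grad (w n) x"
      unfolding v_def[abs_def] using C1_compact_GDERIV[OF C1\<zeta>] C1_compact_GDERIV[OF test_function_C1_compact[OF w(1)]]
      by (intro GDERIV_add GDERIV_mult GDERIV_diff GDERIV_const)
    \<comment> \<open>Three errors: the transported gradient error, the error of \<phi> n against
      the gradient of \<zeta>, and Q. The term u' grad \<zeta> inside Q is what turns the second
      into a difference.\<close>
    then have "grad (v n) x - D' x = (1 - \<zeta> x) *\<^sub>R ((grad (\<phi> n) (\<tau> x) - Du (\<tau> x)) v* jac \<tau> x) + (- (\<phi> n (\<tau> x) - u (\<tau> x))) *\<^sub>R grad \<zeta> x + Q n x"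
      unfolding Q_def using e[OF xS(1)]
      by (simp add: GDERIV_imp_grad vector_matrix_diff algebra_simps)
    then have "(norm (grad (v n) x - D' x))\<^sup>2 \<le> 3 * (norm ((1 - \<zeta> x) *\<^sub>R ((grad (\<phi> n) (\<tau> x) - Du (\<tau> x)) v* jac \<tau> x)))\<^sup>2
        + 3 * (norm ((- (\<phi> n (\<tau> x) - u (\<tau> x))) *\<^sub>R grad \<zeta> x))\<^sup>2 + 3 * (norm (Q n x))\<^sup>2"
      using norm_sum3_sq_le by metis
    moreover have "(norm ((1 - \<zeta> x) *\<^sub>R ((grad (\<phi> n) (\<tau> x) - Du (\<tau> x)) v* jac \<tau> x)))\<^sup>2 \<le> C\<^sup>2 * B n (\<tau> x)"
    proof -
      have "norm ((1 - \<zeta> x) *\<^sub>R ((grad (\<phi> n) (\<tau> x) - Du (\<tau> x)) v* jac \<tau> x)) \<le> 1 * norm ((grad (\<phi> n) (\<tau> x) - Du (\<tau> x)) v* jac \<tau> x)"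
        unfolding norm_scaleR using \<zeta>(2,3)[of x] by (intro mult_right_mono) auto
      also have "\<dots> \<le> C * norm (grad (\<phi> n) (\<tau> x) - Du (\<tau> x))" using C(2)[OF xS(2)] by simp
      finally show ?thesis unfolding B_def power_mult_distrib[symmetric] by (rule power_mono) simp
    qed
    moreover have "(norm ((- (\<phi> n (\<tau> x) - u (\<tau> x))) *\<^sub>R grad \<zeta> x))\<^sup>2 \<le> Z\<^sup>2 * A n (\<tau> x)"
    proof -
      have "(norm ((- (\<phi> n (\<tau> x) - u (\<tau> x))) *\<^sub>R grad \<zeta> x))\<^sup>2 = (norm (grad \<zeta> x))\<^sup>2 * A n (\<tau> x)"
        by (simp add: A_def power_mult_distrib power2_commute)
      also have "\<dots> \<le> Z\<^sup>2 * A n (\<tau> x)" using Z(2) by (intro mult_right_mono power_mono) (auto simp: A_def)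
      finally show ?thesis .
    qed
    ultimately show ?thesis using xS(1) by simp
  next
    case False
    then have xW: "x \<in> W" using E(2) x closure_subset[of \<Omega>'] by blast
    have "grad (v n) x = grad (w n) x" by (rule grad_cong_open[OF \<zeta>(4) xW]) (simp add: v_def \<zeta>(5))
    moreover have "grad \<zeta> x = grad (\<lambda>_. 1) x" by (rule grad_cong_open[OF \<zeta>(4) xW \<zeta>(5)])
    moreover have "grad (\<lambda>_. 1 :: real) x = 0" by (rule GDERIV_imp_grad[OF GDERIV_const])
    ultimately show ?thesis using False \<zeta>(5)[OF xW] by (simp add: Q_def)
  qed
  have nnA: "0 \<le> A n y" and nnB: "0 \<le> B n y" for n y by (auto simp: A_def B_def)
  note mA = rm[OF meas[OF Am]] and mB = rm[OF meas[OF Bm]]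
  have mR: "(\<lambda>x. (R n x)\<^sup>2) \<in> borel_measurable (lebesgue_on \<Omega>')" for n by (intro borel_measurable_power rm Rm)
  have mQ: "(\<lambda>x. (norm (Q n x))\<^sup>2) \<in> borel_measurable (lebesgue_on \<Omega>')" for n
    unfolding norm_sq_sum by (intro borel_measurable_sum borel_measurable_power rm Qm)
  have I1: "(\<integral>\<^sup>+x. ennreal ((v n x - u' x)\<^sup>2) \<partial>lebesgue_on \<Omega>')
    \<le> ennreal (2 * M) * (\<integral>\<^sup>+y. ennreal (A n y) \<partial>lebesgue_on \<Omega>) + ennreal 2 * ennreal (1 / real (Suc n))" for n
  proof -
    have "(\<integral>\<^sup>+x. ennreal ((v n x - u' x)\<^sup>2) \<partial>lebesgue_on \<Omega>')
      \<le> (\<integral>\<^sup>+x. ennreal 2 * ennreal (indicat_real ?S x * A n (\<tau> x)) + ennreal 2 * ennreal ((R n x)\<^sup>2) \<partial>lebesgue_on \<Omega>')"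
    proof (rule nn_integral_mono)
      fix x assume "x \<in> space (lebesgue_on \<Omega>')"
      then have "x \<in> \<Omega>'" by (simp add: space_restrict_space)
      from ennreal_leI[OF f1[OF this, of n]] nnA[of n "\<tau> x"]
      show "ennreal ((v n x - u' x)\<^sup>2) \<le> ennreal 2 * ennreal (indicat_real ?S x * A n (\<tau> x)) + ennreal 2 * ennreal ((R n x)\<^sup>2)"
        by (simp add: ennreal_mult')
    qed
    also have "\<dots> = ennreal 2 * (\<integral>\<^sup>+x. ennreal (indicat_real ?S x * A n (\<tau> x)) \<partial>lebesgue_on \<Omega>') + ennreal 2 * (\<integral>\<^sup>+x. ennreal ((R n x)\<^sup>2) \<partial>lebesgue_on \<Omega>')"
      using mA[of n] mR[of n] by (subst nn_integral_add) (auto simp: nn_integral_cmult)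
    also have "\<dots> \<le> ennreal 2 * (ennreal M * (\<integral>\<^sup>+y. ennreal (A n y) \<partial>lebesgue_on \<Omega>)) + ennreal 2 * ennreal (1 / real (Suc n))"
      by (intro add_mono mult_left_mono bound[OF Am nnA] Rb) auto
    finally show ?thesis using M(1) by (simp add: ennreal_mult mult.assoc)
  qed
  have I2: "(\<integral>\<^sup>+x. ennreal ((norm (grad (v n) x - D' x))\<^sup>2) \<partial>lebesgue_on \<Omega>')
    \<le> ennreal 1 * (ennreal (3 * C\<^sup>2 * M) * (\<integral>\<^sup>+y. ennreal (B n y) \<partial>lebesgue_on \<Omega>) + ennreal (3 * Z\<^sup>2 * M) * (\<integral>\<^sup>+y. ennreal (A n y) \<partial>lebesgue_on \<Omega>))
      + ennreal 9 * ennreal (1 / real (Suc n))" for n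
  proof -
    have "(\<integral>\<^sup>+x. ennreal ((norm (grad (v n) x - D' x))\<^sup>2) \<partial>lebesgue_on \<Omega>')
      \<le> (\<integral>\<^sup>+x. ennreal (3 * C\<^sup>2) * ennreal (indicat_real ?S x * B n (\<tau> x)) + ennreal (3 * Z\<^sup>2) * ennreal (indicat_real ?S x * A n (\<tau> x))
        + ennreal 3 * ennreal ((norm (Q n x))\<^sup>2) \<partial>lebesgue_on \<Omega>')"
    proof (rule nn_integral_mono)
      fix x assume "x \<in> space (lebesgue_on \<Omega>')"
      then have "x \<in> \<Omega>'" by (simp add: space_restrict_space)
      from ennreal_leI[OF f2[OF this, of n]] nnA[of n "\<tau> x"] nnB[of n "\<tau> x"]
      show "ennreal ((norm (grad (v n) x - D' x))\<^sup>2) \<le> ennreal (3 * C\<^sup>2) * ennreal (indicat_real ?S x * B n (\<tau> x)) + ennreal (3 * Z\<^sup>2) * ennreal (indicat_real ?S x * A n (\<tau> x))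
        + ennreal 3 * ennreal ((norm (Q n x))\<^sup>2)"
        by (simp add: ennreal_mult')
    qed
    also have "\<dots> = ennreal (3 * C\<^sup>2) * (\<integral>\<^sup>+x. ennreal (indicat_real ?S x * B n (\<tau> x)) \<partial>lebesgue_on \<Omega>')
      + ennreal (3 * Z\<^sup>2) * (\<integral>\<^sup>+x. ennreal (indicat_real ?S x * A n (\<tau> x)) \<partial>lebesgue_on \<Omega>') + ennreal 3 * (\<integral>\<^sup>+x. ennreal ((norm (Q n x))\<^sup>2) \<partial>lebesgue_on \<Omega>')"
      using mA[of n] mB[of n] mQ[of n] by (simp add: nn_integral_add nn_integral_cmult)
    also have "\<dots> \<le> ennreal (3 * C\<^sup>2) * (ennreal M * (\<integral>\<^sup>+y. ennreal (B n y) \<partial>lebesgue_on \<Omega>))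
      + ennreal (3 * Z\<^sup>2) * (ennreal M * (\<integral>\<^sup>+y. ennreal (A n y) \<partial>lebesgue_on \<Omega>)) + ennreal 3 * (ennreal 3 * ennreal (1 / real (Suc n)))"
      by (intro add_mono mult_left_mono bound[OF Am nnA] bound[OF Bm nnB] Qb) auto
    also have "\<dots> = ennreal (3 * C\<^sup>2 * M) * (\<integral>\<^sup>+y. ennreal (B n y) \<partial>lebesgue_on \<Omega>)
      + ennreal (3 * Z\<^sup>2 * M) * (\<integral>\<^sup>+y. ennreal (A n y) \<partial>lebesgue_on \<Omega>) + (ennreal 3 * ennreal 3) * ennreal (1 / real (Suc n))"
      using M(1) by (simp add: ennreal_mult mult.assoc)
    also have "ennreal 3 * ennreal 3 = ennreal 9" by (subst ennreal_mult[symmetric]) auto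
    finally show ?thesis by simp
  qed
  have limA: "(\<lambda>n. \<integral>\<^sup>+y. ennreal (A n y) \<partial>lebesgue_on \<Omega>) \<longlonglongrightarrow> 0" and limB: "(\<lambda>n. \<integral>\<^sup>+y. ennreal (B n y) \<partial>lebesgue_on \<Omega>) \<longlonglongrightarrow> 0"
    using \<phi>(2,3) by (simp_all add: A_def B_def)
  show ?thesis
    unfolding has_trace_def
  proof (intro conjI exI[of _ v] allI)
    show "h' \<in> borel_measurable ?\<mu>"
    proof (subst measurable_cong)
      show "h' x = h x" if "x \<in> space ?\<mu>" for x using that h(1) unfolding spc by blast
      show "h \<in> borel_measurable ?\<mu>" using tr unfolding has_trace_def by blast
    qed
    show "smooth_on (closure \<Omega>') (v n)" for n by (rule smooth)
    show "(\<lambda>n. \<integral>\<^sup>+x. ennreal ((v n x - u' x)\<^sup>2) \<partial>lebesgue_on \<Omega>') \<longlonglongrightarrow> 0"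
      by (rule ennreal_null_sequences[OF I1 limA lim])
    show "(\<lambda>n. \<integral>\<^sup>+x. ennreal ((norm (grad (v n) x - D' x))\<^sup>2) \<partial>lebesgue_on \<Omega>') \<longlonglongrightarrow> 0"
      by (rule ennreal_null_sequences[OF I2 ennreal_null_sequences[OF order_refl limB limA] lim])
    have "(\<integral>\<^sup>+x. ennreal ((v n x - h' x)\<^sup>2) \<partial>?\<mu>) = (\<integral>\<^sup>+x. ennreal ((\<phi> n x - h x)\<^sup>2) \<partial>?\<mu>)" for n
      by (rule nn_integral_cong) (use sph h(1) in \<open>unfold spc, simp\<close>)
    then show "(\<lambda>n. \<integral>\<^sup>+x. ennreal ((v n x - h' x)\<^sup>2) \<partial>?\<mu>) \<longlonglongrightarrow> 0" using \<phi>(4) by simp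
  qed
qed


lemma closed_norm_intervals: "closed {x::'a::real_normed_vector. a \<le> norm x}" "open {x::'a::real_normed_vector. a < norm x}"
  by (intro closed_Collect_le open_Collect_less continuous_intros)+

lemma compact_shell: "compact {x::real^'n. a \<le> norm x \<and> norm x \<le> b}"
proof -
  have "{x::real^'n. a \<le> norm x \<and> norm x \<le> b} = cball 0 b \<inter> {x. a \<le> norm x}" by auto
  then show ?thesis using compact_Int_closed[OF compact_cball closed_norm_intervals(1)] by metis
qed

text \<open>Smoothness up to the boundary refers to an open neighbourhood of the closure, so the
  maps are also needed beyond radius 2.\<close>

lemma F1_diffeo_outer: "C1_diffeo (UNIV - {0}) {y. 1 < norm y} F1 \<Phi>"
  unfolding F1_eq_radial
proof (rule radial_C1_diffeo)
  fix x :: "real^3" assume "x \<in> UNIV - {0}"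
  then show "1 / 2 * norm x + 1 > 0 \<and> radial (1 / 2) 1 x \<in> {y. 1 < norm y}"
    using norm_radial[of x "1 / 2" 1] by (simp add: add_nonneg_pos)
next
  fix x :: "real^3" assume "x \<in> {y. 1 < norm y}"
  then have x: "1 < norm x" "x \<noteq> 0" by auto
  then have "norm (radial 2 (- 2) x) = 2 * norm x - 2" using norm_radial[of x 2 "- 2"] by simp
  then show "2 * norm x + - 2 > 0 \<and> radial 2 (- 2) x \<in> UNIV - {0}" using x by auto
qed (use closed_norm_intervals(2) in auto)

lemma radial_fixes_sphere: "norm x = 2 \<Longrightarrow> F1 x = x" "norm x = 2 \<Longrightarrow> \<Phi> x = x"
  unfolding F1_eq_radial by (simp_all add: radial_def)

lemma norm_\<Phi>: "1 < norm y \<Longrightarrow> norm (\<Phi> y) = 2 * norm y - 2"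
  using norm_radial[of y 2 "- 2"] by (cases "y = 0") auto

lemma H1_loc_grad_measurable:
  assumes "H1_loc_grad U u Du" "U' \<subseteq> U"
  shows "u \<in> borel_measurable (lebesgue_on U')" "(\<lambda>x. Du x $ i) \<in> borel_measurable (lebesgue_on U')"
  using assms by (auto simp: H1_loc_grad_def intro!: L2_loc_measurable L2_loc_subset[OF _ assms(2)])

text \<open>The trace on N is known in the collar V only, which contains the norms in (r, 2]. The
  cutoff is 1 on the ball of radius s = 2 (r - 1), whose complement in the ball is sent into the
  collar; it also hides the singularity of \<open>F1\<close> at the origin.\<close>

lemma trace_M1_forward:
  assumes V: "open V" "frontier dom_N \<subseteq> V" and tr: "has_trace 2 (V \<inter> dom_N1) ut Du ht"
    and H: "H1_loc_grad dom_N1 ut Du" "H1_loc_grad dom_M1 u1 D1"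
    and e: "\<And>x. x \<in> punctured_M1 \<Longrightarrow> u1 x = ut (F1 x)" "\<And>x. x \<in> punctured_M1 \<Longrightarrow> D1 x = Du (F1 x) v* jac F1 x"
    and h: "\<And>x. x \<in> sphere 0 2 \<Longrightarrow> h x = ht (F1 x)"
  shows "has_trace 2 dom_M1 u1 D1 h"
proof -
  have "sphere 0 2 \<subseteq> V" using V(2) by (simp add: dom_N_def frontier_ball)
  then obtain r where r: "1 < r" "r < 2" "\<And>y. r < norm y \<Longrightarrow> norm y \<le> 2 \<Longrightarrow> y \<in> V"
    using frontier_collar[OF V(1)] by metis
  define s where "s = 2 * (r - 1)"
  have s: "0 < s" "s < 2" using r by (auto simp: s_def)
  obtain \<zeta> W where \<zeta>: "test_function dom_M1 \<zeta>" "\<And>x. 0 \<le> \<zeta> x" "\<And>x. \<zeta> x \<le> 1" "open W" "cball 0 s \<subseteq> W" "\<And>x. x \<in> W \<Longrightarrow> \<zeta> x = 1"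
  proof (rule bump_exists[of "cball (0::real^3) s" dom_M1])
    show "cball 0 s \<subseteq> dom_M1" using s by (auto simp: dom_M1_def)
  qed (use open_domains in \<open>auto intro: that\<close>)
  have F1V: "F1 x \<in> V" "1 < norm (F1 x)" "norm (F1 x) \<le> 2" "norm x < 2 \<Longrightarrow> norm (F1 x) < 2" if "s < norm x" "norm x \<le> 2" for x
  proof -
    have n: "norm (F1 x) = norm x / 2 + 1" using norm_F1[of x] that s by (cases "x = 0") auto
    show "F1 x \<in> V" "1 < norm (F1 x)" "norm (F1 x) \<le> 2" "norm x < 2 \<Longrightarrow> norm (F1 x) < 2"
      using n that r s by (auto simp: s_def intro!: r(3))
  qed
  have cl: "y \<in> closure (V \<inter> dom_N1)" if "y \<in> V" "1 < norm y" "norm y \<le> 2" for y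
  proof -
    have "dom_N1 = - cball 0 1 \<inter> ball 0 2" by (auto simp: dom_N1_def)
    then have "y \<in> closure dom_N1" using open_Int_closure_subset[OF open_Compl[OF closed_cball], of 0 1 "ball (0::real^3) 2"] that by auto
    then show ?thesis using open_Int_closure_subset[OF V(1), of dom_N1] that(1) by blast
  qed
  show ?thesis
  proof (rule has_trace_transport[OF tr _ _ _ _ _ _ H(2) F1_diffeo_outer _ compact_shell _ \<zeta>(1-4,6)])
    show "open (V \<inter> dom_N1)" "open dom_M1" "open {x. s < norm x}" using V(1) open_domains closed_norm_intervals(2) by auto
    show "bounded (V \<inter> dom_N1)" unfolding dom_N1_def by (meson bounded_Int bounded_ball bounded_diff)
    show "ut \<in> borel_measurable (lebesgue_on (V \<inter> dom_N1))" "(\<lambda>x. Du x $ i) \<in> borel_measurable (lebesgue_on (V \<inter> dom_N1))" for i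
      using H1_loc_grad_measurable[OF H(1), of "V \<inter> dom_N1"] by auto
    show "Ck_on n (UNIV - {0}) (\<lambda>x. F1 x $ i)" for n i unfolding F1_eq_radial by (rule radial_smooth) auto
    show "{x. s \<le> norm x \<and> norm x \<le> 2} \<subseteq> UNIV - {0}" "{x::real^3. s < norm x} \<subseteq> UNIV - {0}" using s by auto
    show "closure dom_M1 \<subseteq> W \<union> {x. s < norm x}" using \<zeta>(5) by (auto simp: dom_M1_def subset_iff)
    show "{x. s < norm x} \<inter> dom_M1 \<subseteq> {x. s \<le> norm x \<and> norm x \<le> 2}" by (auto simp: dom_M1_def)
    show "F1 ` ({x. s < norm x} \<inter> closure dom_M1) \<subseteq> closure (V \<inter> dom_N1)"
      using F1V cl by (auto simp: dom_M1_def)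
    show "F1 ` ({x. s < norm x} \<inter> dom_M1) \<subseteq> V \<inter> dom_N1" using F1V by (auto simp: dom_M1_def mem_dom_N1)
    show "h x = ht x" "F1 x = x" if "x \<in> sphere 0 2" for x using h[OF that] radial_fixes_sphere(1)[of x] that by auto
    show "u1 x = ut (F1 x)" "D1 x = Du (F1 x) v* jac F1 x" if "x \<in> {x. s < norm x} \<inter> dom_M1" for x
      using e[of x] that s by (cases "x = 0", auto)+
  qed (auto simp: dom_M1_def)
qed

text \<open>The collar beyond radius 3/2 stays away from \<Sigma>, and the inverse map is smooth
  around its closure. No cutoff is called for, hence \<zeta> = 0 and W empty in the
  transport.\<close>

lemma trace_M1_backward:
  assumes tr: "has_trace 2 dom_M1 u1 D1 h" and H: "H1_loc_grad dom_N1 ut Du" "H1_loc_grad dom_M1 u1 D1"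
    and e: "\<And>x. x \<in> dom_N1 \<Longrightarrow> ut x = u1 (\<Phi> x)" "\<And>x. x \<in> dom_N1 \<Longrightarrow> Du x = D1 (\<Phi> x) v* jac \<Phi> x"
    and h: "\<And>x. x \<in> sphere 0 2 \<Longrightarrow> h x = ht (F1 x)"
  defines "V \<equiv> {x. 3 / 2 < norm x}"
  shows "has_trace 2 (V \<inter> dom_N1) ut Du ht"
proof -
  have V: "open (V \<inter> dom_N1)" "V \<inter> dom_N1 \<subseteq> dom_N1" "V \<inter> dom_N1 \<subseteq> {x. 3 / 2 \<le> norm x \<and> norm x \<le> 2}"
    using open_Int[OF closed_norm_intervals(2) open_domains(1), of "3 / 2"] by (auto simp: V_def mem_dom_N1)
  have cl: "closure (V \<inter> dom_N1) \<subseteq> {x. 3 / 2 \<le> norm x \<and> norm x \<le> 2}"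
    by (rule closure_minimal[OF V(3) compact_imp_closed[OF compact_shell]])
  show ?thesis
  proof (rule has_trace_transport[OF tr _ _ _ _ V(1) _ H1_loc_grad_subset[OF H(1) open_domains(1) V(1,2)] C1_diffeo_sym[OF F1_diffeo_outer] _ compact_shell, where \<zeta> = "\<lambda>_. 0" and W = "{}"])
    show "open dom_M1" "open {x::real^3. 1 < norm x}" using open_domains closed_norm_intervals(2) by auto
    show "bounded dom_M1" by (simp add: dom_M1_def)
    show "u1 \<in> borel_measurable (lebesgue_on dom_M1)" "(\<lambda>x. D1 x $ i) \<in> borel_measurable (lebesgue_on dom_M1)" for i
      using H1_loc_grad_measurable[OF H(2), of dom_M1] by auto
    show "V \<inter> dom_N1 \<subseteq> ball 0 2" by (auto simp: mem_dom_N1)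
    show "Ck_on n {y. 1 < norm y} (\<lambda>x. \<Phi> x $ i)" for n i by (rule radial_smooth) (use closed_norm_intervals(2) in auto)
    show "{x. 3 / 2 \<le> norm x \<and> norm x \<le> 2} \<subseteq> {y::real^3. 1 < norm y}" "{y::real^3. 1 < norm y} \<subseteq> {y. 1 < norm y}" by auto
    show "test_function (V \<inter> dom_N1) (\<lambda>_. 0)" unfolding test_function_def using smooth_on_const by blast
    show "closure (V \<inter> dom_N1) \<subseteq> {} \<union> {x. 1 < norm x}" using cl by auto
    show "{x. 1 < norm x} \<inter> (V \<inter> dom_N1) \<subseteq> {x. 3 / 2 \<le> norm x \<and> norm x \<le> 2}" using V(3) by auto
    show "\<Phi> ` ({x. 1 < norm x} \<inter> closure (V \<inter> dom_N1)) \<subseteq> closure dom_M1"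
      using cl norm_\<Phi> by (auto simp: dom_M1_def)
    show "\<Phi> ` ({x. 1 < norm x} \<inter> (V \<inter> dom_N1)) \<subseteq> dom_M1" using norm_\<Phi> by (auto simp: dom_M1_def mem_dom_N1)
    show "ht x = h x" "\<Phi> x = x" if "x \<in> sphere 0 2" for x using h[OF that] radial_fixes_sphere[of x] that by auto
    show "ut x = u1 (\<Phi> x)" "Du x = D1 (\<Phi> x) v* jac \<Phi> x" if "x \<in> {x. 1 < norm x} \<inter> (V \<inter> dom_N1)" for x
      using e[of x] that by auto
  qed auto
qed


section \<open>The sphere\<close>

text \<open>By \<open>expc_antipodal\<close> this is the transition between the geodesic coordinates
  at P and at -P. It exchanges the boundary of the unit ball with its centre.\<close>

abbreviation "antipode \<equiv> radial (- 1) 1 :: real^3 \<Rightarrow> real^3"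

lemma antipode_diffeo: "C1_diffeo (ball 0 1 - {0}) (ball 0 1 - {0}) antipode antipode"
proof -
  have "- 1 * norm x + 1 > 0 \<and> antipode x \<in> ball 0 1 - {0}" if "x \<in> ball 0 1 - {0}" for x
    using that norm_radial[of x "- 1" 1] by auto
  then show ?thesis by (intro radial_C1_diffeo) auto
qed

lemma norm_antipode: "x \<in> ball 0 1 - {0} \<Longrightarrow> norm (antipode x) = 1 - norm x"
  using norm_radial[of x "- 1" 1] by auto

lemma L2_loc_cong_AE:
  fixes f g :: "'a::euclidean_space \<Rightarrow> real"
  assumes "open U" "L2_loc U f" "g \<in> borel_measurable (lebesgue_on U)" "AE x in lebesgue. x \<in> U \<longrightarrow> f x = g x"
  shows "L2_loc U g"
proof (rule L2_locI[OF assms(3)])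
  fix K assume K: "compact K" "K \<subseteq> U"
  show "integrable lebesgue (\<lambda>x. indicat_real K x * (g x)\<^sup>2)"
  proof (rule integrable_cong_AE_imp[OF L2_loc_compact(2)[OF assms(2) K]])
    have "(\<lambda>x. (g x)\<^sup>2) \<in> borel_measurable (lebesgue_on U)" using assms(3) by measurable
    then show "(\<lambda>x. indicat_real K x * (g x)\<^sup>2) \<in> borel_measurable lebesgue"
      by (rule indicator_mult_measurable[OF _ K(2) compact_in_sets_lebesgue[OF K(1)]])
    show "AE x in lebesgue. indicat_real K x * (f x)\<^sup>2 = indicat_real K x * (g x)\<^sup>2"
      using assms(4) by eventually_elim (use K(2) in \<open>auto simp: indicator_def\<close>)
  qed
qed (use assms(1) in auto)

lemma L2_loc_metric_weight:
  assumes U: "open U" "finite P" and G: "metric_field U G" and w: "w \<in> borel_measurable (lebesgue_on (U - P))"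
    and i: "integrable (lebesgue_on (U - P)) (\<lambda>x. (w x)\<^sup>2 * sqrt (det (G x)))"
  shows "L2_loc U w"
proof (rule L2_locI_weighted[OF U w i])
  fix K assume "compact K" "K \<subseteq> U"
  then obtain c where c: "c > 0" "\<And>x. x \<in> K \<Longrightarrow> c \<le> sqrt (det (G x))"
    by (rule metric_field_bounds[OF G]) blast
  have "(w x)\<^sup>2 \<le> 1 / c * ((w x)\<^sup>2 * sqrt (det (G x)))" if "x \<in> K - P" for x
    using mult_left_mono[OF c(2), of x "(w x)\<^sup>2"] c(1) that by (simp add: field_simps)
  then show "\<exists>C. \<forall>x\<in>K - P. (w x)\<^sup>2 \<le> C * ((w x)\<^sup>2 * sqrt (det (G x)))" by blast
qed

lemma L2_loc_vec_energy:
  assumes U: "open U" "finite P" and G: "metric_field U G" and w: "L2_loc_vec (U - P) X"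
    and i: "integrable (lebesgue_on (U - P)) (energy G X)"
  shows "L2_loc_vec U X"
  unfolding L2_loc_vec_def
proof
  fix j
  have m: "(\<lambda>x. X x $ j) \<in> borel_measurable (lebesgue_on (U - P))" using w L2_loc_measurable by (auto simp: L2_loc_vec_def)
  show "L2_loc U (\<lambda>x. X x $ j)"
  proof (rule L2_locI_weighted[OF U m i])
    fix K assume "compact K" "K \<subseteq> U"
    then obtain c where c: "c > 0" "\<And>x Du. x \<in> K \<Longrightarrow> c * (norm (Du x))\<^sup>2 \<le> energy G Du x"
      by (rule metric_field_bounds[OF G]) blast
    have "(X x $ j)\<^sup>2 \<le> 1 / c * energy G X x" if "x \<in> K - P" for x
    proof -
      have "c * (X x $ j)\<^sup>2 \<le> c * (norm (X x))\<^sup>2" using c(1) sum_component_square by (intro mult_left_mono) auto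
      also have "\<dots> \<le> energy G X x" using c(2) that by auto
      finally show ?thesis using c(1) by (simp add: field_simps)
    qed
    then show "\<exists>C. \<forall>x\<in>K - P. (X x $ j)\<^sup>2 \<le> C * energy G X x" by blast
  qed
qed

lemma integrable_lebesgue_on_subset:
  fixes f :: "'a::euclidean_space \<Rightarrow> real"
  assumes "integrable (lebesgue_on \<Omega>) f" "open \<Omega>" "open U" "U \<subseteq> \<Omega>"
  shows "integrable (lebesgue_on U) f"
proof -
  have O: "\<Omega> \<in> sets lebesgue" "U \<in> sets lebesgue" using assms by auto
  have i: "integrable lebesgue (\<lambda>x. indicat_real U x *\<^sub>R (indicat_real \<Omega> x * f x))"
    using assms(1) unfolding integrable_lebesgue_on_iff[OF O(1)] by (rule integrable_mult_indicator[OF O(2)])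
  have e: "indicat_real U x *\<^sub>R (indicat_real \<Omega> x * f x) = indicat_real U x * f x" for x
    using assms(4) by (cases "x \<in> U") auto
  show ?thesis unfolding integrable_lebesgue_on_iff[OF O(2)] using i unfolding e .
qed

lemma integrable_delete_point:
  fixes f :: "'a::euclidean_space \<Rightarrow> real"
  shows "open U \<Longrightarrow> integrable (lebesgue_on (U - {p})) f \<longleftrightarrow> integrable (lebesgue_on U) f"
  using has_bochner_integral_delete_point[of U p f] unfolding integrable.simps by blast

lemma energy_nonneg:
  assumes "metric_field U G" "x \<in> U"
  shows "0 \<le> energy G X x"
proof (cases "X x = 0")
  case False
  then show ?thesis using metric_fieldD(4,7)[OF assms(1) assms(2)] by (simp add: energy_def order_less_imp_le)
qed (simp add: energy_def)

context
  fixes P \<iota> g assumes S: "sphere_frame P \<iota>" and g: "riemannian_metric dom_M2 tangent_sphere g"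
begin

lemma expc_metric: "metric_field (ball 0 1) (pullback_metric (expc P \<iota>) g)"
  by (rule chart_metric_field[OF expc_chart[OF S] g])

lemma expc_differentiable: "expc P \<iota> differentiable (at v)" and expc_jac_continuous: "continuous_on UNIV (jac (expc P \<iota>))"
  by (rule Ck_on_1_imp_jac[OF expc_smooth[OF S open_UNIV]] UNIV_I)+

text \<open>The exponential formula is smooth on all of the space, so the density stays continuous,
  hence bounded, up to norm v = 1, where the whole unit sphere collapses to -P and the metric
  degenerates.\<close>

lemma expc_density_continuous: "continuous_on UNIV (\<lambda>v. sqrt (det (pullback_metric (expc P \<iota>) g v)))"
proof -
  have "continuous_on UNIV (expc P \<iota>)"
    using expc_differentiable differentiable_imp_continuous_within continuous_at_imp_continuous_on by blast
  then have "continuous_on UNIV (\<lambda>v. g (expc P \<iota> v))"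
    by (rule continuous_on_compose2[OF riemannian_metric_continuous[OF g]]) (use expc_in_sphere[OF S] in auto)
  then show ?thesis
    unfolding pullback_metric_jac
    by (intro continuous_on_real_sqrt continuous_on_det continuous_on_matrix_mult continuous_on_transpose expc_jac_continuous)
qed

lemma expc_antipode_metric:
  assumes "v \<in> ball 0 1 - {0}"
  shows "pullback_metric (expc (- P) \<iota>) g v = pullback_metric antipode (pullback_metric (expc P \<iota>) g) v"
proof -
  have "pullback_metric (expc (- P) \<iota>) g v = pullback_metric (\<lambda>v. expc P \<iota> (antipode v)) g v"
    using jac_cong_open[OF C1_diffeoD(1)[OF antipode_diffeo] assms expc_antipodal[OF S]] expc_antipodal[OF S assms]
    by (simp add: pullback_metric_jac)
  also have "\<dots> = pullback_metric antipode (pullback_metric (expc P \<iota>) g) v"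
    by (rule pullback_metric_compose[OF C1_diffeoD(5)[OF antipode_diffeo assms] expc_differentiable])
  finally show ?thesis .
qed

lemma square_integrable_weight:
  "square_integrable (lebesgue_on (ball 0 1)) w \<Longrightarrow>
    integrable (lebesgue_on (ball 0 1)) (\<lambda>x. (w x)\<^sup>2 * sqrt (det (pullback_metric (expc P \<iota>) g x)))"
  by (rule weighted_square_integrable[where S = "cball 0 1"])
    (use continuous_on_subset[OF expc_density_continuous] in auto)

end

text \<open>The chart at P controls compact parts of the open ball only. Near its boundary the
  solution is read in the chart at -P, where that boundary is the origin: mass and energy are finite
  there by local square integrability, and the Neumann condition follows from
  \<open>weak_div_point_test\<close>.\<close>

lemma M2_backward:
  fixes ut ft :: "real^3 \<Rightarrow> real" and u f :: "real^4 \<Rightarrow> real"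
  assumes S: "sphere_frame P \<iota>" and g: "riemannian_metric dom_M2 tangent_sphere g"
    and ft: "square_integrable (lebesgue_on (ball 0 1)) ft"
    and sol: "solution_M2 g k u f"
    and e: "\<And>v. v \<in> ball 0 1 \<Longrightarrow> u (expc P \<iota> v) = ut v" "\<And>v. v \<in> ball 0 1 \<Longrightarrow> f (expc P \<iota> v) = ft v"
  defines "G \<equiv> pullback_metric (expc P \<iota>) g"
  obtains Du where "integrable (lebesgue_on (ball 0 1)) (\<lambda>x. (ut x)\<^sup>2 * sqrt (det (G x)))"
    "integrable (lebesgue_on (ball 0 1)) (energy G Du)" "weak_helmholtz (ball 0 1) G k ut Du ft"
    "\<And>\<psi>. smooth_on (closure (ball 0 1)) \<psi> \<Longrightarrow> has_bochner_integral (lebesgue_on (ball 0 1)) (weak_integrand G k ut Du ft \<psi>) 0"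
proof -
  let ?B = "ball (0::real^3) 1"
  let ?K = "cball (0::real^3) (1 / 2)"
  note S' = sphere_frame_minus[OF S]
  define G' where "G' = pullback_metric (expc (- P) \<iota>) g"
  define u' where "u' = u \<circ> expc (- P) \<iota>"
  define f' where "f' = f \<circ> expc (- P) \<iota>"
  have mG: "metric_field ?B G" "metric_field ?B G'" unfolding G_def G'_def by (rule expc_metric[OF S g] expc_metric[OF S' g])+
  note T = antipode_diffeo
  note TD = C1_diffeoD[OF T]
  have B: "open ?B" "open (?B - {0})" "?B - {0} \<subseteq> ?B" "?K \<subseteq> ?B" by auto
  note mG0 = mG[THEN metric_field_subset, OF B(3)]
  have GT: "G v = pullback_metric antipode G' v" "G' v = pullback_metric antipode G v" if "v \<in> ?B - {0}" for v
    using expc_antipode_metric[OF S' g that] expc_antipode_metric[OF S g that] by (auto simp: G_def G'_def)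
  have eT: "u' v = ut (antipode v)" "f' v = ft (antipode v)" if "v \<in> ?B - {0}" for v
    using expc_antipodal[OF S that] e TD(3)[OF that] by (auto simp: u'_def f'_def)
  have eT': "ut v = u' (antipode v)" "ft v = f' (antipode v)" if "v \<in> ?B - {0}" for v
    using eT[OF TD(3)[OF that]] TD(4)[OF that] by auto
  obtain Du1 where "weak_helmholtz ?B G k (u \<circ> expc P \<iota>) Du1 (f \<circ> expc P \<iota>)"
    using sol expc_chart[OF S] unfolding solution_M2_def G_def by blast
  then have w1: "weak_helmholtz ?B G k ut Du1 ft" by (rule weak_helmholtz_cong[OF B(1) _ _ _ _, rotated -1]) (auto simp: e)
  obtain Du2 where w2: "weak_helmholtz ?B G' k u' Du2 f'"
    using sol expc_chart[OF S'] unfolding solution_M2_def G'_def u'_def f'_def by blast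
  have h: "H1_loc_grad ?B ut Du1" "H1_loc_grad ?B u' Du2" using w1 w2 by (auto simp: weak_helmholtz_def)
  have L: "L2_loc ?B ut" "L2_loc ?B u'" "L2_loc_vec ?B Du1" "L2_loc_vec ?B Du2"
    using h by (auto simp: H1_loc_grad_def L2_loc_vec_def)
  have Lft: "L2_loc ?B ft" by (rule square_integrable_L2_loc[OF B(1) ft])
  have "(\<lambda>v. ft (antipode v)) \<in> borel_measurable (lebesgue_on (?B - {0}))"
    by (rule L2_loc_measurable[OF C1_diffeo_L2_loc[OF T L2_loc_subset[OF Lft B(3)]]])
  then have f'm: "f' \<in> borel_measurable (lebesgue_on (?B - {0}))"
    by (subst measurable_cong[of _ f' "\<lambda>v. ft (antipode v)"]) (auto simp: space_restrict_space eT)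
  have "integrable (lebesgue_on (?B - {0})) (\<lambda>x. 1 * ((ft x)\<^sup>2 * sqrt (det (G x))))"
    using square_integrable_weight[OF S g ft] B by (simp add: G_def integrable_lebesgue_on_subset)
  then have "integrable (lebesgue_on (?B - {0})) (\<lambda>x. (ft (antipode x))\<^sup>2 * sqrt (det (G' x)))"
    using C1_diffeo_energy_integrable(2)[OF T mG0(1) GT(2), where c = "\<lambda>_. 1" and u = ft] by simp
  then have "integrable (lebesgue_on (?B - {0})) (\<lambda>x. (f' x)\<^sup>2 * sqrt (det (G' x)))"
    by (subst Bochner_Integration.integrable_cong[OF refl, of _ _ "\<lambda>x. (ft (antipode x))\<^sup>2 * sqrt (det (G' x))"])
      (auto simp: space_restrict_space eT)
  then have Lf': "L2_loc ?B f'" by (rule L2_loc_metric_weight[OF B(1) _ mG(2) f'm, rotated]) simp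
  define D where "D v = Du2 (antipode v) v* jac antipode v" for v
  note w2' = weak_helmholtz_subset[OF w2 B(1,2,3) mG(2) Lf']
  have "weak_helmholtz (?B - {0}) (pullback_metric antipode G') k (\<lambda>x. u' (antipode x)) (\<lambda>x. Du2 (antipode x) v* jac antipode x) (\<lambda>x. f' (antipode x))"
    by (rule weak_helmholtz_pullback[OF T mG0(2) L2_loc_subset[OF Lf' B(3)] w2'])
  then have wD: "weak_helmholtz (?B - {0}) G k ut D ft"
    by (rule weak_helmholtz_cong[OF B(2) _ _ _ _, rotated -1]) (auto simp: D_def GT eT')
  then have hD: "H1_loc_grad (?B - {0}) ut D" by (simp add: weak_helmholtz_def)
  have LD: "L2_loc_vec ?B D"
    unfolding L2_loc_vec_def
  proof
    fix i
    have "(\<lambda>x. D x $ i) \<in> borel_measurable (lebesgue_on (?B - {0}))" by (rule H1_loc_grad_measurable(2)[OF hD order_refl])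
    then have m: "(\<lambda>x. D x $ i) \<in> borel_measurable (lebesgue_on ?B)"
      by (rule borel_measurable_lebesgue_on_finite_extension[OF B(1) finite.insertI[OF finite.emptyI]])
    have "AE x in lebesgue. x \<in> ?B - {0} \<longrightarrow> Du1 x = D x"
      by (rule H1_loc_grad_unique[OF B(2) H1_loc_grad_subset[OF h(1) B(1,2,3)] hD])
    then have ae: "AE x in lebesgue. x \<in> ?B \<longrightarrow> Du1 x $ i = D x $ i"
      using AE_lebesgue_neq[of 0] by eventually_elim auto
    show "L2_loc ?B (\<lambda>x. D x $ i)"
      by (rule L2_loc_cong_AE[OF B(1) _ m ae]) (use L(3) in \<open>auto simp: L2_loc_vec_def\<close>)
  qed
  have W: "weak_helmholtz ?B G k ut D ft"
    by (rule weak_helmholtz_remove_point[OF B(1) mG(1) L(1) LD Lft wD])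
  have Kc: "compact ?K" by simp
  have restr: "integrable (lebesgue_on (?B - {0})) r" if "integrable lebesgue r" for r :: "real^3 \<Rightarrow> real"
    by (rule integrable_lebesgue_on_subset[OF _ open_UNIV B(2) subset_UNIV]) (simp only: that lebesgue_on_UNIV_eq)
  \<comment> \<open>The norms of x and of its reflection add up to 1, so one of the two lies in the
    closed half ball \<open>?K\<close>. Integrability near the centre in each chart therefore
    suffices.\<close>
  have fin: "integrable (lebesgue_on ?B) r"
    if r: "integrable lebesgue (\<lambda>x. indicat_real ?K x * r x)" "integrable (lebesgue_on (?B - {0})) (\<lambda>x. indicat_real ?K (antipode x) * r x)"
      "\<And>x. x \<in> ?B - {0} \<Longrightarrow> 0 \<le> r x" "r \<in> borel_measurable (lebesgue_on ?B)" for r :: "real^3 \<Rightarrow> real"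
  proof -
    have ab: "r x \<le> indicat_real ?K x * r x + indicat_real ?K (antipode x) * r x" if x: "x \<in> ?B - {0}" for x
      using norm_antipode[OF x] r(3)[OF x] by (cases "norm x \<le> 1 / 2") auto
    have "integrable (lebesgue_on (?B - {0})) r"
    proof (rule Bochner_Integration.integrable_bound[OF Bochner_Integration.integrable_add[OF restr[OF r(1)] r(2)]])
      show "r \<in> borel_measurable (lebesgue_on (?B - {0}))" by (rule measurable_restrict_mono[OF r(4) B(3)])
      show "AE x in lebesgue_on (?B - {0}). norm (r x) \<le> norm (indicat_real ?K x * r x + indicat_real ?K (antipode x) * r x)"
      proof (rule AE_I2)
        fix x assume "x \<in> space (lebesgue_on (?B - {0}))"
        then have "x \<in> ?B - {0}" by (simp add: space_restrict_space)
        then show "norm (r x) \<le> norm (indicat_real ?K x * r x + indicat_real ?K (antipode x) * r x)" using ab[of x] r(3)[of x] by simp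
      qed
    qed
    then show ?thesis by (simp add: integrable_delete_point[OF B(1)])
  qed
  have I1: "integrable (lebesgue_on ?B) (\<lambda>x. (ut x)\<^sup>2 * sqrt (det (G x)))"
  proof (rule fin)
    show "integrable lebesgue (\<lambda>x. indicat_real ?K x * ((ut x)\<^sup>2 * sqrt (det (G x))))"
      by (rule L2_weight_integrable_compact[OF B(1) mG(1) L(1) Kc B(4)])
    have "integrable (lebesgue_on (?B - {0})) (\<lambda>x. indicat_real ?K (antipode x) * ((u' (antipode x))\<^sup>2 * sqrt (det (G x))))"
      by (rule iffD1[OF C1_diffeo_energy_integrable(2)[OF T mG0(2) GT(1), where c = "indicat_real ?K" and u = u']
        restr[OF L2_weight_integrable_compact[OF B(1) mG(2) L(2) Kc B(4)]]])
    then show "integrable (lebesgue_on (?B - {0})) (\<lambda>x. indicat_real ?K (antipode x) * ((ut x)\<^sup>2 * sqrt (det (G x))))"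
      by (subst Bochner_Integration.integrable_cong[OF refl, of _ _ "\<lambda>x. indicat_real ?K (antipode x) * ((u' (antipode x))\<^sup>2 * sqrt (det (G x)))"])
        (auto simp: space_restrict_space eT')
    show "0 \<le> (ut x)\<^sup>2 * sqrt (det (G x))" if "x \<in> ?B - {0}" for x
      using metric_fieldD(4)[OF mG0(1) that] by simp
    show "(\<lambda>x. (ut x)\<^sup>2 * sqrt (det (G x))) \<in> borel_measurable (lebesgue_on ?B)"
      using L2_loc_measurable[OF L(1)] continuous_on_borel_measurable_lebesgue_on[OF B(1) metric_fieldD(6)[OF mG(1)]]
      by (intro borel_measurable_times borel_measurable_power)
  qed
  have I2: "integrable (lebesgue_on ?B) (energy G D)"
  proof (rule fin)
    show "integrable lebesgue (\<lambda>x. indicat_real ?K x * energy G D x)"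
      by (rule energy_integrable_compact[OF B(1) mG(1) LD Kc B(4)])
    show "integrable (lebesgue_on (?B - {0})) (\<lambda>x. indicat_real ?K (antipode x) * energy G D x)"
      unfolding D_def[abs_def]
      by (rule iffD1[OF C1_diffeo_energy_integrable(1)[OF T mG0(2) GT(1), where c = "indicat_real ?K" and Du = Du2]
        restr[OF energy_integrable_compact[OF B(1) mG(2) L(4) Kc B(4)]]])
    show "0 \<le> energy G D x" if "x \<in> ?B - {0}" for x by (rule energy_nonneg[OF mG0(1) that])
    show "energy G D \<in> borel_measurable (lebesgue_on ?B)"
      using LD L2_loc_measurable by (intro energy_measurable[OF B(1) mG(1)]) (auto simp: L2_loc_vec_def)
  qed
  \<comment> \<open>The test function splits as \<eta> \<psi> + (1 - \<eta>) \<psi>. The first part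
    has compact support in the open ball; the second vanishes on the half ball, so its reflection is
    supported in the half ball around the other pole.\<close>
  obtain \<eta> W where \<eta>: "test_function ?B \<eta>" "?K \<subseteq> W" "\<And>x. x \<in> W \<Longrightarrow> \<eta> x = 1"
    using bump_exists[OF Kc B(1,4)] by metis
  have C\<eta>: "C1_compact ?B \<eta>" by (rule test_function_C1_compact[OF \<eta>(1)])
  have wd: "weak_div ?B (flux G D) (source G k ut ft)" "weak_div ?B (flux G' Du2) (source G' k u' f')"
    using W w2 weak_helmholtz_iff_weak_div[OF B(1) mG(1) Lft] weak_helmholtz_iff_weak_div[OF B(1) mG(2) Lf'] by auto
  have I3: "has_bochner_integral (lebesgue_on ?B) (weak_integrand G k ut D ft \<psi>) 0" if \<psi>: "smooth_on (closure ?B) \<psi>" for \<psi>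
  proof -
    obtain b where b: "\<And>y. y \<in> ?B \<Longrightarrow> GDERIV \<psi> y :> grad \<psi> y" "continuous_on ?B (grad \<psi>)"
      using smooth_on_closure_bounds[OF \<psi> B(1) bounded_ball] by metis
    note c1 = C1_compact_mult[OF B(1) C\<eta> b]
    define psi0 where "psi0 x = (1 - \<eta> x) * \<psi> x" for x
    have "smooth_on (closure ?B) (\<lambda>x. 1 - \<eta> x)"
      using \<eta>(1) smooth_on_subset unfolding test_function_def
      by (intro smooth_on_binop[where p = "(-)", OF Ck_on_diff smooth_on_const[of _ 1]]) auto
    then have s0: "smooth_on (closure ?B) psi0" unfolding psi0_def[abs_def] by (intro smooth_on_binop[where p = "(*)", OF Ck_on_mult _ \<psi>]) auto
    obtain b0 where b0: "b0 > 0" "\<And>y. y \<in> ?B \<Longrightarrow> \<bar>psi0 y\<bar> \<le> b0" "\<And>y. y \<in> ?B \<Longrightarrow> norm (grad psi0 y) \<le> b0"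
      "\<And>y. y \<in> ?B \<Longrightarrow> GDERIV psi0 y :> grad psi0 y" "continuous_on ?B (grad psi0)"
      using smooth_on_closure_bounds[OF s0 B(1) bounded_ball] by (metis (no_types, lifting))
    define \<phi> where "\<phi> x = psi0 (antipode x)" for x
    have Tx: "antipode x \<in> ?B" "x \<noteq> 0" "norm x \<le> 1" if "x \<in> ?B - {0}" for x using TD(3)[OF that] that by auto
    have \<phi>b: "GDERIV \<phi> x :> grad psi0 (antipode x) v* jac antipode x" "norm (grad psi0 (antipode x) v* jac antipode x) \<le> (3 * b0) / norm x" if x: "x \<in> ?B - {0}" for x
      using radial_composition_bound[OF Tx(2)[OF x] b0(4)[OF Tx(1)[OF x]] b0(3)[OF Tx(1)[OF x]] Tx(3)[OF x]]
      unfolding \<phi>_def[abs_def] by auto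
    have g\<phi>: "grad \<phi> x = grad psi0 (antipode x) v* jac antipode x" if "x \<in> ?B - {0}" for x by (rule GDERIV_imp_grad[OF \<phi>b(1)[OF that]])
    have "has_bochner_integral (lebesgue_on (?B - {0})) (\<lambda>x. flux G' Du2 x \<bullet> grad \<phi> x + source G' k u' f' x * \<phi> x) 0"
    proof (rule weak_div_point_test[OF B(1) L2_loc_flux[OF B(1) mG(2) L(4)] L2_loc_source[OF B(1) mG(2) L(2) Lf'] weak_div_subset[OF wd(2) B(3)]])
      show "GDERIV \<phi> x :> grad \<phi> x" if "x \<in> ?B - {0}" for x using \<phi>b(1)[OF that] g\<phi>[OF that] by simp
      have "continuous_on (?B - {0}) (\<lambda>x. grad psi0 (antipode x) v* jac antipode x)"
        by (intro continuous_on_vector_matrix_mult TD(6) continuous_on_compose2[OF b0(5) TD(7)]) (use Tx(1) in blast)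
      then show "continuous_on (?B - {0}) (grad \<phi>)" by (rule continuous_on_eq) (simp add: g\<phi>)
      show "\<phi> x = 0" if x: "x \<in> ?B - {0}" "x \<notin> ?K" for x
        using \<eta>(2,3) norm_antipode[OF x(1)] x(2) by (auto simp: \<phi>_def psi0_def subset_iff)
      show "\<bar>\<phi> x\<bar> \<le> 3 * b0" if "x \<in> ?B - {0}" for x using b0(1) b0(2)[OF Tx(1)[OF that]] by (simp add: \<phi>_def)
      show "norm (grad \<phi> x) \<le> (3 * b0) / norm (x - 0)" if "x \<in> ?B - {0}" for x using \<phi>b(2)[OF that] g\<phi>[OF that] by simp
    qed (use B(4) in auto)
    then have "has_bochner_integral (lebesgue_on (?B - {0})) (weak_integrand G' k u' Du2 f' \<phi>) 0"
      by (simp add: weak_integrand_eq[abs_def])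
    then have "has_bochner_integral (lebesgue_on (?B - {0})) (weak_integrand G k ut D ft psi0) 0"
      by (rule C1_diffeo_weak_integrand[OF T mG0(2) GT(1), THEN iffD1, rotated -1])
        (use \<phi>b(1) g\<phi> eT' TD(4) in \<open>auto simp: \<phi>_def D_def\<close>)
    then have h0: "has_bochner_integral (lebesgue_on ?B) (weak_integrand G k ut D ft psi0) 0"
      using has_bochner_integral_delete_point[OF B(1)] by blast
    obtain Kc where Kc: "Kc \<subseteq> ?B" "\<And>x. x \<notin> Kc \<Longrightarrow> \<eta> x * \<psi> x = 0" "\<And>x. x \<notin> Kc \<Longrightarrow> grad (\<lambda>x. \<eta> x * \<psi> x) x = 0"
      using C1_compactE[OF c1(1)] by (metis (no_types, lifting))
    have z: "weak_integrand G k ut D ft (\<lambda>x. \<eta> x * \<psi> x) x = 0" if "x \<notin> ?B" for x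
    proof -
      have x: "x \<notin> Kc" using that Kc(1) by blast
      show ?thesis unfolding weak_integrand_eq Kc(2)[OF x] Kc(3)[OF x] by simp
    qed
    have "has_bochner_integral lebesgue (weak_integrand G k ut D ft (\<lambda>x. \<eta> x * \<psi> x)) 0"
      using wd(1) c1(1) unfolding weak_div_def weak_integrand_eq[abs_def] by blast
    then have h1: "has_bochner_integral (lebesgue_on ?B) (weak_integrand G k ut D ft (\<lambda>x. \<eta> x * \<psi> x)) 0"
      by (subst has_bochner_integral_lebesgue_on_iff[OF _ z]) auto
    have "weak_integrand G k ut D ft \<psi> x = weak_integrand G k ut D ft (\<lambda>x. \<eta> x * \<psi> x) x + weak_integrand G k ut D ft psi0 x" if x: "x \<in> ?B" for x
    proof -
      have "GDERIV (\<lambda>x. \<eta> x * \<psi> x + psi0 x) x :> grad (\<lambda>x. \<eta> x * \<psi> x) x + grad psi0 x"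
        by (intro GDERIV_add C1_compact_GDERIV[OF c1(1)] b0(4)[OF x])
      moreover have "(\<lambda>x. \<eta> x * \<psi> x + psi0 x) = \<psi>" by (auto simp: psi0_def algebra_simps)
      ultimately have "grad \<psi> x = grad (\<lambda>x. \<eta> x * \<psi> x) x + grad psi0 x" by (simp add: GDERIV_imp_grad)
      moreover have "\<eta> x * \<psi> x + psi0 x = \<psi> x" by (simp add: psi0_def algebra_simps)
      then have "source G k ut ft x * \<psi> x = source G k ut ft x * (\<eta> x * \<psi> x) + source G k ut ft x * psi0 x"
        unfolding distrib_left[symmetric] by simp
      ultimately show ?thesis unfolding weak_integrand_eq by (simp add: inner_add_right)
    qed
    then show ?thesis
      using has_bochner_integral_add[OF h1 h0]
      by (subst has_bochner_integral_cong[OF refl _ refl, of _ _ "\<lambda>x. weak_integrand G k ut D ft (\<lambda>x. \<eta> x * \<psi> x) x + weak_integrand G k ut D ft psi0 x"])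
        (auto simp: space_restrict_space)
  qed
  show ?thesis by (rule that[OF I1 I2 W I3])
qed


section \<open>Passage to arbitrary charts of the sphere\<close>

lemma Ck_on_1_compose_real:
  fixes q :: "'a::euclidean_space \<Rightarrow> real"
  assumes U: "open U" and q: "Ck_on 1 U q"
    and f: "\<And>x. x \<in> U \<Longrightarrow> (f has_real_derivative f' (q x)) (at (q x))" and c: "continuous_on U (\<lambda>x. f' (q x))"
  shows "Ck_on 1 U (\<lambda>x. f (q x))"
  unfolding One_nat_def
proof (rule Ck_on_SucI[OF U])
  show "((\<lambda>x. f (q x)) has_derivative (\<lambda>h. f' (q x) * frechet_derivative q (at x) h)) (at x)" if x: "x \<in> U" for x
    using has_derivative_compose[OF Ck_on_Suc_has_derivative[OF q[unfolded One_nat_def] x] f[OF x, unfolded has_field_derivative_def]] .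
  show "Ck_on 0 U (\<lambda>x. f' (q x) * frechet_derivative q (at x) b)" if "b \<in> Basis" for b
    using q c that by (auto intro!: continuous_intros)
qed

text \<open>In the variable t = cos \<theta> the function is \<theta> / sin \<theta>, the factor in
  the explicit inverse of the exponential map.\<close>

lemma arccos_quotient_deriv:
  fixes t :: real
  assumes "-1 < t" "t < 1"
  shows "((\<lambda>t. arccos t * (1 / sqrt (1 - t\<^sup>2))) has_real_derivative
    (t * arccos t * (1 / sqrt (1 - t\<^sup>2)) - 1) / (1 - t\<^sup>2)) (at t)"
proof -
  have p: "0 < 1 - t\<^sup>2" using assms by (simp add: abs_square_less_1)
  define s where "s = sqrt (1 - t\<^sup>2)"
  have nz: "sqrt (1 - t\<^sup>2) \<noteq> 0" using p by simp
  have s: "s > 0" "s * s = 1 - t\<^sup>2" using p by (auto simp: s_def)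
  have "((\<lambda>t. sqrt (1 - t\<^sup>2)) has_real_derivative (inverse s / 2 * (- (2 * t)))) (at t)"
    unfolding s_def using p by (auto intro!: derivative_eq_intros DERIV_real_sqrt)
  note d = DERIV_mult[OF DERIV_arccos[OF assms] DERIV_inverse'[OF this nz]]
  have "((\<lambda>t. arccos t * inverse (sqrt (1 - t\<^sup>2))) has_real_derivative
    (t * arccos t * inverse (sqrt (1 - t\<^sup>2)) - 1) / (1 - t\<^sup>2)) (at t)"
  proof (rule DERIV_cong[OF d])
    show "inverse (- sqrt (1 - t\<^sup>2)) * inverse (sqrt (1 - t\<^sup>2)) + - (inverse (sqrt (1 - t\<^sup>2)) * (inverse s / 2 * - (2 * t)) * inverse (sqrt (1 - t\<^sup>2))) * arccos t
      = (t * arccos t * inverse (sqrt (1 - t\<^sup>2)) - 1) / (1 - t\<^sup>2)"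
      unfolding s_def[symmetric] unfolding s(2)[symmetric] using s(1) by (simp add: field_simps)
  qed
  then show ?thesis unfolding inverse_eq_divide .
qed

lemma injective_matrix_det_nonzero:
  fixes A :: "real^'n^'n"
  assumes "\<And>h. A *v h = 0 \<Longrightarrow> h = 0"
  shows "det A \<noteq> 0"
  using assms matrix_left_invertible_ker[of A] invertible_left_inverse[of A] invertible_det_nz[of A] by blast

text \<open>An arbitrary chart is compared with the geodesic one off the preimages of both poles. -P
  lies outside the geodesic chart; P is left out because the explicit inverse divides by sin
  \<theta>. The finite weighted norms are invariant, hence give local square integrability in the
  new chart, and the points can be filled in.\<close>

lemma M2_forward:
  fixes ut ft :: "real^3 \<Rightarrow> real" and u f :: "real^4 \<Rightarrow> real"
  assumes S: "sphere_frame P \<iota>" and g: "riemannian_metric dom_M2 tangent_sphere g"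
    and G: "\<And>v. v \<in> ball 0 1 \<Longrightarrow> G v = pullback_metric (expc P \<iota>) g v"
    and ft: "square_integrable (lebesgue_on (ball 0 1)) ft"
    and ut2: "integrable (lebesgue_on (ball 0 1)) (\<lambda>x. (ut x)\<^sup>2 * sqrt (det (G x)))"
    and en: "integrable (lebesgue_on (ball 0 1)) (energy G Du)"
    and wh: "weak_helmholtz (ball 0 1) G k ut Du ft"
    and e: "\<And>v. v \<in> ball 0 1 \<Longrightarrow> u (expc P \<iota> v) = ut v" "\<And>v. v \<in> ball 0 1 \<Longrightarrow> f (expc P \<iota> v) = ft v"
  shows "solution_M2 g k u f"
  unfolding solution_M2_def
proof (intro allI impI)
  let ?B = "ball (0::real^3) 1"
  let ?e = "expc P \<iota>"
  have mG: "metric_field ?B G" by (rule metric_field_cong[OF _ expc_metric[OF S g]]) (simp add: G)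
  have Lft: "L2_loc ?B ft" by (rule square_integrable_L2_loc[OF open_ball ft])
  have ft2: "integrable (lebesgue_on ?B) (\<lambda>x. (ft x)\<^sup>2 * sqrt (det (G x)))"
    using square_integrable_weight[OF S g ft]
    by (subst Bochner_Integration.integrable_cong[OF refl, of _ _ "\<lambda>x. (ft x)\<^sup>2 * sqrt (det (pullback_metric (expc P \<iota>) g x))"])
      (auto simp: space_restrict_space G)
  fix U \<kappa> assume ch: "chart_M2 U \<kappa>"
  note C = chart_M2D[OF ch]
  \<comment> \<open>At most two points, as \<kappa> is injective.\<close>
  define Z where "Z = \<kappa> -` {P, - P} \<inter> U"
  have Z: "finite Z" unfolding Z_def by (rule finite_vimage_IntI[OF _ C(2)]) simp
  define U' where "U' = U - Z"
  have U': "open U'" "U' \<subseteq> U" "\<And>z. z \<in> U' \<Longrightarrow> \<kappa> z \<noteq> P \<and> \<kappa> z \<noteq> - P"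
    using open_Diff[OF C(1) finite_imp_closed[OF Z]] by (auto simp: U'_def Z_def)
  define a where "a z = pi\<^sup>2 * (P \<bullet> \<kappa> z)" for z
  define m :: "real \<Rightarrow> real" where "m = (\<lambda>t. arccos t * (1 / sqrt (1 - t\<^sup>2)))"
  \<comment> \<open>The formula of \<open>expc_inverse_explicit\<close> evaluated along \<kappa>:
    the transition map from the chart to the geodesic coordinates.\<close>
  define \<tau> where "\<tau> z = m (a z) *\<^sub>R adjoint \<iota> (\<kappa> z)" for z
  have \<tau>: "\<tau> z \<in> ?B - {0}" "?e (\<tau> z) = \<kappa> z" "-1 < a z" "a z < 1" if z: "z \<in> U'" for z
  proof -
    have "\<kappa> z \<in> dom_M2" using C(3) U'(2) z by blast
    then obtain v where v: "v \<in> ?B" "?e v = \<kappa> z" using expc_surj[OF S] U'(3)[OF z] by metis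
    then have v0: "v \<in> ?B - {0}" using expc_eq_P_iff[OF S v(1)] U'(3)[OF z] by auto
    note x = expc_inverse_explicit[OF S v0, unfolded v(2), folded a_def]
    have "\<tau> z = v" using x(1) by (simp add: \<tau>_def m_def)
    then show "\<tau> z \<in> ?B - {0}" "?e (\<tau> z) = \<kappa> z" "-1 < a z" "a z < 1" using v0 v(2) x(2,3) by auto
  qed
  have \<kappa>C: "Ck_on 1 U' (\<lambda>z. \<kappa> z $ i)" for i by (rule Ck_on_subset[OF C(4) U'(2)])
  have lin: "Ck_on 1 U' (\<lambda>z. w \<bullet> \<kappa> z)" for w
    unfolding inner_vec_def inner_real_def by (intro Ck_on_sum Ck_on_cmult U'(1) \<kappa>C)
  have aC: "Ck_on 1 U' a" unfolding a_def[abs_def] by (rule Ck_on_cmult[OF U'(1) lin])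
  have ac: "continuous_on U' a" by (rule Ck_on_continuous[OF aC])
  have mC: "Ck_on 1 U' (\<lambda>z. m (a z))"
  proof (rule Ck_on_1_compose_real[OF U'(1) aC])
    show "(m has_real_derivative (a z * arccos (a z) * (1 / sqrt (1 - (a z)\<^sup>2)) - 1) / (1 - (a z)\<^sup>2)) (at (a z))" if "z \<in> U'" for z
      unfolding m_def by (rule arccos_quotient_deriv[OF \<tau>(3,4)[OF that]])
    have "1 - (a z)\<^sup>2 > 0" if "z \<in> U'" for z using \<tau>(3,4)[OF that] by (simp add: abs_square_less_1)
    then have "1 - (a z)\<^sup>2 \<noteq> 0" if "z \<in> U'" for z using that by force
    moreover have "continuous_on U' (\<lambda>z. arccos (a z))"
      by (rule continuous_on_arccos[OF ac]) (use \<tau>(3,4) in force)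
    ultimately show "continuous_on U' (\<lambda>z. (a z * arccos (a z) * (1 / sqrt (1 - (a z)\<^sup>2)) - 1) / (1 - (a z)\<^sup>2))"
      by (intro continuous_on_divide continuous_on_diff continuous_on_mult continuous_on_const continuous_on_real_sqrt continuous_on_power ac) auto
  qed
  have \<tau>C: "Ck_on 1 U' (\<lambda>z. \<tau> z $ i)" for i
  proof -
    have "adjoint \<iota> x $ i = adjoint \<iota> x \<bullet> axis i 1" for x by (simp add: inner_axis)
    then have "adjoint \<iota> x $ i = \<iota> (axis i 1) \<bullet> x" for x using adjoint_frame[OF S] inner_commute by metis
    then show ?thesis unfolding \<tau>_def vector_scaleR_component by (simp only: real_scaleR_def Ck_on_mult[OF U'(1) mC lin])
  qed
  note \<tau>J = Ck_on_1_imp_jac[OF \<tau>C]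
  have "inj_on \<tau> U'" using \<tau>(2) C(2) U'(2) by (metis inj_on_def subset_iff)
  \<comment> \<open>\<kappa> factors as the exponential map after \<tau>, so a vector killed by the
    Jacobian of \<tau> would be killed by that of \<kappa>.\<close>
  moreover have "det (jac \<tau> z) \<noteq> 0" if z: "z \<in> U'" for z
  proof (rule injective_matrix_det_nonzero)
    fix h assume h: "jac \<tau> z *v h = 0"
    have "jac \<kappa> z = jac (\<lambda>z. ?e (\<tau> z)) z" by (rule jac_cong_open[OF U'(1) z]) (simp add: \<tau>(2))
    also have "\<dots> = jac ?e (\<tau> z) ** jac \<tau> z" by (rule jac_compose(2)[OF \<tau>J(1)[OF z] expc_differentiable[OF S g]])
    finally have "jac \<kappa> z *v h = 0" using h by (simp add: matrix_vector_mul_assoc[symmetric])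
    then show "h = 0" using C(8) z U'(2) by blast
  qed
  ultimately have d: "C1_diffeo U' (\<tau> ` U') \<tau> (inv_into U' \<tau>)"
    by (intro C1_diffeo_inv_into U'(1) \<tau>J(1,2)) auto
  note D = C1_diffeoD[OF d]
  have im: "\<tau> ` U' \<subseteq> ?B" using \<tau>(1) by blast
  note mG' = metric_field_subset[OF mG im]
  define g' where "g' = pullback_metric \<kappa> g"
  have mg: "metric_field U g'" unfolding g'_def by (rule chart_metric_field[OF ch g])
  have g': "g' z = pullback_metric \<tau> G z" if z: "z \<in> U'" for z
  proof -
    have "g' z = pullback_metric (\<lambda>z. ?e (\<tau> z)) g z"
      using jac_cong_open[OF U'(1) z, of \<kappa> "\<lambda>z. ?e (\<tau> z)"] \<tau>(2) z by (simp add: g'_def pullback_metric_jac)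
    also have "\<dots> = pullback_metric \<tau> (pullback_metric ?e g) z"
      by (rule pullback_metric_compose[OF \<tau>J(1)[OF z] expc_differentiable[OF S g]])
    also have "\<dots> = pullback_metric \<tau> G z" using G[of "\<tau> z"] \<tau>(1)[OF z] by (simp add: pullback_metric_jac[of \<tau>])
    finally show ?thesis .
  qed
  define Dk where "Dk z = Du (\<tau> z) v* jac \<tau> z" for z
  have ek: "(u \<circ> \<kappa>) z = ut (\<tau> z)" "(f \<circ> \<kappa>) z = ft (\<tau> z)" if z: "z \<in> U'" for z
    using e[of "\<tau> z"] \<tau>(1,2)[OF z] by auto
  have "weak_helmholtz U' (pullback_metric \<tau> G) k (\<lambda>z. ut (\<tau> z)) (\<lambda>z. Du (\<tau> z) v* jac \<tau> z) (\<lambda>z. ft (\<tau> z))"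
    by (rule weak_helmholtz_pullback[OF d mG' L2_loc_subset[OF Lft im] weak_helmholtz_subset[OF wh open_ball D(2) im mG Lft]])
  then have w': "weak_helmholtz U' g' k (u \<circ> \<kappa>) Dk (f \<circ> \<kappa>)"
    by (rule weak_helmholtz_cong[OF U'(1) _ _ _ _, rotated -1]) (simp_all add: g' ek[unfolded o_def] Dk_def)
  then have h': "H1_loc_grad U' (u \<circ> \<kappa>) Dk" by (simp add: weak_helmholtz_def)
  have w2: "integrable (lebesgue_on (U - Z)) (\<lambda>z. (w' z)\<^sup>2 * sqrt (det (g' z)))"
    if w: "integrable (lebesgue_on ?B) (\<lambda>x. (w x)\<^sup>2 * sqrt (det (G x)))" and e: "\<And>z. z \<in> U' \<Longrightarrow> w' z = w (\<tau> z)" for w w'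
  proof -
    have i: "integrable (lebesgue_on (\<tau> ` U')) (\<lambda>x. 1 * ((w x)\<^sup>2 * sqrt (det (G x))))"
      using integrable_lebesgue_on_subset[OF w open_ball D(2) im] by simp
    have "integrable (lebesgue_on U') (\<lambda>z. 1 * ((w (\<tau> z))\<^sup>2 * sqrt (det (g' z))))"
      by (rule iffD1[OF C1_diffeo_energy_integrable(2)[OF d mG' g', where c = "\<lambda>_. 1" and u = w] i])
    then show ?thesis
      unfolding U'_def[symmetric]
      by (subst Bochner_Integration.integrable_cong[OF refl, of _ _ "\<lambda>z. 1 * ((w (\<tau> z))\<^sup>2 * sqrt (det (g' z)))"])
        (auto simp: space_restrict_space e)
  qed
  have Lu: "L2_loc U (u \<circ> \<kappa>)"
    by (rule L2_loc_metric_weight[OF C(1) Z mg _ w2[OF ut2 ek(1)]])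
      (use H1_loc_grad_measurable(1)[OF h' order_refl] in \<open>simp_all add: U'_def o_def\<close>)
  have "(\<lambda>z. ft (\<tau> z)) \<in> borel_measurable (lebesgue_on U')"
    by (rule L2_loc_measurable[OF C1_diffeo_L2_loc[OF d L2_loc_subset[OF Lft im]]])
  then have fm: "f \<circ> \<kappa> \<in> borel_measurable (lebesgue_on U')"
    by (subst measurable_cong[of _ "f \<circ> \<kappa>" "\<lambda>z. ft (\<tau> z)"]) (auto simp: space_restrict_space ek[unfolded o_apply])
  have Lf: "L2_loc U (f \<circ> \<kappa>)"
    by (rule L2_loc_metric_weight[OF C(1) Z mg _ w2[OF ft2 ek(2)]]) (use fm in \<open>simp_all add: U'_def o_def\<close>)
  have i: "integrable (lebesgue_on (\<tau> ` U')) (\<lambda>x. 1 * energy G Du x)"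
    using integrable_lebesgue_on_subset[OF en open_ball D(2) im] by simp
  have "integrable (lebesgue_on U') (\<lambda>z. 1 * energy g' (\<lambda>z. Du (\<tau> z) v* jac \<tau> z) z)"
    by (rule iffD1[OF C1_diffeo_energy_integrable(1)[OF d mG' g', where c = "\<lambda>_. 1" and Du = Du] i])
  then have "integrable (lebesgue_on (U - Z)) (energy g' Dk)" by (simp add: Dk_def[abs_def] U'_def)
  then have LD: "L2_loc_vec U Dk"
    by (rule L2_loc_vec_energy[OF C(1) Z mg, rotated]) (use h' in \<open>simp add: H1_loc_grad_def L2_loc_vec_def U'_def\<close>)
  have "weak_helmholtz U g' k (u \<circ> \<kappa>) Dk (f \<circ> \<kappa>)"
    by (rule weak_helmholtz_remove_finite[OF Z C(1) mg Lu LD Lf w'[unfolded U'_def]])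
  then show "\<exists>Du. weak_helmholtz U (pullback_metric \<kappa> g) k (u \<circ> \<kappa>) Du (f \<circ> \<kappa>)"
    unfolding g'_def by blast
qed


section \<open>Gluing\<close>

lemma has_bochner_integral_lebesgue_on_Un:
  fixes f :: "'a::euclidean_space \<Rightarrow> real"
  assumes o: "open A" "open B" "A \<inter> B = {}"
    and "has_bochner_integral (lebesgue_on A) f I" "has_bochner_integral (lebesgue_on B) f J"
  shows "has_bochner_integral (lebesgue_on (A \<union> B)) f (I + J)"
proof -
  have s: "A \<inter> space lebesgue \<in> sets lebesgue" "B \<inter> space lebesgue \<in> sets lebesgue" "(A \<union> B) \<inter> space lebesgue \<in> sets lebesgue"
    using o by auto
  have "indicat_real (A \<union> B) x *\<^sub>R f x = indicat_real A x *\<^sub>R f x + indicat_real B x *\<^sub>R f x" for x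
    using o(3) by (auto simp: indicator_def)
  then show ?thesis
    using has_bochner_integral_add assms(4,5)
    unfolding has_bochner_integral_restrict_space[OF s(1)] has_bochner_integral_restrict_space[OF s(2)] has_bochner_integral_restrict_space[OF s(3)]
    by fastforce
qed

lemma L2_loc_Un:
  fixes f :: "'a::euclidean_space \<Rightarrow> real"
  assumes o: "open A" "open B" "A \<inter> B = {}" and f: "L2_loc A f" "L2_loc B f"
  shows "L2_loc (A \<union> B) f"
proof (rule L2_locI)
  have e: "indicat_real (A \<union> B) x * f x = indicat_real A x * f x + indicat_real B x * f x" for x
    using o(3) by (auto simp: indicator_def)
  have "(\<lambda>x. indicat_real A x * f x + indicat_real B x * f x) \<in> borel_measurable lebesgue"
    using o by (intro borel_measurable_add indicator_mult_measurable[OF L2_loc_measurable[OF f(1)]] indicator_mult_measurable[OF L2_loc_measurable[OF f(2)]]) auto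
  then show "f \<in> borel_measurable (lebesgue_on (A \<union> B))"
    using o by (subst borel_measurable_restrict_space_iff) (auto simp: e)
  show "A \<union> B \<in> sets lebesgue" using o by auto
  fix K assume K: "compact K" "K \<subseteq> A \<union> B"
  \<comment> \<open>Since A and B are open and disjoint, a compact subset of their union splits into
    a compact part in each.\<close>
  have c: "compact (K - B)" "K - B \<subseteq> A" "compact (K - A)" "K - A \<subseteq> B" using K o(1,2) by (auto intro: compact_diff)
  have "indicat_real K x * (f x)\<^sup>2 = indicat_real (K - B) x * (f x)\<^sup>2 + indicat_real (K - A) x * (f x)\<^sup>2" for x
    using o(3) K(2) by (auto simp: indicator_def)
  then show "integrable lebesgue (\<lambda>x. indicat_real K x * (f x)\<^sup>2)"
    using Bochner_Integration.integrable_add[OF L2_loc_compact(2)[OF f(1) c(1,2)] L2_loc_compact(2)[OF f(2) c(3,4)]] by simp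
qed

lemma C1_compact_restrict:
  assumes o: "open A" "open B" "A \<inter> B = {}" and \<phi>: "C1_compact (A \<union> B) \<phi>"
  shows "C1_compact A (\<lambda>x. if x \<in> A then \<phi> x else 0)"
proof -
  obtain K where K: "compact K" "K \<subseteq> A \<union> B" "\<And>x. x \<notin> K \<Longrightarrow> \<phi> x = 0" by (rule C1_compactE[OF \<phi>]) blast
  have "GDERIV (\<lambda>x. if x \<in> A then \<phi> x else 0) x :> grad \<phi> x" if x: "x \<in> A" for x
    using GDERIV_cong_open[OF o(1) x, of "\<lambda>x. if x \<in> A then \<phi> x else 0" \<phi>] C1_compact_GDERIV[OF \<phi>] by simp
  moreover have "compact (K - B)" "K - B \<subseteq> A" using K o by (auto intro: compact_diff)
  moreover have "(if x \<in> A then \<phi> x else 0) = 0" if "x \<notin> K - B" for x using that K(3) o(3) by auto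
  ultimately show ?thesis
    by (intro C1_compactI[OF o(1), where D = "grad \<phi>" and K = "K - B"] continuous_on_subset[OF C1_compact_continuous_grad[OF \<phi>]]) auto
qed

lemma weak_div_Un:
  assumes o: "open A" "open B" "A \<inter> B = {}" and w: "weak_div A X Y" "weak_div B X Y"
  shows "weak_div (A \<union> B) X Y"
  unfolding weak_div_def
proof (intro allI impI)
  fix \<phi> assume \<phi>: "C1_compact (A \<union> B) \<phi>"
  define p where "p = (\<lambda>x. if x \<in> A then \<phi> x else 0)"
  define q where "q = (\<lambda>x. if x \<in> B then \<phi> x else 0)"
  have c: "C1_compact A p" "C1_compact B q"
    using C1_compact_restrict[OF o \<phi>] C1_compact_restrict[OF o(2,1)] o(3) \<phi> by (auto simp: p_def q_def Un_commute Int_commute)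
  have z: "\<phi> x = 0" if "x \<notin> A \<union> B" for x using C1_compactE[OF \<phi>] that by (metis subsetD)
  have pq: "\<phi> = (\<lambda>x. p x + q x)" using z o(3) by (fastforce simp: p_def q_def)
  have g: "grad \<phi> x = grad p x + grad q x" for x
    unfolding pq by (rule GDERIV_imp_grad[OF GDERIV_add[OF C1_compact_GDERIV[OF c(1)] C1_compact_GDERIV[OF c(2)]]])
  have "has_bochner_integral lebesgue (\<lambda>x. (X x \<bullet> grad p x + Y x * p x) + (X x \<bullet> grad q x + Y x * q x)) (0 + 0)"
    using w c unfolding weak_div_def by (intro has_bochner_integral_add) blast+
  moreover have "X x \<bullet> grad \<phi> x + Y x * \<phi> x = (X x \<bullet> grad p x + Y x * p x) + (X x \<bullet> grad q x + Y x * q x)" for x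
    unfolding g using fun_cong[OF pq, of x] by (simp add: inner_add_right distrib_left)
  ultimately show "has_bochner_integral lebesgue (\<lambda>x. X x \<bullet> grad \<phi> x + Y x * \<phi> x) 0" by simp
qed

lemma H1_loc_grad_Un:
  assumes o: "open A" "open B" "A \<inter> B = {}" and h: "H1_loc_grad A u Du" "H1_loc_grad B u Du"
  shows "H1_loc_grad (A \<union> B) u Du"
  using h L2_loc_Un[OF o] weak_div_Un[OF o]
  unfolding H1_loc_grad_iff_weak_div[OF o(1)] H1_loc_grad_iff_weak_div[OF o(2)] H1_loc_grad_iff_weak_div[OF open_Un[OF o(1,2)]] L2_loc_vec_def
  by blast

lemma weak_integrand_test_restrict:
  assumes "open A" "open B" "A \<subseteq> B" "test_function A \<phi>"
    and "has_bochner_integral (lebesgue_on B) (weak_integrand G k u Du f \<phi>) I"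
  shows "has_bochner_integral (lebesgue_on A) (weak_integrand G k u Du f \<phi>) I"
proof -
  obtain K where K: "K \<subseteq> A" "\<And>x. x \<notin> K \<Longrightarrow> \<phi> x = 0" "\<And>x. x \<notin> K \<Longrightarrow> grad \<phi> x = 0"
    using C1_compactE[OF test_function_C1_compact[OF assms(4)]] by (metis (no_types, lifting))
  have z: "weak_integrand G k u Du f \<phi> x = 0" if "x \<notin> A" for x
  proof -
    have "x \<notin> K" using that K(1) by blast
    then show ?thesis using K(2,3) by (simp add: weak_integrand_def)
  qed
  have "has_bochner_integral lebesgue (weak_integrand G k u Du f \<phi>) I"
    using assms(5) by (subst (asm) has_bochner_integral_lebesgue_on_iff) (use z assms(2,3) in auto)
  then show ?thesis by (subst has_bochner_integral_lebesgue_on_iff) (use z assms(1) in auto)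
qed

lemma punctured_N: "dom_N - Sig = dom_N1 \<union> dom_N2" "dom_N1 \<inter> dom_N2 = {}" "dom_N2 \<inter> dom_N1 = {}"
  by (auto simp: dom_N_def Sig_def dom_N1_def dom_N2_def)

context
  fixes NP \<iota> g1 g2 assumes dc: "double_coating NP \<iota> g1 g2"
begin

lemma double_coating_frame: "sphere_frame (- NP) \<iota>"
  using dc by (simp add: double_coating_def sphere_frame_def dom_M2_def tangent_sphere_def)

lemma F2_expc:
  assumes v: "v \<in> dom_N2"
  shows "F2 NP \<iota> (expc (- NP) \<iota> v) = v" "expc (- NP) \<iota> v \<in> dom_M2 - {NP}"
proof -
  note S = double_coating_frame
  show "F2 NP \<iota> (expc (- NP) \<iota> v) = v"
    using inv_into_f_f[OF expc_inj[OF S], of v] v by (simp add: F2_def dom_N2_def expc_def[abs_def])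
  show "expc (- NP) \<iota> v \<in> dom_M2 - {NP}"
    using expc_in_sphere[OF S] expc_neq_antipode[OF S, of v] v by (auto simp: dom_N2_def)
qed

text \<open>\<open>push_metric\<close> inverts a map that is itself chosen as an inverse; on the
  sphere without NP the two inversions cancel and return the exponential map.\<close>

lemma inv_into_F2:
  assumes v: "v \<in> dom_N2"
  shows "inv_into (dom_M2 - {NP}) (F2 NP \<iota>) v = expc (- NP) \<iota> v"
proof -
  have "inj_on (F2 NP \<iota>) (dom_M2 - {NP})"
  proof (rule inj_on_inverseI)
    fix x assume "x \<in> dom_M2 - {NP}"
    then obtain v where "v \<in> ball 0 1" "expc (- NP) \<iota> v = x" using expc_surj[OF double_coating_frame, of x] by auto
    then show "expc (- NP) \<iota> (F2 NP \<iota> x) = x" using F2_expc(1)[of v] by (auto simp: dom_N2_def)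
  qed
  from inv_into_f_f[OF this F2_expc(2)[OF v]] show ?thesis by (simp add: F2_expc(1)[OF v])
qed

lemma push_metric_N2:
  assumes "y \<in> dom_N2"
  shows "push_metric NP \<iota> g1 g2 y = pullback_metric (expc (- NP) \<iota>) g2 y"
  using jac_cong_open[OF open_domains(2) assms inv_into_F2] inv_into_F2[OF assms] assms
  by (simp add: push_metric_def pullback_metric_jac)

end

text \<open>A function with compact support K in one component, paired with 0 on the other, is an
  admissible test: for the outer component the complement of K is a neighbourhood of the outer
  boundary on which it vanishes.\<close>

lemma weak_helmholtz_of_finite_energy:
  assumes H: "H1_loc_grad (dom_N - Sig) u Du"
    and t: "\<And>\<psi>1 \<psi>2 V. smooth_on (closure dom_N1) \<psi>1 \<Longrightarrow> open V \<Longrightarrow> frontier dom_N \<subseteq> V \<Longrightarrow> (\<forall>x \<in> V \<inter> closure dom_N1. \<psi>1 x = 0) \<Longrightarrow>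
      smooth_on (closure dom_N2) \<psi>2 \<Longrightarrow>
      has_bochner_integral (lebesgue_on (dom_N - Sig)) (weak_integrand G k u Du f (\<lambda>x. if x \<in> dom_N2 then \<psi>2 x else \<psi>1 x)) 0"
  shows "weak_helmholtz dom_N1 G k u Du f" "weak_helmholtz dom_N2 G k u Du f"
proof -
  note o = open_domains
  have N: "open (dom_N - Sig)" "dom_N1 \<subseteq> dom_N - Sig" "dom_N2 \<subseteq> dom_N - Sig" unfolding punctured_N(1) using o by auto
  have "has_bochner_integral (lebesgue_on dom_N1) (weak_integrand G k u Du f \<phi>) 0" if \<phi>: "test_function dom_N1 \<phi>" for \<phi>
  proof -
    obtain K where K: "compact K" "K \<subseteq> dom_N1" "\<And>x. x \<notin> K \<Longrightarrow> \<phi> x = 0" using \<phi> unfolding test_function_def by blast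
    have "(\<lambda>x. if x \<in> dom_N2 then 0 else \<phi> x) = \<phi>" using K(2,3) punctured_N(2) by (fastforce simp: fun_eq_iff)
    moreover have "smooth_on (closure dom_N1) \<phi>" using \<phi> smooth_on_subset unfolding test_function_def by blast
    moreover have "frontier dom_N \<subseteq> - K" using K(2) by (auto simp: dom_N_def frontier_ball mem_dom_N1 subset_iff)
    ultimately have "has_bochner_integral (lebesgue_on (dom_N - Sig)) (weak_integrand G k u Du f \<phi>) 0"
      using t[of \<phi> "- K" "\<lambda>_. 0"] K(3) open_Compl[OF compact_imp_closed[OF K(1)]] smooth_on_const by auto
    then show ?thesis by (rule weak_integrand_test_restrict[OF o(1) N(1,2) \<phi>])
  qed
  then show "weak_helmholtz dom_N1 G k u Du f"
    unfolding weak_helmholtz_def using H1_loc_grad_subset[OF H N(1) o(1) N(2)] by blast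
  have "has_bochner_integral (lebesgue_on dom_N2) (weak_integrand G k u Du f \<phi>) 0" if \<phi>: "test_function dom_N2 \<phi>" for \<phi>
  proof -
    have "(\<lambda>x. if x \<in> dom_N2 then \<phi> x else 0) = \<phi>" using \<phi> unfolding test_function_def fun_eq_iff by (metis subsetD)
    moreover have "smooth_on (closure dom_N2) \<phi>" using \<phi> smooth_on_subset unfolding test_function_def by blast
    ultimately have "has_bochner_integral (lebesgue_on (dom_N - Sig)) (weak_integrand G k u Du f \<phi>) 0"
      using t[of "\<lambda>_. 0" UNIV \<phi>] smooth_on_const by auto
    then show ?thesis by (rule weak_integrand_test_restrict[OF o(2) N(1,3) \<phi>])
  qed
  then show "weak_helmholtz dom_N2 G k u Du f"
    unfolding weak_helmholtz_def using H1_loc_grad_subset[OF H N(1) o(2) N(3)] by blast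
qed

theorem theorem3p11:
  fixes NP :: "real^4" and \<iota> :: "real^3 \<Rightarrow> real^4"
    and g1 :: "real^3 \<Rightarrow> real^3^3" and g2 :: "real^4 \<Rightarrow> real^4^4" and k :: real
    and u f :: "real^3 + real^4 \<Rightarrow> real" and ut ft h ht :: "real^3 \<Rightarrow> real"
  assumes "double_coating NP \<iota> g1 g2"
    and "0 \<le> k"
    and "u \<circ> Inl \<in> borel_measurable (lebesgue_on (dom_M1 - {0}))"
    and "u \<circ> Inr \<in> borel_measurable (restrict_space (completion (sphere_measure (1 / pi))) (dom_M2 - {NP}))"
    and "ut \<in> borel_measurable (lebesgue_on (dom_N - Sig))"
    and "\<forall>x \<in> dom_M - gam NP. u x = ut (F NP \<iota> x)"
    and "square_integrable (lebesgue_on (dom_M1 - {0})) (f \<circ> Inl)"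
    and "square_integrable (restrict_space (completion (sphere_measure (1 / pi))) (dom_M2 - {NP})) (f \<circ> Inr)"
    and "square_integrable (lebesgue_on (dom_N - Sig)) ft"
    and "\<exists>V. open V \<and> 0 \<in> V \<and> (AE x in lebesgue_on (dom_M1 - {0}). x \<in> V \<longrightarrow> f (Inl x) = 0)"
    and "\<exists>V. open V \<and> NP \<in> V \<and>
           (AE x in restrict_space (completion (sphere_measure (1 / pi))) (dom_M2 - {NP}).
              x \<in> V \<longrightarrow> f (Inr x) = 0)"
    and "\<exists>V. open V \<and> Sig \<subseteq> V \<and> (AE x in lebesgue_on (dom_N - Sig). x \<in> V \<longrightarrow> ft x = 0)"
    and "\<forall>x \<in> dom_M - gam NP. f x = ft (F NP \<iota> x)"
    and "\<forall>x \<in> frontier dom_M1. h x = ht (F1 x)"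
  shows "finite_energy_solution (push_metric NP \<iota> g1 g2) k ut ft ht \<longleftrightarrow>
         solution_M1 g1 k (u \<circ> Inl) (f \<circ> Inl) h \<and> solution_M2 g2 k (u \<circ> Inr) (f \<circ> Inr)"
  proof -
  let ?G = "push_metric NP \<iota> g1 g2"
  let ?e = "expc (- NP) \<iota>"
  note dc = assms(1)
  note S = double_coating_frame[OF dc]
  note o = open_domains
  have g1: "metric_field (cball 0 2) g1" using dc by (intro riemannian_metric_M1) (simp add: double_coating_def)
  have g2: "riemannian_metric dom_M2 tangent_sphere g2" using dc by (simp add: double_coating_def)
  have B: "dom_N2 = ball 0 1" by (simp add: dom_N2_def)
  have N: "open (dom_N - Sig)" "dom_N1 \<subseteq> dom_N - Sig" "dom_N2 \<subseteq> dom_N - Sig" unfolding punctured_N(1) using o by auto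
  note G1 = push_metric_N1 and G2 = push_metric_N2[OF dc]
  have mG1: "metric_field dom_N1 ?G"
  proof (rule metric_field_cong)
    show "metric_field dom_N1 (pullback_metric \<Phi> g1)"
      by (rule metric_field_pullback[OF C1_diffeo_sym[OF F1_diffeo] metric_field_subset[OF g1]]) (auto simp: dom_M1_def)
  qed (simp add: G1)
  have e1: "(u \<circ> Inl) x = ut (F1 x)" "(f \<circ> Inl) x = ft (F1 x)" if "x \<in> punctured_M1" for x
    using assms(6)[rule_format, of "Inl x"] assms(13)[rule_format, of "Inl x"] that by (auto simp: dom_M_def gam_def F_def Plus_def)
  have e2: "(u \<circ> Inr) (?e v) = ut v" "(f \<circ> Inr) (?e v) = ft v" if "v \<in> ball 0 1" for v
    using assms(6)[rule_format, of "Inr (?e v)"] assms(13)[rule_format, of "Inr (?e v)"] F2_expc[OF dc, of v] that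
    unfolding B[symmetric] by (auto simp: dom_M_def gam_def F_def Plus_def)
  have h: "h x = ht (F1 x)" if "x \<in> sphere 0 2" for x
    using assms(14) that by (simp add: dom_M1_def frontier_ball)
  have ftN: "square_integrable (lebesgue_on U) ft" if "open U" "U \<subseteq> dom_N - Sig" for U
    using assms(9) integrable_lebesgue_on_subset[OF _ N(1) that] measurable_restrict_mono[OF _ that(2)] unfolding square_integrable_def by blast
  note ft1 = square_integrable_L2_loc[OF o(1) ftN[OF o(1) N(2)]] and ft2 = ftN[OF o(2) N(3), unfolded B]
  show ?thesis
  proof
    assume "finite_energy_solution ?G k ut ft ht"
    then obtain Du V where um: "ut \<in> borel_measurable (lebesgue_on (dom_N - Sig))"
      and u2: "integrable (lebesgue_on (dom_N - Sig)) (\<lambda>x. (ut x)\<^sup>2 * sqrt (det (?G x)))"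
      and H: "H1_loc_grad (dom_N - Sig) ut Du" and en: "integrable (lebesgue_on (dom_N - Sig)) (energy ?G Du)"
      and V: "open V" "frontier dom_N \<subseteq> V" "has_trace 2 (V \<inter> dom_N1) ut Du ht"
      and t: "\<forall>\<psi>1 \<psi>2. smooth_on (closure dom_N1) \<psi>1 \<and> (\<exists>V. open V \<and> frontier dom_N \<subseteq> V \<and> (\<forall>x \<in> V \<inter> closure dom_N1. \<psi>1 x = 0)) \<and>
        smooth_on (closure dom_N2) \<psi>2 \<longrightarrow>
        has_bochner_integral (lebesgue_on (dom_N - Sig)) (weak_integrand ?G k ut Du ft (\<lambda>x. if x \<in> dom_N2 then \<psi>2 x else \<psi>1 x)) 0"
      unfolding finite_energy_solution_def energy_def[abs_def] by blast
    have wh: "weak_helmholtz dom_N1 ?G k ut Du ft" "weak_helmholtz dom_N2 ?G k ut Du ft"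
      by (rule weak_helmholtz_of_finite_energy[OF H], use t in blast)+
    let ?D1 = "\<lambda>x. Du (F1 x) v* jac F1 x"
    have M1: "square_integrable (lebesgue_on dom_M1) (u \<circ> Inl)" "square_integrable (lebesgue_on dom_M1) (\<lambda>x. ?D1 x $ i)"
      "weak_helmholtz dom_M1 g1 k (u \<circ> Inl) ?D1 (f \<circ> Inl)" for i
      by (rule M1_forward[OF g1 G1 measurable_restrict_mono[OF um N(2)] integrable_lebesgue_on_subset[OF u2 N(1) o(1) N(2)]
        integrable_lebesgue_on_subset[OF en N(1) o(1) N(2)] wh(1) ft1 assms(7) e1]; assumption)+
    have HH: "H1_loc_grad dom_N1 ut Du" "H1_loc_grad dom_M1 (u \<circ> Inl) ?D1"
      using wh(1) M1(3) unfolding weak_helmholtz_def by blast+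
    have "has_trace 2 dom_M1 (u \<circ> Inl) ?D1 h"
      by (rule trace_M1_forward[OF V(1,2,3) HH e1(1) refl h])
    then have "solution_M1 g1 k (u \<circ> Inl) (f \<circ> Inl) h"
      unfolding solution_M1_def by (intro exI[of _ ?D1] conjI allI M1)
    moreover have "solution_M2 g2 k (u \<circ> Inr) (f \<circ> Inr)"
      by (rule M2_forward[OF S g2 G2[unfolded B] ft2 integrable_lebesgue_on_subset[OF u2 N(1) o(2) N(3), unfolded B]
        integrable_lebesgue_on_subset[OF en N(1) o(2) N(3), unfolded B] wh(2)[unfolded B] e2])
    ultimately show "solution_M1 g1 k (u \<circ> Inl) (f \<circ> Inl) h \<and> solution_M2 g2 k (u \<circ> Inr) (f \<circ> Inr)" by blast
  next
    assume sol: "solution_M1 g1 k (u \<circ> Inl) (f \<circ> Inl) h \<and> solution_M2 g2 k (u \<circ> Inr) (f \<circ> Inr)"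
    then obtain D1 where D1: "square_integrable (lebesgue_on dom_M1) (u \<circ> Inl)" "\<And>i. square_integrable (lebesgue_on dom_M1) (\<lambda>x. D1 x $ i)"
      "weak_helmholtz dom_M1 g1 k (u \<circ> Inl) D1 (f \<circ> Inl)" "has_trace 2 dom_M1 (u \<circ> Inl) D1 h"
      unfolding solution_M1_def by blast
    have HM: "H1_loc_grad dom_M1 (u \<circ> Inl) D1" using D1(3) unfolding weak_helmholtz_def by blast
    let ?D1 = "\<lambda>y. D1 (\<Phi> y) v* jac \<Phi> y"
    have M1: "integrable (lebesgue_on dom_N1) (\<lambda>y. (ut y)\<^sup>2 * sqrt (det (?G y)))" "integrable (lebesgue_on dom_N1) (energy ?G ?D1)"
      "weak_helmholtz dom_N1 ?G k ut ?D1 ft"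
      "\<And>\<psi> V. smooth_on (closure dom_N1) \<psi> \<Longrightarrow> open V \<Longrightarrow> frontier dom_N \<subseteq> V \<Longrightarrow> (\<And>y. y \<in> V \<inter> closure dom_N1 \<Longrightarrow> \<psi> y = 0) \<Longrightarrow>
        has_bochner_integral (lebesgue_on dom_N1) (weak_integrand ?G k ut ?D1 ft \<psi>) 0"
      by (rule M1_backward[OF g1 G1 D1(1-3) assms(7) e1]; (assumption | blast))+
    obtain D2 where M2: "integrable (lebesgue_on dom_N2) (\<lambda>x. (ut x)\<^sup>2 * sqrt (det (pullback_metric ?e g2 x)))"
      "integrable (lebesgue_on dom_N2) (energy (pullback_metric ?e g2) D2)" "weak_helmholtz dom_N2 (pullback_metric ?e g2) k ut D2 ft"
      "\<And>\<psi>. smooth_on (closure dom_N2) \<psi> \<Longrightarrow> has_bochner_integral (lebesgue_on dom_N2) (weak_integrand (pullback_metric ?e g2) k ut D2 ft \<psi>) 0"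
      by (rule M2_backward[OF S g2 ft2 conjunct2[OF sol] e2, folded B], assumption, assumption, rule that, assumption, assumption, assumption, blast)
    \<comment> \<open>N1 and N2 are disjoint open sets, so weak gradients on the two sides combine
      without any matching across \<Sigma>.\<close>
    define Du where "Du y = (if y \<in> dom_N2 then D2 y else ?D1 y)" for y
    have Du1: "Du y = ?D1 y" if "y \<in> dom_N1" for y using that punctured_N(2) by (auto simp: Du_def)
    have w1: "weak_helmholtz dom_N1 ?G k ut Du ft"
      by (rule weak_helmholtz_cong[OF o(1) _ _ _ _ M1(3)]) (simp_all add: Du1)
    have w2: "weak_helmholtz dom_N2 ?G k ut Du ft"
      by (rule weak_helmholtz_cong[OF o(2) _ _ _ _ M2(3)]) (simp_all add: Du_def G2)
    have int: "integrable (lebesgue_on (dom_N - Sig)) r"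
      if "integrable (lebesgue_on dom_N1) p" "integrable (lebesgue_on dom_N2) q" "\<And>x. x \<in> dom_N1 \<Longrightarrow> r x = p x" "\<And>x. x \<in> dom_N2 \<Longrightarrow> r x = q x"
      for p q r :: "real^3 \<Rightarrow> real"
    proof -
      have "integrable (lebesgue_on dom_N1) r" "integrable (lebesgue_on dom_N2) r"
        using that Bochner_Integration.integrable_cong[of "lebesgue_on dom_N1" _ r p] Bochner_Integration.integrable_cong[of "lebesgue_on dom_N2" _ r q]
        by (auto simp: space_restrict_space)
      then show ?thesis
        unfolding punctured_N(1) integrable.simps using has_bochner_integral_lebesgue_on_Un[OF o(1,2) punctured_N(2)] by blast
    qed
    \<comment> \<open>A collar of the outer boundary with closure off \<Sigma>, the same as in
      \<open>trace_M1_backward\<close>.\<close>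
    define V where "V = {x::real^3. 3 / 2 < norm x}"
    have "open V" unfolding V_def by (rule closed_norm_intervals(2))
    then have V: "open V" "frontier dom_N \<subseteq> V" by (auto simp: V_def dom_N_def frontier_ball)
    show "finite_energy_solution ?G k ut ft ht"
      unfolding finite_energy_solution_def
    proof (intro conjI exI[of _ Du] exI[of _ V] allI impI V)
      show "ut \<in> borel_measurable (lebesgue_on (dom_N - Sig))" by (rule assms(5))
      show "integrable (lebesgue_on (dom_N - Sig)) (\<lambda>x. (ut x)\<^sup>2 * sqrt (det (?G x)))"
        by (rule int[OF M1(1) M2(1)]) (simp_all add: G2)
      show "H1_loc_grad (dom_N - Sig) ut Du"
        unfolding punctured_N(1) using w1 w2 by (intro H1_loc_grad_Un o punctured_N(2)) (auto simp: weak_helmholtz_def)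
      show "integrable (lebesgue_on (dom_N - Sig)) (\<lambda>x. sqrt (det (?G x)) * (Du x \<bullet> (matrix_inv (?G x) *v Du x)))"
        by (rule int[OF M1(2) M2(2)]) (simp_all add: energy_def Du1, simp add: G2 Du_def)
      show "weak_helmholtz (V \<inter> dom_N1) ?G k ut Du ft"
        by (rule weak_helmholtz_subset[OF w1 o(1) open_Int[OF V(1) o(1)] Int_lower2 mG1 ft1])
      have eu: "ut x = (u \<circ> Inl) (\<Phi> x)" if "x \<in> dom_N1" for x
        using e1(1)[of "\<Phi> x"] C1_diffeoD(8,9)[OF F1_diffeo that] by simp
      show "has_trace 2 (V \<inter> dom_N1) ut Du ht"
        unfolding V_def
        by (rule trace_M1_backward[OF D1(4) _ HM eu Du1 h]) (use w1 in \<open>simp add: weak_helmholtz_def\<close>)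
      fix \<psi>1 \<psi>2
      assume \<psi>: "smooth_on (closure dom_N1) \<psi>1 \<and> (\<exists>V. open V \<and> frontier dom_N \<subseteq> V \<and> (\<forall>x \<in> V \<inter> closure dom_N1. \<psi>1 x = 0)) \<and>
        smooth_on (closure dom_N2) \<psi>2"
      then obtain V' where V': "open V'" "frontier dom_N \<subseteq> V'" "\<And>x. x \<in> V' \<inter> closure dom_N1 \<Longrightarrow> \<psi>1 x = 0" by blast
      let ?\<psi> = "\<lambda>x. if x \<in> dom_N2 then \<psi>2 x else \<psi>1 x"
      have c1: "weak_integrand ?G k ut Du ft ?\<psi> x = weak_integrand ?G k ut ?D1 ft \<psi>1 x" if "x \<in> dom_N1" for x
        by (rule weak_integrand_cong_open[OF o(1) that]) (use that punctured_N(2) in \<open>auto simp: Du1\<close>)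
      have c2: "weak_integrand ?G k ut Du ft ?\<psi> x = weak_integrand (pullback_metric ?e g2) k ut D2 ft \<psi>2 x" if "x \<in> dom_N2" for x
        by (rule weak_integrand_cong_open[OF o(2) that]) (use that in \<open>auto simp: Du_def G2\<close>)
      have "has_bochner_integral (lebesgue_on dom_N1) (weak_integrand ?G k ut Du ft ?\<psi>) 0"
        using M1(4)[OF conjunct1[OF \<psi>] V'] by (subst has_bochner_integral_cong[OF refl c1 refl]) (auto simp: space_restrict_space)
      moreover have "has_bochner_integral (lebesgue_on dom_N2) (weak_integrand ?G k ut Du ft ?\<psi>) 0"
        using M2(4) \<psi> by (subst has_bochner_integral_cong[OF refl c2 refl]) (auto simp: space_restrict_space)
      ultimately show "has_bochner_integral (lebesgue_on (dom_N - Sig)) (weak_integrand ?G k ut Du ft ?\<psi>) 0"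
        unfolding punctured_N(1) using has_bochner_integral_lebesgue_on_Un[OF o(1,2) punctured_N(2)] by fastforce
    qed
  qed
qed

end
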